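(* Let $n\ge3$ and $p\in(1,\infty)$, fix $y\in\mathbb R^n$, and suppose that the constant coefficient operator $\mathcal L(y,\partial_x)=a_{ij}(y)\partial_i\partial_j$ is elliptic and that the coefficients $a_{ij}=a_{ji}$ of $\mathcal L(x,\partial_x)u=a_{ij}(x)\partial_i\partial_ju$ are bounded, measurable, real-valued functions satisfying $\sup_{|x-y|=r}\|{\bf A}_x-{\bf A}_y\|\le\omega(r)$ for $0<r<1$, where ${\bf A}_x=(a_{ij}(x))$ and $\omega$ is a continuous, nondecreasing function on $[0,1)$ with $\omega(0)=0$, $\int_0^1\omega^2(t)\,t^{-1}dt<\infty$, and $\omega(r)\,r^{-1+\kappa}$ nonincreasing for $0<r<1$ for some $\kappa\in(0,1)$. For $\varepsilon>0$ sufficiently small put $$I_y(r)=\frac1{|S^{n-1}|}\int_{r<|z-y|<\varepsilon}\left(\mathrm{tr}({\bf A}_z{\bf A}_y^{-1})-n\,\frac{\langle{\bf A}_z{\bf A}_y^{-1/2}(z-y),{\bf A}_y^{-1/2}(z-y)\rangle}{|z-y|^2}\right)\frac{dz}{|z-y|^n},$$ and let $Z_y$ be the solution, constructed as described in the context, of $\mathcal L(x,\partial_x)Z_y=0$ in $B_{\varepsilon}(y)\setminus\{y\}$, which has the form $Z_y(x)=h_y(|{\bf A}_y^{-1/2}(x-y)|)+v(x)$, where $h_y(r)=\int_r^\varepsilon s^{1-n}e^{I_y(s)}\,ds\,(1+\zeta_y(r))$ with $M_{2,p}(\zeta_y,r;y)\le c\,\max(\omega(r),\sigma(r))$ and $M_{2,p}(v,r;y)\le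 c\,r^{2-n}e^{I_y(r)}\omega(r)$. With $U=B_{\varepsilon}(y)$, consider for $\phi\in C_0^1(U)$ the improper integral $$\langle\mathcal LZ_y,\phi\rangle=\int_U\left[(a_{ij}(x)-a_{ij}(y))\,\partial_i\partial_jZ_y(x)\,\phi(x)-a_{ij}(y)\,\partial_iZ_y(x)\,\partial_j\phi(x)\right]dx .$$ (i) If $I_y(0)=\lim_{r\to0}I_y(r)$ exists and is finite, then this integral converges and $Z_y$ satisfies $-\mathcal L(x,\partial_x)Z_y(x)=C_y\,\delta(x-y)$ in $U$, i.e. $-\langle\mathcal LZ_y,\phi\rangle=C_y\,\phi(y)$, with $$C_y=|S^{n-1}|\,\sqrt{\det{\bf A}_y}\;e^{I_y(0)} .$$ (ii) If $I_y(r)\to-\infty$ as $r\to0$, then this integral converges and $Z_y$ satisfies $-\mathcal L(x,\partial_x)Z_y(x)=C_y\,\delta(x-y)$ in $U$, in the same sense, with $C_y=0$.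
   Context: Summation over repeated indices is understood; ${\bf A}_y$ is symmetric and positive definite; $\mathrm{tr}$ is the matrix trace; $\langle\cdot,\cdot\rangle$ applied to vectors is the inner product in $\mathbb R^n$; $|S^{n-1}|$ is the surface measure of the unit sphere; $B_{\varepsilon}(y)=\{x:|x-y|<\varepsilon\}$; $C_0^1(U)$ is the space of $C^1$ functions with compact support in $U$. The improper integral means $\lim_{\eta\to0}\int_{U\cap\{|x-y|>\eta\}}$. The function $Z_y$: under the stated hypotheses and for $\varepsilon$ sufficiently small, a solution of the form displayed in the claim is known to exist, and $Z_y$ is the one found in that existence result. It is obtained by setting $\tilde x={\bf A}_y^{-1/2}(x-y)$ and $\tilde{\bf A}_{\tilde x}={\bf A}_y^{-1/2}{\bf A}_x{\bf A}_y^{-1/2}=(\tilde a_{ij}(\tilde x))$, so that $\tilde a_{ij}(0)=\delta_{ij}$ and $\mathcal L$ becomes $\tilde a_{k\ell}(\tilde x)\,\partial^2/\partial\tilde x_k\partial\tilde x_\ell$, by constructing a solution $\tilde Z(\tilde x)=\tilde h(|\tilde x|)+\tilde v(\tilde x)$ of the transformed equation near $\tilde x=0$, $\tilde x\ne0$, where $\tilde h(r)$ is the mean of $\tilde Z$ over the sphere $|\tilde x|=r$ and $\tilde v$ has zero mean over each such sphere, and by taking $Z_y(x)=\tilde Z({\bf A}_y^{-1/2}(x-y))$, $h_y=\tilde h$, $v(x)=\tilde v({\bf A}_y^{-1/2}(x-y))$. Put $\sigma(r)=\int_0^r\omega^2(t)\,t^{-1}dt$. For a function $w$, $M_p(w,r;y)=\left(|A_r(y)|^{-1}\int_{A_r(y)}|w(x)|^p\,dx\right)^{1/p}$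 with $A_r(y)=\{x:r<|x-y|<2r\}$, and $M_{2,p}(w,r;y)=r^2M_p(D^2w,r;y)+rM_p(Dw,r;y)+M_p(w,r;y)$, where $Dw$, $D^2w$ are the gradient and Hessian. For a function $\zeta_y$ of $r>0$, $M_{2,p}(\zeta_y,r;y)$ is that of $x\mapsto\zeta_y(|x-y|)$. The letter $c$ denotes constants independent of $r$; the estimates describe behaviour for small $r>0$. *)

theory Defs
  imports "HOL-Analysis.Analysis"
begin

definition spd :: "real^'n^'n \<Rightarrow> bool" where
  "spd B \<longleftrightarrow> transpose B = B \<and> (\<forall>\<xi>. \<xi> \<noteq> 0 \<longrightarrow> 0 < \<xi> \<bullet> (B *v \<xi>))"

text \<open>Only meaningful for \<open>spd B\<close>, where the square root exists and is unique.\<close>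

definition spd_sqrt :: "real^'n^'n \<Rightarrow> real^'n^'n" where
  "spd_sqrt B = (THE C. spd C \<and> C ** C = B)"

definition inv_sqrt :: "real^'n^'n \<Rightarrow> real^'n^'n" where
  "inv_sqrt B = matrix_inv (spd_sqrt B)"

text \<open>Surface measure on the unit sphere, obtained from polar coordinates: a Borel set
  \<open>E\<close> of directions has measure \<open>n\<close> times the volume of the cone of all \<open>t \<theta>\<close> with
  \<open>\<theta> \<in> E\<close> and \<open>0 < t < 1\<close>. (The origin is sent to itself and is a null set.)\<close>

definition sphere_measure :: "(real^'n) measure" where
  "sphere_measure =
     scale_measure (of_nat CARD('n))
       (distr (restrict_space lborel (ball 0 1)) borel (\<lambda>x. x /\<^sub>R norm x))"

definition sphere_area :: "'n::finite itself \<Rightarrow> real" where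
  "sphere_area _ = measure (sphere_measure :: (real^'n) measure) (sphere 0 1)"

text \<open>The measure is completed because \<open>f\<close> will be only Lebesgue measurable.\<close>

definition has_sphere_mean :: "(real^'n \<Rightarrow> real) \<Rightarrow> real \<Rightarrow> real \<Rightarrow> bool" where
  "has_sphere_mean f r m \<longleftrightarrow>
     integrable (completion sphere_measure) (\<lambda>\<theta>. f (r *\<^sub>R \<theta>)) \<and>
     m = (LINT \<theta>|completion sphere_measure. f (r *\<^sub>R \<theta>)) / sphere_area TYPE('n)"

definition partial :: "'n \<Rightarrow> (real^'n \<Rightarrow> real) \<Rightarrow> real^'n \<Rightarrow> real" where
  "partial i \<phi> x = frechet_derivative \<phi> (at x) (axis i 1)"

text \<open>Elements of \<open>C\<^sub>0\<^sup>1(U)\<close> are regarded as functions on the whole space, extended by zero.\<close>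

definition C01 :: "(real^'n) set \<Rightarrow> (real^'n \<Rightarrow> real) set" where
  "C01 U = {\<phi>. (\<forall>x. \<phi> differentiable (at x)) \<and> (\<forall>i. continuous_on UNIV (partial i \<phi>)) \<and>
                compact (closure {x. \<phi> x \<noteq> 0}) \<and> closure {x. \<phi> x \<noteq> 0} \<subseteq> U}"

definition Lp_loc :: "(real^'n) set \<Rightarrow> real \<Rightarrow> (real^'n \<Rightarrow> real) \<Rightarrow> bool" where
  "Lp_loc \<Omega> p f \<longleftrightarrow>
     f \<in> borel_measurable (lebesgue_on \<Omega>) \<and>
     (\<forall>K. compact K \<and> K \<subseteq> \<Omega> \<longrightarrow> set_integrable lebesgue K (\<lambda>x. \<bar>f x\<bar> powr p))"

definition has_weak_partial ::
  "(real^'n) set \<Rightarrow> 'n \<Rightarrow> (real^'n \<Rightarrow> real) \<Rightarrow> (real^'n \<Rightarrow> real) \<Rightarrow> bool" where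
  "has_weak_partial \<Omega> i f g \<longleftrightarrow>
     Lp_loc \<Omega> 1 f \<and> Lp_loc \<Omega> 1 g \<and>
     (\<forall>\<psi>\<in>C01 \<Omega>. (LINT x:\<Omega>|lebesgue. f x * partial i \<psi> x) = - (LINT x:\<Omega>|lebesgue. g x * \<psi> x))"

text \<open>A representative of the weak derivative, which is unique up to null sets; everything
  below depends on it only up to null sets.\<close>

definition weak_partial ::
  "(real^'n) set \<Rightarrow> 'n \<Rightarrow> (real^'n \<Rightarrow> real) \<Rightarrow> real^'n \<Rightarrow> real" where
  "weak_partial \<Omega> i f = (SOME g. has_weak_partial \<Omega> i f g)"

definition weak_grad :: "(real^'n) set \<Rightarrow> (real^'n \<Rightarrow> real) \<Rightarrow> real^'n \<Rightarrow> real^'n" where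
  "weak_grad \<Omega> f x = (\<chi> i. weak_partial \<Omega> i f x)"

definition weak_hess :: "(real^'n) set \<Rightarrow> (real^'n \<Rightarrow> real) \<Rightarrow> real^'n \<Rightarrow> real^'n^'n" where
  "weak_hess \<Omega> f x = (\<chi> i j. weak_partial \<Omega> i (weak_partial \<Omega> j f) x)"

definition W2p_loc :: "(real^'n) set \<Rightarrow> real \<Rightarrow> (real^'n \<Rightarrow> real) \<Rightarrow> bool" where
  "W2p_loc \<Omega> p f \<longleftrightarrow>
     Lp_loc \<Omega> p f \<and>
     (\<forall>i. (\<exists>g. has_weak_partial \<Omega> i f g) \<and> Lp_loc \<Omega> p (weak_partial \<Omega> i f)) \<and>
     (\<forall>i j. (\<exists>g. has_weak_partial \<Omega> i (weak_partial \<Omega> j f) g) \<and>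
            Lp_loc \<Omega> p (weak_partial \<Omega> i (weak_partial \<Omega> j f)))"

definition annulus :: "real \<Rightarrow> real^'n \<Rightarrow> (real^'n) set" where
  "annulus r y = {x. r < norm (x - y) \<and> norm (x - y) < 2 * r}"

definition M_mean :: "real \<Rightarrow> (real^'n \<Rightarrow> 'b::real_normed_vector) \<Rightarrow> real \<Rightarrow> real^'n \<Rightarrow> real" where
  "M_mean p w r y =
     ((LINT x:annulus r y|lebesgue. norm (w x) powr p) / measure lebesgue (annulus r y)) powr (1 / p)"

text \<open>Weak derivatives being local, they are taken on the open annulus itself. This is used
  only for functions in \<open>W\<^sup>2\<^sup>,\<^sup>p\<close> near the closed annulus, so that all integrals are finite.\<close>

definition M2_mean :: "real \<Rightarrow> (real^'n \<Rightarrow> real) \<Rightarrow> real \<Rightarrow> real^'n \<Rightarrow> real" where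
  "M2_mean p w r y =
     r\<^sup>2 * M_mean p (weak_hess (annulus r y) w) r y
     + r * M_mean p (weak_grad (annulus r y) w) r y
     + M_mean p w r y"

definition sq_dini :: "(real \<Rightarrow> real) \<Rightarrow> real \<Rightarrow> real" where
  "sq_dini \<omega> r = (LINT t:{0<..<r}|lborel. (\<omega> t)\<^sup>2 / t)"

definition I_fun :: "(real^'n \<Rightarrow> real^'n^'n) \<Rightarrow> real^'n \<Rightarrow> real \<Rightarrow> real \<Rightarrow> real" where
  "I_fun A y \<epsilon> r =
     (1 / sphere_area TYPE('n)) *
     (LINT z:{z. r < norm (z - y) \<and> norm (z - y) < \<epsilon>}|lebesgue.
        (trace (A z ** matrix_inv (A y))
         - real CARD('n) * (((A z ** inv_sqrt (A y)) *v (z - y)) \<bullet> (inv_sqrt (A y) *v (z - y)))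
             / (norm (z - y))\<^sup>2)
        / norm (z - y) ^ CARD('n))"

definition strong_solution ::
  "(real^'n \<Rightarrow> real^'n^'n) \<Rightarrow> real \<Rightarrow> (real^'n) set \<Rightarrow> (real^'n \<Rightarrow> real) \<Rightarrow> bool" where
  "strong_solution A p \<Omega> Z \<longleftrightarrow>
     W2p_loc \<Omega> p Z \<and>
     (AE x in lebesgue. x \<in> \<Omega> \<longrightarrow>
        (\<Sum>i\<in>UNIV. \<Sum>j\<in>UNIV. A x $ i $ j * weak_hess \<Omega> Z x $ i $ j) = 0)"

text \<open>\<open>Z\<close> is a solution in the punctured ball of the form \<open>h (|A\<^sub>y\<^sup>-\<^sup>1\<^sup>/\<^sup>2 (x - y)|) + v x\<close>, with
  \<open>h\<close>, \<open>\<zeta>\<close>, \<open>v\<close> as in the construction of \<open>Z\<^sub>y\<close>. The point with coordinate \<open>\<xi> = A\<^sub>y\<^sup>-\<^sup>1\<^sup>/\<^sup>2 (x - y)\<close>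
  is \<open>x = y + A\<^sub>y\<^sup>1\<^sup>/\<^sup>2 \<xi>\<close>. Sphere means are required for almost every radius, since functions
  in \<open>W\<^sup>2\<^sup>,\<^sup>p\<close> need not be continuous. The number \<open>\<delta>\<close> says how small the radii must be for
  the local statements to apply.\<close>

definition constructed_solution ::
  "(real^'n \<Rightarrow> real^'n^'n) \<Rightarrow> real^'n \<Rightarrow> (real \<Rightarrow> real) \<Rightarrow> real \<Rightarrow> real \<Rightarrow>
   (real^'n \<Rightarrow> real) \<Rightarrow> (real \<Rightarrow> real) \<Rightarrow> (real \<Rightarrow> real) \<Rightarrow> (real^'n \<Rightarrow> real) \<Rightarrow> bool" where
  "constructed_solution A y \<omega> p \<epsilon> Z h \<zeta> v \<longleftrightarrow>
     strong_solution A p (ball y \<epsilon> - {y}) Z \<and>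
     (\<forall>x\<in>ball y \<epsilon> - {y}. Z x = h (norm (inv_sqrt (A y) *v (x - y))) + v x) \<and>
     (\<forall>r. 0 < r \<and> r < \<epsilon> \<longrightarrow>
        h r = (LINT s:{r..\<epsilon>}|lborel. s powr (1 - real CARD('n)) * exp (I_fun A y \<epsilon> s)) * (1 + \<zeta> r)) \<and>
     (\<exists>\<delta>. 0 < \<delta> \<and> \<delta> \<le> \<epsilon> \<and>
        W2p_loc (ball y \<delta> - {y}) p (\<lambda>x. \<zeta> (norm (x - y))) \<and>
        W2p_loc (ball y \<delta> - {y}) p v \<and>
        (AE r in lborel. 0 < r \<and> r < \<delta> \<longrightarrow>
           has_sphere_mean (\<lambda>\<xi>. Z (y + spd_sqrt (A y) *v \<xi>)) r (h r) \<and>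
           has_sphere_mean (\<lambda>\<xi>. v (y + spd_sqrt (A y) *v \<xi>)) r 0) \<and>
        (\<exists>c. \<forall>r. 0 < r \<and> 2 * r < \<delta> \<longrightarrow>
           M2_mean p (\<lambda>x. \<zeta> (norm (x - y))) r y \<le> c * max (\<omega> r) (sq_dini \<omega> r) \<and>
           M2_mean p v r y \<le> c * r powr (2 - real CARD('n)) * exp (I_fun A y \<epsilon> r) * \<omega> r))"

definition has_improper_integral ::
  "(real^'n \<Rightarrow> real) \<Rightarrow> (real^'n) set \<Rightarrow> real^'n \<Rightarrow> real \<Rightarrow> bool" where
  "has_improper_integral F U y l \<longleftrightarrow>
     (\<forall>\<eta>>0. set_integrable lebesgue (U \<inter> {x. \<eta> < norm (x - y)}) F) \<and>
     ((\<lambda>\<eta>. LINT x:(U \<inter> {x. \<eta> < norm (x - y)})|lebesgue. F x) \<longlongrightarrow> l) (at_right 0)"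

definition LZ_integrand ::
  "(real^'n \<Rightarrow> real^'n^'n) \<Rightarrow> real^'n \<Rightarrow> (real^'n) set \<Rightarrow> (real^'n \<Rightarrow> real) \<Rightarrow> (real^'n \<Rightarrow> real) \<Rightarrow>
   real^'n \<Rightarrow> real" where
  "LZ_integrand A y U Z \<phi> x =
     (\<Sum>i\<in>UNIV. \<Sum>j\<in>UNIV.
        (A x $ i $ j - A y $ i $ j) * weak_hess (U - {y}) Z x $ i $ j * \<phi> x
        - A y $ i $ j * weak_grad (U - {y}) Z x $ i * partial j \<phi> x)"

definition solves_delta ::
  "(real^'n \<Rightarrow> real^'n^'n) \<Rightarrow> real^'n \<Rightarrow> (real^'n) set \<Rightarrow> (real^'n \<Rightarrow> real) \<Rightarrow> real \<Rightarrow> bool" where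
  "solves_delta A y U Z C \<longleftrightarrow>
     (\<forall>\<phi>\<in>C01 U. \<exists>l. has_improper_integral (LZ_integrand A y U Z \<phi>) U y l \<and> - l = C * \<phi> y)"

end

theory Submission
  imports Defs
begin

text \<open>
  Write \<open>B\<close> for the inverse square root of \<open>A y\<close>, \<open>N x\<close> for \<open>|B (x - y)|\<close>, \<open>I\<close> for \<open>I_fun A y \<epsilon>\<close>, \<open>n\<close> for
  the dimension, and \<open>P x\<close> for the integral of \<open>s powr (1 - n) * exp (I s)\<close> over \<open>N x < s < \<epsilon>\<close>, so that
  \<open>Z = P (1 + \<zeta>(N)) + v\<close>. Suppose that \<open>exp (I r)\<close> tends to \<open>L\<close> as \<open>r\<close> tends to \<open>0\<close>; this covers both cases of the
  theorem, with \<open>L = exp I0\<close> in the first and \<open>L = 0\<close> in the second.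

  Integrate the integrand over \<open>|x - y| > \<eta>\<close>. Since \<open>a\<^sub>i\<^sub>j(x) \<partial>\<^sub>i\<partial>\<^sub>jZ = 0\<close>, it is the negative divergence of
  \<open>\<phi> A\<^sub>y \<nabla>Z\<close>, and only the flux of \<open>\<phi> A\<^sub>y \<nabla>Z\<close> through the sphere \<open>|x - y| = \<eta>\<close> remains
  (lemma \<open>cut_pairing\<close>). The conormal derivative of \<open>P\<close> is explicit: \<open>A\<^sub>y \<nabla>P = - exp (I(N)) X\<close> with the field
  \<open>X = N powr (- n) * (x - y)\<close> (lemma \<open>conormal_profile\<close>). This field is divergence free away from \<open>y\<close>, so its
  flux is the same through every surface around \<open>y\<close>, and on the ellipsoid \<open>N = 1\<close> it is \<open>n\<close> times the volume
  inside, that is \<open>|S\<^sup>n\<^sup>-\<^sup>1| / |det B|\<close> (lemma \<open>flux_value\<close>), where \<open>1 / |det B|\<close> is the square root of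
  \<open>det (A y)\<close>. As \<open>exp (I(N)) \<phi>\<close> tends to \<open>L \<phi>(y)\<close>, this contributes the constant of the theorem.

  The rest is small. In the flux it consists of the products of \<open>P\<close> with the gradient of \<open>\<zeta>(N)\<close>, of \<open>\<zeta>(N)\<close> with the
  gradient of \<open>P\<close>, and of the gradient of \<open>v\<close>. The bounds on the means over annuli make each of them
  \<open>o(\<eta> powr (1 - n))\<close> in the sense of \<open>L\<^sup>1\<close> means, and the area of the sphere is of order \<open>\<eta> powr (n - 1)\<close>.

  The functions are only in \<open>W\<^sup>2\<^sup>,\<^sup>p\<close>, so surface integrals are replaced by integrals against the gradient of a cutoff
  \<open>annulus_cut y r k\<close>, which becomes a jump across a sphere as \<open>k\<close> grows. Restriction to the sphere is controlled by
  one more derivative: the trace inequality \<open>trace_bound\<close> is uniform in \<open>k\<close>, so one may first let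
  \<open>k\<close> tend to infinity and then \<open>r\<close> to \<open>0\<close>. It requires a continuously differentiable weight, while \<open>exp (I(N))\<close> is only
  locally Lipschitz; it is approximated by Steklov means with uniform bounds (lemma \<open>steklov_approximation\<close>).
  The means of \<open>\<zeta>\<close> involve weak derivatives on each annulus separately and \<open>\<zeta>(N)\<close> is the image of
  \<open>\<zeta>(|x - y|)\<close> under a linear map, which is why the uniqueness of weak derivatives and their transformation under
  linear maps are established.
\<close>

section \<open>Square roots of positive definite matrices\<close>

lemma matrix_inner_transpose:
  fixes C :: "real^'n^'n"
  assumes "transpose C = C"
  shows "(C *v x) \<bullet> z = x \<bullet> (C *v z)"
  by (metis assms dot_lmul_matrix transpose_matrix_vector)

text \<open>
  The quadratic form has a positive minimum on the compact unit sphere.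
\<close>

lemma spd_lower_bound:
  fixes C :: "real^'n^'n"
  assumes "spd C"
  obtains \<mu> where "0 < \<mu>" "\<And>x. \<mu> * (norm x)\<^sup>2 \<le> x \<bullet> (C *v x)"
proof -
  let ?q = "\<lambda>x. x \<bullet> (C *v x)"
  have cont: "continuous_on (sphere 0 1) ?q"
    by (intro continuous_intros linear_continuous_on) (auto simp: matrix_vector_mul_bounded_linear)
  have ne: "sphere (0::real^'n) 1 \<noteq> {}"
    by simp
  obtain z where z: "z \<in> sphere 0 1" "\<And>x. x \<in> sphere 0 1 \<Longrightarrow> ?q z \<le> ?q x"
    using continuous_attains_inf[OF compact_sphere ne cont] by blast
  show thesis
  proof
    have "z \<noteq> 0"
      using z(1) by auto
    then show "0 < ?q z"
      using assms by (simp add: spd_def)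
    show "?q z * (norm x)\<^sup>2 \<le> ?q x" for x
    proof (cases "x = 0")
      case False
      have "?q z \<le> ?q (x /\<^sub>R norm x)"
        using False by (intro z(2)) auto
      also have "\<dots> = ?q x / (norm x)\<^sup>2"
        by (simp add: matrix_vector_mult_scaleR power2_eq_square divide_inverse)
      finally show ?thesis
        using False by (simp add: field_simps)
    qed auto
  qed
qed

text \<open>
  For large \<open>c\<close> the matrix \<open>E = 1 - M / c\<close> has norm less than \<open>1\<close>, so \<open>Y \<mapsto> (E + Y\<^sup>2) / 2\<close> is a contraction on a
  ball. A fixed point \<open>Y\<close> satisfies \<open>(1 - Y)\<^sup>2 = 1 - E = M / c\<close>.
\<close>

lemma spd_sqrt_ex:
  fixes M :: "real^'n^'n"
  assumes "spd M"
  shows "\<exists>C. spd C \<and> C ** C = M"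
proof -
  obtain \<mu> where \<mu>: "0 < \<mu>" "\<And>x. \<mu> * (norm x)\<^sup>2 \<le> x \<bullet> (M *v x)"
    using spd_lower_bound[OF assms] by blast
  have sym: "transpose M = M"
    using assms by (simp add: spd_def)
  define l where "l = onorm ((*v) M) + 1"
  have l: "norm (M *v x) \<le> l * norm x" "l > 0" for x
  proof -
    have "norm (M *v x) \<le> onorm ((*v) M) * norm x"
      by (simp add: onorm matrix_vector_mul_bounded_linear)
    then show "norm (M *v x) \<le> l * norm x"
      using norm_ge_zero[of x] unfolding l_def distrib_right mult_1 by linarith
    show "l > 0"
      using onorm_pos_le[OF matrix_vector_mul_bounded_linear[of M]] by (simp add: l_def)
  qed
  \<comment> \<open>Large enough that \<open>E = 1 - M / c\<close> is a strict contraction.\<close>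
  define c where "c = l\<^sup>2 / \<mu> + \<mu>"
  have c: "c > 0" "l\<^sup>2 < c * \<mu>"
    using \<mu> l(2) by (auto simp: c_def field_simps power2_eq_square add_pos_pos)
  define q where "q = sqrt (1 - \<mu> / c)"
  have q: "0 \<le> q" "q < 1" "q\<^sup>2 = 1 - \<mu> / c"
    using c \<mu> by (auto simp: q_def c_def field_simps)
  define E :: "(real^'n) \<Rightarrow>\<^sub>L (real^'n)" where "E = Blinfun (\<lambda>x. x - (1/c) *\<^sub>R (M *v x))"
  have E: "blinfun_apply E x = x - (1/c) *\<^sub>R (M *v x)" for x
    unfolding E_def
    by (subst bounded_linear_Blinfun_apply)
       (auto intro!: bounded_linear_intros matrix_vector_mul_bounded_linear)
  have Esym: "blinfun_apply E x \<bullet> z = x \<bullet> blinfun_apply E z" for x z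
    by (simp add: E inner_diff_left inner_diff_right matrix_inner_transpose[OF sym])
  have "norm (blinfun_apply E x) \<le> q * norm x" for x
  proof (rule power2_le_imp_le)
    have "(norm (blinfun_apply E x))\<^sup>2 = (norm x)\<^sup>2 - 2/c * (x \<bullet> (M *v x)) + (norm (M *v x))\<^sup>2 / c\<^sup>2"
      unfolding E power2_norm_eq_inner
      by (simp add: inner_diff_left inner_diff_right inner_commute power2_eq_square field_simps)
    also have "\<dots> \<le> (norm x)\<^sup>2 - 2/c * (\<mu> * (norm x)\<^sup>2) + (l * norm x)\<^sup>2 / c\<^sup>2"
      using \<mu>(2)[of x] l c
      by (intro add_mono diff_mono mult_left_mono divide_right_mono power_mono) auto
    also have "\<dots> \<le> (norm x)\<^sup>2 - 2/c * (\<mu> * (norm x)\<^sup>2) + (c * \<mu>) * (norm x)\<^sup>2 / c\<^sup>2"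
      using c by (intro add_mono divide_right_mono) (auto simp: power_mult_distrib intro!: mult_right_mono)
    also have "\<dots> = (1 - \<mu> / c) * (norm x)\<^sup>2"
      using c by (simp add: field_simps power2_eq_square)
    also have "\<dots> = (q * norm x)\<^sup>2"
      by (simp only: power_mult_distrib q)
    finally show "(norm (blinfun_apply E x))\<^sup>2 \<le> (q * norm x)\<^sup>2" .
  qed (use q in auto)
  then have nE: "norm E \<le> q"
    by (intro norm_blinfun_bound q)
  define s :: "((real^'n) \<Rightarrow>\<^sub>L (real^'n)) set"
    where "s = {Y. norm Y \<le> q \<and> (\<forall>x z. blinfun_apply Y x \<bullet> z = x \<bullet> blinfun_apply Y z)}"
  \<comment> \<open>The fixed point equation \<open>2 Y = E + Y\<^sup>2\<close> says \<open>(1 - Y)\<^sup>2 = 1 - E\<close>. Self-adjointness in \<open>s\<close> survives in the limit.\<close>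
  define F where "F = (\<lambda>Y::(real^'n) \<Rightarrow>\<^sub>L (real^'n). (1/2) *\<^sub>R (E + (Y o\<^sub>L Y)))"
  have "\<exists>!Y\<in>s. F Y = Y"
  proof (rule Banach_fix)
    have "closed s"
    proof -
      have "s = cball 0 q \<inter> (\<Inter>x. \<Inter>z. {Y. blinfun_apply Y x \<bullet> z = x \<bullet> blinfun_apply Y z})"
        by (auto simp: s_def)
      moreover have "closed {Y::(real^'n) \<Rightarrow>\<^sub>L (real^'n). blinfun_apply Y x \<bullet> z = x \<bullet> blinfun_apply Y z}" for x z
        by (intro closed_Collect_eq continuous_intros)
      ultimately show ?thesis
        by (metis (no_types, lifting) closed_INT closed_Int closed_cball)
    qed
    then show "complete s"
      by (simp add: complete_eq_closed)
    show "s \<noteq> {}"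
      using q by (auto simp: s_def intro!: exI[of _ 0])
    show "0 \<le> q" "q < 1" by (fact q)+
    show "F ` s \<subseteq> s"
    proof safe
      fix Y assume Y: "Y \<in> s"
      have "norm (Y o\<^sub>L Y) \<le> q * q"
        by (rule order_trans[OF norm_blinfun_compose mult_mono]) (use Y q in \<open>auto simp: s_def\<close>)
      also have "\<dots> \<le> q"
        using q by (simp add: mult_left_le)
      finally have "norm (E + (Y o\<^sub>L Y)) \<le> q + q"
        using nE norm_triangle_mono by blast
      then show "F Y \<in> s"
        using Y by (auto simp: s_def F_def Esym blinfun.bilinear_simps inner_add_left inner_add_right)
    qed
    show "dist (F Y) (F W) \<le> q * dist Y W" if YW: "Y \<in> s" "W \<in> s" for Y W
    proof -
      have "F Y - F W = (1/2) *\<^sub>R ((Y o\<^sub>L (Y - W)) + ((Y - W) o\<^sub>L W))"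
        by (rule blinfun_eqI) (simp add: F_def blinfun.bilinear_simps scaleR_right_diff_distrib scaleR_add_right)
      then have "norm (F Y - F W) \<le> (1/2) * (norm Y * norm (Y - W) + norm (Y - W) * norm W)"
        using norm_triangle_mono[OF norm_blinfun_compose norm_blinfun_compose, of Y "Y - W" "Y - W" W] by simp
      also have "\<dots> \<le> (1/2) * (q * norm (Y - W) + norm (Y - W) * q)"
        using YW by (intro mult_left_mono add_mono mult_right_mono) (auto simp: s_def)
      finally show ?thesis
        by (simp add: dist_norm mult.commute)
    qed
  qed
  then obtain Y where Y: "Y \<in> s" "F Y = Y" by auto
  define C where "C = matrix (\<lambda>x. sqrt c *\<^sub>R (x - blinfun_apply Y x))"
  have C: "C *v x = sqrt c *\<^sub>R (x - blinfun_apply Y x)" for x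
  proof -
    have "linear (\<lambda>x. sqrt c *\<^sub>R (x - blinfun_apply Y x))"
      by (rule linearI) (simp_all add: blinfun.add_right blinfun.scaleR_right algebra_simps)
    from fun_cong[OF matrix_vector_mul(2)[OF this], of x] show ?thesis
      unfolding C_def .
  qed
  have fix_pt: "2 *\<^sub>R blinfun_apply Y x = blinfun_apply E x + blinfun_apply Y (blinfun_apply Y x)" for x
  proof -
    have "2 *\<^sub>R blinfun_apply Y x = 2 *\<^sub>R blinfun_apply (F Y) x"
      by (simp add: Y)
    also have "\<dots> = blinfun_apply E x + blinfun_apply Y (blinfun_apply Y x)"
      by (simp add: F_def blinfun.bilinear_simps)
    finally show ?thesis .
  qed
  have "C *v (C *v x) = M *v x" for x
  proof -
    have "C *v (C *v x) = (sqrt c * sqrt c) *\<^sub>R ((x - blinfun_apply Y x) - blinfun_apply Y (x - blinfun_apply Y x))"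
      unfolding C blinfun.scaleR_right scaleR_diff_right[symmetric] scaleR_scaleR ..
    also have "\<dots> = c *\<^sub>R (x - 2 *\<^sub>R blinfun_apply Y x + blinfun_apply Y (blinfun_apply Y x))"
      using c by (simp add: blinfun.diff_right scaleR_2)
    also have "\<dots> = c *\<^sub>R ((1/c) *\<^sub>R (M *v x))"
      by (simp only: fix_pt E) simp
    also have "\<dots> = M *v x"
      using c by simp
    finally show ?thesis .
  qed
  then have "C ** C = M"
    by (simp add: matrix_eq matrix_vector_mul_assoc[symmetric])
  moreover have "spd C"
    unfolding spd_def
  proof (intro conjI allI impI)
    have "(C *v x) \<bullet> z = x \<bullet> (C *v z)" for x z
      using Y by (simp add: C s_def inner_diff_left inner_diff_right)
    from this[of "axis _ 1" "axis _ 1"] show "transpose C = C"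
      by (simp add: matrix_vector_mult_basis column_def inner_axis inner_axis' transpose_def vec_eq_iff)
    fix x :: "real^'n" assume x: "x \<noteq> 0"
    have "x \<bullet> blinfun_apply Y x \<le> norm x * norm (blinfun_apply Y x)"
      by (rule norm_cauchy_schwarz)
    also have "\<dots> \<le> norm x * (q * norm x)"
      using Y by (intro mult_left_mono order_trans[OF norm_blinfun mult_right_mono]) (auto simp: s_def)
    also have "\<dots> < norm x * norm x"
      using q x by simp
    finally show "0 < x \<bullet> (C *v x)"
      using c by (simp add: C inner_diff_right power2_norm_eq_inner[symmetric] power2_eq_square[symmetric])
  qed
  ultimately show ?thesis by blast
qed

text \<open>
  With \<open>X = C - D\<close> the equation reads \<open>X C + D X = 0\<close>. Multiplying by \<open>X\<close> and taking traces gives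
  \<open>tr (X C X) + tr (X D X) = 0\<close>, where both terms are nonnegative and vanish only for \<open>X = 0\<close>.
\<close>

lemma spd_sqrt_unique:
  fixes C D :: "real^'n^'n"
  assumes C: "spd C" and D: "spd D" and eq: "C ** C = D ** D"
  shows "C = D"
proof -
  define X where "X = C - D"
  have "transpose (C - D) = transpose C - transpose D"
    by (simp add: transpose_def vec_eq_iff)
  then have symX: "transpose X = X"
    using C D by (simp add: X_def spd_def)
  have quad: "trace (X ** (K ** X)) = (\<Sum>i\<in>UNIV. (X *v axis i 1) \<bullet> (K *v (X *v axis i 1)))" for K :: "real^'n^'n"
  proof -
    have "(X *v axis i 1) \<bullet> (K *v (X *v axis i 1)) = axis i 1 \<bullet> ((X ** (K ** X)) *v axis i 1)" for i
      by (simp add: matrix_inner_transpose[OF symX] matrix_vector_mul_assoc[symmetric])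
    then show ?thesis
      by (simp add: trace_def matrix_vector_mult_basis column_def inner_axis')
  qed
  have "C *v (C *v z) = D *v (D *v z)" for z
    by (simp add: matrix_vector_mul_assoc eq)
  then have "X ** C + D ** X = 0"
    by (simp add: matrix_eq X_def matrix_vector_mul_assoc[symmetric] matrix_vector_mult_add_rdistrib
        matrix_vector_mult_diff_rdistrib matrix_vector_mult_diff_distrib)
  then have "X ** (X ** C) + X ** (D ** X) = X ** 0"
    by (simp add: matrix_add_ldistrib[symmetric])
  then have "X ** (X ** C) + X ** (D ** X) = 0"
    by (simp add: matrix_matrix_mult_def zero_vec_def)
  then have "trace (X ** (X ** C)) + trace (X ** (D ** X)) = 0"
    by (metis trace_0 trace_add mat_0)
  moreover have "trace (X ** (X ** C)) = trace (X ** (C ** X))"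
    by (metis matrix_mul_assoc trace_mul_sym)
  ultimately have sum0: "(\<Sum>i\<in>UNIV. (X *v axis i 1) \<bullet> (C *v (X *v axis i 1)))
      + (\<Sum>i\<in>UNIV. (X *v axis i 1) \<bullet> (D *v (X *v axis i 1))) = 0"
    by (simp add: quad)
  have nonneg: "0 \<le> z \<bullet> (K *v z)" if "spd K" for K :: "real^'n^'n" and z
    using that by (cases "z = 0") (auto simp: spd_def less_imp_le)
  have "(\<Sum>i\<in>UNIV. (X *v axis i 1) \<bullet> (C *v (X *v axis i 1))) = 0"
    using sum0 sum_nonneg[of UNIV "\<lambda>i. (X *v axis i 1) \<bullet> (C *v (X *v axis i 1))"]
      sum_nonneg[of UNIV "\<lambda>i. (X *v axis i 1) \<bullet> (D *v (X *v axis i 1))"] nonneg[OF C] nonneg[OF D]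
    by (smt (verit))
  then have "(X *v axis i 1) \<bullet> (C *v (X *v axis i 1)) = 0" for i
    using sum_nonneg_eq_0_iff[of UNIV "\<lambda>i. (X *v axis i 1) \<bullet> (C *v (X *v axis i 1))"] nonneg[OF C]
    by auto
  then have "X *v axis i 1 = 0" for i
    using C by (metis less_irrefl spd_def)
  then have "X = 0"
    by (simp add: matrix_vector_mult_basis column_def vec_eq_iff)
  then show ?thesis
    by (simp add: X_def)
qed

lemma spd_sqrt:
  fixes M :: "real^'n^'n"
  assumes "spd M"
  shows "spd (spd_sqrt M)" "spd_sqrt M ** spd_sqrt M = M"
proof -
  have "\<exists>!C. spd C \<and> C ** C = M"
    using spd_sqrt_ex[OF assms] spd_sqrt_unique by (metis)
  from theI'[OF this] show "spd (spd_sqrt M)" "spd_sqrt M ** spd_sqrt M = M"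
    by (auto simp: spd_sqrt_def)
qed

lemma spd_invertible:
  fixes M :: "real^'n^'n"
  assumes "spd M"
  shows "invertible M"
proof -
  have "inj ((*v) M)"
  proof (rule linear_injective_0[THEN iffD2, rule_format])
    show "linear ((*v) M)" by simp
    show "x = 0" if "M *v x = 0" for x
      using assms that by (metis inner_zero_right less_irrefl spd_def)
  qed
  then show ?thesis
    by (simp add: invertible_left_inverse matrix_left_invertible_injective)
qed

lemma matrix_inv_mult:
  fixes M :: "real^'n^'n"
  assumes "invertible M"
  shows "M *v (matrix_inv M *v x) = x" "matrix_inv M *v (M *v x) = x"
proof -
  have "M ** matrix_inv M = mat 1 \<and> matrix_inv M ** M = mat 1"
    unfolding matrix_inv_def by (rule someI_ex) (use assms in \<open>simp add: invertible_def\<close>)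
  then show "M *v (matrix_inv M *v x) = x" "matrix_inv M *v (M *v x) = x"
    by (simp_all add: matrix_vector_mul_assoc)
qed

lemma inv_sqrt_facts:
  fixes M :: "real^'n^'n"
  assumes "spd M"
  defines "B \<equiv> inv_sqrt M" and "S \<equiv> spd_sqrt M"
  shows inv_sqrt_left: "B *v (S *v x) = x"
    and inv_sqrt_inner: "(B *v x) \<bullet> z = x \<bullet> (B *v z)"
    and inv_sqrt_square: "M *v (B *v (B *v x)) = x"
    and det_spd_sqrt: "\<bar>det S\<bar> = sqrt (det M)"
proof -
  have S: "spd S" "S ** S = M"
    using spd_sqrt[OF assms(1)] by (auto simp: S_def)
  have inv: "invertible S"
    by (rule spd_invertible) (fact S)
  have 1: "S *v (B *v x) = x" "B *v (S *v x) = x" for x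
    using matrix_inv_mult[OF inv] by (simp_all add: B_def S_def inv_sqrt_def)
  show "B *v (S *v x) = x"
    by (fact 1)
  have "(B *v x) \<bullet> z = (B *v x) \<bullet> (S *v (B *v z))"
    by (simp add: 1)
  also have "\<dots> = (S *v (B *v x)) \<bullet> (B *v z)"
    using matrix_inner_transpose[of S "B *v x" "B *v z"] S(1) by (simp add: spd_def)
  also have "\<dots> = x \<bullet> (B *v z)"
    by (simp add: 1)
  finally show "(B *v x) \<bullet> z = x \<bullet> (B *v z)" .
  show "M *v (B *v (B *v x)) = x"
    by (simp add: S(2)[symmetric] matrix_vector_mul_assoc[symmetric] 1)
  show "\<bar>det S\<bar> = sqrt (det M)"
    by (simp add: S(2)[symmetric] det_mul)
qed

section \<open>Linear changes of variables\<close>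

lemma measure_cbox_cart:
  fixes a b :: "real^'n"
  assumes "cbox a b \<noteq> {}"
  shows "measure lebesgue (cbox a b) = (\<Prod>i\<in>UNIV. b $ i - a $ i)"
  unfolding content_cbox_cart[OF assms, symmetric] by (rule measure_completion) simp

lemma shear_image_measure:
  fixes a b :: "real^'n"
  assumes "m \<noteq> n"
  shows "measure lebesgue ((\<lambda>x. \<chi> i. if i = m then x$m + x$n else x$i) ` cbox a b)
       = measure lebesgue (cbox a b)"
proof (cases "cbox a b = {}")
  case False
  let ?h = "\<lambda>x::real^'n. \<chi> i. if i = m then x$m + x$n else x$i"
  \<comment> \<open>After translation by \<open>?w\<close> the lower corner has \<open>n\<close>-th coordinate \<open>0\<close>.\<close>
  let ?w = "axis n (a $ n) :: real^'n"
  have ne: "cbox (a - ?w) (b - ?w) \<noteq> {}"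
    using False by (auto simp: interval_ne_empty_cart)
  have split: "?h z = ?h ?w + ?h (z - ?w)" for z
    by (simp add: vec_eq_iff)
  have shift: "cbox (a - ?w) (b - ?w) = (\<lambda>z. z - ?w) ` cbox a b"
    using cbox_translation[of "- ?w" a b] by (simp add: uminus_add_conv_diff)
  have "?h ` cbox a b = (+) (?h ?w) ` (?h ` cbox (a - ?w) (b - ?w))"
    unfolding shift image_image by (rule image_cong[OF refl split])
  then have "measure lebesgue (?h ` cbox a b) = measure lebesgue (?h ` cbox (a - ?w) (b - ?w))"
    by (simp only: measure_translation)
  also have "\<dots> = measure lebesgue (cbox (a - ?w) (b - ?w))"
    using ne by (intro measure_shear_interval assms) (auto simp: axis_def)
  also have "\<dots> = measure lebesgue (cbox a b)"
    unfolding measure_cbox_cart[OF False] measure_cbox_cart[OF ne] by simp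
  finally show ?thesis .
qed (simp only: image_empty)

text \<open>
  Every linear map is a product of elementary ones. Those that permute coordinates or shear have determinant
  \<open>1\<close> or \<open>- 1\<close>, and for them it is enough to look at boxes.
\<close>

lemma linear_image_measure:
  fixes f :: "real^'n \<Rightarrow> real^'n"
  assumes "linear f"
  shows "\<forall>S \<in> lmeasurable. f ` S \<in> lmeasurable \<and>
           measure lebesgue (f ` S) = \<bar>det (matrix f)\<bar> * measure lebesgue S"
    (is "?P f")
proof (rule induct_linear_elementary[OF assms, where P = ?P])
  have boxes: "?P f" if "linear f" "\<bar>det (matrix f)\<bar> = 1"
    "\<And>a b. measure lebesgue (f ` cbox a b) = measure lebesgue (cbox a b)" for f :: "real^'n \<Rightarrow> real^'n"
  proof (intro ballI)
    fix S :: "(real^'n) set"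
    assume S: "S \<in> lmeasurable"
    have "f ` S \<in> lmeasurable \<and> 1 * measure lebesgue S = measure lebesgue (f ` S)"
      by (rule measure_linear_sufficient[OF that(1) S]) (simp only: that(3) mult_1)
    then show "f ` S \<in> lmeasurable \<and> measure lebesgue (f ` S) = \<bar>det (matrix f)\<bar> * measure lebesgue S"
      by (simp only: that(2) mult_1)
  qed
  show "?P (f \<circ> g)" if "linear f" "linear g" "?P f" "?P g" for f g :: "real^'n \<Rightarrow> real^'n"
  proof -
    have "matrix (f \<circ> g) = matrix f ** matrix g"
      using that by (simp only: matrix_compose)
    then show ?thesis
      using that(3,4) by (simp only: image_comp[symmetric] det_mul abs_mult) (simp add: mult.assoc)
  qed
  show "?P f" if "linear f" "\<And>x. f x $ i = 0" for f :: "real^'n \<Rightarrow> real^'n" and i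
  proof -
    have "\<not> surj f"
      by (metis that(2) one_index surj_def zero_neq_one)
    then have inj: "\<not> inj f"
      using linear_injective_imp_surjective that(1) by blast
    then have "negligible (f ` S)" for S
      using negligible_linear_singular_image that(1) by blast
    moreover have "det (matrix f) = 0"
      using inj det_nz_iff_inj[OF that(1)] by blast
    ultimately show ?thesis
      by (auto simp: negligible_imp_measure0 negligible_imp_measurable)
  qed
  show "?P (\<lambda>x. \<chi> i. c i * x $ i)" for c
    by (auto simp: measurable_stretch measure_stretch matrix_def axis_def det_diagonal)
  show "?P (\<lambda>x. \<chi> i. x $ Transposition.transpose m n i)" if "m \<noteq> n" for m n :: 'n
  proof -
    let ?t = "Transposition.transpose m n"
    let ?h = "\<lambda>x::real^'n. \<chi> i. x $ ?t i"
    have lin: "linear ?h"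
      by (rule linearI) (simp_all add: vec_eq_iff)
    have hh: "?h (?h x) = x" for x
      by (subst vec_eq_iff) simp
    have "?h \<circ> ?h = id"
      by (rule ext) (simp only: o_apply id_apply hh)
    then have "det (matrix ?h ** matrix ?h) = 1"
      by (simp only: matrix_compose[OF lin lin, symmetric] matrix_id)
    then have "det (matrix ?h) = 1 \<or> det (matrix ?h) = - 1"
      by (simp only: det_mul square_eq_1_iff)
    then have det: "\<bar>det (matrix ?h)\<bar> = 1"
      by (elim disjE) (simp_all only: abs_one abs_minus_cancel)
    have meas: "measure lebesgue (?h ` cbox a b) = measure lebesgue (cbox a b)" for a b
    proof -
      have eq: "?h ` cbox a b = cbox (?h a) (?h b)"
      proof
        show "cbox (?h a) (?h b) \<subseteq> ?h ` cbox a b"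
        proof
          fix x assume "x \<in> cbox (?h a) (?h b)"
          then have "l $ ?t (?t i) \<le> x $ ?t i \<and> x $ ?t i \<le> u $ ?t (?t i)" if "l = a" "u = b" for i l u
            using that by (simp only: mem_box_cart vec_lambda_beta)
          then have "?h x \<in> cbox a b"
            by (simp add: mem_box_cart)
          then show "x \<in> ?h ` cbox a b"
            using imageI[of "?h x" "cbox a b" ?h] by (simp only: hh)
        qed
      qed (auto simp: mem_box_cart)
      have prods: "(\<Prod>i\<in>UNIV. b $ ?t i - a $ ?t i) = (\<Prod>i\<in>UNIV. b $ i - a $ i)"
        by (rule prod.reindex_bij_betw[of _ _ _ "\<lambda>i. b $ i - a $ i"]) simp
      show ?thesis
      proof (cases "cbox a b = {}")
        case False
        then have ne: "cbox (?h a) (?h b) \<noteq> {}"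
          unfolding eq[symmetric] by simp
        show ?thesis
          unfolding eq measure_cbox_cart[OF ne] measure_cbox_cart[OF False]
          by (simp only: vec_lambda_beta prods)
      qed (simp only: image_empty)
    qed
    show ?thesis
      by (rule boxes[OF lin det meas])
  qed
  show "?P (\<lambda>x. \<chi> i. if i = m then x $ m + x $ n else x $ i)" if "m \<noteq> n" for m n :: 'n
  proof -
    let ?h = "\<lambda>x::real^'n. \<chi> i. if i = m then x$m + x$n else x$i"
    have lin: "linear ?h"
      by (rule linearI) (auto simp: vec_eq_iff algebra_simps)
    have "matrix ?h = (\<chi> k. if k = m then row m (mat 1) + 1 *s row n (mat 1) else row k (mat 1))"
      by (auto simp: matrix_def row_def mat_def axis_def vec_eq_iff)
    then have det: "\<bar>det (matrix ?h)\<bar> = 1"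
      using det_row_operation[OF that, where c="1::real" and A="mat 1"] by simp
    show ?thesis
      by (rule boxes[OF lin det shear_image_measure[OF that]])
  qed
qed

lemma lborel_linear:
  fixes M :: "real^'n^'n"
  assumes "det M \<noteq> 0"
  shows "lborel = density (distr lborel borel (\<lambda>x. y + M *v (x - y))) (\<lambda>_. ennreal \<bar>det M\<bar>)"
proof (rule lborel_eqI)
  have inv: "invertible M"
    using assms by (simp add: invertible_det_nz)
  let ?T = "\<lambda>x. y + M *v (x - y)"
  let ?R = "\<lambda>x. y + matrix_inv M *v (x - y)"
  have [measurable]: "?T \<in> borel_measurable borel"
    by (intro borel_measurable_continuous_onI continuous_intros
        bounded_linear.continuous_on[OF matrix_vector_mul_bounded_linear])
  fix l u :: "real^'n" assume lu: "\<And>b. b \<in> Basis \<Longrightarrow> l \<bullet> b \<le> u \<bullet> b"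
  have "?T -` box l u = ?R ` box l u"
  proof safe
    fix x assume "?T x \<in> box l u"
    moreover have "x = ?R (?T x)"
      by (simp add: matrix_inv_mult[OF inv])
    ultimately show "x \<in> ?R ` box l u" by blast
  qed (simp add: matrix_inv_mult[OF inv])
  also have "\<dots> = (\<lambda>x. y + x) ` ((*v) (matrix_inv M) ` ((\<lambda>x. x - y) ` box l u))"
    by (simp add: image_image)
  finally have eq: "?T -` box l u = \<dots>" .
  have sub: "(\<lambda>x. x - y) ` box l u = box (l - y) (u - y)"
  proof -
    have "x \<in> box (l - y) (u - y) \<longleftrightarrow> x + y \<in> box l u" for x
      by (simp add: mem_box inner_diff_left inner_add_left algebra_simps)
    then show ?thesis
      by (force simp: image_iff)
  qed
  have P: "(*v) (matrix_inv M) ` box (l - y) (u - y) \<in> lmeasurable"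
    "measure lebesgue ((*v) (matrix_inv M) ` box (l - y) (u - y)) = \<bar>det (matrix_inv M)\<bar> * measure lebesgue (box (l - y) (u - y))"
    using linear_image_measure[of "(*v) (matrix_inv M)"] by auto
  have "det M * det (matrix_inv M) = 1"
    using inv matrix_inv_mult[OF inv] by (metis det_I det_mul matrix_eq matrix_vector_mul_assoc matrix_vector_mul_lid)
  then have dets: "\<bar>det M\<bar> * \<bar>det (matrix_inv M)\<bar> = 1"
    by (simp flip: abs_mult)
  have meas: "?T -` box l u \<in> sets borel"
    using measurable_sets[of ?T borel borel "box l u"] by simp
  then have "emeasure lborel (?T -` box l u) = emeasure lebesgue (?T -` box l u)"
    by simp
  also have "\<dots> = ennreal (measure lebesgue (?T -` box l u))"
    using P(1) unfolding eq sub by (intro emeasure_eq_measure2 measurable_translation)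
  also have "measure lebesgue (?T -` box l u) = \<bar>det (matrix_inv M)\<bar> * measure lebesgue (box (l - y) (u - y))"
    unfolding eq sub by (simp add: measure_translation P)
  also have "measure lebesgue (box (l - y) (u - y)) = (\<Prod>b\<in>Basis. (u - l) \<bullet> b)"
    using lu by (simp add: measure_lborel_box inner_diff_left)
  finally show "emeasure (density (distr lborel borel ?T) (\<lambda>_. ennreal \<bar>det M\<bar>)) (box l u)
      = ennreal (\<Prod>b\<in>Basis. (u - l) \<bullet> b)"
    using dets
    by (simp add: emeasure_density nn_integral_cmult emeasure_distr ennreal_mult'[symmetric] mult.assoc[symmetric])
qed simp

section \<open>Continuously differentiable functions\<close>

lemma partial_eq:
  assumes "(f has_derivative D) (at x)"
  shows "partial i f x = D (axis i 1)"
  using frechet_derivative_at[OF assms] by (simp add: partial_def)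

lemma partial_cong_open:
  assumes "open S" "x \<in> S" "\<And>z. z \<in> S \<Longrightarrow> f z = g z"
  shows "partial i f x = partial i g x"
proof -
  have "(f has_derivative D) (at x) \<longleftrightarrow> (g has_derivative D) (at x)" for D
    using assms by (auto intro: has_derivative_transform_within_open[of f D x UNIV S g]
        has_derivative_transform_within_open[of g D x UNIV S f])
  then show ?thesis
    by (simp add: partial_def frechet_derivative_def)
qed

lemma partial_mult:
  assumes "f differentiable (at x)" "g differentiable (at x)"
  shows "partial i (\<lambda>x. f x * g x) x = f x * partial i g x + partial i f x * g x"
proof -
  have "((\<lambda>x. f x * g x) has_derivative
      (\<lambda>h. f x * frechet_derivative g (at x) h + frechet_derivative f (at x) h * g x)) (at x)"
    using assms by (intro has_derivative_mult) (simp_all add: frechet_derivative_works)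
  from partial_eq[OF this] show ?thesis
    by (simp add: partial_def)
qed

lemma partial_add:
  assumes "f differentiable (at x)" "g differentiable (at x)"
  shows "partial i (\<lambda>x. f x + g x) x = partial i f x + partial i g x"
proof -
  have "((\<lambda>x. f x + g x) has_derivative
      (\<lambda>h. frechet_derivative f (at x) h + frechet_derivative g (at x) h)) (at x)"
    using assms by (intro has_derivative_add) (simp_all add: frechet_derivative_works)
  from partial_eq[OF this] show ?thesis
    by (simp add: partial_def)
qed

lemma partial_const: "partial i (\<lambda>x. c) x = 0"
  by (rule partial_eq[THEN trans]) (rule has_derivative_const, simp)

lemma partial_cmult:
  assumes "f differentiable (at x)"
  shows "partial i (\<lambda>x. c * f x) x = c * partial i f x"
  using partial_mult[OF differentiable_const assms, of i c] by (simp add: partial_const)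

lemma frechet_derivative_eq_partial:
  assumes "f differentiable (at x)"
  shows "frechet_derivative f (at x) h = (\<Sum>i\<in>UNIV. h $ i * partial i f x)"
proof -
  have lin: "linear (frechet_derivative f (at x))"
    using assms by (rule linear_frechet_derivative)
  have "h = (\<Sum>i\<in>UNIV. h $ i *\<^sub>R axis i 1)"
    by (simp add: basis_expansion scalar_mult_eq_scaleR[symmetric])
  then have "frechet_derivative f (at x) h = frechet_derivative f (at x) (\<Sum>i\<in>UNIV. h $ i *\<^sub>R axis i 1)"
    by simp
  also have "\<dots> = (\<Sum>i\<in>UNIV. h $ i * partial i f x)"
    by (simp add: linear_sum[OF lin] linear_cmul[OF lin] partial_def)
  finally show ?thesis .
qed

definition C1_on :: "(real^'n) set \<Rightarrow> (real^'n \<Rightarrow> real) \<Rightarrow> bool" where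
  "C1_on \<Omega> f \<longleftrightarrow> (\<forall>x\<in>\<Omega>. f differentiable (at x)) \<and> (\<forall>i. continuous_on \<Omega> (partial i f))"

lemma C1_on_subset: "C1_on \<Omega> f \<Longrightarrow> \<Omega>' \<subseteq> \<Omega> \<Longrightarrow> C1_on \<Omega>' f"
  unfolding C1_on_def by (meson continuous_on_subset subsetD)

lemma C1_on_continuous: "C1_on \<Omega> f \<Longrightarrow> continuous_on \<Omega> f"
  unfolding C1_on_def
  by (meson continuous_at_imp_continuous_on differentiable_imp_continuous_within)

lemma C1_onI:
  assumes "\<And>x. x \<in> \<Omega> \<Longrightarrow> (f has_derivative D x) (at x)"
    and "\<And>i. continuous_on \<Omega> (\<lambda>x. D x (axis i 1))"
  shows "C1_on \<Omega> f"
  unfolding C1_on_def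
proof (intro conjI allI ballI)
  show "f differentiable (at x)" if "x \<in> \<Omega>" for x
    using assms(1)[OF that] by (rule differentiableI)
  show "continuous_on \<Omega> (partial i f)" for i
    using assms(2)[of i] by (rule continuous_on_eq) (simp add: partial_eq[OF assms(1)])
qed

lemma C1_on_const: "C1_on \<Omega> (\<lambda>x. c)"
  by (rule C1_onI) (auto intro: has_derivative_const)

lemma C1_on_mult:
  assumes "C1_on \<Omega> f" "C1_on \<Omega> g"
  shows "C1_on \<Omega> (\<lambda>x. f x * g x)"
  unfolding C1_on_def
proof (intro conjI allI ballI)
  show "(\<lambda>x. f x * g x) differentiable (at x)" if "x \<in> \<Omega>" for x
    using assms that by (auto simp: C1_on_def)
  have "continuous_on \<Omega> (\<lambda>x. f x * partial i g x + partial i f x * g x)" for i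
    using assms C1_on_continuous[OF assms(1)] C1_on_continuous[OF assms(2)]
    by (intro continuous_intros) (auto simp: C1_on_def)
  then show "continuous_on \<Omega> (partial i (\<lambda>x. f x * g x))" for i
    by (rule continuous_on_eq) (use assms in \<open>simp add: partial_mult C1_on_def\<close>)
qed

lemma C1_on_add:
  assumes "C1_on \<Omega> f" "C1_on \<Omega> g"
  shows "C1_on \<Omega> (\<lambda>x. f x + g x)"
  unfolding C1_on_def
proof (intro conjI allI ballI)
  show "(\<lambda>x. f x + g x) differentiable (at x)" if "x \<in> \<Omega>" for x
    using assms that by (auto simp: C1_on_def)
  have "continuous_on \<Omega> (\<lambda>x. partial i f x + partial i g x)" for i
    using assms by (intro continuous_intros) (auto simp: C1_on_def)
  then show "continuous_on \<Omega> (partial i (\<lambda>x. f x + g x))" for i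
    by (rule continuous_on_eq) (use assms in \<open>simp add: partial_add C1_on_def\<close>)
qed

lemma C1_on_diff:
  assumes "C1_on \<Omega> f" "C1_on \<Omega> g"
  shows "C1_on \<Omega> (\<lambda>x. f x - g x)"
  using C1_on_add[OF assms(1) C1_on_mult[OF C1_on_const[of _ "-1"] assms(2)]] by simp

lemma has_derivative_component: "((\<lambda>x. (x - y) $ i) has_derivative (\<lambda>h. h $ i)) (at x)"
  by (auto intro!: derivative_eq_intros bounded_linear_imp_has_derivative bounded_linear_vec_nth)

lemma C1_on_component: "C1_on \<Omega> (\<lambda>x. (x - y) $ i)"
  by (rule C1_onI[OF has_derivative_component]) auto

lemma partial_component: "partial j (\<lambda>x. (x - y) $ i) x = of_bool (i = j)"
  unfolding partial_eq[OF has_derivative_component] by (simp add: axis_def)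

lemma has_derivative_radial:
  fixes L :: "real^'n^'n"
  assumes "(G has_real_derivative g) (at ((norm (L *v (x - y)))\<^sup>2))"
  shows "((\<lambda>x. G ((norm (L *v (x - y)))\<^sup>2)) has_derivative
           (\<lambda>h. g * (2 * ((L *v (x - y)) \<bullet> (L *v h))))) (at x)"
proof -
  have "((\<lambda>x. L *v (x - y)) has_derivative (\<lambda>h. L *v h)) (at x)"
    by (auto intro!: derivative_eq_intros bounded_linear.has_derivative[OF matrix_vector_mul_bounded_linear])
  then have "((\<lambda>x. (norm (L *v (x - y)))\<^sup>2) has_derivative (\<lambda>h. 2 * ((L *v (x - y)) \<bullet> (L *v h)))) (at x)"
    unfolding power2_norm_eq_inner
    by (auto intro!: derivative_eq_intros simp: inner_commute)
  from has_derivative_compose[OF this assms[unfolded has_field_derivative_def]] show ?thesis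
    by simp
qed

text \<open>
  Cutoffs and fields are functions of \<open>|L (x - y)|\<^sup>2\<close>, which unlike the norm is smooth at \<open>y\<close>.
\<close>

lemma partial_radial:
  fixes L :: "real^'n^'n"
  assumes "(G has_real_derivative g) (at ((norm (L *v (x - y)))\<^sup>2))"
  shows "partial i (\<lambda>x. G ((norm (L *v (x - y)))\<^sup>2)) x = g * (2 * ((L *v (x - y)) \<bullet> (L *v axis i 1)))"
  by (rule partial_eq[OF has_derivative_radial[OF assms]])

lemma continuous_on_quadratic:
  fixes L :: "real^'n^'n"
  shows "continuous_on \<Omega> (\<lambda>x. (norm (L *v (x - y)))\<^sup>2)"
    and "continuous_on \<Omega> (\<lambda>x. (L *v (x - y)) \<bullet> z)"
  by (intro continuous_intros bounded_linear.continuous_on[OF matrix_vector_mul_bounded_linear])+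

lemma C1_on_radial:
  fixes L :: "real^'n^'n"
  assumes "\<And>t. t \<in> T \<Longrightarrow> (G has_real_derivative g t) (at t)" "continuous_on T g"
    and "\<And>x. x \<in> \<Omega> \<Longrightarrow> (norm (L *v (x - y)))\<^sup>2 \<in> T"
  shows "C1_on \<Omega> (\<lambda>x. G ((norm (L *v (x - y)))\<^sup>2))"
proof (rule C1_onI[OF has_derivative_radial])
  show "(G has_real_derivative g ((norm (L *v (x - y)))\<^sup>2)) (at ((norm (L *v (x - y)))\<^sup>2))"
    if "x \<in> \<Omega>" for x
    using that assms by blast
  have "continuous_on \<Omega> (\<lambda>x. g ((norm (L *v (x - y)))\<^sup>2))"
    by (rule continuous_on_compose2[OF assms(2) continuous_on_quadratic(1)]) (use assms(3) in auto)
  then show "continuous_on \<Omega> (\<lambda>x. g ((norm (L *v (x - y)))\<^sup>2) * (2 * ((L *v (x - y)) \<bullet> (L *v axis i 1))))" for i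
    by (intro continuous_intros continuous_on_quadratic)
qed

lemma C01_support:
  assumes "\<phi> \<in> C01 \<Omega>"
  obtains K where "compact K" "K \<subseteq> \<Omega>" "\<And>x. x \<notin> K \<Longrightarrow> \<phi> x = 0" "\<And>x i. x \<notin> K \<Longrightarrow> partial i \<phi> x = 0"
proof
  let ?K = "closure {x. \<phi> x \<noteq> 0}"
  show "compact ?K" "?K \<subseteq> \<Omega>"
    using assms by (auto simp: C01_def)
  show 0: "\<phi> x = 0" if "x \<notin> ?K" for x
  proof (rule ccontr)
    assume "\<phi> x \<noteq> 0"
    then have "x \<in> ?K"
      by (intro subsetD[OF closure_subset] CollectI)
    then show False
      using that by contradiction
  qed
  show "partial i \<phi> x = 0" if "x \<notin> ?K" for x i
  proof -
    have "partial i \<phi> x = partial i (\<lambda>_. 0) x"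
    proof (rule partial_cong_open)
      show "open (- ?K)"
        by (rule open_Compl[OF closed_closure])
      show "x \<in> - ?K"
        using that unfolding Compl_iff .
      show "\<phi> z = 0" if "z \<in> - ?K" for z
        using ComplD[OF that] by (rule 0)
    qed
    then show ?thesis
      by (simp only: partial_const)
  qed
qed

lemma C01_C1: "\<phi> \<in> C01 \<Omega> \<Longrightarrow> C1_on S \<phi>"
  unfolding C01_def C1_on_def by (auto intro: continuous_on_subset)

lemma C01_continuous:
  assumes "\<phi> \<in> C01 \<Omega>"
  shows "continuous_on UNIV \<phi>" "continuous_on UNIV (partial i \<phi>)"
  using C1_on_continuous[OF C01_C1[OF assms]] assms by (auto simp: C01_def)

lemma C01_differentiable: "\<phi> \<in> C01 \<Omega> \<Longrightarrow> \<phi> differentiable (at x)"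
  by (simp add: C01_def)

lemma C01_mono: "\<phi> \<in> C01 \<Omega> \<Longrightarrow> \<Omega> \<subseteq> \<Omega>' \<Longrightarrow> \<phi> \<in> C01 \<Omega>'"
  by (auto simp: C01_def)

lemma C01I:
  assumes "open \<Omega>" "C1_on \<Omega> f" "compact K" "K \<subseteq> \<Omega>" "\<And>x. x \<notin> K \<Longrightarrow> f x = 0"
  shows "f \<in> C01 \<Omega>"
proof -
  have oK: "open (- K)"
    using \<open>compact K\<close> by (simp add: open_Compl compact_imp_closed)
  have "C1_on (- K) f"
    by (rule C1_onI[where D = "\<lambda>_ _. 0"])
      (auto intro!: has_derivative_transform_within_open[OF has_derivative_const oK] simp: assms(5))
  then have "C1_on (\<Omega> \<union> - K) f"
    using assms(1,2) oK unfolding C1_on_def by (auto intro: continuous_on_open_Un)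
  moreover have "\<Omega> \<union> - K = UNIV"
    using assms(4) by auto
  moreover have sub: "closure {x. f x \<noteq> 0} \<subseteq> K"
    using assms(3,5) by (intro closure_minimal) (auto simp: compact_imp_closed)
  moreover have "compact (closure {x. f x \<noteq> 0})"
    using sub assms(3) by (metis closed_closure compact_Int_closed inf.absorb_iff2)
  ultimately show ?thesis
    using assms(3,4) unfolding C01_def C1_on_def
    by auto
qed

lemma C01_mult:
  assumes "open \<Omega>" "C1_on \<Omega> f" "\<phi> \<in> C01 \<Omega>"
  shows "(\<lambda>x. f x * \<phi> x) \<in> C01 \<Omega>"
proof -
  obtain K where "compact K" "K \<subseteq> \<Omega>" "\<And>x. x \<notin> K \<Longrightarrow> \<phi> x = 0"
    using C01_support[OF assms(3)] by metis
  then show ?thesis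
    by (intro C01I[OF assms(1) _ \<open>compact K\<close> \<open>K \<subseteq> \<Omega>\<close>] C1_on_mult assms(2) C01_C1[OF assms(3)]) auto
qed

lemma integrable_compact_support:
  fixes f :: "real^'n \<Rightarrow> real"
  assumes "continuous_on UNIV f" "compact K" "\<And>x. x \<notin> K \<Longrightarrow> f x = 0"
  shows "integrable lebesgue f"
proof -
  have "integrable lborel (\<lambda>x. indicator K x *\<^sub>R f x)"
    by (rule borel_integrable_compact[OF assms(2) continuous_on_subset[OF assms(1)]]) simp
  also have "(\<lambda>x. indicator K x *\<^sub>R f x) = f"
    using assms(3) by (auto simp: indicator_def fun_eq_iff)
  finally show ?thesis
    using assms(1) by (subst integrable_completion) (auto intro: borel_measurable_continuous_onI)
qed

text \<open>
  Difference quotients have integral \<open>0\<close> by translation invariance, and they converge boundedly to the derivative.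
\<close>

lemma integral_partial_0:
  fixes \<phi> :: "real^'n \<Rightarrow> real"
  assumes "\<phi> \<in> C01 \<Omega>"
  shows "(LINT x|lebesgue. partial i \<phi> x) = 0"
proof -
  obtain K where K: "compact K" "\<And>x. x \<notin> K \<Longrightarrow> \<phi> x = 0" "\<And>x i. x \<notin> K \<Longrightarrow> partial i \<phi> x = 0"
    using C01_support[OF assms] by metis
  obtain R where R: "\<And>x. x \<in> K \<Longrightarrow> norm x \<le> R"
    using compact_imp_bounded[OF K(1)] by (auto simp: bounded_iff)
  have cont: "continuous_on UNIV \<phi>" "continuous_on UNIV (partial i \<phi>)"
    using C01_continuous[OF assms] by auto
  have meas [measurable]: "\<phi> \<in> borel_measurable borel" "partial i \<phi> \<in> borel_measurable borel"
    using cont by (auto intro: borel_measurable_continuous_onI)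
  have "compact (partial i \<phi> ` K)"
    using K(1) cont(2) by (auto intro: compact_continuous_image continuous_on_subset)
  then obtain B0 where "\<And>x. x \<in> K \<Longrightarrow> \<bar>partial i \<phi> x\<bar> \<le> B0"
    using compact_imp_bounded by (force simp: bounded_iff)
  then have B: "\<bar>partial i \<phi> x\<bar> \<le> \<bar>B0\<bar>" for x
    by (cases "x \<in> K") (force simp: K(3))+
  let ?e = "axis i 1 :: real^'n"
  define q where "q = (\<lambda>k x. real (Suc k) * (\<phi> (x + (1 / real (Suc k)) *\<^sub>R ?e) - \<phi> x))"
  have along: "((\<lambda>t. \<phi> (x + t *\<^sub>R ?e)) has_real_derivative partial i \<phi> (x + t *\<^sub>R ?e)) (at t)" for x t
  proof -
    have "((\<lambda>t. x + t *\<^sub>R ?e) has_derivative (\<lambda>s. s *\<^sub>R ?e)) (at t)"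
      by (auto intro!: derivative_eq_intros)
    moreover have "(\<phi> has_derivative frechet_derivative \<phi> (at (x + t *\<^sub>R ?e))) (at (x + t *\<^sub>R ?e))"
      using C01_differentiable[OF assms] by (simp add: frechet_derivative_works)
    ultimately have "((\<lambda>t. \<phi> (x + t *\<^sub>R ?e)) has_derivative
        (\<lambda>s. frechet_derivative \<phi> (at (x + t *\<^sub>R ?e)) (s *\<^sub>R ?e))) (at t)"
      by (rule has_derivative_compose)
    also have "(\<lambda>s. frechet_derivative \<phi> (at (x + t *\<^sub>R ?e)) (s *\<^sub>R ?e)) = (*) (partial i \<phi> (x + t *\<^sub>R ?e))"
      using linear_frechet_derivative[OF C01_differentiable[OF assms]]
      by (auto simp: partial_def linear_cmul mult.commute)
    finally show ?thesis
      by (simp add: has_field_derivative_def)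
  qed
  have bound: "norm (q k x) \<le> \<bar>B0\<bar> * indicator (cball 0 (R + 1)) x" for k x
  proof (cases "x \<in> cball 0 (R + 1)")
    case True
    have "\<bar>\<phi> (x + (1 / real (Suc k)) *\<^sub>R ?e) - \<phi> (x + 0 *\<^sub>R ?e)\<bar> \<le> \<bar>B0\<bar> * \<bar>1 / real (Suc k) - 0\<bar>"
      using field_differentiable_bound[of UNIV "\<lambda>t. \<phi> (x + t *\<^sub>R ?e)" "\<lambda>t. partial i \<phi> (x + t *\<^sub>R ?e)" "\<bar>B0\<bar>" "1 / real (Suc k)" 0]
        along B by auto
    then have "real (Suc k) * \<bar>\<phi> (x + (1 / real (Suc k)) *\<^sub>R ?e) - \<phi> x\<bar> \<le> \<bar>B0\<bar>"
      by (simp add: pos_le_divide_eq mult.commute del: of_nat_Suc)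
    then show ?thesis
      using True by (simp add: q_def abs_mult del: of_nat_Suc)
  next
    case False
    have "norm (x + (1 / real (Suc k)) *\<^sub>R ?e) \<ge> norm x - norm ((1 / real (Suc k)) *\<^sub>R ?e)"
      using norm_triangle_ineq2[of x "- (1 / real (Suc k)) *\<^sub>R ?e"] by simp
    moreover have "norm ((1 / real (Suc k)) *\<^sub>R ?e) \<le> 1"
      by simp
    moreover have "norm x > R + 1"
      using False by simp
    ultimately have "norm (x + (1 / real (Suc k)) *\<^sub>R ?e) > R" "norm x > R"
      by linarith+
    then have "\<phi> (x + (1 / real (Suc k)) *\<^sub>R ?e) = 0" "\<phi> x = 0"
      using R K(2) by force+
    then show ?thesis
      using False by (simp add: q_def)
  qed
  have lim: "(\<lambda>k. LINT x|lborel. q k x) \<longlonglongrightarrow> (LINT x|lborel. partial i \<phi> x)"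
  proof (rule integral_dominated_convergence[where w = "\<lambda>x. \<bar>B0\<bar> * indicator (cball 0 (R + 1)) x"])
    show "integrable lborel (\<lambda>x. \<bar>B0\<bar> * indicat_real (cball 0 (R + 1)) x)"
      by (intro integrable_mult_right integrable_real_indicator emeasure_bounded_finite) auto
    show "AE x in lborel. (\<lambda>k. q k x) \<longlonglongrightarrow> partial i \<phi> x"
    proof (rule AE_I2)
      fix x
      have "((\<lambda>h. (\<phi> (x + h *\<^sub>R ?e) - \<phi> x) / h) \<longlongrightarrow> partial i \<phi> x) (at 0)"
        using along[of x 0] by (simp add: has_field_derivative_iff)
      moreover have "filterlim (\<lambda>k. 1 / real (Suc k)) (at 0) sequentially"
        by (rule filterlim_atI) (use LIMSEQ_inverse_real_of_nat in \<open>auto simp: inverse_eq_divide\<close>)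
      ultimately show "(\<lambda>k. q k x) \<longlonglongrightarrow> partial i \<phi> x"
        using filterlim_compose unfolding q_def by (force simp: mult.commute)
    qed
    show "AE x in lborel. norm (q k x) \<le> \<bar>B0\<bar> * indicat_real (cball 0 (R + 1)) x" for k
      using bound by simp
  qed (auto simp: q_def)
  have zero: "(LINT x|lborel. q k x) = 0" for k
  proof -
    let ?c = "(1 / real (Suc k)) *\<^sub>R ?e"
    have int: "integrable lborel \<phi>"
      using integrable_compact_support[OF cont(1) K(1,2)] by (simp add: integrable_completion)
    then have int2: "integrable (distr lborel borel ((+) ?c)) \<phi>"
      by (simp add: lborel_distr_plus)
    have "integrable lborel (\<lambda>x. \<phi> (?c + x))" "(LINT x|lborel. \<phi> (?c + x)) = (LINT x|lborel. \<phi> x)"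
      using integrable_distr[OF _ int2] integral_distr[of "(+) ?c" lborel borel \<phi>]
      by (auto simp: lborel_distr_plus)
    then show ?thesis
      using int by (simp add: q_def add.commute)
  qed
  have "(LINT x|lborel. partial i \<phi> x) = 0"
    using LIMSEQ_unique[OF lim[unfolded zero] tendsto_const] .
  then show ?thesis
    by (simp add: integral_completion)
qed

section \<open>A smooth step\<close>

lemma DERIV_pos_part_power:
  "((\<lambda>t::real. (max 0 t) ^ Suc (Suc k)) has_real_derivative real (Suc (Suc k)) * (max 0 t) ^ Suc k) (at t)"
proof -
  consider "t < 0" | "t = 0" | "t > 0"
    by linarith
  then show ?thesis
  proof cases
    case 1
    have "((\<lambda>t::real. 0) has_real_derivative 0) (at t)"
      by simp
    then have "((\<lambda>t::real. (max 0 t) ^ Suc (Suc k)) has_real_derivative 0) (at t)"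
      by (rule has_field_derivative_transform_within_open[of _ _ _ "{..<0}"]) (use 1 in auto)
    then show ?thesis
      using 1 by simp
  next
    case 3
    have "((\<lambda>t::real. t ^ Suc (Suc k)) has_real_derivative real (Suc (Suc k)) * t ^ Suc k) (at t)"
      using DERIV_pow[of "Suc (Suc k)" t UNIV] by simp
    then have "((\<lambda>t::real. (max 0 t) ^ Suc (Suc k)) has_real_derivative real (Suc (Suc k)) * t ^ Suc k) (at t)"
      by (rule has_field_derivative_transform_within_open[of _ _ _ "{0<..}"]) (use 3 in auto)
    then show ?thesis
      using 3 by simp
  next
    case 2
    have "((\<lambda>h::real. (max 0 h) ^ Suc (Suc k) / h) \<longlongrightarrow> 0) (at 0)"
    proof (rule Lim_null_comparison)
      show "\<forall>\<^sub>F h in at (0::real). norm ((max 0 h) ^ Suc (Suc k) / h) \<le> \<bar>h\<bar> ^ Suc k"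
      proof (rule always_eventually, rule allI)
        fix h :: real
        show "norm ((max 0 h) ^ Suc (Suc k) / h) \<le> \<bar>h\<bar> ^ Suc k"
        proof (cases "h > 0")
          case False
          then have "max 0 h = 0"
            by simp
          then show ?thesis
            by (simp add: power_0_Suc del: power_Suc)
        qed simp
      qed
      have "((\<lambda>h::real. \<bar>h\<bar> ^ Suc k) \<longlongrightarrow> \<bar>0\<bar> ^ Suc k) (at 0)"
        by (intro tendsto_intros)
      then show "((\<lambda>h::real. \<bar>h\<bar> ^ Suc k) \<longlongrightarrow> 0) (at 0)"
        by simp
    qed
    then show ?thesis
      using 2 by (simp add: has_field_derivative_iff)
  qed
qed

text \<open>
  The cubes make the quotient below twice continuously differentiable, so that the gradient of a cutoff built from
  it is again a test function.
\<close>

definition step_denom :: "real \<Rightarrow> real" where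
  "step_denom t = (max 0 t) ^ 3 + (max 0 (1 - t)) ^ 3"

definition step :: "real \<Rightarrow> real" where
  "step t = (max 0 t) ^ 3 / step_denom t"

definition step_deriv :: "real \<Rightarrow> real" where
  "step_deriv t = 3 * ((max 0 t)\<^sup>2 * (max 0 (1 - t)) ^ 3 + (max 0 t) ^ 3 * (max 0 (1 - t))\<^sup>2) / (step_denom t)\<^sup>2"

lemma step_denom_pos: "step_denom t > 0"
proof (cases "t > 0")
  case True
  then show ?thesis
    by (simp add: step_denom_def add_pos_nonneg)
next
  case False
  then show ?thesis
    by (simp add: step_denom_def add_nonneg_pos)
qed

lemma DERIV_pos_part:
  "((\<lambda>t::real. (max 0 t) ^ 3) has_real_derivative 3 * (max 0 t)\<^sup>2) (at t)"
  "((\<lambda>t::real. (max 0 t) ^ 2) has_real_derivative 2 * (max 0 t)) (at t)"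
  using DERIV_pos_part_power[of 1 t] DERIV_pos_part_power[of 0 t]
  by (simp_all add: numeral_3_eq_3 numeral_2_eq_2)

lemma DERIV_pos_part_rev:
  "((\<lambda>t::real. (max 0 (1 - t)) ^ 3) has_real_derivative - (3 * (max 0 (1 - t))\<^sup>2)) (at t)"
  "((\<lambda>t::real. (max 0 (1 - t)) ^ 2) has_real_derivative - (2 * (max 0 (1 - t)))) (at t)"
proof -
  have *: "((\<lambda>t::real. 1 - t) has_real_derivative -1) (at t)"
    by (auto intro!: derivative_eq_intros)
  show "((\<lambda>t::real. (max 0 (1 - t)) ^ 3) has_real_derivative - (3 * (max 0 (1 - t))\<^sup>2)) (at t)"
    "((\<lambda>t::real. (max 0 (1 - t)) ^ 2) has_real_derivative - (2 * (max 0 (1 - t)))) (at t)"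
    using DERIV_chain2[OF DERIV_pos_part(1) *] DERIV_chain2[OF DERIV_pos_part(2) *] by simp_all
qed

lemma DERIV_step_denom:
  "(step_denom has_real_derivative (3 * (max 0 t)\<^sup>2 - 3 * (max 0 (1 - t))\<^sup>2)) (at t)"
proof -
  have "((\<lambda>t. (max 0 t) ^ 3 + (max 0 (1 - t)) ^ 3) has_real_derivative
      (3 * (max 0 t)\<^sup>2 + - (3 * (max 0 (1 - t))\<^sup>2))) (at t)"
    by (intro DERIV_add DERIV_pos_part DERIV_pos_part_rev)
  then show ?thesis
    by (simp add: step_denom_def[abs_def])
qed

lemma DERIV_step: "(step has_real_derivative step_deriv t) (at t)"
proof -
  have "((\<lambda>t. (max 0 t) ^ 3 / step_denom t) has_real_derivative
      (3 * (max 0 t)\<^sup>2 * step_denom t - (max 0 t) ^ 3 * (3 * (max 0 t)\<^sup>2 - 3 * (max 0 (1 - t))\<^sup>2))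
        / (step_denom t * step_denom t)) (at t)"
    using step_denom_pos[of t] by (intro DERIV_divide DERIV_pos_part DERIV_step_denom) simp
  also have "(3 * (max 0 t)\<^sup>2 * step_denom t - (max 0 t) ^ 3 * (3 * (max 0 t)\<^sup>2 - 3 * (max 0 (1 - t))\<^sup>2))
        / (step_denom t * step_denom t) = step_deriv t"
    unfolding step_deriv_def power2_eq_square[of "step_denom t"]
    by (rule arg_cong[where f = "\<lambda>u. u / _"]) (simp add: step_denom_def algebra_simps power2_eq_square power3_eq_cube)
  finally show ?thesis
    by (simp add: step_def[abs_def])
qed

lemma DERIV_step_deriv:
  obtains g where "\<And>t. (step_deriv has_real_derivative g t) (at t)" "continuous_on UNIV g"
proof
  let ?a = "\<lambda>t::real. max 0 t" and ?b = "\<lambda>t::real. max 0 (1 - t)"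
  let ?N = "\<lambda>t. 3 * ((?a t)\<^sup>2 * (?b t) ^ 3 + (?a t) ^ 3 * (?b t)\<^sup>2)"
  let ?N' = "\<lambda>t. 3 * ((2 * ?a t * (?b t) ^ 3 + - (3 * (?b t)\<^sup>2) * (?a t)\<^sup>2) +
      (3 * (?a t)\<^sup>2 * (?b t)\<^sup>2 + - (2 * ?b t) * (?a t) ^ 3))"
  let ?D' = "\<lambda>t. 3 * (?a t)\<^sup>2 - 3 * (?b t)\<^sup>2"
  let ?g = "\<lambda>t. (?N' t * (step_denom t)\<^sup>2 - ?N t * (real 2 * (?D' t * step_denom t ^ (2 - Suc 0))))
      / ((step_denom t)\<^sup>2 * (step_denom t)\<^sup>2)"
  show "(step_deriv has_real_derivative ?g t) (at t)" for t
  proof -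
    have "((\<lambda>t. ?N t / (step_denom t)\<^sup>2) has_real_derivative ?g t) (at t)"
      using step_denom_pos[of t]
      by (intro DERIV_divide DERIV_power DERIV_cmult DERIV_add DERIV_mult DERIV_pos_part DERIV_pos_part_rev DERIV_step_denom) simp
    then show ?thesis
      by (simp add: step_deriv_def[abs_def])
  qed
  have "continuous_on UNIV step_denom"
    using DERIV_step_denom by (intro continuous_at_imp_continuous_on ballI DERIV_isCont) auto
  then show "continuous_on UNIV ?g"
    using step_denom_pos by (intro continuous_intros) (auto simp: less_imp_neq[symmetric])
qed

lemma continuous_on_step: "continuous_on S step" "continuous_on S step_deriv"
proof -
  show "continuous_on S step"
    using DERIV_step by (intro continuous_at_imp_continuous_on ballI DERIV_isCont) auto
  show "continuous_on S step_deriv"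
    using DERIV_step_deriv by (metis DERIV_isCont continuous_at_imp_continuous_on)
qed

lemma step_range: "0 \<le> step t" "step t \<le> 1"
  using step_denom_pos[of t] by (auto simp: step_def step_denom_def divide_simps)

lemma step_eq_0: "t \<le> 0 \<Longrightarrow> step t = 0"
  and step_eq_1: "t \<ge> 1 \<Longrightarrow> step t = 1"
  by (simp_all add: step_def step_denom_def)

lemma step_deriv_nonneg: "0 \<le> step_deriv t"
  by (simp add: step_deriv_def)

lemma step_deriv_eq_0: "t \<le> 0 \<or> t \<ge> 1 \<Longrightarrow> step_deriv t = 0"
  by (auto simp: step_deriv_def)

lemma step_deriv_bounded: obtains M where "0 < M" "\<And>t. step_deriv t \<le> M"
proof -
  have "compact (step_deriv ` {0..1})"
    by (intro compact_continuous_image continuous_on_step) auto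
  then obtain M where M: "\<And>t. t \<in> {0..1} \<Longrightarrow> \<bar>step_deriv t\<bar> \<le> M"
    using compact_imp_bounded by (force simp: bounded_iff)
  have "step_deriv t \<le> \<bar>M\<bar> + 1" for t
    using M[of t] step_deriv_eq_0[of t] by (cases "t \<in> {0..1}") auto
  then show thesis
    by (intro that[of "\<bar>M\<bar> + 1"]) auto
qed

lemma step_tendsto: "(\<lambda>k. step (real (Suc k) * t)) \<longlonglongrightarrow> of_bool (t > 0)"
proof (cases "t > 0")
  case True
  have "\<forall>\<^sub>F k in sequentially. step (real (Suc k) * t) = 1"
  proof -
    obtain N where N: "1 / t \<le> real N"
      using real_arch_simple by blast
    have "\<forall>\<^sub>F k in sequentially. N \<le> k"
      by (rule eventually_ge_at_top)
    then show ?thesis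
    proof eventually_elim
      case (elim k)
      then have "1 / t \<le> real (Suc k)"
        using N by linarith
      then show ?case
        using True by (intro step_eq_1) (simp add: pos_divide_le_eq)
    qed
  qed
  then show ?thesis
    using True by (simp add: tendsto_eventually)
next
  case False
  then have "step (real (Suc k) * t) = 0" for k
    by (intro step_eq_0) (simp add: mult_nonneg_nonpos)
  then show ?thesis
    using False by simp
qed

lemma C1_on_component_compose:
  fixes y :: "real^'n"
  assumes "\<And>t. (G has_real_derivative g t) (at t)" "continuous_on UNIV g"
  shows "C1_on \<Omega> (\<lambda>x. G (a * ((x - y) $ i)))"
proof (rule C1_onI)
  show "((\<lambda>x. G (a * ((x - y) $ i))) has_derivative (\<lambda>h. g (a * ((x - y) $ i)) * (a * h $ i))) (at x)" for x
    using has_derivative_compose[OF has_derivative_mult_right[OF has_derivative_component, of a y i x]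
        assms(1)[unfolded has_field_derivative_def]] by simp
  have "continuous_on \<Omega> (\<lambda>x. g (a * ((x - y) $ i)))"
    by (rule continuous_on_compose2[OF assms(2)]) (auto intro!: continuous_intros)
  then show "continuous_on \<Omega> (\<lambda>x. g (a * ((x - y) $ i)) * (a * axis j 1 $ i))" for j
    by (intro continuous_intros)
qed

lemma C1_on_prod:
  assumes "finite I" "\<And>i. i \<in> I \<Longrightarrow> C1_on \<Omega> (f i)"
  shows "C1_on \<Omega> (\<lambda>x. \<Prod>i\<in>I. f i x)"
  using assms by (induction I rule: finite_induct) (auto intro!: C1_on_mult C1_on_const)

section \<open>Weak derivatives and test functions\<close>

lemma Lp_loc_1_set_integrable:
  fixes f :: "real^'n \<Rightarrow> real"
  assumes "Lp_loc \<Omega> 1 f" "open \<Omega>" "compact K" "K \<subseteq> \<Omega>"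
  shows "integrable lebesgue (\<lambda>x. indicator K x *\<^sub>R f x)"
proof -
  have "(\<lambda>x. if x \<in> \<Omega> then f x else 0) \<in> borel_measurable lebesgue"
    using assms by (subst borel_measurable_if) (auto simp: Lp_loc_def)
  moreover have "K \<in> sets lebesgue"
    using assms(3) by (simp add: lmeasurable_compact fmeasurableD)
  ultimately have "(\<lambda>x. indicator K x *\<^sub>R (if x \<in> \<Omega> then f x else 0)) \<in> borel_measurable lebesgue"
    by measurable
  also have "(\<lambda>x. indicator K x *\<^sub>R (if x \<in> \<Omega> then f x else 0)) = (\<lambda>x. indicator K x *\<^sub>R f x)"
    using assms(4) by (auto simp: indicator_def fun_eq_iff)
  finally have meas: "(\<lambda>x. indicator K x *\<^sub>R f x) \<in> borel_measurable lebesgue" .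
  have "integrable lebesgue (\<lambda>x. indicator K x *\<^sub>R (\<bar>f x\<bar> powr 1))"
    using assms by (auto simp: Lp_loc_def set_integrable_def)
  then show ?thesis
    by (rule Bochner_Integration.integrable_bound[OF _ meas]) (auto simp: indicator_def)
qed

lemma integrable_mult_bounded:
  fixes f g :: "'a \<Rightarrow> real"
  assumes "integrable M f" "g \<in> borel_measurable M" "\<And>x. \<bar>g x\<bar> \<le> B"
  shows "integrable M (\<lambda>x. f x * g x)"
proof (rule Bochner_Integration.integrable_bound)
  show "integrable M (\<lambda>x. B * f x)"
    using assms(1) by simp
  show "(\<lambda>x. f x * g x) \<in> borel_measurable M"
    using assms by measurable
  have "\<bar>f x\<bar> * \<bar>g x\<bar> \<le> \<bar>B\<bar> * \<bar>f x\<bar>" for x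
    using assms(3)[of x] by (subst mult.commute, intro mult_right_mono) auto
  then show "AE x in M. norm (f x * g x) \<le> norm (B * f x)"
    by (simp add: abs_mult)
qed

lemma continuous_compact_support_bounded:
  fixes \<psi> :: "real^'n \<Rightarrow> real"
  assumes "continuous_on UNIV \<psi>" "compact K" "\<And>x. x \<notin> K \<Longrightarrow> \<psi> x = 0"
  obtains B where "\<And>x. \<bar>\<psi> x\<bar> \<le> B"
proof -
  have "compact (\<psi> ` K)"
    by (intro compact_continuous_image continuous_on_subset[OF assms(1)] assms(2)) simp
  then obtain B where B: "\<And>x. x \<in> K \<Longrightarrow> \<bar>\<psi> x\<bar> \<le> B"
    using compact_imp_bounded by (force simp: bounded_iff)
  have "\<bar>\<psi> x\<bar> \<le> \<bar>B\<bar>" for x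
    using B[of x] assms(3)[of x] by (cases "x \<in> K") auto
  then show thesis
    by (rule that)
qed

lemma Lp_loc_1_times_integrable:
  fixes f \<psi> :: "real^'n \<Rightarrow> real"
  assumes "Lp_loc \<Omega> 1 f" "open \<Omega>" "compact K" "K \<subseteq> \<Omega>"
    and "continuous_on UNIV \<psi>" "\<And>x. x \<notin> K \<Longrightarrow> \<psi> x = 0"
  shows "integrable lebesgue (\<lambda>x. f x * \<psi> x)"
proof -
  obtain B where B: "\<And>x. \<bar>\<psi> x\<bar> \<le> B"
    using continuous_compact_support_bounded[OF assms(5,3,6)] by metis
  have "\<psi> \<in> borel_measurable lebesgue"
    using assms(5) by (intro measurable_completion) (auto intro: borel_measurable_continuous_onI)
  then have "integrable lebesgue (\<lambda>x. (indicator K x *\<^sub>R f x) * \<psi> x)"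
    using Lp_loc_1_set_integrable[OF assms(1-4)] B by (intro integrable_mult_bounded)
  also have "(\<lambda>x. (indicator K x *\<^sub>R f x) * \<psi> x) = (\<lambda>x. f x * \<psi> x)"
    using assms(6) by (auto simp: indicator_def fun_eq_iff)
  finally show ?thesis .
qed

lemma Lp_loc_1_times_C01:
  fixes f \<psi> :: "real^'n \<Rightarrow> real"
  assumes "Lp_loc \<Omega> 1 f" "open \<Omega>" "\<psi> \<in> C01 \<Omega>"
  shows "integrable lebesgue (\<lambda>x. f x * \<psi> x)" "integrable lebesgue (\<lambda>x. f x * partial i \<psi> x)"
    and "(LINT x:\<Omega>|lebesgue. f x * \<psi> x) = (LINT x|lebesgue. f x * \<psi> x)"
    and "(LINT x:\<Omega>|lebesgue. f x * partial i \<psi> x) = (LINT x|lebesgue. f x * partial i \<psi> x)"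
proof -
  obtain K where K: "compact K" "K \<subseteq> \<Omega>" "\<And>x. x \<notin> K \<Longrightarrow> \<psi> x = 0" "\<And>x i. x \<notin> K \<Longrightarrow> partial i \<psi> x = 0"
    using C01_support[OF assms(3)] by metis
  show "integrable lebesgue (\<lambda>x. f x * \<psi> x)" "integrable lebesgue (\<lambda>x. f x * partial i \<psi> x)"
    by (intro Lp_loc_1_times_integrable[OF assms(1,2) K(1,2)] C01_continuous[OF assms(3)] K(3,4); assumption)+
  have "(\<lambda>x. indicator \<Omega> x *\<^sub>R (f x * \<psi> x)) = (\<lambda>x. f x * \<psi> x)"
    "(\<lambda>x. indicator \<Omega> x *\<^sub>R (f x * partial i \<psi> x)) = (\<lambda>x. f x * partial i \<psi> x)"
    using K(2,3,4) by (auto simp: indicator_def fun_eq_iff)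
  then show "(LINT x:\<Omega>|lebesgue. f x * \<psi> x) = (LINT x|lebesgue. f x * \<psi> x)"
    "(LINT x:\<Omega>|lebesgue. f x * partial i \<psi> x) = (LINT x|lebesgue. f x * partial i \<psi> x)"
    by (simp_all only: set_lebesgue_integral_def)
qed

lemma weak_partial_by_parts:
  fixes f g \<psi> :: "real^'n \<Rightarrow> real"
  assumes "has_weak_partial \<Omega> i f g" "open \<Omega>" "\<psi> \<in> C01 \<Omega>"
  shows "(LINT x|lebesgue. f x * partial i \<psi> x) = - (LINT x|lebesgue. g x * \<psi> x)"
  using assms Lp_loc_1_times_C01(3,4)[OF _ assms(2,3)] unfolding has_weak_partial_def by metis

lemma has_weak_partialI:
  fixes f g :: "real^'n \<Rightarrow> real"
  assumes "open \<Omega>" "Lp_loc \<Omega> 1 f" "Lp_loc \<Omega> 1 g"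
    and "\<And>\<psi>. \<psi> \<in> C01 \<Omega> \<Longrightarrow> (LINT x|lebesgue. f x * partial i \<psi> x) = - (LINT x|lebesgue. g x * \<psi> x)"
  shows "has_weak_partial \<Omega> i f g"
  unfolding has_weak_partial_def
proof (intro conjI assms(2,3) ballI)
  fix \<psi> assume \<psi>: "\<psi> \<in> C01 \<Omega>"
  show "(LINT x:\<Omega>|lebesgue. f x * partial i \<psi> x) = - (LINT x:\<Omega>|lebesgue. g x * \<psi> x)"
    using Lp_loc_1_times_C01(4)[OF assms(2,1) \<psi>] Lp_loc_1_times_C01(3)[OF assms(3,1) \<psi>] assms(4)[OF \<psi>] by simp
qed

lemma Lp_loc_subset:
  fixes f :: "real^'n \<Rightarrow> real"
  assumes "Lp_loc \<Omega> q f" "open \<Omega>" "open \<Omega>'" "\<Omega>' \<subseteq> \<Omega>"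
  shows "Lp_loc \<Omega>' q f"
  unfolding Lp_loc_def
proof (intro conjI allI impI)
  have "(\<lambda>x. if x \<in> \<Omega> then f x else 0) \<in> borel_measurable lebesgue"
    using assms by (subst borel_measurable_if) (auto simp: Lp_loc_def)
  moreover have "\<Omega>' \<in> sets lebesgue"
    using assms(3) by auto
  ultimately have "(\<lambda>x. if x \<in> \<Omega>' then (if x \<in> \<Omega> then f x else 0) else 0) \<in> borel_measurable lebesgue"
    by measurable
  also have "(\<lambda>x. if x \<in> \<Omega>' then (if x \<in> \<Omega> then f x else 0) else 0) = (\<lambda>x. if x \<in> \<Omega>' then f x else 0)"
    using assms(4) by (auto simp: fun_eq_iff)
  finally show "f \<in> borel_measurable (lebesgue_on \<Omega>')"
    using assms(3) by (subst (asm) borel_measurable_if) auto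
  fix K :: "(real^'n) set"
  assume "compact K \<and> K \<subseteq> \<Omega>'"
  then show "set_integrable lebesgue K (\<lambda>x. \<bar>f x\<bar> powr q)"
    using assms unfolding Lp_loc_def by blast
qed

lemma has_weak_partial_subset:
  fixes f g :: "real^'n \<Rightarrow> real"
  assumes "has_weak_partial \<Omega> i f g" "open \<Omega>" "open \<Omega>'" "\<Omega>' \<subseteq> \<Omega>"
  shows "has_weak_partial \<Omega>' i f g"
proof (rule has_weak_partialI[OF assms(3)])
  show "Lp_loc \<Omega>' 1 f" "Lp_loc \<Omega>' 1 g"
    using assms by (auto simp: has_weak_partial_def intro: Lp_loc_subset)
  show "(LINT x|lebesgue. f x * partial i \<psi> x) = - (LINT x|lebesgue. g x * \<psi> x)" if "\<psi> \<in> C01 \<Omega>'" for \<psi>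
    by (rule weak_partial_by_parts[OF assms(1,2) C01_mono[OF that assms(4)]])
qed

lemma weak_partial_works:
  "has_weak_partial \<Omega> i f g \<Longrightarrow> has_weak_partial \<Omega> i f (weak_partial \<Omega> i f)"
  unfolding weak_partial_def by (rule someI[of "\<lambda>g. has_weak_partial \<Omega> i f g"])

section \<open>Uniqueness of weak derivatives\<close>

text \<open>
  Products of steps in the single coordinates are test functions that converge to the indicator of the box.
\<close>

lemma weakly_zero_box:
  fixes g :: "real^'n \<Rightarrow> real"
  assumes "open \<Omega>" "Lp_loc \<Omega> 1 g" "\<And>\<psi>. \<psi> \<in> C01 \<Omega> \<Longrightarrow> (LINT x|lebesgue. g x * \<psi> x) = 0"
    and sub: "cbox c d \<subseteq> \<Omega>"
  shows "(LINT x|lebesgue. g x * indicator (box c d) x) = 0"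
proof -
  define \<psi> where "\<psi> = (\<lambda>k x. \<Prod>i\<in>UNIV. step (real (Suc k) * ((x - c) $ i)) * step (- real (Suc k) * ((x - d) $ i)))"
  have zero: "\<psi> k x = 0" if "x \<notin> cbox c d" for k x
  proof -
    obtain i where "x $ i < c $ i \<or> d $ i < x $ i"
      using \<open>x \<notin> cbox c d\<close> unfolding mem_box_cart by (meson not_le)
    then have "step (real (Suc k) * ((x - c) $ i)) * step (- real (Suc k) * ((x - d) $ i)) = 0"
      by (auto intro!: step_eq_0 simp: mult_le_0_iff zero_le_mult_iff)
    then show ?thesis
      unfolding \<psi>_def by (intro prod_zero) auto
  qed
  have range: "0 \<le> \<psi> k x" "\<psi> k x \<le> 1" for k x
    unfolding \<psi>_def by (auto intro!: prod_nonneg prod_le_1 mult_nonneg_nonneg mult_le_one simp: step_range)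
  have C01: "\<psi> k \<in> C01 \<Omega>" for k
  proof (rule C01I[OF assms(1) _ compact_cbox sub zero])
    show "C1_on \<Omega> (\<psi> k)"
      unfolding \<psi>_def
      by (intro C1_on_prod C1_on_mult C1_on_component_compose[OF DERIV_step continuous_on_step(2)]) simp
  qed
  have int: "integrable lebesgue (\<lambda>x. g x * \<psi> k x)" for k
    by (rule Lp_loc_1_times_C01(1)[OF assms(2,1) C01])
  have "(\<lambda>k. LINT x|lebesgue. g x * \<psi> k x) \<longlonglongrightarrow> (LINT x|lebesgue. g x * indicator (box c d) x)"
  proof (rule integral_dominated_convergence[where w = "\<lambda>x. norm (indicator (cbox c d) x *\<^sub>R g x)"])
    have g: "integrable lebesgue (\<lambda>x. indicator (cbox c d) x *\<^sub>R g x)"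
      by (rule Lp_loc_1_set_integrable[OF assms(2,1) compact_cbox sub])
    then show "integrable lebesgue (\<lambda>x. norm (indicator (cbox c d) x *\<^sub>R g x))"
      by (rule integrable_norm)
    have "box c d \<in> sets lebesgue"
      by simp
    then have "(\<lambda>x. (indicator (cbox c d) x *\<^sub>R g x) * indicat_real (box c d) x) \<in> borel_measurable lebesgue"
      using borel_measurable_integrable[OF g] by measurable
    also have "(\<lambda>x. (indicator (cbox c d) x *\<^sub>R g x) * indicat_real (box c d) x) = (\<lambda>x. g x * indicator (box c d) x)"
      using box_subset_cbox[of c d] by (auto simp: indicator_def fun_eq_iff)
    finally show "(\<lambda>x. g x * indicat_real (box c d) x) \<in> borel_measurable lebesgue" .
    show "(\<lambda>x. g x * \<psi> k x) \<in> borel_measurable lebesgue" for k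
      using int by (rule borel_measurable_integrable)
    show "AE x in lebesgue. norm (g x * \<psi> k x) \<le> norm (indicat_real (cbox c d) x *\<^sub>R g x)" for k
    proof (rule AE_I2)
      fix x
      show "norm (g x * \<psi> k x) \<le> norm (indicat_real (cbox c d) x *\<^sub>R g x)"
        using zero[of x k] range[of k x] by (cases "x \<in> cbox c d") (auto simp: abs_mult mult_left_le)
    qed
    show "AE x in lebesgue. (\<lambda>k. g x * \<psi> k x) \<longlonglongrightarrow> g x * indicat_real (box c d) x"
    proof (rule AE_I2)
      fix x
      have "(\<lambda>k. \<psi> k x) \<longlonglongrightarrow> (\<Prod>i\<in>UNIV. of_bool ((x - c) $ i > 0) * of_bool (- (x - d) $ i > 0))"
      proof -
        have "(\<lambda>k. step (- real (Suc k) * ((x - d) $ i))) \<longlonglongrightarrow> of_bool (- (x - d) $ i > 0)" for i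
          using step_tendsto[of "- (x - d) $ i"] by (simp only: mult_minus_left mult_minus_right)
        then show ?thesis
          unfolding \<psi>_def by (intro tendsto_prod tendsto_mult step_tendsto)
      qed
      also have "(\<Prod>i\<in>UNIV. of_bool ((x - c) $ i > 0) * of_bool (- (x - d) $ i > 0)) = indicat_real (box c d) x"
      proof (cases "x \<in> box c d")
        case True
        then show ?thesis
          by (auto simp: mem_box_cart intro!: prod.neutral)
      next
        case False
        then obtain i where "\<not> ((x - c) $ i > 0 \<and> - (x - d) $ i > 0)"
          by (auto simp: mem_box_cart)
        then have "of_bool ((x - c) $ i > 0) * of_bool (- (x - d) $ i > 0) = (0::real)"
          by auto
        then have "(\<Prod>i\<in>UNIV. of_bool ((x - c) $ i > 0) * of_bool (- (x - d) $ i > 0)) = (0::real)"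
          by (intro prod_zero) auto
        then show ?thesis
          using False by simp
      qed
      finally show "(\<lambda>k. g x * \<psi> k x) \<longlonglongrightarrow> g x * indicat_real (box c d) x"
        by (intro tendsto_mult tendsto_const)
    qed
  qed
  then show ?thesis
    unfolding assms(3)[OF C01] using LIMSEQ_unique tendsto_const by blast
qed

text \<open>
  Boxes are stable under intersection and generate the Borel sets, so the integral over every Borel set vanishes. As \<open>g\<close> is
  only Lebesgue measurable, the argument is carried out for a Borel representative \<open>q'\<close>.
\<close>

lemma weakly_zero_AE_box:
  fixes g :: "real^'n \<Rightarrow> real"
  assumes "open \<Omega>" "Lp_loc \<Omega> 1 g" "\<And>\<psi>. \<psi> \<in> C01 \<Omega> \<Longrightarrow> (LINT x|lebesgue. g x * \<psi> x) = 0"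
    and sub: "cbox a b \<subseteq> \<Omega>"
  shows "AE x in lebesgue. x \<in> cbox a b \<longrightarrow> g x = 0"
proof -
  define q where "q = (\<lambda>x. g x * indicator (box a b) x)"
  have q: "integrable lebesgue q"
  proof -
    have "integrable lebesgue (\<lambda>x. (indicator (cbox a b) x *\<^sub>R g x) * indicator (box a b) x)"
    proof (rule integrable_mult_bounded[OF Lp_loc_1_set_integrable[OF assms(2,1) compact_cbox sub]])
      show "indicat_real (box a b) \<in> borel_measurable lebesgue"
        by (rule borel_measurable_indicator) simp
      show "\<bar>indicat_real (box a b) x\<bar> \<le> 1" for x
        by (simp add: indicator_def)
    qed
    also have "(\<lambda>x. (indicator (cbox a b) x *\<^sub>R g x) * indicator (box a b) x) = q"
      using box_subset_cbox[of a b] by (auto simp: q_def indicator_def fun_eq_iff)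
    finally show ?thesis .
  qed
  obtain q' where q': "q' \<in> borel_measurable lborel" "AE x in lborel. q x = q' x"
    using completion_ex_borel_measurable_real[OF borel_measurable_integrable[OF q]] by blast
  have eq: "AE x in lebesgue. q x = q' x"
    using q'(2) by (rule AE_completion)
  have q'_meas: "q' \<in> borel_measurable lebesgue"
    using q'(1) by (rule measurable_completion)
  then have "integrable lebesgue q'"
    using q integrable_cong_AE[OF borel_measurable_integrable[OF q] q'_meas eq] by simp
  then have q'_int: "integrable lborel q'"
    using q'(1) by (simp add: integrable_completion)
  have LINT_q': "(LINT x:S|lborel. q' x) = (LINT x|lebesgue. q x * indicator S x)" if "S \<in> sets borel" for S
  proof -
    have S: "S \<in> sets lebesgue"
      using that by simp
    have "(LINT x|lebesgue. q x * indicator S x) = (LINT x|lebesgue. q' x * indicator S x)"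
    proof (rule integral_cong_AE)
      show "(\<lambda>x. q x * indicat_real S x) \<in> borel_measurable lebesgue"
        using S borel_measurable_integrable[OF q] by measurable
      show "(\<lambda>x. q' x * indicat_real S x) \<in> borel_measurable lebesgue"
        using S q'_meas by measurable
      show "AE x in lebesgue. q x * indicat_real S x = q' x * indicat_real S x"
        using eq by eventually_elim simp
    qed
    also have "\<dots> = (LINT x|lborel. q' x * indicator S x)"
      using q'(1) that by (intro integral_completion borel_measurable_times borel_measurable_indicator) auto
    finally show ?thesis
      by (simp add: set_lebesgue_integral_def mult.commute)
  qed
  have box: "(LINT x:box c d|lborel. q' x) = 0" for c d
  proof -
    obtain e f where ef: "box a b \<inter> box c d = box e f"
      using box_Int_box by blast
    have "(\<lambda>x. q x * indicator (box c d) x) = (\<lambda>x. g x * indicator (box e f) x)"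
      unfolding ef[symmetric] q_def by (auto simp: indicator_def fun_eq_iff)
    then have *: "(LINT x:box c d|lborel. q' x) = (LINT x|lebesgue. g x * indicator (box e f) x)"
      by (simp add: LINT_q')
    show ?thesis
    proof (cases "box e f = {}")
      case True
      show ?thesis
        unfolding * unfolding True by simp
    next
      case False
      have "cbox e f = closure (box e f)"
        using False by (rule closure_box[symmetric])
      also have "\<dots> \<subseteq> closure (box a b)"
        by (intro closure_mono) (use ef in blast)
      also have "\<dots> \<subseteq> cbox a b"
        by (intro closure_minimal box_subset_cbox closed_cbox)
      finally have "cbox e f \<subseteq> \<Omega>"
        using sub by (rule subset_trans)
      from weakly_zero_box[OF assms(1,2,3) this] show ?thesis
        unfolding * .
    qed
  qed
  have total: "(LINT x|lborel. q' x) = 0"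
  proof -
    obtain c where c: "cbox a b \<subseteq> box (- c) c"
      using bounded_subset_box_symmetric[OF bounded_cbox] by metis
    have "(LINT x|lborel. q' x) = (LINT x|lebesgue. q x)"
      using LINT_q'[of UNIV] by (simp add: set_lebesgue_integral_def)
    also have "q = (\<lambda>x. q x * indicator (box (-c) c) x)"
      using c box_subset_cbox[of a b] by (auto simp: q_def indicator_def fun_eq_iff)
    also have "(LINT x|lebesgue. q x * indicator (box (-c) c) x) = 0"
      using box[of "-c" c] by (simp add: LINT_q')
    finally show ?thesis .
  qed
  have borel: "(LINT x:S|lborel. q' x) = 0" if "S \<in> sigma_sets UNIV (range (\<lambda>(c, d). box c d))" for S :: "(real^'n) set"
  proof (rule sigma_sets_induct_disjoint[OF _ _ that, where P = "\<lambda>S. (LINT x:S|lborel. q' x) = 0"])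
    show "Int_stable (range (\<lambda>(c, d). box c d :: (real^'n) set))"
      by (auto simp: Int_stable_def box_Int_box)
    show "(LINT x:S|lborel. q' x) = 0" if "S \<in> range (\<lambda>(c, d). box c d)" for S
      using that box by auto
    have sets: "S \<in> sets lborel" if "S \<in> sigma_sets UNIV (range (\<lambda>(c, d). box c d))" for S :: "(real^'n) set"
      using that by (simp add: borel_eq_box)
    have si: "set_integrable lborel S q'" if "S \<in> sets lborel" for S
      unfolding set_integrable_def by (rule integrable_mult_indicator[OF that q'_int])
    show "(LINT x:UNIV - S|lborel. q' x) = 0"
      if "S \<in> sigma_sets UNIV (range (\<lambda>(c, d). box c d))" "(LINT x:S|lborel. q' x) = 0" for S
    proof -
      have "(LINT x:UNIV|lborel. q' x) = (LINT x:S|lborel. q' x) + (LINT x:UNIV - S|lborel. q' x)"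
        using set_integral_Un[of S "UNIV - S" lborel q'] si sets[OF that(1)] by (simp add: Un_Diff_cancel)
      then show ?thesis
        using that(2) total by (simp add: set_lebesgue_integral_def)
    qed
    show "(LINT x:(\<Union>i. F i)|lborel. q' x) = 0"
      if "disjoint_family F" "range F \<subseteq> sigma_sets UNIV (range (\<lambda>(c, d). box c d))"
        "\<And>i::nat. (LINT x:F i|lborel. q' x) = 0" for F
    proof -
      have F: "F i \<in> sets lborel" for i
        using that(2) by (intro sets) auto
      have "set_integrable lborel (\<Union>i. F i) q'"
        using F by (intro si sets.countable_UN) auto
      from lebesgue_integral_countable_add[OF F _ this]
      have "(LINT x:(\<Union>i. F i)|lborel. q' x) = (\<Sum>i. LINT x:F i|lborel. q' x)"
        using that(1) by (auto simp: disjoint_family_on_def)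
      then show ?thesis
        by (simp add: that(3))
    qed
  qed (auto simp: set_lebesgue_integral_def)
  have "AE x in lborel. q' x = 0"
  proof (rule sigma_finite_measure.density_zero[OF lborel.sigma_finite_measure_axioms q'_int])
    show "(LINT x:S|lborel. q' x) = 0" if "S \<in> sets lborel" for S
      using that by (intro borel) (simp add: borel_eq_box)
  qed
  then have "AE x in lebesgue. q' x = 0"
    by (rule AE_completion)
  moreover have "AE x in lebesgue. x \<notin> cbox a b - box a b"
    using negligible_frontier_interval[of a b] unfolding negligible_iff_null_sets by (rule AE_not_in)
  ultimately show ?thesis
    using eq
  proof eventually_elim
    case (elim x)
    show ?case
    proof
      assume "x \<in> cbox a b"
      then have "x \<in> box a b"
        using elim(2) by blast
      then show "g x = 0"
        using elim(1,3) by (simp add: q_def)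
    qed
  qed
qed

lemma weakly_zero_AE:
  fixes g :: "real^'n \<Rightarrow> real"
  assumes "open \<Omega>" "Lp_loc \<Omega> 1 g" "\<And>\<psi>. \<psi> \<in> C01 \<Omega> \<Longrightarrow> (LINT x|lebesgue. g x * \<psi> x) = 0"
  shows "AE x in lebesgue. x \<in> \<Omega> \<longrightarrow> g x = 0"
proof -
  obtain \<D> where \<D>: "countable \<D>" "\<D> \<subseteq> Pow \<Omega>" "\<And>X. X \<in> \<D> \<Longrightarrow> \<exists>a b. X = cbox a b" "\<Union>\<D> = \<Omega>"
    using open_countable_Union_open_cbox[OF assms(1)] by metis
  have "AE x in lebesgue. x \<in> X \<longrightarrow> g x = 0" if X: "X \<in> \<D>" for X
  proof -
    obtain a b where ab: "X = cbox a b"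
      using \<D>(3)[OF X] by blast
    have "cbox a b \<subseteq> \<Omega>"
      using X \<D>(2) unfolding ab by blast
    from weakly_zero_AE_box[OF assms this] show ?thesis
      unfolding ab .
  qed
  then have "AE x in lebesgue. \<forall>X\<in>\<D>. x \<in> X \<longrightarrow> g x = 0"
    by (intro AE_ball_countable[OF \<D>(1), THEN iffD2] ballI)
  then show ?thesis
    by eventually_elim (use \<D>(4) in blast)
qed

lemma Lp_loc_1_diff:
  fixes f g :: "real^'n \<Rightarrow> real"
  assumes "Lp_loc \<Omega> 1 f" "Lp_loc \<Omega> 1 g" "open \<Omega>"
  shows "Lp_loc \<Omega> 1 (\<lambda>x. f x - g x)"
  unfolding Lp_loc_def
proof (intro conjI allI impI)
  show "(\<lambda>x. f x - g x) \<in> borel_measurable (lebesgue_on \<Omega>)"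
    using assms by (auto simp: Lp_loc_def)
  fix K assume "compact K \<and> K \<subseteq> \<Omega>"
  then have "integrable lebesgue (\<lambda>x. indicator K x *\<^sub>R f x - indicator K x *\<^sub>R g x)"
    using Lp_loc_1_set_integrable assms by (intro Bochner_Integration.integrable_diff) auto
  then have "integrable lebesgue (\<lambda>x. \<bar>indicator K x *\<^sub>R f x - indicator K x *\<^sub>R g x\<bar>)"
    by (rule integrable_abs)
  also have "(\<lambda>x. \<bar>indicator K x *\<^sub>R f x - indicator K x *\<^sub>R g x\<bar>) = (\<lambda>x. indicator K x *\<^sub>R (\<bar>f x - g x\<bar> powr 1))"
    by (auto simp: indicator_def fun_eq_iff)
  finally show "set_integrable lebesgue K (\<lambda>x. \<bar>f x - g x\<bar> powr 1)"
    by (simp only: set_integrable_def)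
qed

text \<open>
  A weak derivative is an arbitrary representative, and one on a small open set need not be the restriction of one on
  a larger set. Uniqueness up to null sets allows comparing them.
\<close>

lemma weak_partial_unique:
  fixes f f' g g' :: "real^'n \<Rightarrow> real"
  assumes "has_weak_partial \<Omega> i f g" "has_weak_partial \<Omega> i f' g'" "open \<Omega>"
    and eq: "AE x in lebesgue. x \<in> \<Omega> \<longrightarrow> f x = f' x"
  shows "AE x in lebesgue. x \<in> \<Omega> \<longrightarrow> g x = g' x"
proof -
  have loc: "Lp_loc \<Omega> 1 f" "Lp_loc \<Omega> 1 f'" "Lp_loc \<Omega> 1 g" "Lp_loc \<Omega> 1 g'"
    using assms(1,2) by (auto simp: has_weak_partial_def)
  have "AE x in lebesgue. x \<in> \<Omega> \<longrightarrow> g x - g' x = 0"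
  proof (rule weakly_zero_AE[OF assms(3) Lp_loc_1_diff[OF loc(3,4) assms(3)]])
    fix \<psi> assume \<psi>: "\<psi> \<in> C01 \<Omega>"
    obtain K where K: "K \<subseteq> \<Omega>" "\<And>x. x \<notin> K \<Longrightarrow> partial i \<psi> x = 0"
      using C01_support[OF \<psi>] by metis
    have "(LINT x|lebesgue. f x * partial i \<psi> x) = (LINT x|lebesgue. f' x * partial i \<psi> x)"
    proof (rule integral_cong_AE)
      show "(\<lambda>x. f x * partial i \<psi> x) \<in> borel_measurable lebesgue"
        "(\<lambda>x. f' x * partial i \<psi> x) \<in> borel_measurable lebesgue"
        using Lp_loc_1_times_C01(2)[OF _ assms(3) \<psi>] loc by (auto intro: borel_measurable_integrable)
      show "AE x in lebesgue. f x * partial i \<psi> x = f' x * partial i \<psi> x"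
        using eq by eventually_elim (use K in force)
    qed
    then have "(LINT x|lebesgue. g x * \<psi> x) = (LINT x|lebesgue. g' x * \<psi> x)"
      using weak_partial_by_parts[OF assms(1,3) \<psi>] weak_partial_by_parts[OF assms(2,3) \<psi>] by simp
    then show "(LINT x|lebesgue. (g x - g' x) * \<psi> x) = 0"
      using Lp_loc_1_times_C01(1)[OF loc(3) assms(3) \<psi>] Lp_loc_1_times_C01(1)[OF loc(4) assms(3) \<psi>]
      by (simp add: left_diff_distrib)
  qed
  then show ?thesis
    by eventually_elim simp
qed

lemma has_weak_partial_cong_AE:
  fixes f f' g :: "real^'n \<Rightarrow> real"
  assumes "has_weak_partial \<Omega> i f g" "Lp_loc \<Omega> 1 f'" "open \<Omega>"
    and eq: "AE x in lebesgue. x \<in> \<Omega> \<longrightarrow> f x = f' x"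
  shows "has_weak_partial \<Omega> i f' g"
proof (rule has_weak_partialI[OF assms(3,2)])
  show "Lp_loc \<Omega> 1 g"
    using assms(1) by (simp add: has_weak_partial_def)
  fix \<psi> assume \<psi>: "\<psi> \<in> C01 \<Omega>"
  obtain K where K: "K \<subseteq> \<Omega>" "\<And>x. x \<notin> K \<Longrightarrow> partial i \<psi> x = 0"
    using C01_support[OF \<psi>] by metis
  have "(LINT x|lebesgue. f' x * partial i \<psi> x) = (LINT x|lebesgue. f x * partial i \<psi> x)"
  proof (rule integral_cong_AE)
    show "(\<lambda>x. f x * partial i \<psi> x) \<in> borel_measurable lebesgue"
      "(\<lambda>x. f' x * partial i \<psi> x) \<in> borel_measurable lebesgue"
      using Lp_loc_1_times_C01(2)[OF _ assms(3) \<psi>] assms(1,2)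
      by (auto simp: has_weak_partial_def intro: borel_measurable_integrable)
    show "AE x in lebesgue. f' x * partial i \<psi> x = f x * partial i \<psi> x"
      using eq by eventually_elim (use K in force)
  qed
  then show "(LINT x|lebesgue. f' x * partial i \<psi> x) = - (LINT x|lebesgue. g x * \<psi> x)"
    using weak_partial_by_parts[OF assms(1,3) \<psi>] by simp
qed

section \<open>Weak derivatives and linear maps\<close>

lemma measurable_affine_matrix: "(\<lambda>x::real^'n. y + M *v (x - y)) \<in> borel_measurable borel"
  by (intro borel_measurable_continuous_onI continuous_intros
      bounded_linear.continuous_on[OF matrix_vector_mul_bounded_linear])

context
  fixes M :: "real^'n^'n" and y :: "real^'n"
  assumes det_M: "det M \<noteq> 0"
begin

lemma AE_affine_matrix:
  assumes "AE x in lebesgue. P x"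
  shows "AE x in lebesgue. P (y + M *v (x - y))"
proof -
  let ?T = "\<lambda>x. y + M *v (x - y)"
  have [measurable]: "?T \<in> borel_measurable borel"
    by (rule measurable_affine_matrix)
  have "AE x in lborel. P x"
    using assms by (simp add: AE_completion_iff)
  then obtain N where N: "{x. \<not> P x} \<subseteq> N" "N \<in> sets borel" "emeasure lborel N = 0"
    by (auto simp: eventually_ae_filter null_sets_def)
  have "?T -` N \<in> sets borel"
    using measurable_sets[of ?T borel borel N] N(2) by simp
  moreover have "ennreal \<bar>det M\<bar> * emeasure lborel (?T -` N) = 0"
    using N(2,3) by (subst (asm) lborel_linear[OF det_M, of y])
      (simp add: emeasure_density nn_integral_cmult emeasure_distr)
  then have "emeasure lborel (?T -` N) = 0"
    using det_M by simp
  ultimately have "?T -` N \<in> null_sets lborel"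
    by auto
  then have "AE x in lborel. P (?T x)"
    by (rule AE_I') (use N(1) in auto)
  then show ?thesis
    by (rule AE_completion)
qed

lemma borel_measurable_affine_matrix:
  fixes f :: "real^'n \<Rightarrow> real"
  assumes "f \<in> borel_measurable lebesgue"
  shows "(\<lambda>x. f (y + M *v (x - y))) \<in> borel_measurable lebesgue"
proof -
  obtain f' where f': "f' \<in> borel_measurable lborel" "AE x in lborel. f x = f' x"
    using completion_ex_borel_measurable_real[OF assms] by blast
  have "(\<lambda>x. f' (y + M *v (x - y))) \<in> borel_measurable lborel"
    using measurable_compose[OF measurable_affine_matrix[of y M], of f' borel] f'(1) by simp
  then have "(\<lambda>x. f' (y + M *v (x - y))) \<in> borel_measurable lebesgue"
    by (rule measurable_completion)
  moreover have "AE x in lebesgue. f' (y + M *v (x - y)) = f (y + M *v (x - y))"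
    using AE_affine_matrix[OF AE_completion[OF f'(2)]] by eventually_elim simp
  ultimately show ?thesis
    by (rule borel_measurable_AE)
qed

lemma lebesgue_integral_affine_matrix:
  fixes f :: "real^'n \<Rightarrow> real"
  assumes "integrable lebesgue f"
  shows "integrable lebesgue (\<lambda>x. f (y + M *v (x - y)))"
    and "\<bar>det M\<bar> * (LINT x|lebesgue. f (y + M *v (x - y))) = (LINT x|lebesgue. f x)"
proof -
  let ?T = "\<lambda>x. y + M *v (x - y)"
  have T[measurable]: "?T \<in> borel_measurable borel"
    by (rule measurable_affine_matrix)
  have f_meas: "f \<in> borel_measurable lebesgue"
    using assms by (rule borel_measurable_integrable)
  obtain f' where f': "f' \<in> borel_measurable lborel" "AE x in lborel. f x = f' x"
    using completion_ex_borel_measurable_real[OF f_meas] by blast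
  have f'b[measurable]: "f' \<in> borel_measurable borel"
    using f'(1) by simp
  have eq: "AE x in lebesgue. f x = f' x"
    by (rule AE_completion[OF f'(2)])
  have eqT: "AE x in lebesgue. f (?T x) = f' (?T x)"
    by (rule AE_affine_matrix[OF eq])
  have f'_meas: "f' \<in> borel_measurable lebesgue"
    by (rule measurable_completion[OF f'(1)])
  have f'T_meas: "(\<lambda>x. f' (?T x)) \<in> borel_measurable lebesgue" "(\<lambda>x. f (?T x)) \<in> borel_measurable lebesgue"
    by (rule borel_measurable_affine_matrix, fact)+
  have "integrable lebesgue f'"
    using assms integrable_cong_AE[OF f_meas f'_meas eq] by simp
  then have "integrable lborel f'"
    using f'(1) by (simp add: integrable_completion)
  then have "integrable (density (distr lborel borel ?T) (\<lambda>_. ennreal \<bar>det M\<bar>)) f'"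
    by (subst (asm) lborel_linear[OF det_M, of y])
  then have "integrable (distr lborel borel ?T) (\<lambda>x. \<bar>det M\<bar> *\<^sub>R f' x)"
    by (subst (asm) integrable_density) auto
  then have "integrable lborel (\<lambda>x. \<bar>det M\<bar> *\<^sub>R f' (?T x))"
    by (subst (asm) integrable_distr_eq) auto
  then have int: "integrable lborel (\<lambda>x. f' (?T x))"
    using det_M by simp
  have bT: "(\<lambda>x. f' (?T x)) \<in> borel_measurable lborel"
    by simp
  have "integrable lebesgue (\<lambda>x. f' (?T x))"
    using int integrable_completion[OF bT] by simp
  then show "integrable lebesgue (\<lambda>x. f (?T x))"
    using integrable_cong_AE[OF f'T_meas(2,1) eqT] by simp
  have "(LINT x|lebesgue. f x) = (LINT x|lebesgue. f' x)"
    by (rule integral_cong_AE[OF f_meas f'_meas eq])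
  also have "\<dots> = (LINT x|lborel. f' x)"
    by (rule integral_completion[OF f'(1)])
  also have "\<dots> = integral\<^sup>L (density (distr lborel borel ?T) (\<lambda>_. ennreal \<bar>det M\<bar>)) f'"
    by (subst lborel_linear[OF det_M, of y]) (rule refl)
  also have "\<dots> = (LINT x|distr lborel borel ?T. \<bar>det M\<bar> *\<^sub>R f' x)"
    by (subst integral_density) auto
  also have "\<dots> = (LINT x|lborel. \<bar>det M\<bar> *\<^sub>R f' (?T x))"
    by (subst integral_distr) auto
  also have "\<dots> = \<bar>det M\<bar> * (LINT x|lborel. f' (?T x))"
    by simp
  also have "(LINT x|lborel. f' (?T x)) = (LINT x|lebesgue. f' (?T x))"
    by (rule integral_completion[OF bT, symmetric])
  also have "\<dots> = (LINT x|lebesgue. f (?T x))"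
    by (rule integral_cong_AE[OF f'T_meas(2,1) eqT, symmetric])
  finally show "\<bar>det M\<bar> * (LINT x|lebesgue. f (?T x)) = (LINT x|lebesgue. f x)" ..
qed

end

lemma Lp_loc_1I:
  fixes f :: "real^'n \<Rightarrow> real"
  assumes "f \<in> borel_measurable (lebesgue_on \<Omega>)"
    and "\<And>K. compact K \<Longrightarrow> K \<subseteq> \<Omega> \<Longrightarrow> integrable lebesgue (\<lambda>x. indicator K x *\<^sub>R f x)"
  shows "Lp_loc \<Omega> 1 f"
  unfolding Lp_loc_def
proof (intro conjI assms(1) allI impI)
  fix K assume "compact K \<and> K \<subseteq> \<Omega>"
  then have "integrable lebesgue (\<lambda>x. \<bar>indicator K x *\<^sub>R f x\<bar>)"
    using assms(2) by (intro integrable_abs) auto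
  also have "(\<lambda>x. \<bar>indicator K x *\<^sub>R f x\<bar>) = (\<lambda>x. indicator K x *\<^sub>R (\<bar>f x\<bar> powr 1))"
    by (auto simp: indicator_def fun_eq_iff)
  finally show "set_integrable lebesgue K (\<lambda>x. \<bar>f x\<bar> powr 1)"
    by (simp only: set_integrable_def)
qed

lemma Lp_loc_1_lincomb:
  fixes f :: "'k::finite \<Rightarrow> real^'n \<Rightarrow> real"
  assumes "open \<Omega>" "\<And>k. Lp_loc \<Omega> 1 (f k)"
  shows "Lp_loc \<Omega> 1 (\<lambda>x. \<Sum>k\<in>UNIV. c k * f k x)"
proof (rule Lp_loc_1I)
  show "(\<lambda>x. \<Sum>k\<in>UNIV. c k * f k x) \<in> borel_measurable (lebesgue_on \<Omega>)"
    using assms(2) by (intro borel_measurable_sum borel_measurable_times) (auto simp: Lp_loc_def)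
  fix K assume K: "compact K" "K \<subseteq> \<Omega>"
  have "integrable lebesgue (\<lambda>x. \<Sum>k\<in>UNIV. c k * (indicator K x *\<^sub>R f k x))"
    by (intro Bochner_Integration.integrable_sum integrable_mult_right Lp_loc_1_set_integrable[OF assms(2,1) K])
  also have "(\<lambda>x. \<Sum>k\<in>UNIV. c k * (indicator K x *\<^sub>R f k x)) = (\<lambda>x. indicator K x *\<^sub>R (\<Sum>k\<in>UNIV. c k * f k x))"
    by (auto simp: indicator_def fun_eq_iff)
  finally show "integrable lebesgue (\<lambda>x. indicator K x *\<^sub>R (\<Sum>k\<in>UNIV. c k * f k x))" .
qed

lemma has_derivative_affine_matrix:
  fixes M :: "real^'n^'n"
  shows "((\<lambda>x. y + M *v (x - y)) has_derivative (\<lambda>h. M *v h)) (at x)"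
  by (auto intro!: derivative_eq_intros bounded_linear.has_derivative[OF matrix_vector_mul_bounded_linear])

lemma continuous_on_affine_matrix:
  fixes M :: "real^'n^'n"
  shows "continuous_on S (\<lambda>x. y + M *v (x - y))"
  by (intro continuous_intros bounded_linear.continuous_on[OF matrix_vector_mul_bounded_linear])

lemma partial_affine_matrix:
  fixes M :: "real^'n^'n"
  assumes "\<phi> differentiable (at (y + M *v (x - y)))"
  shows "((\<lambda>x. \<phi> (y + M *v (x - y))) has_derivative
      (\<lambda>h. frechet_derivative \<phi> (at (y + M *v (x - y))) (M *v h))) (at x)"
    and "partial i (\<lambda>x. \<phi> (y + M *v (x - y))) x = (\<Sum>k\<in>UNIV. M $ k $ i * partial k \<phi> (y + M *v (x - y)))"
proof -
  have "(\<phi> has_derivative frechet_derivative \<phi> (at (y + M *v (x - y)))) (at (y + M *v (x - y)))"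
    using assms by (simp add: frechet_derivative_works)
  from has_derivative_compose[OF has_derivative_affine_matrix this]
  show *: "((\<lambda>x. \<phi> (y + M *v (x - y))) has_derivative
      (\<lambda>h. frechet_derivative \<phi> (at (y + M *v (x - y))) (M *v h))) (at x)" .
  show "partial i (\<lambda>x. \<phi> (y + M *v (x - y))) x = (\<Sum>k\<in>UNIV. M $ k $ i * partial k \<phi> (y + M *v (x - y)))"
    unfolding partial_eq[OF *] frechet_derivative_eq_partial[OF assms]
    by (simp add: matrix_vector_mult_basis column_def)
qed

lemma C01_affine_matrix:
  fixes M M' :: "real^'n^'n"
  assumes "\<psi> \<in> C01 \<Omega>'" "\<And>z. M' *v (M *v z) = z" "\<And>z. M *v (M' *v z) = z"
    and "open \<Omega>" "\<And>x. x \<in> \<Omega>' \<Longrightarrow> y + M *v (x - y) \<in> \<Omega>"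
  shows "(\<lambda>w. \<psi> (y + M' *v (w - y))) \<in> C01 \<Omega>"
proof -
  obtain K where K: "compact K" "K \<subseteq> \<Omega>'" "\<And>x. x \<notin> K \<Longrightarrow> \<psi> x = 0"
    using C01_support[OF assms(1)] by metis
  show ?thesis
  proof (rule C01I[OF assms(4)])
    show "compact ((\<lambda>x. y + M *v (x - y)) ` K)"
      using K(1) by (intro compact_continuous_image continuous_on_affine_matrix)
    show "(\<lambda>x. y + M *v (x - y)) ` K \<subseteq> \<Omega>"
      using K(2) assms(5) by auto
    show "\<psi> (y + M' *v (w - y)) = 0" if "w \<notin> (\<lambda>x. y + M *v (x - y)) ` K" for w
    proof (rule K(3))
      have "w = y + M *v ((y + M' *v (w - y)) - y)"
        by (simp add: assms(3))
      then show "y + M' *v (w - y) \<notin> K"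
        using that by (metis imageI)
    qed
    show "C1_on \<Omega> (\<lambda>w. \<psi> (y + M' *v (w - y)))"
    proof (rule C1_onI[OF partial_affine_matrix(1)[OF C01_differentiable[OF assms(1)]]])
      fix i
      have "continuous_on \<Omega> (\<lambda>w. \<Sum>k\<in>UNIV. M' $ k $ i * partial k \<psi> (y + M' *v (w - y)))"
        by (intro continuous_intros continuous_on_compose2[OF C01_continuous(2)[OF assms(1)] continuous_on_affine_matrix]) simp
      then show "continuous_on \<Omega> (\<lambda>w. frechet_derivative \<psi> (at (y + M' *v (w - y))) (M' *v axis i 1))"
        by (simp add: frechet_derivative_eq_partial[OF C01_differentiable[OF assms(1)]] matrix_vector_mult_basis column_def)
    qed
  qed
qed

lemma Lp_loc_1_affine_matrix:
  fixes M :: "real^'n^'n" and f :: "real^'n \<Rightarrow> real" and y :: "real^'n"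
  assumes "det M \<noteq> 0" "open \<Omega>" "Lp_loc \<Omega> 1 f"
  defines "T \<equiv> \<lambda>x. y + M *v (x - y)"
  shows "Lp_loc (T -` \<Omega>) 1 (\<lambda>x. f (T x))" "open (T -` \<Omega>)"
proof -
  have T_eq: "y + M *v (x - y) = T x" for x
    by (simp add: T_def)
  show op: "open (T -` \<Omega>)"
    unfolding T_def by (rule open_vimage[OF assms(2) continuous_on_affine_matrix])
  have inj: "T x = T z \<longleftrightarrow> x = z" for x z
  proof
    assume "T x = T z"
    then have "M *v (x - y) = M *v (z - y)"
      unfolding T_def by (rule add_left_imp_eq)
    then have "matrix_inv M *v (M *v (x - y)) = matrix_inv M *v (M *v (z - y))"
      by (rule arg_cong)
    moreover have "invertible M"
      using assms(1) by (simp add: invertible_det_nz)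
    ultimately have "x - y = z - y"
      by (simp only: matrix_inv_mult)
    then show "x = z"
      by simp
  qed (rule arg_cong)
  show "Lp_loc (T -` \<Omega>) 1 (\<lambda>x. f (T x))"
  proof (rule Lp_loc_1I)
    have "(\<lambda>x. if x \<in> \<Omega> then f x else 0) \<in> borel_measurable lebesgue"
      using assms(2,3) by (subst borel_measurable_if) (auto simp: Lp_loc_def)
    from borel_measurable_affine_matrix[OF assms(1) this, where y = y, unfolded T_eq]
    have "(\<lambda>x. if x \<in> T -` \<Omega> then f (T x) else 0) \<in> borel_measurable lebesgue"
      by (simp only: vimage_eq)
    then show "(\<lambda>x. f (T x)) \<in> borel_measurable (lebesgue_on (T -` \<Omega>))"
      using op by (subst (asm) borel_measurable_if) auto
    fix K assume K: "compact K" "K \<subseteq> T -` \<Omega>"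
    have "compact (T ` K)" "T ` K \<subseteq> \<Omega>"
      using K unfolding T_def by (auto intro: compact_continuous_image continuous_on_affine_matrix)
    from lebesgue_integral_affine_matrix(1)[OF assms(1) Lp_loc_1_set_integrable[OF assms(3,2) this], where y = y, unfolded T_eq]
    have "integrable lebesgue (\<lambda>x. indicat_real (T ` K) (T x) *\<^sub>R f (T x))" .
    also have "(\<lambda>x. indicat_real (T ` K) (T x) *\<^sub>R f (T x)) = (\<lambda>x. indicator K x *\<^sub>R f (T x))"
      by (auto simp: indicator_def fun_eq_iff inj)
    finally show "integrable lebesgue (\<lambda>x. indicator K x *\<^sub>R f (T x))" .
  qed
qed

text \<open>
  A test function is carried to the image domain by the inverse map, where the definition applies; the determinant
  cancels on both sides.
\<close>

lemma has_weak_partial_affine_matrix: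
  fixes M :: "real^'n^'n" and f :: "real^'n \<Rightarrow> real" and y :: "real^'n"
  assumes "det M \<noteq> 0" "open \<Omega>" "\<And>k. has_weak_partial \<Omega> k f (g k)"
  defines "T \<equiv> \<lambda>x. y + M *v (x - y)"
  shows "has_weak_partial (T -` \<Omega>) i (\<lambda>x. f (T x)) (\<lambda>x. \<Sum>k\<in>UNIV. M $ k $ i * g k (T x))"
proof -
  have T_eq: "y + M *v (x - y) = T x" for x
    by (simp add: T_def)
  have loc: "Lp_loc \<Omega> 1 f" "Lp_loc \<Omega> 1 (g k)" for k
    using assms(3) by (auto simp: has_weak_partial_def)
  note compose = Lp_loc_1_affine_matrix[OF assms(1,2), where y = y, unfolded T_eq]
  have op: "open (T -` \<Omega>)"
    by (rule compose(2)[OF loc(1)])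
  have inv: "matrix_inv M *v (M *v z) = z" "M *v (matrix_inv M *v z) = z" for z
    using assms(1) by (simp_all add: matrix_inv_mult invertible_det_nz)
  show ?thesis
  proof (rule has_weak_partialI[OF op compose(1)[OF loc(1)] Lp_loc_1_lincomb[OF op compose(1)[OF loc(2)], where c = "\<lambda>k. M $ k $ i"]])
    fix \<psi> assume \<psi>: "\<psi> \<in> C01 (T -` \<Omega>)"
    define \<psi>' where "\<psi>' = (\<lambda>w. \<psi> (y + matrix_inv M *v (w - y)))"
    have \<psi>': "\<psi>' \<in> C01 \<Omega>"
      unfolding \<psi>'_def by (rule C01_affine_matrix[OF \<psi> inv assms(2)]) (simp add: T_def)
    have \<psi>_T: "\<psi> x = \<psi>' (T x)" for x
      by (simp add: \<psi>'_def T_def inv)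
    have \<psi>_fun: "\<psi> = (\<lambda>x. \<psi>' (T x))"
      by (rule ext) (rule \<psi>_T)
    have part: "partial i \<psi> x = (\<Sum>k\<in>UNIV. M $ k $ i * partial k \<psi>' (T x))" for x
      unfolding \<psi>_fun
      using partial_affine_matrix(2)[OF C01_differentiable[OF \<psi>'], where i = i and y = y and M = M and x = x] unfolding T_eq .
    note int_f = lebesgue_integral_affine_matrix[OF assms(1) Lp_loc_1_times_C01(2)[OF loc(1) assms(2) \<psi>'], where y = y, unfolded T_eq]
    note int_g = lebesgue_integral_affine_matrix[OF assms(1) Lp_loc_1_times_C01(1)[OF loc(2) assms(2) \<psi>'], where y = y, unfolded T_eq]
    have eq: "(LINT x|lebesgue. f (T x) * partial k \<psi>' (T x)) = - (LINT x|lebesgue. g k (T x) * \<psi>' (T x))" for k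
    proof -
      have "\<bar>det M\<bar> * (LINT x|lebesgue. f (T x) * partial k \<psi>' (T x)) = \<bar>det M\<bar> * - (LINT x|lebesgue. g k (T x) * \<psi>' (T x))"
        using int_f(2)[of k] int_g(2)[of k] weak_partial_by_parts[OF assms(3,2) \<psi>', of k] by simp
      moreover have "\<bar>det M\<bar> \<noteq> 0"
        using assms(1) by simp
      ultimately show ?thesis
        using mult_left_cancel by blast
    qed
    have "(LINT x|lebesgue. f (T x) * partial i \<psi> x)
        = (LINT x|lebesgue. (\<Sum>k\<in>UNIV. M $ k $ i * (f (T x) * partial k \<psi>' (T x))))"
      by (simp add: part sum_distrib_left mult.left_commute)
    also have "\<dots> = (\<Sum>k\<in>UNIV. M $ k $ i * (LINT x|lebesgue. f (T x) * partial k \<psi>' (T x)))"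
      using int_f(1) by simp
    also have "\<dots> = - (\<Sum>k\<in>UNIV. M $ k $ i * (LINT x|lebesgue. g k (T x) * \<psi>' (T x)))"
      by (simp add: eq sum_negf)
    also have "(\<Sum>k\<in>UNIV. M $ k $ i * (LINT x|lebesgue. g k (T x) * \<psi>' (T x)))
        = (LINT x|lebesgue. (\<Sum>k\<in>UNIV. M $ k $ i * (g k (T x) * \<psi>' (T x))))"
      using int_g(1) by simp
    also have "\<dots> = (LINT x|lebesgue. (\<Sum>k\<in>UNIV. M $ k $ i * g k (T x)) * \<psi> x)"
      by (simp add: \<psi>_T sum_distrib_right mult.assoc)
    finally show "(LINT x|lebesgue. f (T x) * partial i \<psi> x)
        = - (LINT x|lebesgue. (\<Sum>k\<in>UNIV. M $ k $ i * g k (T x)) * \<psi> x)" .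
  qed
qed

section \<open>Integral means over annuli\<close>

lemma annulus_eq: "annulus r y = ball y (2 * r) - cball y r"
  by (auto simp: annulus_def dist_norm norm_minus_commute)

lemma open_annulus: "open (annulus r y)"
  unfolding annulus_eq by (intro open_Diff open_ball closed_cball)

lemma measure_annulus:
  fixes y :: "real^'n"
  assumes "0 < r"
  shows "measure lebesgue (annulus r y) = unit_ball_vol (real CARD('n)) * (2 ^ CARD('n) - 1) * r ^ CARD('n)"
    and "annulus r y \<in> lmeasurable"
proof -
  have "measure lebesgue (ball y (2 * r) - cball y r) = measure lebesgue (ball y (2 * r)) - measure lebesgue (cball y r)"
    using assms by (intro measurable_measure_Diff) (auto simp: fmeasurableD)
  also have "\<dots> = unit_ball_vol (real CARD('n)) * (2 ^ CARD('n) - 1) * r ^ CARD('n)"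
    using assms by (simp add: content_ball content_cball algebra_simps power_mult_distrib)
  finally show "measure lebesgue (annulus r y) = unit_ball_vol (real CARD('n)) * (2 ^ CARD('n) - 1) * r ^ CARD('n)"
    unfolding annulus_eq .
  show "annulus r y \<in> lmeasurable"
    unfolding annulus_eq by (intro fmeasurable.Diff) auto
qed

lemma measure_annulus_pos:
  fixes y :: "real^'n"
  assumes "0 < r"
  shows "0 < measure lebesgue (annulus r y)"
proof -
  have "(2::real) ^ CARD('n) > 1"
    by (intro one_less_power) auto
  then show ?thesis
    unfolding measure_annulus(1)[OF assms] using assms by (intro mult_pos_pos) auto
qed

text \<open>
  Taken at \<open>\<mu>\<close> near the mean, this replaces Hoelder's inequality, up to a factor of \<open>2\<close>.
\<close>

lemma le_plus_powr:
  fixes a \<mu> p :: real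
  assumes "0 < \<mu>" "0 \<le> a" "1 < p"
  shows "a \<le> \<mu> + \<mu> powr (1 - p) * a powr p"
proof (cases "a \<le> \<mu>")
  case True
  then show ?thesis
    by (simp add: add_increasing2)
next
  case False
  have "1 = \<mu> powr (1 - p) * \<mu> powr (p - 1)"
    using assms by (simp flip: powr_add)
  also have "\<dots> \<le> \<mu> powr (1 - p) * a powr (p - 1)"
    using assms False by (intro mult_left_mono powr_mono2) auto
  finally have "a * 1 \<le> a * (\<mu> powr (1 - p) * a powr (p - 1))"
    using assms by (intro mult_left_mono)
  also have "\<dots> = \<mu> powr (1 - p) * (a powr 1 * a powr (p - 1))"
    by (simp only: powr_one[OF assms(2)] mult.left_commute)
  also have "a powr 1 * a powr (p - 1) = a powr p"
    by (simp only: powr_add[symmetric]) simp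
  finally show ?thesis
    using assms by linarith
qed

definition annulus_L1 :: "real \<Rightarrow> real^'n \<Rightarrow> (real^'n \<Rightarrow> real) \<Rightarrow> real" where
  "annulus_L1 r y f = (LINT x:annulus r y|lebesgue. \<bar>f x\<bar>)"

lemma annulus_L1_le_M_mean:
  fixes y :: "real^'n" and W :: "real^'n \<Rightarrow> 'b::real_normed_vector"
  assumes "0 < r" "1 < p"
    and f: "set_integrable lebesgue (annulus r y) f"
    and W: "set_integrable lebesgue (annulus r y) (\<lambda>x. norm (W x) powr p)"
    and le: "\<And>x. x \<in> annulus r y \<Longrightarrow> \<bar>f x\<bar> \<le> norm (W x)"
  shows "annulus_L1 r y f \<le> 2 * measure lebesgue (annulus r y) * M_mean p W r y"
proof -
  let ?V = "measure lebesgue (annulus r y)"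
  define J where "J = (LINT x:annulus r y|lebesgue. norm (W x) powr p)"
  have V: "0 < ?V"
    by (rule measure_annulus_pos[OF assms(1)])
  have J: "0 \<le> J"
    unfolding J_def set_lebesgue_integral_def by (intro integral_nonneg_AE) (auto simp: indicator_def)
  have M: "M_mean p W r y = (J / ?V) powr (1 / p)"
    by (simp add: M_mean_def J_def)
  have M0: "0 \<le> M_mean p W r y"
    by (simp add: M)
  have Mp: "M_mean p W r y powr p = J / ?V"
    using J V assms(2) by (simp add: M powr_powr)
  have const: "set_integrable lebesgue (annulus r y) (\<lambda>x. \<mu>::real)" for \<mu>
    using measure_annulus(2)[OF assms(1), of y] unfolding set_integrable_def
    by (intro integrable_scaleR_left integrable_real_indicator) (auto simp: fmeasurable_def)
  \<comment> \<open>The mean itself may be \<open>0\<close>, so a slightly larger \<open>\<mu>\<close> is used and the bound is taken to the limit.\<close>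
  have bound: "annulus_L1 r y f \<le> 2 * ?V * \<mu>" if "M_mean p W r y < \<mu>" for \<mu>
  proof -
    have \<mu>: "0 < \<mu>"
      using that M0 by linarith
    have "annulus_L1 r y f \<le> (LINT x:annulus r y|lebesgue. \<mu> + \<mu> powr (1 - p) * norm (W x) powr p)"
      unfolding annulus_L1_def
    proof (rule set_integral_mono)
      show "set_integrable lebesgue (annulus r y) (\<lambda>x. \<bar>f x\<bar>)"
        using f by (rule set_integrable_abs)
      show "set_integrable lebesgue (annulus r y) (\<lambda>x. \<mu> + \<mu> powr (1 - p) * norm (W x) powr p)"
        using W by (intro set_integral_add const set_integrable_mult_right) auto
      show "\<bar>f x\<bar> \<le> \<mu> + \<mu> powr (1 - p) * norm (W x) powr p" if "x \<in> annulus r y" for x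
        using le[OF that] le_plus_powr[OF \<mu> _ assms(2), of "norm (W x)"] by simp
    qed
    also have "\<dots> = (LINT x:annulus r y|lebesgue. \<mu>) + \<mu> powr (1 - p) * J"
      using W by (subst set_integral_add(2)) (auto intro!: const simp: J_def)
    also have "(LINT x:annulus r y|lebesgue. \<mu>) = ?V * \<mu>"
      using measure_annulus(2)[OF assms(1), of y] by (simp add: set_lebesgue_integral_def fmeasurable_def)
    also have "J = ?V * M_mean p W r y powr p"
      using V by (simp add: Mp)
    also have "?V * \<mu> + \<mu> powr (1 - p) * (?V * M_mean p W r y powr p)
        \<le> ?V * \<mu> + \<mu> powr (1 - p) * (?V * \<mu> powr p)"
      using V M0 that assms(2) by (intro add_left_mono mult_left_mono powr_mono2) auto
    also have "\<dots> = ?V * \<mu> + ?V * (\<mu> powr (1 - p) * \<mu> powr p)"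
      by simp
    also have "\<mu> powr (1 - p) * \<mu> powr p = \<mu>"
      using \<mu> by (simp flip: powr_add)
    finally show ?thesis
      by (simp add: algebra_simps)
  qed
  show ?thesis
  proof (rule ccontr)
    assume "\<not> ?thesis"
    then have "M_mean p W r y < annulus_L1 r y f / (2 * ?V)"
      using V by (simp add: field_simps)
    then obtain \<mu> where "M_mean p W r y < \<mu>" "\<mu> < annulus_L1 r y f / (2 * ?V)"
      using dense by blast
    with bound[of \<mu>] V show False
      by (simp add: field_simps)
  qed
qed

lemma closed_annulus_compact: "compact {x::real^'n. r \<le> norm (x - y) \<and> norm (x - y) \<le> R}"
proof -
  have "{x::real^'n. r \<le> norm (x - y) \<and> norm (x - y) \<le> R} = cball y R - ball y r"
    by (auto simp: dist_norm norm_minus_commute)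
  then show ?thesis
    by (simp add: compact_diff)
qed

lemma norm_vec_le_sum:
  fixes x :: "('b::real_normed_vector)^'n"
  shows "norm x \<le> (\<Sum>i\<in>UNIV. norm (x $ i))" "norm (x $ i) \<le> norm x"
  by (auto simp: norm_vec_def intro: L2_set_le_sum member_le_L2_set)

lemma sum_powr_le:
  fixes a :: "'k \<Rightarrow> real"
  assumes "finite I" "\<And>i. i \<in> I \<Longrightarrow> 0 \<le> a i" "1 < p"
  shows "(\<Sum>i\<in>I. a i) powr p \<le> real (card I) powr p * (\<Sum>i\<in>I. a i powr p)"
proof (cases "I = {}")
  case False
  define m where "m = Max (a ` I)"
  have m: "a i \<le> m" if "i \<in> I" for i
    using assms(1) that by (simp add: m_def)
  obtain k where k: "k \<in> I" "a k = m"
    using Max_in[of "a ` I"] assms(1) False by (metis empty_is_image finite_imageI imageE m_def)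
  have "(\<Sum>i\<in>I. a i) \<le> real (card I) * m"
    using sum_bounded_above[of I a m] m by simp
  then have "(\<Sum>i\<in>I. a i) powr p \<le> (real (card I) * m) powr p"
    using assms by (intro powr_mono2 sum_nonneg) auto
  also have "\<dots> = real (card I) powr p * m powr p"
    by (rule powr_mult)
  also have "m powr p \<le> (\<Sum>i\<in>I. a i powr p)"
    using k assms(1) member_le_sum[of k I "\<lambda>i. a i powr p"] by auto
  finally show ?thesis
    by (simp add: mult_left_mono)
qed simp

text \<open>
  The \<open>L\<^sup>1\<close> norm of a component is compared with the \<open>p\<close>-mean of a vector or matrix. Here \<open>f\<close> and \<open>F\<close> are two
  representatives of the components, one on \<open>\<Omega>\<close> and one on the annulus.
\<close>

lemma annulus_L1_components:
  fixes y :: "real^'n" and W :: "real^'n \<Rightarrow> 'b::real_normed_vector" and f F :: "'k::finite \<Rightarrow> real^'n \<Rightarrow> real"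
  assumes r: "0 < r" and p: "1 < p" and sub: "{x. r \<le> norm (x - y) \<and> norm (x - y) \<le> 2 * r} \<subseteq> \<Omega>"
    and op: "open \<Omega>" and loc1: "\<And>k. Lp_loc \<Omega> 1 (f k)" and locp: "\<And>k. Lp_loc \<Omega> p (f k)"
    and eq: "\<And>k. AE x in lebesgue. x \<in> annulus r y \<longrightarrow> f k x = F k x"
    and loc: "\<And>k. Lp_loc (annulus r y) 1 (F k)"
    and W_meas: "(\<And>k. F k \<in> borel_measurable (lebesgue_on (annulus r y))) \<Longrightarrow>
        (\<lambda>x. norm (W x)) \<in> borel_measurable (lebesgue_on (annulus r y))"
    and W_le: "\<And>x. norm (W x) \<le> (\<Sum>k\<in>UNIV. \<bar>F k x\<bar>)" and W_ge: "\<And>k x. \<bar>F k x\<bar> \<le> norm (W x)"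
  shows "annulus_L1 r y (f k) \<le> 2 * measure lebesgue (annulus r y) * M_mean p W r y"
proof -
  let ?A = "annulus r y" and ?K = "{x. r \<le> norm (x - y) \<and> norm (x - y) \<le> 2 * r}"
  have A_sets: "?A \<in> sets lebesgue"
    using open_annulus[of r y] by auto
  have AK: "?A \<subseteq> ?K"
    by (auto simp: annulus_def)
  have F_meas: "F k \<in> borel_measurable (lebesgue_on ?A)" for k
    using loc by (simp add: Lp_loc_def)
  have F_meas': "(\<lambda>x. if x \<in> ?A then F k x else 0) \<in> borel_measurable lebesgue" for k
    using F_meas A_sets by (subst borel_measurable_if) auto
  have f_int: "integrable lebesgue (\<lambda>x. indicator ?A x *\<^sub>R f k x)" for k
  proof -
    have "set_integrable lebesgue ?K (f k)"
      unfolding set_integrable_def by (rule Lp_loc_1_set_integrable[OF loc1 op closed_annulus_compact sub])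
    then have "set_integrable lebesgue ?A (f k)"
      using set_integrable_subset A_sets AK by blast
    then show ?thesis
      by (simp add: set_integrable_def)
  qed
  have F_int: "set_integrable lebesgue ?A (F k)" for k
    unfolding set_integrable_def
  proof (rule integrable_cong_AE_imp[OF f_int])
    have "(\<lambda>x. if x \<in> ?A then F k x else 0) = (\<lambda>x. indicator ?A x *\<^sub>R F k x)"
      by (auto simp: fun_eq_iff indicator_def)
    then show "(\<lambda>x. indicator ?A x *\<^sub>R F k x) \<in> borel_measurable lebesgue"
      using F_meas'[of k] by simp
    show "AE x in lebesgue. indicator ?A x *\<^sub>R f k x = indicator ?A x *\<^sub>R F k x"
      using eq[of k] by eventually_elim (auto simp: indicator_def)
  qed
  have Fp_int: "integrable lebesgue (\<lambda>x. indicator ?A x *\<^sub>R (\<bar>F k x\<bar> powr p))" for k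
  proof (rule integrable_cong_AE_imp)
    have "set_integrable lebesgue ?K (\<lambda>x. \<bar>f k x\<bar> powr p)"
      using locp[of k] sub closed_annulus_compact[of r y "2 * r"] unfolding Lp_loc_def by blast
    then have "set_integrable lebesgue ?A (\<lambda>x. \<bar>f k x\<bar> powr p)"
      using set_integrable_subset A_sets AK by blast
    then show "integrable lebesgue (\<lambda>x. indicator ?A x *\<^sub>R (\<bar>f k x\<bar> powr p))"
      by (simp add: set_integrable_def)
    have "(\<lambda>x. \<bar>if x \<in> ?A then F k x else 0\<bar> powr p) \<in> borel_measurable lebesgue"
      using F_meas'[of k] by measurable
    also have "(\<lambda>x. \<bar>if x \<in> ?A then F k x else 0\<bar> powr p) = (\<lambda>x. indicator ?A x *\<^sub>R (\<bar>F k x\<bar> powr p))"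
      using p by (auto simp: fun_eq_iff indicator_def)
    finally show "(\<lambda>x. indicator ?A x *\<^sub>R (\<bar>F k x\<bar> powr p)) \<in> borel_measurable lebesgue" .
    show "AE x in lebesgue. indicator ?A x *\<^sub>R (\<bar>f k x\<bar> powr p) = indicator ?A x *\<^sub>R (\<bar>F k x\<bar> powr p)"
      using eq[of k] by eventually_elim (auto simp: indicator_def)
  qed
  have Wp: "set_integrable lebesgue ?A (\<lambda>x. norm (W x) powr p)"
    unfolding set_integrable_def
  proof (rule Bochner_Integration.integrable_bound)
    show "integrable lebesgue (\<lambda>x. real CARD('k) powr p * (\<Sum>k\<in>UNIV. indicator ?A x *\<^sub>R (\<bar>F k x\<bar> powr p)))"
      by (intro integrable_mult_right Bochner_Integration.integrable_sum Fp_int)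
    have "(\<lambda>x. if x \<in> ?A then norm (W x) else 0) \<in> borel_measurable lebesgue"
      using W_meas[OF F_meas] A_sets by (subst borel_measurable_if) auto
    then have "(\<lambda>x. (if x \<in> ?A then norm (W x) else 0) powr p) \<in> borel_measurable lebesgue"
      by measurable
    also have "(\<lambda>x. (if x \<in> ?A then norm (W x) else 0) powr p) = (\<lambda>x. indicator ?A x *\<^sub>R (norm (W x) powr p))"
      using p by (auto simp: fun_eq_iff indicator_def)
    finally show "(\<lambda>x. indicator ?A x *\<^sub>R (norm (W x) powr p)) \<in> borel_measurable lebesgue" .
    show "AE x in lebesgue. norm (indicator ?A x *\<^sub>R (norm (W x) powr p))
        \<le> norm (real CARD('k) powr p * (\<Sum>k\<in>UNIV. indicator ?A x *\<^sub>R (\<bar>F k x\<bar> powr p)))"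
    proof (rule AE_I2)
      fix x
      have "norm (W x) powr p \<le> (\<Sum>k\<in>UNIV. \<bar>F k x\<bar>) powr p"
        using W_le[of x] p by (intro powr_mono2) auto
      also have "\<dots> \<le> real CARD('k) powr p * (\<Sum>k\<in>UNIV. \<bar>F k x\<bar> powr p)"
        using p by (intro sum_powr_le) auto
      finally have "norm (W x) powr p \<le> real CARD('k) powr p * (\<Sum>k\<in>UNIV. \<bar>F k x\<bar> powr p)" .
      moreover have "0 \<le> real CARD('k) powr p * (\<Sum>k\<in>UNIV. \<bar>F k x\<bar> powr p)"
        by (intro mult_nonneg_nonneg sum_nonneg) auto
      ultimately show "norm (indicator ?A x *\<^sub>R (norm (W x) powr p))
        \<le> norm (real CARD('k) powr p * (\<Sum>k\<in>UNIV. indicator ?A x *\<^sub>R (\<bar>F k x\<bar> powr p)))"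
        by (auto simp: indicator_def)
    qed
  qed
  have "annulus_L1 r y (f k) = annulus_L1 r y (F k)"
    unfolding annulus_L1_def set_lebesgue_integral_def
  proof (rule integral_cong_AE)
    show "(\<lambda>x. indicator ?A x *\<^sub>R \<bar>f k x\<bar>) \<in> borel_measurable lebesgue"
      "(\<lambda>x. indicator ?A x *\<^sub>R \<bar>F k x\<bar>) \<in> borel_measurable lebesgue"
      using set_integrable_abs[of lebesgue ?A "f k"] set_integrable_abs[OF F_int[of k]] f_int[of k]
      by (auto simp: set_integrable_def intro: borel_measurable_integrable)
    show "AE x in lebesgue. indicator ?A x *\<^sub>R \<bar>f k x\<bar> = indicator ?A x *\<^sub>R \<bar>F k x\<bar>"
      using eq[of k] by eventually_elim (auto simp: indicator_def)
  qed
  also have "\<dots> \<le> 2 * measure lebesgue ?A * M_mean p W r y"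
    by (rule annulus_L1_le_M_mean[OF r p F_int Wp W_ge])
  finally show ?thesis .
qed

text \<open>
  The means refer to weak derivatives on the annulus, the left-hand sides to those on the punctured ball; they agree
  almost everywhere.
\<close>

lemma W2p_annulus_L1:
  fixes y :: "real^'n" and w :: "real^'n \<Rightarrow> real"
  assumes W: "W2p_loc (ball y \<delta> - {y}) p w" and p: "1 < p" and r: "0 < r" "2 * r < \<delta>"
  defines "\<Omega> \<equiv> ball y \<delta> - {y}" and "A \<equiv> annulus r y"
  shows "annulus_L1 r y w \<le> 2 * measure lebesgue A * M_mean p w r y"
    and "annulus_L1 r y (weak_partial \<Omega> i w) \<le> 2 * measure lebesgue A * M_mean p (weak_grad A w) r y"
    and "annulus_L1 r y (weak_partial \<Omega> i (weak_partial \<Omega> j w)) \<le> 2 * measure lebesgue A * M_mean p (weak_hess A w) r y"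
proof -
  have op: "open \<Omega>" "open A"
    unfolding \<Omega>_def A_def by (auto intro: open_annulus)
  have sub: "{x. r \<le> norm (x - y) \<and> norm (x - y) \<le> 2 * r} \<subseteq> \<Omega>"
    using r by (auto simp: \<Omega>_def dist_norm norm_minus_commute)
  have sub': "A \<subseteq> \<Omega>"
    using r by (auto simp: \<Omega>_def A_def annulus_def dist_norm norm_minus_commute)
  have locp: "Lp_loc \<Omega> p w" "Lp_loc \<Omega> p (weak_partial \<Omega> i w)" "Lp_loc \<Omega> p (weak_partial \<Omega> i (weak_partial \<Omega> j w))" for i j
    using W by (auto simp: W2p_loc_def \<Omega>_def)
  have D1: "has_weak_partial \<Omega> i w (weak_partial \<Omega> i w)" for i
    using W weak_partial_works by (fastforce simp: W2p_loc_def \<Omega>_def)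
  have D2: "has_weak_partial \<Omega> i (weak_partial \<Omega> j w) (weak_partial \<Omega> i (weak_partial \<Omega> j w))" for i j
    using W weak_partial_works by (fastforce simp: W2p_loc_def \<Omega>_def)
  have loc1: "Lp_loc \<Omega> 1 w" "Lp_loc \<Omega> 1 (weak_partial \<Omega> i w)" "Lp_loc \<Omega> 1 (weak_partial \<Omega> i (weak_partial \<Omega> j w))" for i j
    using D1 D2 by (auto simp: has_weak_partial_def)
  have E1: "has_weak_partial A i w (weak_partial A i w)" for i
    by (rule weak_partial_works[OF has_weak_partial_subset[OF D1 op sub']])
  have eq1: "AE x in lebesgue. x \<in> A \<longrightarrow> weak_partial \<Omega> i w x = weak_partial A i w x" for i
    by (rule weak_partial_unique[OF has_weak_partial_subset[OF D1 op sub'] E1 op(2)]) simp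
  have locA: "Lp_loc A 1 (weak_partial A i w)" for i
    using E1 by (simp add: has_weak_partial_def)
  have E2': "has_weak_partial A i (weak_partial A j w) (weak_partial \<Omega> i (weak_partial \<Omega> j w))" for i j
    by (rule has_weak_partial_cong_AE[OF has_weak_partial_subset[OF D2 op sub'] locA op(2) eq1])
  have E2: "has_weak_partial A i (weak_partial A j w) (weak_partial A i (weak_partial A j w))" for i j
    by (rule weak_partial_works[OF E2'])
  have eq2: "AE x in lebesgue. x \<in> A \<longrightarrow> weak_partial \<Omega> i (weak_partial \<Omega> j w) x = weak_partial A i (weak_partial A j w) x" for i j
    by (rule weak_partial_unique[OF E2' E2 op(2)]) simp
  have locA2: "Lp_loc A 1 (weak_partial A i (weak_partial A j w))" for i j
    using E2 by (simp add: has_weak_partial_def)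
  show "annulus_L1 r y w \<le> 2 * measure lebesgue A * M_mean p w r y"
    unfolding A_def
    by (rule annulus_L1_components[where f = "\<lambda>_::unit. w" and F = "\<lambda>_::unit. w", OF r(1) p sub op(1) loc1(1) locp(1)])
       (use Lp_loc_subset[OF loc1(1) op sub'] in \<open>auto simp: A_def\<close>)
  show "annulus_L1 r y (weak_partial \<Omega> i w) \<le> 2 * measure lebesgue A * M_mean p (weak_grad A w) r y"
  proof (rule annulus_L1_components[where f = "\<lambda>i. weak_partial \<Omega> i w" and F = "\<lambda>i. weak_partial (annulus r y) i w" and k = i,
        OF r(1) p sub op(1) loc1(2) locp(2) eq1[unfolded A_def] locA[unfolded A_def], folded A_def])
    show "norm (weak_grad A w x) \<le> (\<Sum>k\<in>UNIV. \<bar>weak_partial A k w x\<bar>)" for x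
      using norm_vec_le_sum(1)[of "weak_grad A w x"] by (simp add: weak_grad_def)
    show "\<bar>weak_partial A k w x\<bar> \<le> norm (weak_grad A w x)" for k x
      using norm_vec_le_sum(2)[of "weak_grad A w x" k] by (simp add: weak_grad_def)
    show "(\<lambda>x. norm (weak_grad A w x)) \<in> borel_measurable (lebesgue_on A)"
      if "\<And>k. weak_partial A k w \<in> borel_measurable (lebesgue_on A)"
      using that unfolding norm_vec_def L2_set_def weak_grad_def vec_lambda_beta by measurable
  qed
  show "annulus_L1 r y (weak_partial \<Omega> i (weak_partial \<Omega> j w)) \<le> 2 * measure lebesgue A * M_mean p (weak_hess A w) r y"
  proof (rule annulus_L1_components[where f = "\<lambda>k. weak_partial \<Omega> (fst k) (weak_partial \<Omega> (snd k) w)"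
        and F = "\<lambda>k. weak_partial (annulus r y) (fst k) (weak_partial (annulus r y) (snd k) w)" and k = "(i, j)",
        OF r(1) p sub op(1) loc1(3) locp(3) eq2[unfolded A_def] locA2[unfolded A_def], folded A_def, unfolded fst_conv snd_conv])
    show "norm (weak_hess A w x) \<le> (\<Sum>k\<in>UNIV. \<bar>weak_partial A (fst k) (weak_partial A (snd k) w) x\<bar>)" for x
    proof -
      have "norm (weak_hess A w x) \<le> (\<Sum>i\<in>UNIV. norm (weak_hess A w x $ i))"
        by (rule norm_vec_le_sum)
      also have "\<dots> \<le> (\<Sum>i\<in>UNIV. \<Sum>j\<in>UNIV. norm (weak_hess A w x $ i $ j))"
        by (intro sum_mono norm_vec_le_sum)
      also have "\<dots> = (\<Sum>k\<in>UNIV. \<bar>weak_partial A (fst k) (weak_partial A (snd k) w) x\<bar>)"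
        by (simp add: weak_hess_def sum.cartesian_product case_prod_beta)
      finally show ?thesis .
    qed
    show "\<bar>weak_partial A (fst k) (weak_partial A (snd k) w) x\<bar> \<le> norm (weak_hess A w x)" for k x
      using norm_vec_le_sum(2)[of "weak_hess A w x" "fst k"] norm_vec_le_sum(2)[of "weak_hess A w x $ fst k" "snd k"]
      by (simp add: weak_hess_def)
    show "(\<lambda>x. norm (weak_hess A w x)) \<in> borel_measurable (lebesgue_on A)"
      if "\<And>k. weak_partial A (fst k) (weak_partial A (snd k) w) \<in> borel_measurable (lebesgue_on A)"
    proof -
      have "weak_partial A i (weak_partial A j w) \<in> borel_measurable (lebesgue_on A)" for i j
        using that[of "(i, j)"] by simp
      then show ?thesis
        unfolding norm_vec_def L2_set_def weak_hess_def vec_lambda_beta by measurable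
    qed
  qed
qed

section \<open>The flux field of the fundamental solution\<close>

lemma C01_integrable:
  fixes \<phi> :: "real^'n \<Rightarrow> real"
  assumes "\<phi> \<in> C01 \<Omega>"
  shows "integrable lebesgue \<phi>" "integrable lebesgue (partial i \<phi>)"
proof -
  obtain K where K: "compact K" "\<And>x. x \<notin> K \<Longrightarrow> \<phi> x = 0" "\<And>x i. x \<notin> K \<Longrightarrow> partial i \<phi> x = 0"
    using C01_support[OF assms] by metis
  show "integrable lebesgue \<phi>" "integrable lebesgue (partial i \<phi>)"
    by (rule integrable_compact_support[OF C01_continuous(1)[OF assms] K(1,2)], assumption)
       (rule integrable_compact_support[OF C01_continuous(2)[OF assms] K(1,3)], assumption)
qed

lemma C01_outside:
  assumes "\<phi> \<in> C01 \<Omega>" "x \<notin> \<Omega>"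
  shows "\<phi> x = 0" "partial i \<phi> x = 0"
proof -
  obtain K where "K \<subseteq> \<Omega>" "\<And>x. x \<notin> K \<Longrightarrow> \<phi> x = 0" "\<And>x i. x \<notin> K \<Longrightarrow> partial i \<phi> x = 0"
    using C01_support[OF assms(1)] by metis
  then show "\<phi> x = 0" "partial i \<phi> x = 0"
    using assms(2) by auto
qed

text \<open>
  The transition from \<open>0\<close> to \<open>1\<close> takes place between the ellipsoids \<open>c |L (x - y)|\<^sup>2 = d\<close> and \<open>c |L (x - y)|\<^sup>2 = d + 1\<close>.
\<close>

definition ellip_cut :: "real^'n^'n \<Rightarrow> real^'n \<Rightarrow> real \<Rightarrow> real \<Rightarrow> real^'n \<Rightarrow> real" where
  "ellip_cut L y c d x = step (c * (norm (L *v (x - y)))\<^sup>2 - d)"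

lemma DERIV_affine_compose:
  assumes "\<And>t. (G has_real_derivative g t) (at t)"
  shows "((\<lambda>t. G (c * t - d)) has_real_derivative (g (c * t - d) * c)) (at t)"
proof -
  have "((\<lambda>t. c * t - d) has_real_derivative c) (at t)"
    by (auto intro!: derivative_eq_intros)
  from DERIV_chain2[OF assms this] show ?thesis .
qed

lemma partial_ellip_cut:
  "partial i (ellip_cut L y c d) x =
     step_deriv (c * (norm (L *v (x - y)))\<^sup>2 - d) * c * (2 * ((L *v (x - y)) \<bullet> (L *v axis i 1)))"
  unfolding ellip_cut_def[abs_def]
  by (rule partial_radial[where G = "\<lambda>t. step (c * t - d)"]) (rule DERIV_affine_compose[OF DERIV_step])

lemma C1_on_ellip_cut: "C1_on \<Omega> (ellip_cut L y c d)"
  unfolding ellip_cut_def[abs_def]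
  by (rule C1_on_radial[where T = UNIV and G = "\<lambda>t. step (c * t - d)", OF DERIV_affine_compose[OF DERIV_step]])
     (auto intro!: continuous_intros continuous_on_compose2[OF continuous_on_step(2)[of UNIV]])

lemma C1_on_inner:
  fixes L :: "real^'n^'n"
  shows "C1_on \<Omega> (\<lambda>x. (L *v (x - y)) \<bullet> z)"
proof (rule C1_onI)
  show "((\<lambda>x. (L *v (x - y)) \<bullet> z) has_derivative (\<lambda>h. (L *v h) \<bullet> z)) (at x)" for x
    by (auto intro!: derivative_eq_intros bounded_linear.has_derivative[OF matrix_vector_mul_bounded_linear])
qed auto

lemma C1_on_partial_ellip_cut: "C1_on \<Omega> (partial i (ellip_cut L y c d))"
proof -
  obtain g where g: "\<And>t. (step_deriv has_real_derivative g t) (at t)" "continuous_on UNIV g"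
    using DERIV_step_deriv by metis
  have "C1_on \<Omega> (\<lambda>x. step_deriv (c * (norm (L *v (x - y)))\<^sup>2 - d))"
    by (rule C1_on_radial[where T = UNIV and G = "\<lambda>t. step_deriv (c * t - d)", OF DERIV_affine_compose[OF g(1)]])
       (auto intro!: continuous_intros continuous_on_compose2[OF g(2)])
  then have "C1_on \<Omega> (\<lambda>x. step_deriv (c * (norm (L *v (x - y)))\<^sup>2 - d) * c * (2 * ((L *v (x - y)) \<bullet> (L *v axis i 1))))"
    by (intro C1_on_mult C1_on_const C1_on_inner)
  then show ?thesis
    by (simp only: partial_ellip_cut[abs_def])
qed

lemma sum_component_inner:
  fixes L :: "real^'n^'n"
  shows "(\<Sum>i\<in>UNIV. z $ i * (w \<bullet> (L *v axis i 1))) = w \<bullet> (L *v z)"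
proof -
  have lin: "linear (\<lambda>h. w \<bullet> (L *v h))"
    by (rule linearI) (simp_all add: matrix_vector_right_distrib inner_add_right matrix_vector_mult_scaleR)
  have "(\<Sum>i\<in>UNIV. z $ i * (w \<bullet> (L *v axis i 1))) = w \<bullet> (L *v (\<Sum>i\<in>UNIV. z $ i *\<^sub>R axis i 1))"
    by (simp only: linear_sum[OF lin] linear_cmul[OF lin] real_scaleR_def)
  also have "(\<Sum>i\<in>UNIV. z $ i *\<^sub>R axis i 1) = z"
    by (simp add: basis_expansion scalar_mult_eq_scaleR[symmetric])
  finally show ?thesis .
qed

text \<open>
  The radial derivative of a function of \<open>|L (x - y)|\<^sup>2\<close>. Its sign is the sign of the flux through the cutoff.
\<close>

lemma euler_ellip_cut:
  fixes L :: "real^'n^'n"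
  shows "(\<Sum>i\<in>UNIV. (x - y) $ i * partial i (ellip_cut L y c d) x)
    = 2 * c * step_deriv (c * (norm (L *v (x - y)))\<^sup>2 - d) * (norm (L *v (x - y)))\<^sup>2"
proof -
  have *: "(norm (L *v (x - y)))\<^sup>2 = (\<Sum>i\<in>UNIV. (x - y) $ i * ((L *v (x - y)) \<bullet> (L *v axis i 1)))"
    by (simp only: power2_norm_eq_inner sum_component_inner)
  show ?thesis
    unfolding partial_ellip_cut
    by (subst (3) *) (simp add: sum_distrib_left mult_ac del: vector_minus_component)
qed

lemma ellip_cut_0_1:
  fixes L :: "real^'n^'n"
  assumes m: "0 < m" "\<And>z. m * norm z \<le> norm (L *v z)" and "0 < c" "0 < d"
  obtains a b where "0 < a" "a < b" "\<And>x. norm (x - y) < a \<Longrightarrow> c * (norm (L *v (x - y)))\<^sup>2 - d < 0"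
    "\<And>x. b < norm (x - y) \<Longrightarrow> 1 < c * (norm (L *v (x - y)))\<^sup>2 - d"
proof -
  define l where "l = onorm ((*v) L) + 1"
  have l: "norm (L *v z) \<le> l * norm z" "l > 0" for z
  proof -
    have "norm (L *v z) \<le> onorm ((*v) L) * norm z"
      by (simp add: onorm matrix_vector_mul_bounded_linear)
    then show "norm (L *v z) \<le> l * norm z"
      using norm_ge_zero[of z] unfolding l_def distrib_right mult_1 by linarith
    show "l > 0"
      using onorm_pos_le[OF matrix_vector_mul_bounded_linear[of L]] by (simp add: l_def)
  qed
  define a where "a = sqrt (d / c) / l"
  define b where "b = max (2 * a) (sqrt ((d + 1) / c) / m)"
  have a: "0 < a"
    using assms l by (simp add: a_def)
  show thesis
  proof
    show "0 < a" by (fact a)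
    show "a < b"
      using a by (simp add: b_def)
    show "c * (norm (L *v (x - y)))\<^sup>2 - d < 0" if "norm (x - y) < a" for x
    proof -
      have "norm (L *v (x - y)) \<le> l * norm (x - y)"
        by (rule l)
      also have "\<dots> < sqrt (d / c)"
        using that l(2) by (simp add: a_def field_simps)
      finally have "(norm (L *v (x - y)))\<^sup>2 < (sqrt (d / c))\<^sup>2"
        by (intro power_strict_mono) auto
      then show ?thesis
        using assms by (simp add: field_simps)
    qed
    show "1 < c * (norm (L *v (x - y)))\<^sup>2 - d" if "b < norm (x - y)" for x
    proof -
      have "sqrt ((d + 1) / c) / m < norm (x - y)"
        using that by (simp add: b_def)
      then have "sqrt ((d + 1) / c) < m * norm (x - y)"
        using m(1) by (simp add: field_simps)
      also have "\<dots> \<le> norm (L *v (x - y))"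
        by (rule m)
      finally have "(sqrt ((d + 1) / c))\<^sup>2 < (norm (L *v (x - y)))\<^sup>2"
        using assms by (intro power_strict_mono) auto
      then show ?thesis
        using assms by (simp add: field_simps)
    qed
  qed
qed

lemma partial_ellip_cut_C01:
  fixes L :: "real^'n^'n"
  assumes m: "0 < m" "\<And>z. m * norm z \<le> norm (L *v z)" and "0 < c" "0 < d"
  shows "partial i (ellip_cut L y c d) \<in> C01 (UNIV - {y})"
proof -
  obtain a b where ab: "0 < a" "a < b" "\<And>x. norm (x - y) < a \<Longrightarrow> c * (norm (L *v (x - y)))\<^sup>2 - d < 0"
    "\<And>x. b < norm (x - y) \<Longrightarrow> 1 < c * (norm (L *v (x - y)))\<^sup>2 - d"
    using ellip_cut_0_1[OF assms, of y] by metis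
  show ?thesis
  proof (rule C01I[OF _ C1_on_partial_ellip_cut closed_annulus_compact[of a y b]])
    show "open (UNIV - {y})"
      by auto
    show "{x. a \<le> norm (x - y) \<and> norm (x - y) \<le> b} \<subseteq> UNIV - {y}"
      using ab(1) by auto
    show "partial i (ellip_cut L y c d) x = 0" if "x \<notin> {x. a \<le> norm (x - y) \<and> norm (x - y) \<le> b}" for x
      using that ab(3,4)[of x] step_deriv_eq_0[of "c * (norm (L *v (x - y)))\<^sup>2 - d"]
      by (auto simp: partial_ellip_cut not_le less_imp_le)
  qed
qed

context
  fixes B :: "real^'n^'n" and y :: "real^'n" and m :: real
  assumes m: "0 < m" "\<And>z. m * norm z \<le> norm (B *v z)"
begin

text \<open>
  Up to the factor \<open>A\<^sub>y\<close> and a constant, the gradient of the fundamental solution of the operator with coefficients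
  frozen at \<open>y\<close>, when \<open>B\<close> is the inverse square root of \<open>A\<^sub>y\<close>.
\<close>

definition flux_field :: "'n \<Rightarrow> real^'n \<Rightarrow> real" where
  "flux_field i x = ((norm (B *v (x - y)))\<^sup>2) powr (- real CARD('n) / 2) * (x - y) $ i"

lemma N_pos: "x \<noteq> y \<Longrightarrow> 0 < (norm (B *v (x - y)))\<^sup>2"
  using m(2)[of "x - y"] m(1) by (smt (verit) mult_pos_pos norm_eq_zero norm_ge_zero right_minus_eq zero_less_power)

lemma C1_on_powr_N: "C1_on (UNIV - {y}) (\<lambda>x. ((norm (B *v (x - y)))\<^sup>2) powr q)"
proof (rule C1_on_radial[where T = "{0<..}" and G = "\<lambda>t. t powr q" and g = "\<lambda>t. q * t powr (q - 1)"])
  show "((\<lambda>t. t powr q) has_real_derivative q * t powr (q - 1)) (at t)" if "t \<in> {0<..}" for t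
    using that by (intro has_real_derivative_powr) auto
  show "continuous_on {0<..} (\<lambda>t. q * t powr (q - 1))"
    by (intro continuous_intros) auto
qed (use N_pos in auto)

lemma C1_on_flux_field: "C1_on (UNIV - {y}) (flux_field i)"
  unfolding flux_field_def[abs_def] by (intro C1_on_mult C1_on_powr_N C1_on_component)

text \<open>
  The field is homogeneous of degree \<open>1 - n\<close> and radial: differentiating \<open>x - y\<close> contributes \<open>n\<close>, and Euler's relation
  for the power of the norm contributes \<open>- n\<close>.
\<close>

lemma divergence_flux_field:
  assumes "x \<noteq> y"
  shows "(\<Sum>i\<in>UNIV. partial i (flux_field i) x) = 0"
proof -
  let ?q = "- real CARD('n) / 2" and ?N = "(norm (B *v (x - y)))\<^sup>2"
  have N: "0 < ?N"
    by (rule N_pos[OF assms])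
  have "partial i (flux_field i) x = ?N powr ?q + (x - y) $ i * (?q * ?N powr (?q - 1) * (2 * ((B *v (x - y)) \<bullet> (B *v axis i 1))))" for i
  proof -
    have d: "((\<lambda>t. t powr ?q) has_real_derivative ?q * ?N powr (?q - 1)) (at ?N)"
      using N by (intro has_real_derivative_powr) auto
    have d1: "(\<lambda>x. ((norm (B *v (x - y)))\<^sup>2) powr ?q) differentiable (at x)"
      using has_derivative_radial[where G = "\<lambda>t. t powr ?q", OF d] by (rule differentiableI)
    have d2: "(\<lambda>x. (x - y) $ i) differentiable (at x)"
      using has_derivative_component by (rule differentiableI)
    show ?thesis
      unfolding flux_field_def[abs_def] partial_mult[OF d1 d2] partial_component
        partial_radial[where G = "\<lambda>t. t powr ?q", OF d]
      by simp
  qed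
  moreover have gen: "(\<Sum>i\<in>UNIV. P + f i * (Q * (2 * e i))) = real CARD('n) * P + Q * 2 * (\<Sum>i\<in>UNIV. f i * e i)"
    for P Q :: real and f e :: "'n \<Rightarrow> real"
    by (simp add: sum.distrib sum_distrib_left mult_ac)
  ultimately have "(\<Sum>i\<in>UNIV. partial i (flux_field i) x)
      = real CARD('n) * ?N powr ?q + ?q * ?N powr (?q - 1) * 2 * (\<Sum>i\<in>UNIV. (x - y) $ i * ((B *v (x - y)) \<bullet> (B *v axis i 1)))"
    by (simp only: gen)
  also have "(\<Sum>i\<in>UNIV. (x - y) $ i * ((B *v (x - y)) \<bullet> (B *v axis i 1))) = ?N"
    by (simp only: power2_norm_eq_inner sum_component_inner)
  also have "?q * ?N powr (?q - 1) * 2 * ?N = - real CARD('n) * ?N powr ?q"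
  proof -
    have "?N powr (?q - 1) * ?N = ?N powr ((?q - 1) + 1)"
      unfolding powr_add using N by simp
    then have "?N powr (?q - 1) * ?N = ?N powr ?q"
      by simp
    then show ?thesis
      by (simp add: algebra_simps)
  qed
  finally show ?thesis
    by simp
qed

lemma flux_integrable:
  assumes "\<And>i. partial i u \<in> C01 (UNIV - {y})"
  shows "integrable lebesgue (\<lambda>x. \<Sum>i\<in>UNIV. flux_field i x * partial i u x)"
proof (rule Bochner_Integration.integrable_sum)
  fix i
  have C: "(\<lambda>x. flux_field i x * partial i u x) \<in> C01 (UNIV - {y})"
    by (rule C01_mult[OF _ C1_on_flux_field assms]) auto
  then show "integrable lebesgue (\<lambda>x. flux_field i x * partial i u x)"
    by (rule C01_integrable)
qed

text \<open>
  The difference of the two cutoffs is a test function supported away from \<open>y\<close>, where the field is divergence free.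
\<close>

lemma flux_independent:
  assumes "C1_on UNIV u" "\<And>i. partial i u \<in> C01 (UNIV - {y})"
    and "C1_on UNIV u'" "\<And>i. partial i u' \<in> C01 (UNIV - {y})"
    and "0 < a" "\<And>x. norm (x - y) < a \<or> b < norm (x - y) \<Longrightarrow> u x = u' x"
  shows "(LINT x|lebesgue. (\<Sum>i\<in>UNIV. flux_field i x * partial i u x))
       = (LINT x|lebesgue. (\<Sum>i\<in>UNIV. flux_field i x * partial i u' x))"
proof -
  let ?\<Omega> = "UNIV - {y}"
  define D where "D = (\<lambda>x. u x - u' x)"
  have op: "open ?\<Omega>"
    by auto
  have D: "D \<in> C01 ?\<Omega>"
  proof (rule C01I[OF op _ closed_annulus_compact[of a y b]])
    show "C1_on ?\<Omega> D"
      unfolding D_def using assms(1,3) by (intro C1_on_diff) (auto intro: C1_on_subset)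
  qed (use assms(5,6) in \<open>auto simp: D_def not_le\<close>)
  have eD: "(\<lambda>x. flux_field i x * D x) \<in> C01 ?\<Omega>" for i
    by (rule C01_mult[OF op C1_on_flux_field D])
  have pD: "partial i D x = partial i u x - partial i u' x" for i x
    using partial_add[of u x "\<lambda>x. -1 * u' x" i] partial_cmult[of u' x i "-1"] assms(1,3)
    by (simp add: D_def C1_on_def)
  have peD: "partial i (\<lambda>x. flux_field i x * D x) x = flux_field i x * partial i D x + partial i (flux_field i) x * D x" for i x
  proof (cases "x = y")
    case True
    then have x: "x \<notin> ?\<Omega>"
      by simp
    have "D x = 0" "partial i D x = 0" "partial i (\<lambda>x. flux_field i x * D x) x = 0"
      by (rule C01_outside[OF D x] C01_outside(2)[OF eD x])+
    then show ?thesis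
      by simp
  next
    case False
    then show ?thesis
      using C1_on_flux_field[of i] C01_differentiable[OF D] by (intro partial_mult) (auto simp: C1_on_def)
  qed
  have int: "integrable lebesgue (partial i (\<lambda>x. flux_field i x * D x))" for i
    by (rule C01_integrable[OF eD])
  have "0 = (\<Sum>i\<in>UNIV. LINT x|lebesgue. partial i (\<lambda>x. flux_field i x * D x) x)"
    by (simp only: integral_partial_0[OF eD] sum.neutral_const)
  also have "\<dots> = (LINT x|lebesgue. (\<Sum>i\<in>UNIV. partial i (\<lambda>x. flux_field i x * D x) x))"
    using int by (intro Bochner_Integration.integral_sum[symmetric])
  also have "(\<lambda>x. \<Sum>i\<in>UNIV. partial i (\<lambda>x. flux_field i x * D x) x)
      = (\<lambda>x. (\<Sum>i\<in>UNIV. flux_field i x * partial i u x) - (\<Sum>i\<in>UNIV. flux_field i x * partial i u' x))"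
  proof
    fix x
    have "D x * (\<Sum>i\<in>UNIV. partial i (flux_field i) x) = 0"
      using divergence_flux_field[of x] C01_outside(1)[OF D, of x] by (cases "x = y") auto
    then show "(\<Sum>i\<in>UNIV. partial i (\<lambda>x. flux_field i x * D x) x)
      = (\<Sum>i\<in>UNIV. flux_field i x * partial i u x) - (\<Sum>i\<in>UNIV. flux_field i x * partial i u' x)"
      unfolding peD pD by (simp add: sum.distrib sum_subtractf right_diff_distrib sum_distrib_left mult.commute)
  qed
  also have "(LINT x|lebesgue. (\<Sum>i\<in>UNIV. flux_field i x * partial i u x) - (\<Sum>i\<in>UNIV. flux_field i x * partial i u' x))
      = (LINT x|lebesgue. (\<Sum>i\<in>UNIV. flux_field i x * partial i u x)) - (LINT x|lebesgue. (\<Sum>i\<in>UNIV. flux_field i x * partial i u' x))"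
    by (rule Bochner_Integration.integral_diff[OF flux_integrable[OF assms(2)] flux_integrable[OF assms(4)]])
  finally show ?thesis
    by simp
qed

end

section \<open>The value of the flux\<close>

text \<open>
  The cone over the whole sphere is the unit ball.
\<close>

lemma sphere_area_eq: "sphere_area TYPE('n::finite) = real CARD('n) * unit_ball_vol (real CARD('n))"
proof -
  let ?f = "\<lambda>x::real^'n. x /\<^sub>R norm x"
  have [measurable]: "?f \<in> restrict_space lborel (ball 0 1) \<rightarrow>\<^sub>M borel"
    by (intro measurable_restrict_space1) measurable
  have "?f -` sphere 0 1 \<inter> space (restrict_space lborel (ball 0 1)) = ball 0 1 - {0}"
    by (auto simp: space_restrict_space)
  then have "measure (distr (restrict_space lborel (ball 0 1)) borel ?f) (sphere 0 1)
      = measure (restrict_space lborel (ball 0 1)) (ball (0::real^'n) 1 - {0})"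
    by (subst measure_distr) auto
  also have "\<dots> = measure lborel (ball (0::real^'n) 1 - {0})"
    by (intro measure_restrict_space) auto
  also have "\<dots> = measure lborel (ball (0::real^'n) 1)"
    by (intro measure_Diff_null_set) auto
  also have "\<dots> = unit_ball_vol (real CARD('n))"
    by (simp add: content_ball)
  finally show ?thesis
    by (simp add: sphere_area_def sphere_measure_def measure_def enn2real_mult ennreal_of_nat_eq_real_of_nat)
qed

lemma ellipsoid_volume:
  fixes B :: "real^'n^'n" and y :: "real^'n"
  assumes "det B \<noteq> 0" "0 \<le> \<rho>"
  shows "integrable lebesgue (indicat_real {x. norm (B *v (x - y)) \<le> \<rho>})"
    and "(LINT x|lebesgue. indicat_real {x. norm (B *v (x - y)) \<le> \<rho>} x)
      = unit_ball_vol (real CARD('n)) * \<rho> ^ CARD('n) / \<bar>det B\<bar>"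
proof -
  have int: "integrable lebesgue (indicat_real (cball y \<rho>))"
    using lmeasurable_cball[of y \<rho>] by (simp add: fmeasurable_def)
  have eq: "(\<lambda>x. indicat_real (cball y \<rho>) (y + B *v (x - y))) = indicat_real {x. norm (B *v (x - y)) \<le> \<rho>}"
    by (auto simp: fun_eq_iff indicator_def dist_norm)
  show "integrable lebesgue (indicat_real {x. norm (B *v (x - y)) \<le> \<rho>})"
    using lebesgue_integral_affine_matrix(1)[OF assms(1) int, of y] unfolding eq .
  have "(LINT x|lebesgue. indicat_real (cball y \<rho>) x) = unit_ball_vol (real CARD('n)) * \<rho> ^ CARD('n)"
    using assms(2) by (simp add: content_cball)
  then have "\<bar>det B\<bar> * (LINT x|lebesgue. indicat_real {x. norm (B *v (x - y)) \<le> \<rho>} x)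
      = unit_ball_vol (real CARD('n)) * \<rho> ^ CARD('n)"
    using lebesgue_integral_affine_matrix(2)[OF assms(1) int, of y] unfolding eq by simp
  then show "(LINT x|lebesgue. indicat_real {x. norm (B *v (x - y)) \<le> \<rho>} x)
      = unit_ball_vol (real CARD('n)) * \<rho> ^ CARD('n) / \<bar>det B\<bar>"
    using assms(1) by (simp add: field_simps)
qed

lemma matrix_injective_bound:
  fixes B :: "real^'n^'n"
  assumes "det B \<noteq> 0"
  obtains m where "0 < m" "\<And>z. m * norm z \<le> norm (B *v z)"
proof -
  have "inj ((*v) B)"
    using assms by (metis det_nz_iff_inj matrix_of_matrix_vector_mul matrix_vector_mul_linear)
  then obtain m where "0 < m" "\<And>z. m * norm z \<le> norm (B *v z)"
    using linear_inj_bounded_below_pos[OF matrix_vector_mul_linear[of B]] by metis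
  then show thesis
    by (rule that)
qed

text \<open>
  On the thin shell between \<open>N = 1\<close> and \<open>N\<^sup>2 = 1 + 1 / j\<close> the power of \<open>N\<close> in the field is nearly \<open>1\<close>. Without it the flux is
  that of \<open>x - y\<close>, which by the divergence theorem is \<open>n\<close> times a volume between those of the two ellipsoids.
\<close>

lemma flux_value_thin:
  fixes B :: "real^'n^'n" and y :: "real^'n"
  assumes "det B \<noteq> 0" "1 \<le> j"
  defines "V \<equiv> unit_ball_vol (real CARD('n)) / \<bar>det B\<bar>"
    and "F \<equiv> (LINT x|lebesgue. (\<Sum>i\<in>UNIV. flux_field B y i x * partial i (ellip_cut B y j j) x))"
  shows "(1 + 1 / j) powr (- real CARD('n) / 2) * (real CARD('n) * V) \<le> F"
    and "F \<le> real CARD('n) * V * sqrt (1 + 1 / j) ^ CARD('n)"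
proof -
  obtain m where m: "0 < m" "\<And>z. m * norm z \<le> norm (B *v z)"
    using matrix_injective_bound[OF assms(1)] by blast
  have j: "0 < j"
    using assms(2) by simp
  let ?N = "\<lambda>x. (norm (B *v (x - y)))\<^sup>2"
  let ?q = "- real CARD('n) / 2"
  define u where "u = ellip_cut B y j j"
  define W where "W = (\<lambda>x. \<Sum>i\<in>UNIV. (x - y) $ i * partial i u x)"
  have W_eq: "W x = 2 * j * step_deriv (j * ?N x - j) * ?N x" for x
    unfolding W_def u_def by (rule euler_ellip_cut)
  have W_nonneg: "0 \<le> W x" for x
    using j by (simp add: W_eq step_deriv_nonneg)
  have W_supp: "1 \<le> ?N x \<and> ?N x \<le> 1 + 1 / j" if "W x \<noteq> 0" for x
  proof -
    have "step_deriv (j * ?N x - j) \<noteq> 0"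
      using that by (auto simp: W_eq)
    then have "0 < j * ?N x - j" "j * ?N x - j < 1"
      by (smt (verit) step_deriv_eq_0)+
    then show ?thesis
      using j by (simp add: field_simps)
  qed
  obtain a b where ab: "0 < a" "a < b" "\<And>x. norm (x - y) < a \<Longrightarrow> j * ?N x - j < 0"
    "\<And>x. b < norm (x - y) \<Longrightarrow> 1 < j * ?N x - j"
    using ellip_cut_0_1[OF m j j, of y] by metis
  have u_C1: "C1_on UNIV u"
    unfolding u_def by (rule C1_on_ellip_cut)
  have one_minus: "C1_on UNIV (\<lambda>x. 1 - u x)"
    by (intro C1_on_diff C1_on_const u_C1)
  have far: "1 - u x = 0" if "x \<notin> cball y b" for x
    using ab(4)[of x] that by (simp add: u_def ellip_cut_def step_eq_1 dist_norm norm_minus_commute)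
  have C: "(\<lambda>x. (x - y) $ i * (1 - u x)) \<in> C01 UNIV" for i
    using far by (intro C01I[OF _ C1_on_mult[OF C1_on_component one_minus], of "cball y b"]) auto
  have C1: "(\<lambda>x. 1 - u x) \<in> C01 UNIV"
    using far by (intro C01I[OF _ one_minus, of "cball y b"]) auto
  have pu: "partial i u \<in> C01 (UNIV - {y})" for i
    unfolding u_def by (rule partial_ellip_cut_C01[OF m j j])
  have W_int: "integrable lebesgue W"
  proof -
    have "(\<lambda>x. (x - y) $ i * partial i u x) \<in> C01 (UNIV - {y})" for i
      by (rule C01_mult[OF _ C1_on_component pu]) auto
    then show ?thesis
      unfolding W_def by (intro Bochner_Integration.integrable_sum C01_integrable)
  qed
  have part: "partial i (\<lambda>x. (x - y) $ i * (1 - u x)) x = (1 - u x) - (x - y) $ i * partial i u x" for i x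
  proof -
    have d: "(\<lambda>x. (x - y) $ i) differentiable (at x)" "(\<lambda>x. 1 - u x) differentiable (at x)" "u differentiable (at x)"
      using C1_on_component one_minus u_C1 by (auto simp: C1_on_def)
    have "partial i (\<lambda>x. 1 - u x) x = - partial i u x"
      using partial_add[OF differentiable_const[of 1], of "\<lambda>x. -1 * u x" x i] partial_cmult[OF d(3), of i "-1"] d(3)
      by (simp add: partial_const)
    then show ?thesis
      unfolding partial_mult[OF d(1,2)] partial_component by simp
  qed
  have "0 = (\<Sum>i\<in>UNIV. LINT x|lebesgue. partial i (\<lambda>x. (x - y) $ i * (1 - u x)) x)"
    by (simp only: integral_partial_0[OF C] sum.neutral_const)
  also have "\<dots> = (LINT x|lebesgue. (\<Sum>i\<in>UNIV. partial i (\<lambda>x. (x - y) $ i * (1 - u x)) x))"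
    by (intro Bochner_Integration.integral_sum[symmetric] C01_integrable(2)[OF C])
  also have "\<dots> = (LINT x|lebesgue. real CARD('n) * (1 - u x) - W x)"
    unfolding part W_def sum_subtractf by (simp add: right_diff_distrib)
  also have "\<dots> = real CARD('n) * (LINT x|lebesgue. 1 - u x) - (LINT x|lebesgue. W x)"
    using C01_integrable(1)[OF C1] W_int by simp
  finally have W_mass: "(LINT x|lebesgue. W x) = real CARD('n) * (LINT x|lebesgue. 1 - u x)"
    by simp
  have lower: "V \<le> (LINT x|lebesgue. 1 - u x)"
  proof -
    have "(LINT x|lebesgue. indicat_real {x. norm (B *v (x - y)) \<le> 1} x) \<le> (LINT x|lebesgue. 1 - u x)"
    proof (rule integral_mono[OF ellipsoid_volume(1)[OF assms(1)] C01_integrable(1)[OF C1]])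
      show "indicat_real {x. norm (B *v (x - y)) \<le> 1} x \<le> 1 - u x" for x
      proof (cases "norm (B *v (x - y)) \<le> 1")
        case True
        then have "?N x \<le> 1"
          by (simp add: power_le_one)
        then have "u x = 0"
          using j by (auto simp: u_def ellip_cut_def intro!: step_eq_0)
        then show ?thesis
          by (simp add: indicator_def)
      qed (use step_range in \<open>auto simp: indicator_def u_def ellip_cut_def\<close>)
    qed simp
    then show ?thesis
      unfolding ellipsoid_volume(2)[OF assms(1) zero_le_one] by (simp add: V_def)
  qed
  have upper: "(LINT x|lebesgue. 1 - u x) \<le> V * sqrt (1 + 1 / j) ^ CARD('n)"
  proof -
    let ?\<rho> = "sqrt (1 + 1 / j)"
    have \<rho>: "0 \<le> ?\<rho>"
      using j by simp
    have "(LINT x|lebesgue. 1 - u x) \<le> (LINT x|lebesgue. indicat_real {x. norm (B *v (x - y)) \<le> ?\<rho>} x)"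
    proof (rule integral_mono[OF C01_integrable(1)[OF C1] ellipsoid_volume(1)[OF assms(1) \<rho>]])
      show "1 - u x \<le> indicat_real {x. norm (B *v (x - y)) \<le> ?\<rho>} x" for x
      proof (cases "norm (B *v (x - y)) \<le> ?\<rho>")
        case False
        then have "?\<rho>\<^sup>2 < ?N x"
          using \<rho> by (intro power_strict_mono) auto
        then have "1 + 1 / j < ?N x"
          using j by simp
        then have "j * (1 + 1 / j) < j * ?N x"
          using j by (intro mult_strict_left_mono)
        then have "1 \<le> j * ?N x - j"
          using j by (simp add: distrib_left)
        then have "u x = 1"
          by (simp add: u_def ellip_cut_def step_eq_1)
        then show ?thesis
          by simp
      qed (use step_range in \<open>auto simp: indicator_def u_def ellip_cut_def\<close>)
    qed
    then show ?thesis
      unfolding ellipsoid_volume(2)[OF assms(1) \<rho>] by (simp add: V_def)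
  qed
  have field: "(\<Sum>i\<in>UNIV. flux_field B y i x * partial i u x) = ?N x powr ?q * W x" for x
    unfolding flux_field_def[OF m] W_def by (simp add: sum_distrib_left mult.assoc)
  have F: "F = (LINT x|lebesgue. ?N x powr ?q * W x)"
    unfolding F_def u_def[symmetric] field ..
  have F_int: "integrable lebesgue (\<lambda>x. ?N x powr ?q * W x)"
    using flux_integrable[OF m pu] unfolding field .
  have "(1 + 1 / j) powr ?q * (real CARD('n) * V) \<le> (1 + 1 / j) powr ?q * (LINT x|lebesgue. W x)"
    unfolding W_mass using lower by (intro mult_left_mono) auto
  also have "\<dots> = (LINT x|lebesgue. (1 + 1 / j) powr ?q * W x)"
    by simp
  also have "\<dots> \<le> F"
    unfolding F
  proof (rule integral_mono[OF _ F_int])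
    show "(1 + 1 / j) powr ?q * W x \<le> ?N x powr ?q * W x" for x
    proof (cases "W x = 0")
      case False
      have "(1 + 1 / j) powr ?q \<le> ?N x powr ?q"
        using W_supp[OF False] by (intro powr_mono2') auto
      then show ?thesis
        using W_nonneg by (rule mult_right_mono)
    qed simp
  qed (use W_int in simp)
  finally show "(1 + 1 / j) powr ?q * (real CARD('n) * V) \<le> F" .
  have "F \<le> (LINT x|lebesgue. W x)"
    unfolding F
  proof (rule integral_mono[OF F_int W_int])
    show "?N x powr ?q * W x \<le> W x" for x
    proof (cases "W x = 0")
      case False
      have "?N x powr ?q \<le> 1 powr ?q"
        using W_supp[OF False] by (intro powr_mono2') auto
      then show ?thesis
        using W_nonneg[of x] mult_right_mono[of "?N x powr ?q" 1 "W x"] by simp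
    qed simp
  qed
  also have "\<dots> \<le> real CARD('n) * (V * sqrt (1 + 1 / j) ^ CARD('n))"
    unfolding W_mass using upper by (intro mult_left_mono) auto
  finally show "F \<le> real CARD('n) * V * sqrt (1 + 1 / j) ^ CARD('n)"
    by (simp add: mult.assoc)
qed

text \<open>
  The flux is the same for all cutoffs, so it equals its limit for cutoffs adapted to the ellipsoid \<open>N = 1\<close> that become
  arbitrarily thin.
\<close>

lemma flux_value:
  fixes B :: "real^'n^'n" and y :: "real^'n"
  assumes "det B \<noteq> 0" "0 < c" "0 < d"
  shows "(LINT x|lebesgue. (\<Sum>i\<in>UNIV. flux_field B y i x * partial i (ellip_cut (mat 1) y c d) x))
    = sphere_area TYPE('n) / \<bar>det B\<bar>" (is "?F = _")
proof -
  obtain m where m: "0 < m" "\<And>z. m * norm z \<le> norm (B *v z)"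
    using matrix_injective_bound[OF assms(1)] by blast
  have id: "0 < (1::real)" "1 * norm z \<le> norm (mat 1 *v z)" for z :: "real^'n"
    by simp_all
  let ?L = "real CARD('n) * (unit_ball_vol (real CARD('n)) / \<bar>det B\<bar>)"
  have same: "?F = (LINT x|lebesgue. (\<Sum>i\<in>UNIV. flux_field B y i x * partial i (ellip_cut B y j j) x))"
    if "1 \<le> j" for j
  proof -
    have j: "0 < j"
      using that by simp
    obtain a b where ab: "0 < a" "\<And>x. norm (x - y) < a \<Longrightarrow> c * (norm (mat 1 *v (x - y)))\<^sup>2 - d < 0"
      "\<And>x. b < norm (x - y) \<Longrightarrow> 1 < c * (norm (mat 1 *v (x - y)))\<^sup>2 - d"
      using ellip_cut_0_1[OF id assms(2,3), of y] by metis
    obtain a' b' where ab': "0 < a'" "\<And>x. norm (x - y) < a' \<Longrightarrow> j * (norm (B *v (x - y)))\<^sup>2 - j < 0"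
      "\<And>x. b' < norm (x - y) \<Longrightarrow> 1 < j * (norm (B *v (x - y)))\<^sup>2 - j"
      using ellip_cut_0_1[OF m j j, of y] by metis
    show ?thesis
    proof (rule flux_independent[OF m C1_on_ellip_cut partial_ellip_cut_C01[OF id assms(2,3)]
          C1_on_ellip_cut partial_ellip_cut_C01[OF m j j], of "min a a'" _ "max b b'"])
      show "0 < min a a'"
        using ab(1) ab'(1) by simp
      show "ellip_cut (mat 1) y c d x = ellip_cut B y j j x"
        if "norm (x - y) < min a a' \<or> max b b' < norm (x - y)" for x
        using that
      proof
        assume "norm (x - y) < min a a'"
        then show ?thesis
          using ab(2)[of x] ab'(2)[of x] by (simp add: ellip_cut_def step_eq_0 less_imp_le)
      next
        assume "max b b' < norm (x - y)"
        then show ?thesis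
          using ab(3)[of x] ab'(3)[of x] by (simp add: ellip_cut_def step_eq_1 less_imp_le)
      qed
    qed
  qed
  have lim: "(\<lambda>j. 1 + 1 / real (Suc j)) \<longlonglongrightarrow> 1"
    using tendsto_add[OF tendsto_const[of 1] LIMSEQ_inverse_real_of_nat] by (simp add: inverse_eq_divide)
  have "(\<lambda>j. (1 + 1 / real (Suc j)) powr (- real CARD('n) / 2) * ?L) \<longlonglongrightarrow> 1 powr (- real CARD('n) / 2) * ?L"
    using lim by (intro tendsto_intros) auto
  moreover have "(1 + 1 / real (Suc j)) powr (- real CARD('n) / 2) * ?L \<le> ?F" for j
    using flux_value_thin(1)[OF assms(1), of "real (Suc j)" y] same[of "real (Suc j)"] by simp
  ultimately have 1: "1 powr (- real CARD('n) / 2) * ?L \<le> ?F"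
    by (intro LIMSEQ_le_const2) auto
  have "(\<lambda>j. ?L * sqrt (1 + 1 / real (Suc j)) ^ CARD('n)) \<longlonglongrightarrow> ?L * sqrt 1 ^ CARD('n)"
    using lim by (intro tendsto_intros)
  moreover have "?F \<le> ?L * sqrt (1 + 1 / real (Suc j)) ^ CARD('n)" for j
    using flux_value_thin(2)[OF assms(1), of "real (Suc j)" y] same[of "real (Suc j)"] by simp
  ultimately have 2: "?F \<le> ?L * sqrt 1 ^ CARD('n)"
    by (intro LIMSEQ_le_const) auto
  show ?thesis
    using 1 2 by (simp add: sphere_area_eq)
qed

section \<open>A trace inequality\<close>

text \<open>
  As \<open>k\<close> tends to infinity this becomes the indicator of \<open>|x - y| > sqrt 2 * r\<close>. The sphere of radius \<open>sqrt 2 * r\<close> lies inside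
  the annulus, and for \<open>k \<ge> 1\<close> so does the support of the gradient.
\<close>

definition annulus_cut :: "real^'n \<Rightarrow> real \<Rightarrow> real \<Rightarrow> real^'n \<Rightarrow> real" where
  "annulus_cut y r k = ellip_cut (mat 1) y (k / r\<^sup>2) (2 * k)"

lemma annulus_cut_eq: "annulus_cut y r k x = step (k * ((norm (x - y))\<^sup>2 / r\<^sup>2 - 2))"
  by (simp add: annulus_cut_def ellip_cut_def algebra_simps)

lemma partial_annulus_cut:
  "partial i (annulus_cut y r k) x = step_deriv (k * ((norm (x - y))\<^sup>2 / r\<^sup>2 - 2)) * k * 2 * (x - y) $ i / r\<^sup>2"
  unfolding annulus_cut_def partial_ellip_cut by (simp add: inner_axis algebra_simps)

lemma partial_annulus_cut_support:
  assumes "0 < r" "1 \<le> k" "partial i (annulus_cut y r k) x \<noteq> 0"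
  shows "2 < (norm (x - y))\<^sup>2 / r\<^sup>2" "(norm (x - y))\<^sup>2 / r\<^sup>2 < 3"
proof -
  let ?s = "(norm (x - y))\<^sup>2 / r\<^sup>2"
  have "step_deriv (k * (?s - 2)) \<noteq> 0"
    using assms(3) by (auto simp: partial_annulus_cut)
  then have *: "0 < k * (?s - 2)" "k * (?s - 2) < 1"
    by (smt (verit) step_deriv_eq_0)+
  then show "2 < ?s"
    using assms(2) by (simp add: zero_less_mult_iff)
  then have "1 * (?s - 2) \<le> k * (?s - 2)"
    using assms(2) by (intro mult_right_mono) auto
  with *(2) show "?s < 3"
    by simp
qed

lemma shell_annulus:
  assumes "0 < r" "1 < a" "b < 4" "a \<le> (norm (x - y))\<^sup>2 / r\<^sup>2" "(norm (x - y))\<^sup>2 / r\<^sup>2 \<le> b"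
  shows "x \<in> annulus r y"
proof -
  have "r\<^sup>2 < (norm (x - y))\<^sup>2" "(norm (x - y))\<^sup>2 < (2 * r)\<^sup>2"
  proof -
    have "1 < (norm (x - y))\<^sup>2 / r\<^sup>2" "(norm (x - y))\<^sup>2 / r\<^sup>2 < 4"
      using assms by linarith+
    then show "r\<^sup>2 < (norm (x - y))\<^sup>2" "(norm (x - y))\<^sup>2 < (2 * r)\<^sup>2"
      using assms(1) by (simp_all add: field_simps)
  qed
  then show ?thesis
    using assms(1) power2_less_imp_less[of r "norm (x - y)"] power2_less_imp_less[of "norm (x - y)" "2 * r"]
    by (simp add: annulus_def)
qed

lemma shell_compact: "0 < r \<Longrightarrow> compact {x::real^'n. a \<le> (norm (x - y))\<^sup>2 / r\<^sup>2 \<and> (norm (x - y))\<^sup>2 / r\<^sup>2 \<le> b}"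
proof -
  assume r: "0 < r"
  have cl: "closed {x::real^'n. a \<le> (norm (x - y))\<^sup>2 / r\<^sup>2 \<and> (norm (x - y))\<^sup>2 / r\<^sup>2 \<le> b}"
    by (intro closed_Collect_conj closed_Collect_le continuous_intros) (use r in auto)
  have sub: "{x::real^'n. a \<le> (norm (x - y))\<^sup>2 / r\<^sup>2 \<and> (norm (x - y))\<^sup>2 / r\<^sup>2 \<le> b} \<subseteq> cball y (r * sqrt \<bar>b\<bar>)"
  proof safe
    fix x :: "real^'n" assume "(norm (x - y))\<^sup>2 / r\<^sup>2 \<le> b"
    then have "(norm (x - y))\<^sup>2 \<le> b * r\<^sup>2"
      using r by (simp add: pos_divide_le_eq)
    also have "\<dots> \<le> \<bar>b\<bar> * r\<^sup>2"
      by (intro mult_right_mono) auto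
    also have "\<dots> = (r * sqrt \<bar>b\<bar>)\<^sup>2"
      by (simp add: power_mult_distrib)
    finally have "norm (x - y) \<le> r * sqrt \<bar>b\<bar>"
      by (rule power2_le_imp_le) (use r in auto)
    then show "x \<in> cball y (r * sqrt \<bar>b\<bar>)"
      by (simp add: dist_norm norm_minus_commute)
  qed
  show ?thesis
    unfolding compact_eq_bounded_closed using bounded_subset[OF bounded_cball sub] cl by (rule conjI)
qed

lemma C01_times_partial_annulus_cut:
  fixes y :: "real^'n"
  assumes "0 < r" "1 \<le> k" "C1_on (annulus r y) \<rho>"
  shows "(\<lambda>x. \<rho> x * partial i (annulus_cut y r k) x) \<in> C01 (annulus r y)"
proof (rule C01I[OF open_annulus _ shell_compact[OF assms(1), of 2 y 3]])
  show "C1_on (annulus r y) (\<lambda>x. \<rho> x * partial i (annulus_cut y r k) x)"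
    unfolding annulus_cut_def by (intro C1_on_mult assms(3) C1_on_partial_ellip_cut)
  show "{x. 2 \<le> (norm (x - y))\<^sup>2 / r\<^sup>2 \<and> (norm (x - y))\<^sup>2 / r\<^sup>2 \<le> 3} \<subseteq> annulus r y"
    using shell_annulus[OF assms(1), of 2 3] by auto
  show "\<rho> x * partial i (annulus_cut y r k) x = 0"
    if "x \<notin> {x. 2 \<le> (norm (x - y))\<^sup>2 / r\<^sup>2 \<and> (norm (x - y))\<^sup>2 / r\<^sup>2 \<le> 3}" for x
    using that partial_annulus_cut_support[OF assms(1,2), of i y x] by force
qed

text \<open>
  It bounds the gradient of a fixed cutoff of width comparable to \<open>r\<close>; a choice operator makes it independent of the
  functions and of the annulus.
\<close>

definition trace_constant :: real where
  "trace_constant = 1 + 8 * (SOME M. 0 < M \<and> (\<forall>t. step_deriv t \<le> M))"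

lemma trace_constant: "step_deriv t * 8 \<le> trace_constant - 1" "1 < trace_constant"
proof -
  have "\<exists>M. 0 < M \<and> (\<forall>t. step_deriv t \<le> M)"
    using step_deriv_bounded by metis
  from someI_ex[OF this] show "step_deriv t * 8 \<le> trace_constant - 1" "1 < trace_constant"
    unfolding trace_constant_def by auto
qed

text \<open>
  The gradient of the cutoff \<open>u\<close> is of size \<open>k / r\<close>, but it enters only through a derivative: with a second cutoff \<open>\<theta>\<close> that
  descends to \<open>0\<close> further out, at a rate independent of \<open>k\<close>, the function \<open>\<psi> = \<rho> u \<theta>\<close> is a test function on the annulus, and
  \<open>\<rho> \<partial>\<^sub>iu\<close> differs from \<open>\<partial>\<^sub>i\<psi>\<close> by a term bounded independently of \<open>k\<close>. Integrating the latter by parts leaves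
  \<open>w'\<close> against the bounded function \<open>\<psi>\<close>.
\<close>

lemma trace_bound:
  fixes y :: "real^'n" and w w' \<rho> :: "real^'n \<Rightarrow> real"
  assumes r: "0 < r" and k: "1 \<le> k"
    and w: "has_weak_partial (annulus r y) i w w'"
    and int: "set_integrable lebesgue (annulus r y) w" "set_integrable lebesgue (annulus r y) w'"
    and \<rho>: "C1_on (annulus r y) \<rho>" "\<And>x. x \<in> annulus r y \<Longrightarrow> \<bar>\<rho> x\<bar> \<le> R"
      "\<And>x. x \<in> annulus r y \<Longrightarrow> \<bar>partial i \<rho> x\<bar> \<le> R / r"
  shows "\<bar>LINT x|lebesgue. w x * (\<rho> x * partial i (annulus_cut y r k) x)\<bar>
    \<le> trace_constant * R * (annulus_L1 r y w' + annulus_L1 r y w / r)"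
proof -
  let ?A = "annulus r y"
  let ?s = "\<lambda>x. (norm (x - y))\<^sup>2 / r\<^sup>2"
  define u where "u = annulus_cut y r k"
  \<comment> \<open>The cutoff \<open>\<theta>\<close> descends where \<open>|x - y|\<^sup>2 / r\<^sup>2\<close> is between \<open>3\<close> and \<open>7/2\<close>, beyond the support of the gradient of \<open>u\<close>.\<close>
  define \<theta> where "\<theta> = (\<lambda>x. 1 - ellip_cut (mat 1) y (2 / r\<^sup>2) 6 x)"
  define \<psi> where "\<psi> = (\<lambda>x. \<rho> x * (u x * \<theta> x))"
  have \<theta>_eq: "\<theta> x = 1 - step (2 * (?s x - 3))" for x
    by (simp add: \<theta>_def ellip_cut_def algebra_simps)
  have u_C1: "C1_on S u" for S
    unfolding u_def annulus_cut_def by (rule C1_on_ellip_cut)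
  have \<theta>_C1: "C1_on S \<theta>" for S
    unfolding \<theta>_def by (intro C1_on_diff C1_on_const C1_on_ellip_cut)
  have u_range: "0 \<le> u x" "u x \<le> 1" and \<theta>_range: "0 \<le> \<theta> x" "\<theta> x \<le> 1" for x
    using step_range by (auto simp: u_def annulus_cut_eq \<theta>_eq)
  have p\<theta>: "partial i \<theta> x = - (step_deriv (2 * (?s x - 3)) * 4 * (x - y) $ i / r\<^sup>2)" for x
  proof -
    have "ellip_cut (mat 1) y (2 / r\<^sup>2) 6 differentiable (at x)"
      using C1_on_ellip_cut[of UNIV "mat 1" y "2 / r\<^sup>2" 6] by (auto simp: C1_on_def)
    then have "partial i \<theta> x = - partial i (ellip_cut (mat 1) y (2 / r\<^sup>2) 6) x"
      using partial_add[OF differentiable_const[of 1], of "\<lambda>x. -1 * ellip_cut (mat 1) y (2 / r\<^sup>2) 6 x" x i]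
        partial_cmult[of "ellip_cut (mat 1) y (2 / r\<^sup>2) 6" x i "-1"]
      by (simp add: partial_const \<theta>_def)
    then show ?thesis
      unfolding partial_ellip_cut by (simp add: inner_axis algebra_simps)
  qed
  have \<psi>_C01: "\<psi> \<in> C01 ?A"
  proof (rule C01I[OF open_annulus _ shell_compact[OF r, of 2 y "7/2"]])
    show "C1_on ?A \<psi>"
      unfolding \<psi>_def by (intro C1_on_mult \<rho> u_C1 \<theta>_C1)
    show "{x. 2 \<le> ?s x \<and> ?s x \<le> 7/2} \<subseteq> ?A"
      using shell_annulus[OF r, of 2 "7/2"] by auto
    show "\<psi> x = 0" if "x \<notin> {x. 2 \<le> ?s x \<and> ?s x \<le> 7/2}" for x
    proof (cases "?s x < 2")
      case True
      then have "u x = 0"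
        using k unfolding u_def annulus_cut_eq by (intro step_eq_0) (simp add: mult_nonneg_nonpos)
      then show ?thesis
        by (simp add: \<psi>_def)
    next
      case False
      then have "7/2 < ?s x"
        using that by simp
      moreover have "1 \<le> 2 * (t - 3)" if "7/2 < t" for t :: real
        using that by simp
      ultimately have "1 \<le> 2 * (?s x - 3)"
        by blast
      then have "\<theta> x = 0"
        unfolding \<theta>_eq by (simp only: step_eq_1)
      then show ?thesis
        by (simp add: \<psi>_def)
    qed
  qed
  have \<rho>u_C01: "(\<lambda>x. \<rho> x * partial i u x) \<in> C01 ?A"
    unfolding u_def by (rule C01_times_partial_annulus_cut[OF r k \<rho>(1)])
  have loc: "Lp_loc ?A 1 w" "Lp_loc ?A 1 w'"
    using w by (auto simp: has_weak_partial_def)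
  define b where "b = (\<lambda>x. partial i \<psi> x - \<rho> x * partial i u x)"
  have b: "\<bar>b x\<bar> \<le> trace_constant * R / r * indicator ?A x" for x
  proof (cases "x \<in> ?A")
    case True
    have d: "\<rho> differentiable (at x)" "u differentiable (at x)" "\<theta> differentiable (at x)"
      using \<rho>(1) u_C1[of UNIV] \<theta>_C1[of UNIV] True by (auto simp: C1_on_def)
    have "(\<lambda>x. u x * \<theta> x) differentiable (at x)"
      using d by (intro differentiable_mult)
    then have p: "partial i \<psi> x = \<rho> x * (u x * partial i \<theta> x + partial i u x * \<theta> x) + partial i \<rho> x * (u x * \<theta> x)"
      unfolding \<psi>_def using d by (simp add: partial_mult)
    have "partial i u x * \<theta> x = partial i u x"
    proof (cases "partial i u x = 0")
      case False
      then have "?s x < 3"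
        using partial_annulus_cut_support[OF r k] unfolding u_def by blast
      then have "\<theta> x = 1"
        by (simp add: \<theta>_eq step_eq_0)
      then show ?thesis
        by simp
    qed simp
    then have b_eq: "b x = \<rho> x * (u x * partial i \<theta> x) + partial i \<rho> x * (u x * \<theta> x)"
      unfolding b_def p by (simp add: algebra_simps)
    have "\<bar>partial i \<theta> x\<bar> \<le> (trace_constant - 1) / r"
    proof -
      have "\<bar>(x - y) $ i\<bar> \<le> norm (x - y)"
        by (rule component_le_norm_cart)
      also have "\<dots> \<le> 2 * r"
        using True by (simp add: annulus_def)
      finally have le: "\<bar>(x - y) $ i\<bar> \<le> 2 * r" .
      have "\<bar>partial i \<theta> x\<bar> = step_deriv (2 * (?s x - 3)) * 4 * \<bar>(x - y) $ i\<bar> / r\<^sup>2"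
        unfolding p\<theta> by (simp add: abs_mult step_deriv_nonneg del: vector_minus_component)
      also have "\<dots> \<le> step_deriv (2 * (?s x - 3)) * 4 * (2 * r) / r\<^sup>2"
        using le step_deriv_nonneg by (intro divide_right_mono mult_left_mono) auto
      also have "\<dots> = step_deriv (2 * (?s x - 3)) * 8 / r"
        using r by (simp add: power2_eq_square)
      also have "\<dots> \<le> (trace_constant - 1) / r"
        using trace_constant r by (intro divide_right_mono) auto
      finally show ?thesis .
    qed
    moreover have R: "0 \<le> R"
      using \<rho>(2)[OF True] by linarith
    ultimately have "\<bar>\<rho> x\<bar> * (\<bar>u x\<bar> * \<bar>partial i \<theta> x\<bar>) \<le> R * (1 * ((trace_constant - 1) / r))"
      using \<rho>(2)[OF True] u_range[of x] by (intro mult_mono) auto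
    moreover have "\<bar>partial i \<rho> x\<bar> * (\<bar>u x\<bar> * \<bar>\<theta> x\<bar>) \<le> R / r * (1 * 1)"
      using \<rho>(3)[OF True] u_range[of x] \<theta>_range[of x] R r by (intro mult_mono) auto
    ultimately have "\<bar>b x\<bar> \<le> R * ((trace_constant - 1) / r) + R / r"
      unfolding b_eq
      using abs_triangle_ineq[of "\<rho> x * (u x * partial i \<theta> x)" "partial i \<rho> x * (u x * \<theta> x)"]
      by (simp add: abs_mult)
    also have "\<dots> = trace_constant * R / r"
      using r by (simp add: field_simps)
    finally show ?thesis
      using True by simp
  next
    case False
    then have "partial i \<psi> x = 0" "\<rho> x * partial i u x = 0"
      using C01_outside(2)[OF \<psi>_C01] C01_outside(1)[OF \<rho>u_C01] by auto
    then show ?thesis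
      using False by (simp add: b_def)
  qed
  have \<psi>_le: "\<bar>\<psi> x\<bar> \<le> R * indicator ?A x" for x
  proof (cases "x \<in> ?A")
    case True
    have "\<bar>\<rho> x\<bar> * (\<bar>u x\<bar> * \<bar>\<theta> x\<bar>) \<le> R * (1 * 1)"
      using \<rho>(2)[OF True] u_range[of x] \<theta>_range[of x] by (intro mult_mono) auto
    then show ?thesis
      using True by (simp add: \<psi>_def abs_mult)
  next
    case False
    then show ?thesis
      using C01_outside(1)[OF \<psi>_C01] by simp
  qed
  have int\<psi>: "integrable lebesgue (\<lambda>x. w x * partial i \<psi> x)" "integrable lebesgue (\<lambda>x. w' x * \<psi> x)"
    "integrable lebesgue (\<lambda>x. w x * (\<rho> x * partial i u x))"
    by (rule Lp_loc_1_times_C01[OF loc(1) open_annulus \<psi>_C01] Lp_loc_1_times_C01(1)[OF loc(2) open_annulus \<psi>_C01]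
        Lp_loc_1_times_C01(1)[OF loc(1) open_annulus \<rho>u_C01])+
  have "(LINT x|lebesgue. w x * (\<rho> x * partial i u x))
      = (LINT x|lebesgue. w x * partial i \<psi> x - w x * b x)"
    by (simp add: b_def algebra_simps)
  also have "\<dots> = (LINT x|lebesgue. w x * partial i \<psi> x) - (LINT x|lebesgue. w x * b x)"
    using int\<psi>(1,3) by (intro Bochner_Integration.integral_diff) (auto simp: b_def right_diff_distrib)
  also have "(LINT x|lebesgue. w x * partial i \<psi> x) = - (LINT x|lebesgue. w' x * \<psi> x)"
    by (rule weak_partial_by_parts[OF w open_annulus \<psi>_C01])
  finally have "\<bar>LINT x|lebesgue. w x * (\<rho> x * partial i u x)\<bar>
      \<le> \<bar>LINT x|lebesgue. w' x * \<psi> x\<bar> + \<bar>LINT x|lebesgue. w x * b x\<bar>"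
    by linarith
  also have "\<bar>LINT x|lebesgue. w' x * \<psi> x\<bar> \<le> R * annulus_L1 r y w'"
  proof -
    have "\<bar>LINT x|lebesgue. w' x * \<psi> x\<bar> \<le> (LINT x|lebesgue. R * (indicator ?A x *\<^sub>R \<bar>w' x\<bar>))"
    proof (rule order_trans[OF integral_abs_bound integral_mono])
      show "integrable lebesgue (\<lambda>x. \<bar>w' x * \<psi> x\<bar>)"
        using int\<psi>(2) by (rule integrable_abs)
      show "integrable lebesgue (\<lambda>x. R * (indicator ?A x *\<^sub>R \<bar>w' x\<bar>))"
        using set_integrable_abs[OF int(2)] by (simp add: set_integrable_def)
      show "\<bar>w' x * \<psi> x\<bar> \<le> R * (indicator ?A x *\<^sub>R \<bar>w' x\<bar>)" for x
        using mult_left_mono[OF \<psi>_le[of x], of "\<bar>w' x\<bar>"] by (simp add: abs_mult algebra_simps)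
    qed
    then show ?thesis
      by (simp add: annulus_L1_def set_lebesgue_integral_def)
  qed
  also have "\<bar>LINT x|lebesgue. w x * b x\<bar> \<le> trace_constant * R / r * annulus_L1 r y w"
  proof -
    have "\<bar>LINT x|lebesgue. w x * b x\<bar> \<le> (LINT x|lebesgue. trace_constant * R / r * (indicator ?A x *\<^sub>R \<bar>w x\<bar>))"
    proof (rule order_trans[OF integral_abs_bound integral_mono])
      have "integrable lebesgue (\<lambda>x. w x * b x)"
        using int\<psi>(1,3) by (simp add: b_def right_diff_distrib)
      then show "integrable lebesgue (\<lambda>x. \<bar>w x * b x\<bar>)"
        by (rule integrable_abs)
      show "integrable lebesgue (\<lambda>x. trace_constant * R / r * (indicator ?A x *\<^sub>R \<bar>w x\<bar>))"
        using set_integrable_abs[OF int(1)] unfolding set_integrable_def by (rule integrable_mult_right)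
      show "\<bar>w x * b x\<bar> \<le> trace_constant * R / r * (indicator ?A x *\<^sub>R \<bar>w x\<bar>)" for x
        using mult_left_mono[OF b[of x], of "\<bar>w x\<bar>"] by (simp add: abs_mult mult_ac)
    qed
    also have "\<dots> = trace_constant * R / r * annulus_L1 r y w"
      unfolding annulus_L1_def set_lebesgue_integral_def by (rule integral_mult_right_zero)
    finally show ?thesis .
  qed
  finally have "\<bar>LINT x|lebesgue. w x * (\<rho> x * partial i u x)\<bar>
      \<le> R * annulus_L1 r y w' + trace_constant * R / r * annulus_L1 r y w"
    by linarith
  also have "R * annulus_L1 r y w' \<le> trace_constant * R * annulus_L1 r y w'"
  proof -
    have "x \<in> ?A \<Longrightarrow> 0 \<le> R" for x
      using \<rho>(2)[of x] by linarith
    moreover have "?A \<noteq> {}"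
      using measure_annulus_pos[OF r, of y] by auto
    ultimately have "0 \<le> R"
      by blast
    moreover have "0 \<le> annulus_L1 r y w'"
      unfolding annulus_L1_def set_lebesgue_integral_def by (intro integral_nonneg_AE) (auto simp: indicator_def)
    ultimately show ?thesis
      using trace_constant(2) mult_right_mono[of 1 trace_constant "R * annulus_L1 r y w'"] by (simp add: mult.assoc)
  qed
  finally show ?thesis
    unfolding u_def by (simp add: algebra_simps)
qed

section \<open>Slowly varying exponents\<close>

text \<open>
  A bound \<open>C / s\<close> on the slope of \<open>J\<close>, stated without derivatives.
\<close>

definition slowly_varying :: "(real \<Rightarrow> real) \<Rightarrow> real \<Rightarrow> real \<Rightarrow> bool" where
  "slowly_varying J C \<epsilon> \<longleftrightarrow>
     (\<forall>s t. 0 < s \<and> s \<le> \<epsilon> \<and> 0 < t \<and> t \<le> \<epsilon> \<and> \<bar>s - t\<bar> \<le> s / 2 \<longrightarrow> \<bar>J s - J t\<bar> \<le> C * \<bar>s - t\<bar> / s)"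

lemma slowly_varying_continuous:
  assumes "slowly_varying J C \<epsilon>"
  shows "continuous_on {0<..\<epsilon>} J"
  unfolding continuous_on_iff
proof (intro ballI allI impI)
  fix s e :: real assume s: "s \<in> {0<..\<epsilon>}" and e: "0 < e"
  define d where "d = min (s / 2) (e * s / (\<bar>C\<bar> + 1))"
  have "0 < d"
    using s e by (simp add: d_def)
  moreover have "dist (J t) (J s) < e" if "t \<in> {0<..\<epsilon>}" "dist t s < d" for t
  proof -
    have ts: "\<bar>s - t\<bar> \<le> s / 2" "\<bar>s - t\<bar> < e * s / (\<bar>C\<bar> + 1)"
      using that(2) by (auto simp: d_def dist_real_def abs_minus_commute)
    have "\<bar>J s - J t\<bar> \<le> C * \<bar>s - t\<bar> / s"
      using assms s that(1) ts(1) unfolding slowly_varying_def by auto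
    also have "\<dots> \<le> (\<bar>C\<bar> + 1) * \<bar>s - t\<bar> / s"
      using s by (intro divide_right_mono mult_right_mono) auto
    also have "\<dots> < e"
      using ts(2) s by (simp add: field_simps)
    finally show ?thesis
      by (simp add: dist_real_def abs_minus_commute)
  qed
  ultimately show "\<exists>d>0. \<forall>t\<in>{0<..\<epsilon>}. dist t s < d \<longrightarrow> dist (J t) (J s) < e"
    by blast
qed

text \<open>
  Averaging \<open>J\<close> over \<open>(t, t + h)\<close> before exponentiating makes it differentiable, the derivative being a difference
  quotient of \<open>J\<close>; the bounds do not depend on \<open>h\<close>.
\<close>

lemma steklov_approximation:
  fixes J :: "real \<Rightarrow> real"
  assumes sv: "slowly_varying J C \<epsilon>" and K: "\<And>t. 0 < t \<Longrightarrow> t \<le> \<epsilon> \<Longrightarrow> exp (J t) \<le> K"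
    and ab: "0 < a" "a < b" "b < \<epsilon>"
  obtains E E' where "\<And>k t. t \<in> {a<..<b} \<Longrightarrow> (E k has_real_derivative E' k t) (at t)"
    "\<And>k::nat. continuous_on {a<..<b} (E' k)"
    "\<And>k t. t \<in> {a<..<b} \<Longrightarrow> 0 \<le> E k t \<and> E k t \<le> K"
    "\<And>k t. t \<in> {a<..<b} \<Longrightarrow> \<bar>E' k t\<bar> \<le> K * C / t"
    "\<And>t. t \<in> {a<..<b} \<Longrightarrow> (\<lambda>k. E k t) \<longlonglongrightarrow> exp (J t)"
proof -
  have cont: "continuous_on {a..\<epsilon>} J"
    using ab by (intro continuous_on_subset[OF slowly_varying_continuous[OF sv]]) auto
  define Y where "Y = (\<lambda>t. integral {a..t} J)"
  have Y: "(Y has_real_derivative J t) (at t)" if "a < t" "t < \<epsilon>" for t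
  proof -
    have "(Y has_real_derivative J t) (at t within {a..\<epsilon>})"
      unfolding Y_def using that by (intro integral_has_real_derivative[OF cont]) auto
    then show ?thesis
      using that by (simp add: at_within_Icc_at)
  qed
  obtain N where N: "0 < N" "1 / real N < min (a / 2) (\<epsilon> - b)"
  proof -
    have "0 < min (a / 2) (\<epsilon> - b)"
      using ab by simp
    then obtain N where "inverse (real (Suc N)) < min (a / 2) (\<epsilon> - b)"
      using reals_Archimedean by blast
    then show thesis
      by (intro that[of "Suc N"]) (simp_all add: inverse_eq_divide)
  qed
  \<comment> \<open>The averaging intervals stay inside \<open>(0, \<epsilon>)\<close> and shorter than half the distance to \<open>0\<close>.\<close>
  define h where "h = (\<lambda>k. 1 / real (N + k))"
  have h: "0 < h k" "h k < a / 2" "h k < \<epsilon> - b" for k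
  proof -
    have "h k \<le> 1 / real N"
      unfolding h_def using N(1) by (intro divide_left_mono) auto
    then show "h k < a / 2" "h k < \<epsilon> - b"
      using N(2) by auto
    show "0 < h k"
      using N(1) by (simp add: h_def)
  qed
  define E where "E = (\<lambda>k t. exp ((Y (t + h k) - Y t) / h k))"
  define E' where "E' = (\<lambda>k t. E k t * ((J (t + h k) - J t) / h k))"
  have E_deriv: "(E k has_real_derivative E' k t) (at t)" if "t \<in> {a<..<b}" for k t
  proof -
    have 1: "((\<lambda>t. Y (t + h k)) has_real_derivative J (t + h k)) (at t)"
      using DERIV_shift[of Y "J (t + h k)" t "h k"] Y[of "t + h k"] h[of k] that by simp
    have 2: "(Y has_real_derivative J t) (at t)"
      using that ab by (intro Y) auto
    show ?thesis
      unfolding E_def E'_def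
      using h[of k] by (auto intro!: derivative_eq_intros 1 2)
  qed
  have Y_le: "Y (t + h k) - Y t \<le> ln K * h k" if "t \<in> {a<..<b}" for k t
  proof -
    have "\<exists>z. t < z \<and> z < t + h k \<and> Y (t + h k) - Y t = (t + h k - t) * J z"
    proof (rule MVT2)
      show "(Y has_real_derivative J x) (at x)" if "t \<le> x" "x \<le> t + h k" for x
        using \<open>t \<in> {a<..<b}\<close> that h[of k] by (intro Y) auto
    qed (use h[of k] in simp)
    then obtain z where z: "t < z" "z < t + h k" "Y (t + h k) - Y t = (t + h k - t) * J z"
      by blast
    have "exp (J z) \<le> K"
      using z h[of k] that ab by (intro K) auto
    then have "J z \<le> ln K"
      using exp_gt_zero[of "J z"] by (subst ln_ge_iff) linarith+
    then have "h k * J z \<le> h k * ln K"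
      using h[of k] by (intro mult_left_mono) auto
    then show ?thesis
      using z(3) by (simp add: mult.commute)
  qed
  have "0 < K"
    using K[of \<epsilon>] ab exp_gt_zero[of "J \<epsilon>"] by linarith
  have E_le: "E k t \<le> K" if "t \<in> {a<..<b}" for k t
  proof -
    have "(Y (t + h k) - Y t) / h k \<le> ln K"
      using Y_le[OF that, of k] h[of k] by (simp add: pos_divide_le_eq)
    then have "E k t \<le> exp (ln K)"
      by (simp add: E_def)
    then show ?thesis
      using \<open>0 < K\<close> by simp
  qed
  show thesis
  proof
    show "(E k has_real_derivative E' k t) (at t)" if "t \<in> {a<..<b}" for k t
      by (rule E_deriv[OF that])
    show "0 \<le> E k t \<and> E k t \<le> K" if "t \<in> {a<..<b}" for k t
      using E_le[OF that] by (simp add: E_def)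
    show "continuous_on {a<..<b} (E' k)" for k
    proof -
      have "continuous_on {a<..<b} (E k)"
        using E_deriv by (intro continuous_at_imp_continuous_on ballI DERIV_isCont) auto
      moreover have "continuous_on {a<..<b} J"
        using ab by (intro continuous_on_subset[OF cont]) auto
      moreover have "continuous_on {a<..<b} (\<lambda>t. J (t + h k))"
        using h[of k] ab by (intro continuous_on_compose2[OF cont] continuous_intros) auto
      ultimately show ?thesis
        unfolding E'_def using h[of k] by (intro continuous_intros) auto
    qed
    show "\<bar>E' k t\<bar> \<le> K * C / t" if "t \<in> {a<..<b}" for k t
    proof -
      have "\<bar>J t - J (t + h k)\<bar> \<le> C * \<bar>t - (t + h k)\<bar> / t"
      proof -
        have "0 < t \<and> t \<le> \<epsilon> \<and> 0 < t + h k \<and> t + h k \<le> \<epsilon> \<and> \<bar>t - (t + h k)\<bar> \<le> t / 2"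
          using h[of k] that ab by auto
        then show ?thesis
          using sv unfolding slowly_varying_def by blast
      qed
      then have "\<bar>(J (t + h k) - J t) / h k\<bar> \<le> C / t"
        using h[of k] that ab by (simp add: abs_minus_commute field_simps)
      then have "E k t * \<bar>(J (t + h k) - J t) / h k\<bar> \<le> K * (C / t)"
        using E_le[OF that, of k] \<open>0 < K\<close> by (intro mult_mono) (auto simp: E_def)
      then show ?thesis
        by (simp add: E'_def E_def abs_mult)
    qed
    show "(\<lambda>k. E k t) \<longlonglongrightarrow> exp (J t)" if "t \<in> {a<..<b}" for t
    proof -
      have "((\<lambda>d. (Y (t + d) - Y t) / d) \<longlongrightarrow> J t) (at 0)"
        using Y[of t] that ab unfolding has_field_derivative_def has_derivative_at
        by (simp add: DERIV_def[symmetric] has_field_derivative_def[symmetric] Y)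
      moreover have "filterlim h (at 0) sequentially"
      proof (rule filterlim_atI)
        have "(\<lambda>k. 1 / real (k + N)) \<longlonglongrightarrow> 0"
          by (rule LIMSEQ_ignore_initial_segment[OF lim_1_over_n])
        then show "h \<longlonglongrightarrow> 0"
          by (simp add: h_def add.commute)
        show "\<forall>\<^sub>F k in sequentially. h k \<noteq> 0"
          using h(1) by (intro always_eventually allI) (simp add: less_imp_neq[symmetric])
      qed
      ultimately have "(\<lambda>k. (Y (t + h k) - Y t) / h k) \<longlonglongrightarrow> J t"
        by (rule filterlim_compose)
      then show ?thesis
        unfolding E_def by (rule tendsto_exp)
    qed
  qed
qed

section \<open>The radial profile\<close>

text \<open>
  The radial part of the solution without the factor \<open>1 + \<zeta>\<close>.
\<close>

definition profile :: "nat \<Rightarrow> (real \<Rightarrow> real) \<Rightarrow> real \<Rightarrow> real \<Rightarrow> real" where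
  "profile n J \<epsilon> r = (LINT s:{r..\<epsilon>}|lborel. s powr (1 - real n) * exp (J s))"

lemma profile_nonneg: "0 \<le> profile n J \<epsilon> r"
  unfolding profile_def set_lebesgue_integral_def by (intro integral_nonneg_AE) (auto simp: indicator_def)

lemma profile_deriv:
  assumes "continuous_on {0<..\<epsilon>} J" "0 < r" "r < \<epsilon>"
  shows "(profile n J \<epsilon> has_real_derivative - (r powr (1 - real n) * exp (J r))) (at r)"
proof -
  let ?f = "\<lambda>s. s powr (1 - real n) * exp (J s)"
  have cont: "continuous_on {a..\<epsilon>} ?f" if "0 < a" for a
    using that by (intro continuous_intros continuous_on_subset[OF assms(1)]) auto
  have eq: "profile n J \<epsilon> a = integral {a..\<epsilon>} ?f" if "0 < a" for a
    unfolding profile_def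
    by (rule set_borel_integral_eq_integral(2)) (rule borel_integrable_atLeastAtMost'[OF cont[OF that]])
  have "((\<lambda>t. integral {r/2..t} ?f) has_real_derivative ?f r) (at r within {r/2..\<epsilon>})"
    using assms by (intro integral_has_real_derivative cont) auto
  then have "((\<lambda>t. integral {r/2..t} ?f) has_real_derivative ?f r) (at r)"
    using assms by (simp add: at_within_Icc_at)
  then have "((\<lambda>t. integral {r/2..\<epsilon>} ?f - integral {r/2..t} ?f) has_real_derivative - ?f r) (at r)"
    by (auto intro!: derivative_eq_intros)
  then show ?thesis
  proof (rule has_field_derivative_transform_within_open[of _ _ _ "{r/2<..<\<epsilon>}"])
    show "integral {r/2..\<epsilon>} ?f - integral {r/2..t} ?f = profile n J \<epsilon> t" if "t \<in> {r/2<..<\<epsilon>}" for t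
    proof -
      have "integral {r/2..t} ?f + integral {t..\<epsilon>} ?f = integral {r/2..\<epsilon>} ?f"
        using that assms by (intro Henstock_Kurzweil_Integration.integral_combine integrable_continuous_real cont) auto
      then show ?thesis
        using that assms eq[of t] by simp
    qed
  qed (use assms in auto)
qed

text \<open>
  Compare with \<open>K / (n - 2) * r powr (2 - n)\<close>, whose derivative is at most that of the profile: their difference is
  decreasing. The value at \<open>\<epsilon> / 2\<close> is absorbed into the constant.
\<close>

lemma profile_bound:
  assumes n: "3 \<le> n" and \<epsilon>: "0 < \<epsilon>" and cont: "continuous_on {0<..\<epsilon>} J"
    and K: "\<And>t. 0 < t \<Longrightarrow> t \<le> \<epsilon> \<Longrightarrow> exp (J t) \<le> K"
  obtains C where "0 \<le> C" "\<And>r. 0 < r \<Longrightarrow> r \<le> \<epsilon> / 2 \<Longrightarrow> profile n J \<epsilon> r \<le> C * r powr (2 - real n)"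
proof -
  let ?m = "real n - 2"
  have m: "1 \<le> ?m"
    using n by simp
  have K0: "0 \<le> K"
    using K[OF \<epsilon>] exp_gt_zero[of "J \<epsilon>"] by linarith
  define D where "D = (\<lambda>r. K / ?m * r powr (2 - real n) - profile n J \<epsilon> r)"
  have D: "(D has_real_derivative (r powr (1 - real n) * exp (J r) - K * r powr (1 - real n))) (at r)"
    if "0 < r" "r < \<epsilon>" for r
  proof -
    have "((\<lambda>r. r powr (2 - real n)) has_real_derivative (2 - real n) * r powr (2 - real n - 1)) (at r)"
      using that by (intro has_real_derivative_powr) auto
    then have "((\<lambda>r. K / ?m * r powr (2 - real n)) has_real_derivative K / ?m * ((2 - real n) * r powr (2 - real n - 1))) (at r)"
      by (rule DERIV_cmult)
    moreover have "K / ?m * ((2 - real n) * r powr (2 - real n - 1)) = - (K * r powr (1 - real n))"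
      using m by (simp add: field_simps)
    ultimately have "((\<lambda>r. K / ?m * r powr (2 - real n)) has_real_derivative - (K * r powr (1 - real n))) (at r)"
      by simp
    from DERIV_diff[OF this profile_deriv[OF cont that, of n]] show ?thesis
      by (simp add: D_def)
  qed
  define C where "C = K / ?m + profile n J \<epsilon> (\<epsilon> / 2) / (\<epsilon> / 2) powr (2 - real n)"
  show thesis
  proof
    show "0 \<le> C"
      using K0 m profile_nonneg by (auto simp: C_def)
    fix r assume r: "0 < r" "r \<le> \<epsilon> / 2"
    have "D (\<epsilon> / 2) \<le> D r"
    proof (rule DERIV_nonpos_imp_nonincreasing[OF r(2)])
      fix t assume t: "r \<le> t" "t \<le> \<epsilon> / 2"
      have "t powr (1 - real n) * exp (J t) - K * t powr (1 - real n) \<le> 0"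
        using K[of t] t r mult_left_mono[of "exp (J t)" K "t powr (1 - real n)"] by (simp add: mult.commute)
      then show "\<exists>y. (D has_real_derivative y) (at t) \<and> y \<le> 0"
        using D[of t] t r \<epsilon> by (intro exI[of _ "t powr (1 - real n) * exp (J t) - K * t powr (1 - real n)"]) auto
    qed
    moreover have "0 \<le> K / ?m * (\<epsilon> / 2) powr (2 - real n)"
      using K0 m by simp
    ultimately have "profile n J \<epsilon> r \<le> K / ?m * r powr (2 - real n) + profile n J \<epsilon> (\<epsilon> / 2)"
      by (simp add: D_def)
    also have "profile n J \<epsilon> (\<epsilon> / 2) = profile n J \<epsilon> (\<epsilon> / 2) / (\<epsilon> / 2) powr (2 - real n) * (\<epsilon> / 2) powr (2 - real n)"
      using \<epsilon> by simp
    also have "\<dots> \<le> profile n J \<epsilon> (\<epsilon> / 2) / (\<epsilon> / 2) powr (2 - real n) * r powr (2 - real n)"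
      using r n profile_nonneg by (intro mult_left_mono powr_mono2' divide_nonneg_nonneg) auto
    finally show "profile n J \<epsilon> r \<le> C * r powr (2 - real n)"
      by (simp add: C_def algebra_simps)
  qed
qed

section \<open>The exponent of the fundamental solution\<close>

text \<open>
  The factor of \<open>|z - y| powr (- n)\<close> in the integrand that defines \<open>I\<^sub>y\<close>.
\<close>

definition I_kernel :: "(real^'n \<Rightarrow> real^'n^'n) \<Rightarrow> real^'n \<Rightarrow> real^'n \<Rightarrow> real" where
  "I_kernel A y z = (trace (A z ** matrix_inv (A y))
         - real CARD('n) * (((A z ** inv_sqrt (A y)) *v (z - y)) \<bullet> (inv_sqrt (A y) *v (z - y)))
             / (norm (z - y))\<^sup>2)"

lemma I_kernel_components:
  fixes A :: "real^'n \<Rightarrow> real^'n^'n" and y :: "real^'n"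
  defines "M \<equiv> matrix_inv (A y)" and "b \<equiv> \<lambda>z. inv_sqrt (A y) *v (z - y)"
  shows "I_kernel A y z = (\<Sum>i\<in>UNIV. \<Sum>k\<in>UNIV. A z $ i $ k * M $ k $ i)
    - real CARD('n) * (\<Sum>i\<in>UNIV. \<Sum>j\<in>UNIV. A z $ i $ j * b z $ j * b z $ i) / (norm (z - y))\<^sup>2"
proof -
  have bz: "inv_sqrt (A y) *v (z - y) = b z"
    by (simp add: b_def)
  have tr: "trace (A z ** M) = (\<Sum>i\<in>UNIV. \<Sum>k\<in>UNIV. A z $ i $ k * M $ k $ i)"
    by (simp add: trace_def matrix_matrix_mult_def)
  have "((A z ** inv_sqrt (A y)) *v (z - y)) \<bullet> b z = (A z *v b z) \<bullet> b z"
    by (simp add: b_def matrix_vector_mul_assoc)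
  also have "\<dots> = (\<Sum>i\<in>UNIV. \<Sum>j\<in>UNIV. A z $ i $ j * b z $ j * b z $ i)"
    by (simp add: inner_vec_def matrix_vector_mult_def sum_distrib_right)
  finally show ?thesis
    unfolding I_kernel_def M_def[symmetric] bz tr by simp
qed

text \<open>
  The quadratic form is at most a multiple of \<open>|z - y|\<^sup>2\<close>.
\<close>

lemma I_kernel_bounded:
  fixes A :: "real^'n \<Rightarrow> real^'n^'n" and y :: "real^'n"
  assumes "bounded (range A)"
  obtains Q where "0 \<le> Q" "\<And>z. \<bar>I_kernel A y z\<bar> \<le> Q"
proof -
  obtain a where a: "\<And>z. norm (A z) \<le> a"
    using assms by (auto simp: bounded_iff)
  have a_comp: "\<bar>A z $ i $ j\<bar> \<le> a" for z i j
    using norm_vec_le_sum(2)[of "A z" i] norm_vec_le_sum(2)[of "A z $ i" j] a[of z] by simp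
  have a0: "0 \<le> a"
    using a[of 0] norm_ge_zero[of "A 0"] by linarith
  let ?M = "matrix_inv (A y)" and ?b = "\<lambda>z. inv_sqrt (A y) *v (z - y)"
  define l where "l = onorm ((*v) (inv_sqrt (A y)))"
  have l0: "0 \<le> l"
    by (simp add: l_def onorm_pos_le matrix_vector_mul_bounded_linear)
  have b: "\<bar>?b z $ j\<bar> \<le> l * norm (z - y)" for z j
    using component_le_norm_cart[of "?b z" j] onorm[OF matrix_vector_mul_bounded_linear, of "inv_sqrt (A y)" "z - y"]
    by (simp add: l_def)
  define Q1 where "Q1 = (\<Sum>i\<in>UNIV. \<Sum>k\<in>UNIV. a * \<bar>?M $ k $ i\<bar>)"
  define Q2 where "Q2 = real CARD('n) * (\<Sum>i\<in>(UNIV::'n set). \<Sum>j\<in>(UNIV::'n set). a * l * l)"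
  have "\<bar>I_kernel A y z\<bar> \<le> Q1 + Q2" for z
  proof -
    have 1: "\<bar>\<Sum>i\<in>UNIV. \<Sum>k\<in>UNIV. A z $ i $ k * ?M $ k $ i\<bar> \<le> Q1"
      unfolding Q1_def
      by (intro order_trans[OF sum_abs] sum_mono order_trans[OF sum_abs]) (auto simp: abs_mult intro!: mult_right_mono a_comp)
    have "\<bar>\<Sum>i\<in>UNIV. \<Sum>j\<in>UNIV. A z $ i $ j * ?b z $ j * ?b z $ i\<bar>
        \<le> (\<Sum>i\<in>(UNIV::'n set). \<Sum>j\<in>(UNIV::'n set). a * (l * norm (z - y)) * (l * norm (z - y)))"
      by (intro order_trans[OF sum_abs] sum_mono order_trans[OF sum_abs])
         (unfold abs_mult, intro mult_mono a_comp b, auto intro!: mult_nonneg_nonneg a0 l0)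
    also have "\<dots> = (\<Sum>i\<in>(UNIV::'n set). \<Sum>j\<in>(UNIV::'n set). a * l * l) * (norm (z - y))\<^sup>2"
      by (simp add: power2_eq_square)
    finally have "real CARD('n) * \<bar>\<Sum>i\<in>UNIV. \<Sum>j\<in>UNIV. A z $ i $ j * ?b z $ j * ?b z $ i\<bar> \<le> Q2 * (norm (z - y))\<^sup>2"
      unfolding Q2_def by (simp only: mult.assoc) (rule mult_left_mono, simp_all)
    moreover have "0 \<le> Q2"
      unfolding Q2_def using a0 l0 by (intro mult_nonneg_nonneg sum_nonneg) auto
    ultimately have 2: "real CARD('n) * \<bar>\<Sum>i\<in>UNIV. \<Sum>j\<in>UNIV. A z $ i $ j * ?b z $ j * ?b z $ i\<bar> / (norm (z - y))\<^sup>2 \<le> Q2"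
      by (cases "z = y") (simp_all add: pos_divide_le_eq)
    have tri: "\<bar>p - c * q / r\<bar> \<le> \<bar>p\<bar> + c * \<bar>q\<bar> / r" if "0 \<le> c" "0 \<le> r" for p c q r :: real
      using abs_triangle_ineq4[of p "c * q / r"] that by (simp add: abs_mult)
    show ?thesis
      unfolding I_kernel_components
      by (rule order_trans[OF tri add_mono[OF 1 2]]) simp_all
  qed
  moreover have "0 \<le> Q1 + Q2"
    unfolding Q1_def Q2_def using a0 l0 by (intro add_nonneg_nonneg mult_nonneg_nonneg sum_nonneg) auto
  ultimately show thesis
    by (rule that[rotated])
qed

lemma measurable_matrix_component:
  fixes A :: "real^'n \<Rightarrow> real^'n^'n"
  assumes "A \<in> borel_measurable lebesgue"
  shows "(\<lambda>z. A z $ i $ j) \<in> borel_measurable lebesgue"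
proof -
  have "(\<lambda>X::real^'n^'n. X $ i $ j) \<in> borel_measurable borel"
    by (intro borel_measurable_continuous_onI continuous_intros)
  from measurable_compose[OF assms this] show ?thesis .
qed

lemma I_kernel_measurable:
  fixes A :: "real^'n \<Rightarrow> real^'n^'n"
  assumes "A \<in> borel_measurable lebesgue"
  shows "I_kernel A y \<in> borel_measurable lebesgue"
proof -
  have cont: "f \<in> borel_measurable lebesgue" if "continuous_on UNIV f" for f :: "real^'n \<Rightarrow> real"
    using that by (intro measurable_completion) (simp add: borel_measurable_continuous_onI)
  have "(\<lambda>z. (inv_sqrt (A y) *v (z - y)) $ i) \<in> borel_measurable lebesgue" for i
    by (intro cont continuous_intros bounded_linear.continuous_on[OF matrix_vector_mul_bounded_linear])
  moreover have "(\<lambda>z. (norm (z - y))\<^sup>2) \<in> borel_measurable lebesgue"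
    by (intro cont continuous_intros)
  ultimately show ?thesis
    unfolding I_kernel_components[abs_def] using measurable_matrix_component[OF assms]
    by (intro borel_measurable_diff borel_measurable_divide borel_measurable_sum borel_measurable_times borel_measurable_const)
qed

text \<open>
  The integrand is at most \<open>Q s powr (- n)\<close> outside the ball of radius \<open>s\<close>, and the shell between the radii \<open>s\<close> and
  \<open>t \<le> 2 s\<close> has volume at most a multiple of \<open>s powr (n - 1) * (t - s)\<close>.
\<close>

lemma I_fun_slowly_varying:
  fixes A :: "real^'n \<Rightarrow> real^'n^'n" and y :: "real^'n"
  assumes "A \<in> borel_measurable lebesgue" "bounded (range A)"
  obtains C where "0 \<le> C" "slowly_varying (I_fun A y \<epsilon>) C \<epsilon>"
proof -
  obtain Q where Q: "0 \<le> Q" "\<And>z. \<bar>I_kernel A y z\<bar> \<le> Q"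
    using I_kernel_bounded[OF assms(2)] by blast
  let ?n = "CARD('n)" and ?S = "sphere_area TYPE('n)" and ?V = "unit_ball_vol (real CARD('n))"
  let ?D = "\<lambda>r. {z. r < norm (z - y) \<and> norm (z - y) < \<epsilon>}"
  have S: "0 < ?S"
    unfolding sphere_area_eq by (intro mult_pos_pos) auto
  define g where "g = (\<lambda>z. I_kernel A y z / norm (z - y) ^ ?n)"
  have g_meas: "g \<in> borel_measurable lebesgue"
  proof -
    have "(\<lambda>z. norm (z - y) ^ ?n) \<in> borel_measurable lebesgue"
      by (intro measurable_completion) (simp add: borel_measurable_continuous_onI continuous_intros)
    then show ?thesis
      unfolding g_def using I_kernel_measurable[OF assms(1)] by (intro borel_measurable_divide)
  qed
  have I: "I_fun A y \<epsilon> r = (1 / ?S) * (LINT z:?D r|lebesgue. g z)" for r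
    by (simp add: I_fun_def g_def I_kernel_def)
  have g_le: "\<bar>g z\<bar> \<le> Q / r ^ ?n" if "0 < r" "r < norm (z - y)" for r z
    unfolding g_def abs_divide power_abs abs_norm_cancel
    using Q that by (intro frac_le power_mono) auto
  have D_meas: "?D r \<in> lmeasurable" for r
  proof -
    have "?D r = ball y \<epsilon> - cball y r"
      by (auto simp: dist_norm norm_minus_commute)
    then show ?thesis
      by (simp add: fmeasurable.Diff)
  qed
  have g_int: "set_integrable lebesgue (?D r) g" if "0 < r" for r
    unfolding set_integrable_def
  proof (rule Bochner_Integration.integrable_bound)
    show "integrable lebesgue (\<lambda>z. Q / r ^ ?n * indicat_real (?D r) z)"
      using D_meas[of r] by (intro integrable_mult_right integrable_real_indicator) (auto simp: fmeasurable_def)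
    have "?D r \<in> sets lebesgue"
      using D_meas[of r] by (rule fmeasurableD)
    then show "(\<lambda>z. indicat_real (?D r) z *\<^sub>R g z) \<in> borel_measurable lebesgue"
      using g_meas by (intro borel_measurable_scaleR borel_measurable_indicator)
    show "AE z in lebesgue. norm (indicat_real (?D r) z *\<^sub>R g z) \<le> norm (Q / r ^ ?n * indicat_real (?D r) z)"
      using g_le[OF that] Q(1) that by (intro AE_I2) (auto simp: indicator_def)
  qed
  define C where "C = (1 / ?S) * (Q * ?V * (2 ^ ?n * real ?n / 2))"
  have C0: "0 \<le> C"
    using S Q(1) by (simp add: C_def)
  have one: "\<bar>I_fun A y \<epsilon> s - I_fun A y \<epsilon> t\<bar> \<le> C * (t - s) / s" if st: "0 < s" "s \<le> t" "t \<le> \<epsilon>" "t \<le> 2 * s" for s t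
  proof -
    let ?E = "cball y t - cball y s"
    have E: "?E \<in> lmeasurable"
      by (intro fmeasurable.Diff) auto
    have sub: "cball y s \<subseteq> cball y t"
      using st by auto
    have "(LINT z:?D s|lebesgue. g z) - (LINT z:?D t|lebesgue. g z)
        = (LINT z|lebesgue. indicator (?D s) z *\<^sub>R g z - indicator (?D t) z *\<^sub>R g z)"
      unfolding set_lebesgue_integral_def
      using g_int[of s] g_int[of t] st
      by (intro Bochner_Integration.integral_diff[symmetric]) (auto simp: set_integrable_def)
    also have "\<bar>\<dots>\<bar> \<le> (LINT z|lebesgue. Q / s ^ ?n * indicat_real ?E z)"
    proof (rule order_trans[OF integral_abs_bound integral_mono])
      show "integrable lebesgue (\<lambda>z. \<bar>indicator (?D s) z *\<^sub>R g z - indicator (?D t) z *\<^sub>R g z\<bar>)"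
        using g_int[of s] g_int[of t] st
        by (intro integrable_abs Bochner_Integration.integrable_diff) (auto simp: set_integrable_def)
      show "integrable lebesgue (\<lambda>z. Q / s ^ ?n * indicat_real ?E z)"
        using E by (intro integrable_mult_right integrable_real_indicator) (auto simp: fmeasurable_def)
      show "\<bar>indicator (?D s) z *\<^sub>R g z - indicator (?D t) z *\<^sub>R g z\<bar> \<le> Q / s ^ ?n * indicat_real ?E z" for z
        using g_le[OF st(1), of z] Q(1) st by (auto simp: indicator_def dist_norm norm_minus_commute)
    qed
    also have "\<dots> = Q / s ^ ?n * measure lebesgue ?E"
      using E by (simp add: fmeasurableD)
    also have "measure lebesgue ?E = measure lebesgue (cball y t) - measure lebesgue (cball y s)"
      using sub by (intro measurable_measure_Diff) (auto simp: fmeasurableD)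
    also have "\<dots> = ?V * (t ^ ?n - s ^ ?n)"
      using st by (simp add: content_cball algebra_simps)
    also have "t ^ ?n - s ^ ?n \<le> (2 ^ ?n * real ?n / 2) * s ^ ?n * ((t - s) / s)"
    proof -
      have "(t / (2 * s)) ^ ?n - (s / (2 * s)) ^ ?n \<le> norm ((t / (2 * s)) ^ ?n - (s / (2 * s)) ^ ?n)"
        by simp
      also have "\<dots> \<le> real ?n * norm (t / (2 * s) - s / (2 * s))"
        using st by (intro norm_power_diff) (auto simp: field_simps)
      also have "\<dots> = real ?n * ((t - s) / (2 * s))"
        unfolding diff_divide_distrib[symmetric] using st by (simp only: real_norm_def abs_of_nonneg divide_nonneg_pos diff_ge_0_iff_ge zero_less_mult_iff) simp
      finally have 1: "((t / (2 * s)) ^ ?n - (s / (2 * s)) ^ ?n) * (2 * s) ^ ?n \<le> real ?n * ((t - s) / (2 * s)) * (2 * s) ^ ?n"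
        using st by (intro mult_right_mono) auto
      have 2: "((t / (2 * s)) ^ ?n - (s / (2 * s)) ^ ?n) * (2 * s) ^ ?n = t ^ ?n - s ^ ?n"
        using st by (simp add: power_divide left_diff_distrib power_mult_distrib)
      have 3: "real ?n * ((t - s) / (2 * s)) * (2 * s) ^ ?n = (2 ^ ?n * real ?n / 2) * s ^ ?n * ((t - s) / s)"
        by (simp add: power_mult_distrib)
      show ?thesis
        using 1 unfolding 2 3 .
    qed
    finally have "\<bar>(LINT z:?D s|lebesgue. g z) - (LINT z:?D t|lebesgue. g z)\<bar>
        \<le> Q / s ^ ?n * (?V * ((2 ^ ?n * real ?n / 2) * s ^ ?n * ((t - s) / s)))"
      using Q(1) st by (simp add: mult_left_mono divide_right_mono)
    also have "\<dots> = Q * ?V * (2 ^ ?n * real ?n / 2) * ((t - s) / s)"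
      using st by simp
    finally have "(1 / ?S) * \<bar>(LINT z:?D s|lebesgue. g z) - (LINT z:?D t|lebesgue. g z)\<bar>
        \<le> (1 / ?S) * (Q * ?V * (2 ^ ?n * real ?n / 2) * ((t - s) / s))"
      using S by (intro mult_left_mono) auto
    moreover have "I_fun A y \<epsilon> s - I_fun A y \<epsilon> t = (1 / ?S) * ((LINT z:?D s|lebesgue. g z) - (LINT z:?D t|lebesgue. g z))"
      by (simp add: I right_diff_distrib)
    ultimately show ?thesis
      using S by (simp add: abs_mult C_def mult.assoc)
  qed
  have "slowly_varying (I_fun A y \<epsilon>) (2 * C) \<epsilon>"
    unfolding slowly_varying_def
  proof (intro allI impI, elim conjE)
    fix s t assume st: "0 < s" "s \<le> \<epsilon>" "0 < t" "t \<le> \<epsilon>" "\<bar>s - t\<bar> \<le> s / 2"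
    show "\<bar>I_fun A y \<epsilon> s - I_fun A y \<epsilon> t\<bar> \<le> 2 * C * \<bar>s - t\<bar> / s"
    proof (cases "s \<le> t")
      case True
      then have "\<bar>I_fun A y \<epsilon> s - I_fun A y \<epsilon> t\<bar> \<le> C * (t - s) / s"
        using st by (intro one) auto
      also have "\<dots> \<le> 2 * C * (t - s) / s"
        using True C0 st by (intro divide_right_mono mult_right_mono) auto
      finally show ?thesis
        using True by simp
    next
      case False
      then have "\<bar>I_fun A y \<epsilon> t - I_fun A y \<epsilon> s\<bar> \<le> C * (s - t) / t"
        using st by (intro one) auto
      also have "\<dots> \<le> C * (s - t) / (s / 2)"
        using False C0 st by (intro divide_left_mono) auto
      finally show ?thesis
        using False by (simp add: abs_minus_commute mult_ac)
    qed
  qed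
  then show thesis
    using C0 by (intro that[of "2 * C"]) auto
qed

lemma exp_bounded_of_limit:
  fixes J :: "real \<Rightarrow> real"
  assumes "continuous_on {0<..\<epsilon>} J" "((\<lambda>r. exp (J r)) \<longlongrightarrow> L) (at_right 0)"
  obtains K :: real where "\<And>t. 0 < t \<Longrightarrow> t \<le> \<epsilon> \<Longrightarrow> exp (J t) \<le> K"
proof -
  have "\<forall>\<^sub>F r in at_right 0. exp (J r) < L + 1"
    using assms(2) by (rule order_tendstoD) simp
  then obtain b where b: "0 < b" "\<forall>t>0. t < b \<longrightarrow> exp (J t) < L + 1"
    unfolding eventually_at_right_field by blast
  have "compact ((\<lambda>t. exp (J t)) ` {b..\<epsilon>})"
    using b(1) by (intro compact_continuous_image continuous_on_exp continuous_on_subset[OF assms(1)]) auto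
  from compact_imp_bounded[OF this] obtain K where K: "\<forall>x\<in>(\<lambda>t. exp (J t)) ` {b..\<epsilon>}. norm x \<le> K"
    unfolding bounded_iff by blast
  show thesis
  proof
    show "exp (J t) \<le> max K (L + 1)" if "0 < t" "t \<le> \<epsilon>" for t
    proof (cases "t < b")
      case True
      then have "exp (J t) < L + 1"
        using b(2) that(1) by blast
      then show ?thesis
        by simp
    next
      case False
      then have "norm (exp (J t)) \<le> K"
        using that(2) by (intro K[rule_format] imageI) simp
      then show ?thesis
        by simp
    qed
  qed
qed

section \<open>Smallness over annuli\<close>

text \<open>
  Over an annulus of volume comparable to \<open>r powr n\<close> this says that the mean of \<open>|g|\<close> is \<open>o(r powr (a - n))\<close>.
\<close>

definition L1_small :: "real^'n \<Rightarrow> real \<Rightarrow> (real^'n \<Rightarrow> real) \<Rightarrow> bool" where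
  "L1_small y a g \<longleftrightarrow> ((\<lambda>r. r powr (- a) * annulus_L1 r y g) \<longlongrightarrow> 0) (at_right 0)"

lemma eventually_at_right_0I:
  fixes d :: real
  assumes "0 < d" "\<And>r. 0 < r \<Longrightarrow> r < d \<Longrightarrow> P r"
  shows "eventually P (at_right 0)"
  using assms unfolding eventually_at_right_field by blast

lemma annulus_L1_nonneg: "0 \<le> annulus_L1 r y g"
  unfolding annulus_L1_def set_lebesgue_integral_def by (intro integral_nonneg_AE) (auto simp: indicator_def)

lemma L1_small_of_mean_bound:
  fixes y :: "real^'n"
  assumes "0 < d" "\<And>r. 0 < r \<Longrightarrow> r < d \<Longrightarrow> annulus_L1 r y g \<le> 2 * measure lebesgue (annulus r y) * M r"
    and "\<And>r. 0 < r \<Longrightarrow> r < d \<Longrightarrow> r powr j * M r \<le> M' r"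
    and "((\<lambda>r. r powr b * M' r) \<longlongrightarrow> 0) (at_right 0)"
  shows "L1_small y (real CARD('n) - b - j) g"
  unfolding L1_small_def
proof (rule Lim_null_comparison)
  let ?n = "real CARD('n)"
  let ?\<kappa> = "unit_ball_vol ?n * (2 ^ CARD('n) - 1)"
  have \<kappa>: "0 \<le> ?\<kappa>"
    by simp
  show "\<forall>\<^sub>F r in at_right 0. norm (r powr - (?n - b - j) * annulus_L1 r y g) \<le> 2 * ?\<kappa> * (r powr b * M' r)"
  proof (rule eventually_at_right_0I[OF assms(1)])
    fix r assume r: "0 < r" "r < d"
    have "r powr - (?n - b - j) * annulus_L1 r y g \<le> r powr - (?n - b - j) * (2 * (?\<kappa> * r ^ CARD('n)) * M r)"
      using assms(2)[OF r] unfolding measure_annulus(1)[OF r(1)] by (intro mult_left_mono) auto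
    also have "r ^ CARD('n) = r powr ?n"
      using r by (simp add: powr_realpow)
    also have "r powr - (?n - b - j) * (2 * (?\<kappa> * r powr ?n) * M r) = 2 * ?\<kappa> * (r powr - (?n - b - j) * r powr ?n) * M r"
      by (simp add: mult_ac)
    also have "r powr - (?n - b - j) * r powr ?n = r powr b * r powr j"
      by (simp add: add.commute flip: powr_add)
    also have "2 * ?\<kappa> * (r powr b * r powr j) * M r = 2 * ?\<kappa> * (r powr b * (r powr j * M r))"
      by simp
    also have "\<dots> \<le> 2 * ?\<kappa> * (r powr b * M' r)"
      using assms(3)[OF r] \<kappa> by (intro mult_left_mono) auto
    finally show "norm (r powr - (?n - b - j) * annulus_L1 r y g) \<le> 2 * ?\<kappa> * (r powr b * M' r)"
      using annulus_L1_nonneg[of r y g] by simp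
  qed
  show "((\<lambda>r. 2 * ?\<kappa> * (r powr b * M' r)) \<longlongrightarrow> 0) (at_right 0)"
    using tendsto_mult_right_zero[OF assms(4)] .
qed

lemma M_mean_nonneg: "0 \<le> M_mean p w r y"
  by (simp add: M_mean_def)

lemma M2_mean_ge:
  assumes "0 < r"
  shows "r powr 2 * M_mean p (weak_hess (annulus r y) w) r y \<le> M2_mean p w r y"
    and "r powr 1 * M_mean p (weak_grad (annulus r y) w) r y \<le> M2_mean p w r y"
    and "r powr 0 * M_mean p w r y \<le> M2_mean p w r y" and "0 \<le> M2_mean p w r y"
proof -
  have nn: "0 \<le> r\<^sup>2 * M_mean p (weak_hess (annulus r y) w) r y" "0 \<le> r * M_mean p (weak_grad (annulus r y) w) r y"
    using assms M_mean_nonneg by (auto intro!: mult_nonneg_nonneg)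
  show "r powr 2 * M_mean p (weak_hess (annulus r y) w) r y \<le> M2_mean p w r y"
    "r powr 1 * M_mean p (weak_grad (annulus r y) w) r y \<le> M2_mean p w r y"
    "r powr 0 * M_mean p w r y \<le> M2_mean p w r y" "0 \<le> M2_mean p w r y"
    using nn assms M_mean_nonneg[of p w r y] by (auto simp: M2_mean_def powr_numeral)
qed

text \<open>
  Each derivative costs one power of \<open>r\<close> in \<open>M2_mean\<close>.
\<close>

lemma W2p_L1_small:
  fixes y :: "real^'n" and w :: "real^'n \<Rightarrow> real"
  assumes "W2p_loc (ball y \<delta> - {y}) p w" "1 < p" "0 < \<delta>"
    and lim: "((\<lambda>r. r powr b * M2_mean p w r y) \<longlongrightarrow> 0) (at_right 0)"
  defines "\<Omega> \<equiv> ball y \<delta> - {y}"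
  shows "L1_small y (real CARD('n) - b) w"
    and "L1_small y (real CARD('n) - b - 1) (weak_partial \<Omega> i w)"
    and "L1_small y (real CARD('n) - b - 2) (weak_partial \<Omega> i (weak_partial \<Omega> j w))"
proof -
  have d: "0 < \<delta> / 2"
    using assms(3) by simp
  note bounds = W2p_annulus_L1[OF assms(1,2)]
  have "L1_small y (real CARD('n) - b - 0) w"
    by (rule L1_small_of_mean_bound[OF d _ M2_mean_ge(3) lim]) (auto intro!: bounds(1))
  then show "L1_small y (real CARD('n) - b) w"
    by simp
  show "L1_small y (real CARD('n) - b - 1) (weak_partial \<Omega> i w)"
    unfolding \<Omega>_def by (rule L1_small_of_mean_bound[OF d _ M2_mean_ge(2) lim]) (auto intro!: bounds(2))
  show "L1_small y (real CARD('n) - b - 2) (weak_partial \<Omega> i (weak_partial \<Omega> j w))"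
    unfolding \<Omega>_def by (rule L1_small_of_mean_bound[OF d _ M2_mean_ge(1) lim]) (auto intro!: bounds(3))
qed

definition shell :: "real \<Rightarrow> real \<Rightarrow> real \<Rightarrow> real^'n \<Rightarrow> (real^'n) set" where
  "shell \<alpha> \<beta> r y = {x. \<alpha> * r < norm (x - y) \<and> norm (x - y) < \<beta> * r}"

lemma shell_integrable:
  fixes y :: "real^'n"
  assumes "Lp_loc (ball y \<delta> - {y}) 1 g" "0 < \<alpha>" "0 < r" "\<beta> * r < \<delta>"
  shows "integrable lebesgue (\<lambda>x. indicator (shell \<alpha> \<beta> r y) x * \<bar>g x\<bar>)"
proof -
  let ?K = "{x. \<alpha> * r \<le> norm (x - y) \<and> norm (x - y) \<le> \<beta> * r}"
  have pos: "0 < \<alpha> * r"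
    using assms by simp
  have op: "open (ball y \<delta> - {y})"
    by auto
  have sub: "?K \<subseteq> ball y \<delta> - {y}"
    using assms(4) pos by (auto simp: dist_norm norm_minus_commute)
  have K: "integrable lebesgue (\<lambda>x. indicator ?K x *\<^sub>R g x)"
    by (rule Lp_loc_1_set_integrable[OF assms(1) op closed_annulus_compact sub])
  have "shell \<alpha> \<beta> r y = ball y (\<beta> * r) - cball y (\<alpha> * r)"
    by (auto simp: shell_def dist_norm norm_minus_commute)
  then have "shell \<alpha> \<beta> r y \<in> sets lebesgue"
    by simp
  then have "integrable lebesgue (\<lambda>x. (indicator ?K x *\<^sub>R g x) * indicator (shell \<alpha> \<beta> r y) x)"
    by (intro integrable_mult_bounded[OF K, of _ 1] borel_measurable_indicator) (auto simp: indicator_def)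
  then have "integrable lebesgue (\<lambda>x. \<bar>(indicator ?K x *\<^sub>R g x) * indicator (shell \<alpha> \<beta> r y) x\<bar>)"
    by (rule integrable_abs)
  also have "(\<lambda>x. \<bar>(indicator ?K x *\<^sub>R g x) * indicator (shell \<alpha> \<beta> r y) x\<bar>) = (\<lambda>x. indicator (shell \<alpha> \<beta> r y) x * \<bar>g x\<bar>)"
    by (auto simp: fun_eq_iff indicator_def shell_def)
  finally show ?thesis .
qed

lemma annulus_L1_shell: "annulus_L1 r y g = (LINT x|lebesgue. indicator (shell 1 2 r y) x * \<bar>g x\<bar>)"
  by (simp add: annulus_L1_def set_lebesgue_integral_def shell_def annulus_def)

text \<open>
  Rescaling the radius turns annuli into shells of ratio \<open>2\<close>, and wider shells are covered by finitely many of these.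
  The shells are open, so consecutive ones must overlap; hence steps of ratio \<open>3/2\<close>.
\<close>

lemma L1_small_shell_aux:
  fixes y :: "real^'n"
  assumes loc: "Lp_loc (ball y \<delta> - {y}) 1 g" and \<delta>: "0 < \<delta>" and small: "L1_small y a g" and \<alpha>: "0 < \<alpha>"
  shows "((\<lambda>r. r powr (- a) * (LINT x|lebesgue. indicator (shell \<alpha> (2 * \<alpha> * (3/2) ^ J) r y) x * \<bar>g x\<bar>)) \<longlongrightarrow> 0) (at_right 0)"
proof -
  have one: "((\<lambda>r. r powr (- a) * (LINT x|lebesgue. indicator (shell c (2 * c) r y) x * \<bar>g x\<bar>)) \<longlongrightarrow> 0) (at_right 0)"
    if c: "0 < c" for c
  proof -
    have "filterlim (\<lambda>r. c * r) (at_right 0) (at_right 0)"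
      unfolding filterlim_at
    proof
      show "\<forall>\<^sub>F r in at_right 0. c * r \<in> {0<..} \<and> c * r \<noteq> 0"
        using c by (intro eventually_at_right_0I[of 1]) auto
      show "((\<lambda>r. c * r) \<longlongrightarrow> 0) (at_right 0)"
        by (rule tendsto_mult_right_zero[OF tendsto_ident_at])
    qed
    from filterlim_compose[OF small[unfolded L1_small_def] this]
    have "((\<lambda>r. (c * r) powr (- a) * annulus_L1 (c * r) y g) \<longlongrightarrow> 0) (at_right 0)" .
    from tendsto_mult_right_zero[OF this, of "c powr a"]
    have lim: "((\<lambda>r. c powr a * ((c * r) powr (- a) * annulus_L1 (c * r) y g)) \<longlongrightarrow> 0) (at_right 0)" .
    show ?thesis
    proof (rule Lim_transform_eventually[OF lim])
      show "\<forall>\<^sub>F r in at_right 0. c powr a * ((c * r) powr (- a) * annulus_L1 (c * r) y g)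
          = r powr (- a) * (LINT x|lebesgue. indicator (shell c (2 * c) r y) x * \<bar>g x\<bar>)"
      proof (rule eventually_at_right_0I[OF zero_less_one])
        fix r :: real assume r: "0 < r"
        have "shell 1 2 (c * r) y = shell c (2 * c) r y"
          by (simp add: shell_def mult.assoc)
        moreover have "c powr a * (c * r) powr (- a) = r powr (- a)"
          using c r by (simp add: powr_mult powr_minus)
        ultimately show "c powr a * ((c * r) powr (- a) * annulus_L1 (c * r) y g)
          = r powr (- a) * (LINT x|lebesgue. indicator (shell c (2 * c) r y) x * \<bar>g x\<bar>)"
          by (simp add: annulus_L1_shell flip: mult.assoc)
      qed
    qed
  qed
  show ?thesis
  proof (induction J)
    case 0
    then show ?case
      using one[OF \<alpha>] by simp
  next
    case (Suc J)
    let ?b = "2 * \<alpha> * (3/2) ^ J" and ?c = "\<alpha> * (3/2) ^ Suc J"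
    have c: "0 < ?c"
      using \<alpha> by simp
    have cb: "?c < ?b" "\<alpha> \<le> ?c"
    proof -
      have "1 \<le> (3/2::real) ^ Suc J"
        by (rule one_le_power) simp
      then have "\<alpha> * 1 \<le> ?c"
        using \<alpha> by (intro mult_left_mono) auto
      then show "\<alpha> \<le> ?c"
        by simp
      show "?c < ?b"
        using \<alpha> by simp
    qed
    let ?S = "\<lambda>\<alpha> \<beta> r. (LINT x|lebesgue. indicator (shell \<alpha> \<beta> r y) x * \<bar>g x\<bar>)"
    show ?case
    proof (rule Lim_null_comparison)
      show "\<forall>\<^sub>F r in at_right 0. norm (r powr (- a) * ?S \<alpha> (2 * \<alpha> * (3/2) ^ Suc J) r)
          \<le> r powr (- a) * ?S \<alpha> ?b r + r powr (- a) * ?S ?c (2 * ?c) r"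
      proof (rule eventually_at_right_0I)
        show "0 < \<delta> / (2 * ?c)"
          using \<delta> c by simp
        fix r assume r: "0 < r" "r < \<delta> / (2 * ?c)"
        have r2: "2 * ?c * r < \<delta>"
          using r c by (simp add: pos_less_divide_eq mult.commute)
        moreover have "?b * r \<le> 2 * ?c * r"
          using r \<alpha> by (intro mult_right_mono) auto
        ultimately have r3: "?b * r < \<delta>"
          by linarith
        have int: "integrable lebesgue (\<lambda>x. indicator (shell \<alpha> (2 * ?c) r y) x * \<bar>g x\<bar>)"
          "integrable lebesgue (\<lambda>x. indicator (shell \<alpha> ?b r y) x * \<bar>g x\<bar>)"
          "integrable lebesgue (\<lambda>x. indicator (shell ?c (2 * ?c) r y) x * \<bar>g x\<bar>)"
          by (rule shell_integrable[OF loc \<alpha> r(1) r2] shell_integrable[OF loc \<alpha> r(1) r3] shell_integrable[OF loc c r(1) r2])+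
        have "?S \<alpha> (2 * ?c) r \<le> (LINT x|lebesgue. indicator (shell \<alpha> ?b r y) x * \<bar>g x\<bar> + indicator (shell ?c (2 * ?c) r y) x * \<bar>g x\<bar>)"
        proof (rule integral_mono[OF int(1) Bochner_Integration.integrable_add[OF int(2,3)]])
          fix x
          have "?c * r < ?b * r"
            using cb(1) r(1) by (intro mult_strict_right_mono)
          then have "x \<in> shell \<alpha> ?b r y \<or> x \<in> shell ?c (2 * ?c) r y" if "x \<in> shell \<alpha> (2 * ?c) r y"
            using that unfolding shell_def mem_Collect_eq by linarith
          then show "indicator (shell \<alpha> (2 * ?c) r y) x * \<bar>g x\<bar>
              \<le> indicator (shell \<alpha> ?b r y) x * \<bar>g x\<bar> + indicator (shell ?c (2 * ?c) r y) x * \<bar>g x\<bar>"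
            unfolding indicator_def by auto
        qed
        also have "\<dots> = ?S \<alpha> ?b r + ?S ?c (2 * ?c) r"
          by (rule Bochner_Integration.integral_add[OF int(2,3)])
        finally have "r powr (- a) * ?S \<alpha> (2 * ?c) r \<le> r powr (- a) * (?S \<alpha> ?b r + ?S ?c (2 * ?c) r)"
          by (intro mult_left_mono) auto
        moreover have "0 \<le> ?S \<alpha> (2 * ?c) r"
          by (intro integral_nonneg_AE) auto
        moreover have "2 * \<alpha> * (3/2) ^ Suc J = 2 * ?c"
          by simp
        ultimately show "norm (r powr (- a) * ?S \<alpha> (2 * \<alpha> * (3/2) ^ Suc J) r)
          \<le> r powr (- a) * ?S \<alpha> ?b r + r powr (- a) * ?S ?c (2 * ?c) r"
          by (simp only: distrib_left) simp
      qed
      show "((\<lambda>r. r powr (- a) * ?S \<alpha> ?b r + r powr (- a) * ?S ?c (2 * ?c) r) \<longlongrightarrow> 0) (at_right 0)"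
        using tendsto_add[OF Suc one[OF c]] by simp
    qed
  qed
qed

text \<open>
  The linear map sends an annulus into a shell whose ratio is bounded in terms of the map.
\<close>

lemma L1_small_affine_matrix:
  fixes y :: "real^'n" and B :: "real^'n^'n"
  assumes loc: "Lp_loc (ball y \<delta> - {y}) 1 g" and \<delta>: "0 < \<delta>" and small: "L1_small y a g"
    and det: "det B \<noteq> 0" and m: "0 < m" "\<And>z. m * norm z \<le> norm (B *v z)"
  shows "L1_small y a (\<lambda>x. g (y + B *v (x - y)))"
proof -
  let ?T = "\<lambda>x. y + B *v (x - y)"
  define l where "l = onorm ((*v) B)"
  have l: "norm (B *v z) \<le> l * norm z" for z
    by (simp add: l_def onorm matrix_vector_mul_bounded_linear)
  obtain J where J: "l / m < (3/2::real) ^ J"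
    using real_arch_pow[of "3/2" "l / m"] by auto
  let ?b = "2 * m * (3/2) ^ J"
  have b: "2 * l < ?b" "0 < ?b"
    using J m(1) by (simp_all add: field_simps)
  let ?S = "\<lambda>r. (LINT x|lebesgue. indicator (shell m ?b r y) x * \<bar>g x\<bar>)"
  show ?thesis
    unfolding L1_small_def
  proof (rule Lim_null_comparison)
    show "((\<lambda>r. (1 / \<bar>det B\<bar>) * (r powr (- a) * ?S r)) \<longlongrightarrow> 0) (at_right 0)"
      by (rule tendsto_mult_right_zero[OF L1_small_shell_aux[OF loc \<delta> small m(1)]])
    show "\<forall>\<^sub>F r in at_right 0. norm (r powr (- a) * annulus_L1 r y (\<lambda>x. g (?T x))) \<le> (1 / \<bar>det B\<bar>) * (r powr (- a) * ?S r)"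
    proof (rule eventually_at_right_0I)
      show "0 < \<delta> / ?b"
        using \<delta> b(2) by simp
      fix r assume r: "0 < r" "r < \<delta> / ?b"
      have "?b * r < \<delta>"
        using r b(2) by (simp add: pos_less_divide_eq mult.commute)
      note int = shell_integrable[OF loc m(1) r(1) this]
      note intT = lebesgue_integral_affine_matrix[OF det int, of y]
      have ptw: "indicator (annulus r y) x * \<bar>g (?T x)\<bar> \<le> indicator (shell m ?b r y) (?T x) * \<bar>g (?T x)\<bar>" for x
      proof (cases "x \<in> annulus r y")
        case True
        then have x: "r < norm (x - y)" "norm (x - y) < 2 * r"
          by (auto simp: annulus_def)
        have "m * r < m * norm (x - y)"
          using x(1) m(1) by simp
        then have "m * r < norm (B *v (x - y))"
          using m(2)[of "x - y"] by linarith
        moreover have "norm (B *v (x - y)) < ?b * r"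
        proof -
          have l0: "0 \<le> l"
            by (simp add: l_def onorm_pos_le matrix_vector_mul_bounded_linear)
          have "norm (B *v (x - y)) \<le> l * norm (x - y)"
            by (rule l)
          also have "\<dots> \<le> l * (2 * r)"
            using x(2) l0 by (intro mult_left_mono) auto
          also have "\<dots> < ?b * r"
            using b(1) r(1) mult_strict_right_mono[of "2 * l" ?b r] by simp
          finally show ?thesis .
        qed
        ultimately show ?thesis
          by (simp add: shell_def indicator_def)
      qed simp
      have "annulus_L1 r y (\<lambda>x. g (?T x)) \<le> (LINT x|lebesgue. indicator (shell m ?b r y) (?T x) * \<bar>g (?T x)\<bar>)"
        unfolding annulus_L1_def set_lebesgue_integral_def real_scaleR_def
        by (rule integral_mono'[OF intT(1) ptw]) (auto simp: indicator_def)
      also have "\<dots> = (1 / \<bar>det B\<bar>) * ?S r"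
        using intT(2) det by (simp add: field_simps)
      finally have "r powr (- a) * annulus_L1 r y (\<lambda>x. g (?T x)) \<le> r powr (- a) * ((1 / \<bar>det B\<bar>) * ?S r)"
        by (intro mult_left_mono) auto
      then show "norm (r powr (- a) * annulus_L1 r y (\<lambda>x. g (?T x))) \<le> (1 / \<bar>det B\<bar>) * (r powr (- a) * ?S r)"
        using annulus_L1_nonneg[of r y "\<lambda>x. g (?T x)"] by (simp add: mult.left_commute)
    qed
  qed
qed

lemma L1_small_lincomb:
  fixes y :: "real^'n" and g :: "'k::finite \<Rightarrow> real^'n \<Rightarrow> real"
  assumes loc: "\<And>k. Lp_loc (ball y \<delta> - {y}) 1 (g k)" and \<delta>: "0 < \<delta>" and small: "\<And>k. L1_small y a (g k)"
  shows "L1_small y a (\<lambda>x. \<Sum>k\<in>UNIV. c k * g k x)"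
  unfolding L1_small_def
proof (rule Lim_null_comparison)
  show "((\<lambda>r. \<Sum>k\<in>UNIV. \<bar>c k\<bar> * (r powr (- a) * annulus_L1 r y (g k))) \<longlongrightarrow> 0) (at_right 0)"
    by (intro tendsto_null_sum tendsto_mult_right_zero small[unfolded L1_small_def])
  show "\<forall>\<^sub>F r in at_right 0. norm (r powr (- a) * annulus_L1 r y (\<lambda>x. \<Sum>k\<in>UNIV. c k * g k x))
      \<le> (\<Sum>k\<in>UNIV. \<bar>c k\<bar> * (r powr (- a) * annulus_L1 r y (g k)))"
  proof (rule eventually_at_right_0I)
    show "0 < \<delta> / 2"
      using \<delta> by simp
    fix r assume r: "0 < r" "r < \<delta> / 2"
    have int: "integrable lebesgue (\<lambda>x. indicator (shell 1 2 r y) x * \<bar>g k x\<bar>)" for k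
      using shell_integrable[OF loc zero_less_one r(1), of 2 k] r(2) by simp
    have "annulus_L1 r y (\<lambda>x. \<Sum>k\<in>UNIV. c k * g k x)
        \<le> (LINT x|lebesgue. (\<Sum>k\<in>UNIV. \<bar>c k\<bar> * (indicator (shell 1 2 r y) x * \<bar>g k x\<bar>)))"
      unfolding annulus_L1_shell
    proof (rule integral_mono')
      show "integrable lebesgue (\<lambda>x. \<Sum>k\<in>UNIV. \<bar>c k\<bar> * (indicator (shell 1 2 r y) x * \<bar>g k x\<bar>))"
        by (intro Bochner_Integration.integrable_sum integrable_mult_right int)
      show "indicator (shell 1 2 r y) x * \<bar>\<Sum>k\<in>UNIV. c k * g k x\<bar>
          \<le> (\<Sum>k\<in>UNIV. \<bar>c k\<bar> * (indicator (shell 1 2 r y) x * \<bar>g k x\<bar>))" for x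
        using sum_abs[of "\<lambda>k. c k * g k x" UNIV] by (auto simp: indicator_def abs_mult)
      show "0 \<le> (\<Sum>k\<in>UNIV. \<bar>c k\<bar> * (indicat_real (shell 1 2 r y) x * \<bar>g k x\<bar>))" for x
        by (intro sum_nonneg mult_nonneg_nonneg) auto
    qed
    also have "\<dots> = (\<Sum>k\<in>UNIV. \<bar>c k\<bar> * annulus_L1 r y (g k))"
      unfolding annulus_L1_shell using int by simp
    finally have "r powr (- a) * annulus_L1 r y (\<lambda>x. \<Sum>k\<in>UNIV. c k * g k x)
        \<le> r powr (- a) * (\<Sum>k\<in>UNIV. \<bar>c k\<bar> * annulus_L1 r y (g k))"
      by (intro mult_left_mono) auto
    then show "norm (r powr (- a) * annulus_L1 r y (\<lambda>x. \<Sum>k\<in>UNIV. c k * g k x))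
      \<le> (\<Sum>k\<in>UNIV. \<bar>c k\<bar> * (r powr (- a) * annulus_L1 r y (g k)))"
      using annulus_L1_nonneg[of r y "\<lambda>x. \<Sum>k\<in>UNIV. c k * g k x"]
      by (simp add: sum_distrib_left mult.left_commute)
  qed
qed

section \<open>Functions of homogeneous size on an annulus\<close>

text \<open>
  The function behaves on the annulus like one that is homogeneous of degree \<open>- a\<close>.
\<close>

definition scaled_bound :: "real^'n \<Rightarrow> real \<Rightarrow> 'n \<Rightarrow> real \<Rightarrow> real \<Rightarrow> (real^'n \<Rightarrow> real) \<Rightarrow> bool" where
  "scaled_bound y r i a R \<rho> \<longleftrightarrow> C1_on (annulus r y) \<rho> \<and>
     (\<forall>x\<in>annulus r y. \<bar>\<rho> x\<bar> \<le> R * r powr (- a) \<and> \<bar>partial i \<rho> x\<bar> \<le> R * r powr (- a - 1))"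

lemma scaled_bound_mult:
  assumes "0 < r" "scaled_bound y r i a R \<rho>" "scaled_bound y r i b R' \<rho>'"
  shows "scaled_bound y r i (a + b) (2 * R * R') (\<lambda>x. \<rho> x * \<rho>' x)"
  unfolding scaled_bound_def
proof (intro conjI ballI)
  show "C1_on (annulus r y) (\<lambda>x. \<rho> x * \<rho>' x)"
    using assms by (auto simp: scaled_bound_def intro: C1_on_mult)
  fix x assume x: "x \<in> annulus r y"
  have \<rho>: "\<bar>\<rho> x\<bar> \<le> R * r powr (- a)" "\<bar>partial i \<rho> x\<bar> \<le> R * r powr (- a - 1)" "\<rho> differentiable (at x)"
    "\<bar>\<rho>' x\<bar> \<le> R' * r powr (- b)" "\<bar>partial i \<rho>' x\<bar> \<le> R' * r powr (- b - 1)" "\<rho>' differentiable (at x)"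
    using assms x by (auto simp: scaled_bound_def C1_on_def)
  have p: "r powr (- a) * r powr (- b) = r powr (- (a + b))" "r powr (- a) * r powr (- b - 1) = r powr (- (a + b) - 1)"
    "r powr (- a - 1) * r powr (- b) = r powr (- (a + b) - 1)"
    by (simp_all add: algebra_simps flip: powr_add)
  have 1: "\<bar>\<rho> x\<bar> * \<bar>\<rho>' x\<bar> \<le> (R * r powr (- a)) * (R' * r powr (- b))"
    "\<bar>\<rho> x\<bar> * \<bar>partial i \<rho>' x\<bar> \<le> (R * r powr (- a)) * (R' * r powr (- b - 1))"
    "\<bar>partial i \<rho> x\<bar> * \<bar>\<rho>' x\<bar> \<le> (R * r powr (- a - 1)) * (R' * r powr (- b))"
    using \<rho> by (intro mult_mono; linarith)+
  have q: "(R * r powr (- a)) * (R' * r powr (- b)) = R * R' * r powr (- (a + b))"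
    "(R * r powr (- a)) * (R' * r powr (- b - 1)) = R * R' * r powr (- (a + b) - 1)"
    "(R * r powr (- a - 1)) * (R' * r powr (- b)) = R * R' * r powr (- (a + b) - 1)"
    by (simp only: p(1)[symmetric] mult_ac, simp only: p(2)[symmetric] mult_ac, simp only: p(3)[symmetric] mult_ac)
  have "\<bar>\<rho> x * \<rho>' x\<bar> \<le> R * R' * r powr (- (a + b))"
    using 1(1) unfolding q abs_mult .
  moreover from this have "0 \<le> R * R' * r powr (- (a + b))"
    by linarith
  ultimately show "\<bar>\<rho> x * \<rho>' x\<bar> \<le> 2 * R * R' * r powr (- (a + b))"
    by linarith
  have "\<bar>partial i (\<lambda>x. \<rho> x * \<rho>' x) x\<bar> \<le> \<bar>\<rho> x\<bar> * \<bar>partial i \<rho>' x\<bar> + \<bar>partial i \<rho> x\<bar> * \<bar>\<rho>' x\<bar>"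
    unfolding partial_mult[OF \<rho>(3,6)] abs_mult[symmetric] by (rule abs_triangle_ineq)
  then show "\<bar>partial i (\<lambda>x. \<rho> x * \<rho>' x) x\<bar> \<le> 2 * R * R' * r powr (- (a + b) - 1)"
    using 1(2,3) unfolding q by linarith
qed

lemma scaled_bound_component:
  assumes "0 < r"
  shows "scaled_bound y r i (- 1) 2 (\<lambda>x. (x - y) $ j)"
  unfolding scaled_bound_def
proof (intro conjI ballI C1_on_component)
  fix x assume x: "x \<in> annulus r y"
  show "\<bar>(x - y) $ j\<bar> \<le> 2 * r powr - (- 1)"
    using component_le_norm_cart[of "x - y" j] x assms by (simp add: annulus_def)
  show "\<bar>partial i (\<lambda>x. (x - y) $ j) x\<bar> \<le> 2 * r powr (- (- 1) - 1)"
    unfolding partial_component using assms by simp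
qed

lemma scaled_bound_test_function:
  assumes "0 < r" "r \<le> 1" "\<phi> \<in> C01 \<Omega>" "\<And>x. \<bar>\<phi> x\<bar> \<le> F" "\<And>x. \<bar>partial i \<phi> x\<bar> \<le> F"
  shows "scaled_bound y r i 0 F \<phi>"
  unfolding scaled_bound_def
proof (intro conjI ballI C01_C1[OF assms(3)])
  fix x
  show "\<bar>\<phi> x\<bar> \<le> F * r powr - 0"
    using assms by simp
  have "0 \<le> F"
    using assms(4)[of x] by linarith
  then have "F * 1 \<le> F * r powr (- 0 - 1)"
    using assms(1,2) by (intro mult_left_mono) (simp_all add: powr_minus one_le_inverse_iff)
  then show "\<bar>partial i \<phi> x\<bar> \<le> F * r powr (- 0 - 1)"
    using assms(5)[of x] by linarith
qed

lemma powr_square_norm: "((norm z)\<^sup>2) powr (- n / 2) = norm z powr (- n)"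
proof (cases "z = 0")
  case False
  then have "(norm z)\<^sup>2 = norm z powr 2"
    by simp
  then show ?thesis
    by (simp only: powr_powr) simp
qed simp

lemma norm_radial_deriv:
  fixes B :: "real^'n^'n"
  assumes "(E has_real_derivative E') (at (norm (B *v (x - y))))" "0 < norm (B *v (x - y))"
  shows "((\<lambda>t. E (sqrt t)) has_real_derivative E' * (inverse (norm (B *v (x - y))) / 2)) (at ((norm (B *v (x - y)))\<^sup>2))"
    and "partial i (\<lambda>x. E (norm (B *v (x - y)))) x = E' * ((B *v (x - y)) \<bullet> (B *v axis i 1)) / norm (B *v (x - y))"
proof -
  let ?N = "norm (B *v (x - y))"
  have "(sqrt has_real_derivative inverse (sqrt (?N\<^sup>2)) / 2) (at (?N\<^sup>2))"
    using assms(2) by (intro DERIV_real_sqrt) simp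
  then have s: "(sqrt has_real_derivative inverse ?N / 2) (at (?N\<^sup>2))"
    by simp
  have "(E has_real_derivative E') (at (sqrt (?N\<^sup>2)))"
    using assms(1) by simp
  from DERIV_chain2[OF this s]
  show d: "((\<lambda>t. E (sqrt t)) has_real_derivative E' * (inverse ?N / 2)) (at (?N\<^sup>2))" .
  have "partial i (\<lambda>x. E (sqrt ((norm (B *v (x - y)))\<^sup>2))) x = E' * (inverse ?N / 2) * (2 * ((B *v (x - y)) \<bullet> (B *v axis i 1)))"
    by (rule partial_radial[where G = "\<lambda>t. E (sqrt t)", OF d])
  then show "partial i (\<lambda>x. E (norm (B *v (x - y)))) x = E' * ((B *v (x - y)) \<bullet> (B *v axis i 1)) / ?N"
    by (simp add: field_simps)
qed

context
  fixes B :: "real^'n^'n" and y :: "real^'n" and m l :: real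
  assumes m: "0 < m" "\<And>z. m * norm z \<le> norm (B *v z)" and l: "0 < l" "\<And>z. norm (B *v z) \<le> l * norm z"
begin

lemma N_annulus:
  assumes "x \<in> annulus r y"
  shows "norm (B *v (x - y)) \<in> {m * r<..<2 * l * r}"
proof -
  have x: "r < norm (x - y)" "norm (x - y) < 2 * r"
    using assms by (auto simp: annulus_def)
  have "m * r < m * norm (x - y)" "l * norm (x - y) < l * (2 * r)"
    using x m(1) l(1) by simp_all
  then show ?thesis
    using m(2)[of "x - y"] l(2)[of "x - y"] by simp
qed

lemma C1_on_norm_radial:
  assumes "\<And>s. s \<in> S \<Longrightarrow> (E has_real_derivative E' s) (at s)" "continuous_on S E'" "S \<subseteq> {0<..}"
    "\<And>x. x \<in> \<Omega> \<Longrightarrow> norm (B *v (x - y)) \<in> S"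
  shows "C1_on \<Omega> (\<lambda>x. E (norm (B *v (x - y))))"
proof -
  have "C1_on \<Omega> (\<lambda>x. E (sqrt ((norm (B *v (x - y)))\<^sup>2)))"
  proof (rule C1_on_radial[where T = "{t. 0 < t \<and> sqrt t \<in> S}" and G = "\<lambda>t. E (sqrt t)"
        and g = "\<lambda>t. E' (sqrt t) * (inverse (sqrt t) / 2)"])
    show "((\<lambda>t. E (sqrt t)) has_real_derivative E' (sqrt t) * (inverse (sqrt t) / 2)) (at t)"
      if "t \<in> {t. 0 < t \<and> sqrt t \<in> S}" for t
      using that by (intro DERIV_chain2[OF assms(1) DERIV_real_sqrt]) auto
    show "continuous_on {t. 0 < t \<and> sqrt t \<in> S} (\<lambda>t. E' (sqrt t) * (inverse (sqrt t) / 2))"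
      by (intro continuous_intros continuous_on_compose2[OF assms(2)]) auto
    show "(norm (B *v (x - y)))\<^sup>2 \<in> {t. 0 < t \<and> sqrt t \<in> S}" if "x \<in> \<Omega>" for x
      using assms(3,4) that by force
  qed
  then show ?thesis
    by simp
qed

lemma scaled_bound_norm_radial:
  assumes r: "0 < r"
    and E: "\<And>s. s \<in> {m * r<..<2 * l * r} \<Longrightarrow> (E has_real_derivative E' s) (at s)"
      "continuous_on {m * r<..<2 * l * r} E'"
    and R: "\<And>s. s \<in> {m * r<..<2 * l * r} \<Longrightarrow> \<bar>E s\<bar> \<le> R * r powr (- a)"
      "\<And>s. s \<in> {m * r<..<2 * l * r} \<Longrightarrow> \<bar>E' s\<bar> \<le> R * r powr (- a - 1)"
  shows "scaled_bound y r i a ((1 + l) * R) (\<lambda>x. E (norm (B *v (x - y))))"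
  unfolding scaled_bound_def
proof (intro conjI ballI)
  have mr: "0 < m * r"
    using m(1) r by simp
  show "C1_on (annulus r y) (\<lambda>x. E (norm (B *v (x - y))))"
    by (rule C1_on_norm_radial[OF E _ N_annulus]) (use mr in auto)
  fix x assume x: "x \<in> annulus r y"
  let ?N = "norm (B *v (x - y))"
  have N: "?N \<in> {m * r<..<2 * l * r}"
    by (rule N_annulus[OF x])
  then have "m * r < ?N"
    by simp
  then have N0: "0 < ?N"
    using mr by linarith
  have Rr: "0 \<le> R * r powr (- a)" "0 \<le> R * r powr (- a - 1)"
    using R[OF N] by linarith+
  show "\<bar>E ?N\<bar> \<le> (1 + l) * R * r powr (- a)"
    using R(1)[OF N] mult_nonneg_nonneg[OF less_imp_le[OF l(1)] Rr(1)] by (simp add: distrib_right mult.assoc)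
  have "\<bar>(B *v (x - y)) \<bullet> (B *v axis i 1)\<bar> \<le> ?N * norm (B *v axis i 1)"
    by (rule Cauchy_Schwarz_ineq2)
  also have "\<dots> \<le> ?N * l"
    using l(2)[of "axis i 1"] by (intro mult_left_mono) auto
  finally have "\<bar>(B *v (x - y)) \<bullet> (B *v axis i 1)\<bar> / ?N \<le> l"
    using N0 by (simp add: pos_divide_le_eq mult.commute)
  then have "\<bar>E' ?N\<bar> * (\<bar>(B *v (x - y)) \<bullet> (B *v axis i 1)\<bar> / ?N) \<le> R * r powr (- a - 1) * l"
    using R(2)[OF N] Rr(2) N0 by (intro mult_mono) auto
  then have "\<bar>partial i (\<lambda>x. E (norm (B *v (x - y)))) x\<bar> \<le> R * r powr (- a - 1) * l"
    unfolding norm_radial_deriv(2)[OF E(1)[OF N] N0] by (simp add: abs_mult)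
  then show "\<bar>partial i (\<lambda>x. E (norm (B *v (x - y)))) x\<bar> \<le> (1 + l) * R * r powr (- a - 1)"
    using Rr(2) by (simp add: algebra_simps)
qed

lemma powr_N_bound:
  assumes "0 < r" "s \<in> {m * r<..<2 * l * r}" "a \<le> 0"
  shows "s powr a \<le> m powr a * r powr a"
proof -
  have mr: "0 < m * r"
    using m(1) assms(1) by simp
  have "s powr a \<le> (m * r) powr a"
    using mr assms(2,3) by (intro powr_mono2') auto
  also have "\<dots> = m powr a * r powr a"
    by (rule powr_mult)
  finally show ?thesis .
qed

text \<open>
  The field is homogeneous of degree \<open>1 - n\<close>.
\<close>

lemma scaled_bound_flux_field:
  obtains R where "\<And>r i. 0 < r \<Longrightarrow> scaled_bound y r i (real CARD('n) - 1) R (flux_field B y j)"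
proof -
  let ?n = "real CARD('n)"
  define R where "R = max (m powr (- ?n)) (?n * m powr (- ?n - 1))"
  have "scaled_bound y r i (?n - 1) (2 * ((1 + l) * R) * 2) (flux_field B y j)" if r: "0 < r" for r i
  proof -
    have mr: "0 < m * r"
      using m(1) r by simp
    have "scaled_bound y r i ?n ((1 + l) * R) (\<lambda>x. norm (B *v (x - y)) powr (- ?n))"
    proof (rule scaled_bound_norm_radial[OF r, where E' = "\<lambda>s. - ?n * s powr (- ?n - 1)"])
      fix s assume s: "s \<in> {m * r<..<2 * l * r}"
      then have s0: "0 < s"
        using mr by auto
      show "((\<lambda>s. s powr - ?n) has_real_derivative - ?n * s powr (- ?n - 1)) (at s)"
        by (rule has_real_derivative_powr[OF s0])
      have "s powr (- ?n) \<le> m powr (- ?n) * r powr (- ?n)"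
        by (rule powr_N_bound[OF r s]) simp
      also have "\<dots> \<le> R * r powr (- ?n)"
        by (intro mult_right_mono) (auto simp: R_def)
      finally show "\<bar>s powr - ?n\<bar> \<le> R * r powr - ?n"
        by simp
      have "?n * s powr (- ?n - 1) \<le> ?n * (m powr (- ?n - 1) * r powr (- ?n - 1))"
        by (intro mult_left_mono powr_N_bound[OF r s]) auto
      also have "\<dots> \<le> R * r powr (- ?n - 1)"
        unfolding mult.assoc[symmetric] by (intro mult_right_mono) (auto simp: R_def)
      finally show "\<bar>- ?n * s powr (- ?n - 1)\<bar> \<le> R * r powr (- ?n - 1)"
        by (simp add: abs_mult)
    next
      show "continuous_on {m * r<..<2 * l * r} (\<lambda>s. - ?n * s powr (- ?n - 1))"
        using mr by (intro continuous_intros) auto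
    qed
    from scaled_bound_mult[OF r this scaled_bound_component[OF r]]
    have sb: "scaled_bound y r i (?n - 1) (2 * ((1 + l) * R) * 2) (\<lambda>x. norm (B *v (x - y)) powr (- ?n) * (x - y) $ j)"
      by simp
    have "norm (B *v (x - y)) powr (- ?n) * (x - y) $ j = flux_field B y j x" for x
    proof -
      have "((norm (B *v (x - y)))\<^sup>2) powr (- ?n / 2) = norm (B *v (x - y)) powr (- ?n)"
        by (rule powr_square_norm)
      then show ?thesis
        unfolding flux_field_def[OF m] by simp
    qed
    then show ?thesis
      using sb by simp
  qed
  then show thesis
    by (rule that)
qed

text \<open>
  The profile and its derivative are bounded like \<open>r powr (2 - n)\<close> and \<open>r powr (1 - n)\<close> because \<open>exp J\<close> is bounded.
\<close>

lemma scaled_bound_profile: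
  assumes n: "3 \<le> CARD('n)" and \<epsilon>: "0 < \<epsilon>" and cont: "continuous_on {0<..\<epsilon>} J"
    and K: "\<And>t. 0 < t \<Longrightarrow> t \<le> \<epsilon> \<Longrightarrow> exp (J t) \<le> K"
  obtains R where "\<And>r i. 0 < r \<Longrightarrow> 2 * l * r \<le> \<epsilon> / 2 \<Longrightarrow>
      scaled_bound y r i (real CARD('n) - 2) R (\<lambda>x. profile CARD('n) J \<epsilon> (norm (B *v (x - y))))"
proof -
  let ?n = "real CARD('n)"
  obtain C where C: "0 \<le> C" "\<And>r. 0 < r \<Longrightarrow> r \<le> \<epsilon> / 2 \<Longrightarrow> profile CARD('n) J \<epsilon> r \<le> C * r powr (2 - ?n)"
    using profile_bound[OF n \<epsilon> cont K] by metis
  have K0: "0 \<le> K"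
    using K[OF \<epsilon>] exp_gt_zero[of "J \<epsilon>"] by linarith
  define R where "R = max (C * m powr (2 - ?n)) (m powr (1 - ?n) * K)"
  have "scaled_bound y r i (?n - 2) ((1 + l) * R) (\<lambda>x. profile CARD('n) J \<epsilon> (norm (B *v (x - y))))"
    if r: "0 < r" "2 * l * r \<le> \<epsilon> / 2" for r i
  proof -
    have mr: "0 < m * r"
      using m(1) r by simp
    show ?thesis
    proof (rule scaled_bound_norm_radial[OF r(1), where E' = "\<lambda>s. - (s powr (1 - ?n) * exp (J s))"])
      fix s assume s: "s \<in> {m * r<..<2 * l * r}"
      then have s0: "0 < s" "s \<le> \<epsilon> / 2" "s < \<epsilon>"
        using mr r \<epsilon> by auto
      show "(profile CARD('n) J \<epsilon> has_real_derivative - (s powr (1 - ?n) * exp (J s))) (at s)"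
        by (rule profile_deriv[OF cont s0(1,3)])
      have "profile CARD('n) J \<epsilon> s \<le> C * s powr (2 - ?n)"
        by (rule C(2)[OF s0(1,2)])
      also have "\<dots> \<le> C * (m powr (2 - ?n) * r powr (2 - ?n))"
        using C(1) n by (intro mult_left_mono powr_N_bound[OF r(1) s]) auto
      also have "\<dots> \<le> R * r powr (2 - ?n)"
        unfolding mult.assoc[symmetric] by (intro mult_right_mono) (auto simp: R_def)
      finally show "\<bar>profile CARD('n) J \<epsilon> s\<bar> \<le> R * r powr - (?n - 2)"
        using profile_nonneg[of "CARD('n)" J \<epsilon> s] by simp
      have "s powr (1 - ?n) * exp (J s) \<le> (m powr (1 - ?n) * r powr (1 - ?n)) * K"
        using n s0 by (intro mult_mono K powr_N_bound[OF r(1) s]) auto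
      also have "\<dots> = (m powr (1 - ?n) * K) * r powr (1 - ?n)"
        by simp
      also have "\<dots> \<le> R * r powr (1 - ?n)"
        by (intro mult_right_mono) (auto simp: R_def)
      finally show "\<bar>- (s powr (1 - ?n) * exp (J s))\<bar> \<le> R * r powr (- (?n - 2) - 1)"
        by (simp add: abs_mult)
    next
      show "continuous_on {m * r<..<2 * l * r} (\<lambda>s. - (s powr (1 - ?n) * exp (J s)))"
        using mr r \<epsilon> by (intro continuous_intros continuous_on_subset[OF cont]) auto
    qed
  qed
  then show thesis
    by (rule that)
qed

text \<open>
  The function \<open>exp (J (N x))\<close> is a limit of functions that are bounded like a homogeneous function of degree \<open>0\<close>, with
  the same constant for all of them and for all \<open>r\<close>.
\<close>

lemma scaled_bound_steklov:
  assumes sv: "slowly_varying J C \<epsilon>" and C: "0 \<le> C" and \<epsilon>: "0 < \<epsilon>"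
    and K: "\<And>t. 0 < t \<Longrightarrow> t \<le> \<epsilon> \<Longrightarrow> exp (J t) \<le> K"
    and r: "0 < r" "2 * l * r < \<epsilon>"
  obtains E where "\<And>k::nat. \<And>i. scaled_bound y r i 0 ((1 + l) * (K * (1 + C / m))) (E k)"
    "\<And>x. x \<in> annulus r y \<Longrightarrow> (\<lambda>k. E k x) \<longlonglongrightarrow> exp (J (norm (B *v (x - y))))"
proof -
  let ?S = "{m * r<..<2 * l * r}"
  have mr: "0 < m * r"
    using m(1) r by simp
  have ml: "m * r < 2 * l * r"
  proof -
    have "m * norm (axis undefined 1 :: real^'n) \<le> l * norm (axis undefined 1 :: real^'n)"
      using m(2) l(2) order_trans by blast
    then have "m < 2 * l"
      using l(1) by simp
    then show ?thesis
      using r(1) by (rule mult_strict_right_mono)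
  qed
  have K0: "0 \<le> K"
    using K[OF \<epsilon>] exp_gt_zero[of "J \<epsilon>"] by linarith
  obtain E E' where E: "\<And>k t. t \<in> ?S \<Longrightarrow> (E k has_real_derivative E' k t) (at t)"
    "\<And>k::nat. continuous_on ?S (E' k)"
    "\<And>k t. t \<in> ?S \<Longrightarrow> 0 \<le> E k t \<and> E k t \<le> K"
    "\<And>k t. t \<in> ?S \<Longrightarrow> \<bar>E' k t\<bar> \<le> K * C / t"
    "\<And>t. t \<in> ?S \<Longrightarrow> (\<lambda>k. E k t) \<longlonglongrightarrow> exp (J t)"
    using steklov_approximation[OF sv K mr ml r(2)] by metis
  show thesis
  proof
    show "scaled_bound y r i 0 ((1 + l) * (K * (1 + C / m))) (\<lambda>x. E k (norm (B *v (x - y))))" for k i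
    proof (rule scaled_bound_norm_radial[OF r(1) E(1) E(2)])
      fix s assume s: "s \<in> ?S"
      have Kle: "K \<le> K * (1 + C / m)"
        using K0 C m(1) by (simp add: mult_le_cancel_left1)
      show "\<bar>E k s\<bar> \<le> K * (1 + C / m) * r powr - 0"
        using E(3)[OF s, of k] Kle r(1) by simp
      have "m * r < s"
        using s by simp
      then have s0: "0 < s"
        using mr by linarith
      have "\<bar>E' k s\<bar> \<le> K * C / s"
        by (rule E(4)[OF s])
      also have "\<dots> \<le> K * C / (m * r)"
        by (rule divide_left_mono[OF less_imp_le[OF \<open>m * r < s\<close>] mult_nonneg_nonneg[OF K0 C] mult_pos_pos[OF s0 mr]])
      also have "\<dots> = K * (C / m) * r powr (- 1)"
        using r(1) by (simp add: powr_minus divide_inverse)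
      also have "\<dots> \<le> K * (1 + C / m) * r powr (- 1)"
        using K0 by (intro mult_right_mono mult_left_mono) auto
      finally show "\<bar>E' k s\<bar> \<le> K * (1 + C / m) * r powr (- 0 - 1)"
        by simp
    qed
    show "(\<lambda>k. E k (norm (B *v (x - y)))) \<longlonglongrightarrow> exp (J (norm (B *v (x - y))))" if "x \<in> annulus r y" for x
      by (rule E(5)[OF N_annulus[OF that]])
  qed
qed

end

lemma trace_scaled:
  fixes y :: "real^'n"
  assumes w: "has_weak_partial (ball y \<delta> - {y}) i w w'" and r: "0 < r" "2 * r < \<delta>" and k: "1 \<le> k"
    and \<rho>: "scaled_bound y r i a R \<rho>"
  shows "integrable lebesgue (\<lambda>x. w x * (\<rho> x * partial i (annulus_cut y r k) x))"
    and "\<bar>LINT x|lebesgue. w x * (\<rho> x * partial i (annulus_cut y r k) x)\<bar>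
    \<le> trace_constant * R * (r powr (- a) * annulus_L1 r y w' + r powr (- a - 1) * annulus_L1 r y w)"
proof -
  let ?\<Omega> = "ball y \<delta> - {y}"
  have op: "open ?\<Omega>"
    by auto
  have sub: "annulus r y \<subseteq> ?\<Omega>"
    using r by (auto simp: annulus_def dist_norm norm_minus_commute)
  have wA: "has_weak_partial (annulus r y) i w w'"
    by (rule has_weak_partial_subset[OF w op open_annulus sub])
  have C1: "C1_on (annulus r y) \<rho>"
    using \<rho> by (simp add: scaled_bound_def)
  have loc: "Lp_loc ?\<Omega> 1 w" "Lp_loc ?\<Omega> 1 w'"
    using w by (auto simp: has_weak_partial_def)
  have K: "{x. r \<le> norm (x - y) \<and> norm (x - y) \<le> 2 * r} \<subseteq> ?\<Omega>"
    using r by (auto simp: dist_norm norm_minus_commute)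
  have int: "set_integrable lebesgue (annulus r y) f" if "Lp_loc ?\<Omega> 1 f" for f
  proof -
    have "set_integrable lebesgue {x. r \<le> norm (x - y) \<and> norm (x - y) \<le> 2 * r} f"
      unfolding set_integrable_def by (rule Lp_loc_1_set_integrable[OF that op closed_annulus_compact K])
    moreover have "annulus r y \<in> sets lebesgue"
      using open_annulus[of r y] by auto
    moreover have "annulus r y \<subseteq> {x. r \<le> norm (x - y) \<and> norm (x - y) \<le> 2 * r}"
      by (auto simp: annulus_def)
    ultimately show ?thesis
      by (rule set_integrable_subset)
  qed
  have pr: "R * r powr (- a) / r = R * r powr (- a - 1)"
    using r by (simp add: powr_diff)
  have "\<bar>LINT x|lebesgue. w x * (\<rho> x * partial i (annulus_cut y r k) x)\<bar>
      \<le> trace_constant * (R * r powr (- a)) * (annulus_L1 r y w' + annulus_L1 r y w / r)"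
    by (rule trace_bound[OF r(1) k wA int[OF loc(1)] int[OF loc(2)] C1]) (use \<rho> pr in \<open>auto simp: scaled_bound_def\<close>)
  also have "\<dots> = trace_constant * R * (r powr (- a) * annulus_L1 r y w' + r powr (- a - 1) * annulus_L1 r y w)"
    using r by (simp add: powr_diff algebra_simps)
  finally show "\<bar>LINT x|lebesgue. w x * (\<rho> x * partial i (annulus_cut y r k) x)\<bar>
    \<le> trace_constant * R * (r powr (- a) * annulus_L1 r y w' + r powr (- a - 1) * annulus_L1 r y w)" .
  show "integrable lebesgue (\<lambda>x. w x * (\<rho> x * partial i (annulus_cut y r k) x))"
    using wA Lp_loc_1_times_C01(1)[OF _ open_annulus C01_times_partial_annulus_cut[OF r(1) k C1]]
    by (auto simp: has_weak_partial_def)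
qed

text \<open>
  The inequality contains only bounds on the weight, so it passes to pointwise limits of weights by dominated
  convergence, even when the limit is not differentiable.
\<close>

lemma trace_scaled_limit:
  fixes y :: "real^'n"
  assumes w: "has_weak_partial (ball y \<delta> - {y}) i w w'" and r: "0 < r" "2 * r < \<delta>" and k: "1 \<le> k"
    and \<rho>: "\<And>j::nat. scaled_bound y r i a R (\<rho>s j)"
    and lim: "\<And>x. x \<in> annulus r y \<Longrightarrow> (\<lambda>j. \<rho>s j x) \<longlonglongrightarrow> \<rho> x"
  shows "integrable lebesgue (\<lambda>x. w x * (\<rho> x * partial i (annulus_cut y r k) x))"
    and "\<bar>LINT x|lebesgue. w x * (\<rho> x * partial i (annulus_cut y r k) x)\<bar>
    \<le> trace_constant * R * (r powr (- a) * annulus_L1 r y w' + r powr (- a - 1) * annulus_L1 r y w)"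
proof -
  let ?u = "partial i (annulus_cut y r k)"
  have u: "?u \<in> C01 (annulus r y)"
    using C01_times_partial_annulus_cut[OF r(1) k C1_on_const[of _ 1]] by simp
  have op: "open (ball y \<delta> - {y})"
    by auto
  have sub: "annulus r y \<subseteq> ball y \<delta> - {y}"
    using r by (auto simp: annulus_def dist_norm norm_minus_commute)
  have int_u: "integrable lebesgue (\<lambda>x. w x * ?u x)"
    using w Lp_loc_1_times_C01(1)[OF _ op C01_mono[OF u sub]] by (auto simp: has_weak_partial_def)
  then have dom: "integrable lebesgue (\<lambda>x. R * r powr (- a) * \<bar>w x * ?u x\<bar>)"
    by (intro integrable_mult_right integrable_abs)
  have int_j: "(\<lambda>x. w x * (\<rho>s j x * ?u x)) \<in> borel_measurable lebesgue" for j
    by (rule borel_measurable_integrable[OF trace_scaled(1)[OF w r k \<rho>]])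
  have ptw: "(\<lambda>j. w x * (\<rho>s j x * ?u x)) \<longlonglongrightarrow> w x * (\<rho> x * ?u x)" for x
  proof (cases "x \<in> annulus r y")
    case True
    then show ?thesis
      by (intro tendsto_intros lim)
  next
    case False
    then show ?thesis
      using C01_outside(1)[OF u] by simp
  qed
  have meas: "(\<lambda>x. w x * (\<rho> x * ?u x)) \<in> borel_measurable lebesgue"
    by (rule borel_measurable_LIMSEQ_real[OF ptw int_j])
  have bd: "norm (w x * (\<rho>s j x * ?u x)) \<le> R * r powr (- a) * \<bar>w x * ?u x\<bar>" for j x
  proof (cases "x \<in> annulus r y")
    case True
    then have "\<bar>\<rho>s j x\<bar> \<le> R * r powr (- a)"
      using \<rho>[of j] by (simp add: scaled_bound_def)
    then have "\<bar>\<rho>s j x\<bar> * \<bar>w x * ?u x\<bar> \<le> R * r powr (- a) * \<bar>w x * ?u x\<bar>"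
      by (intro mult_right_mono) auto
    then show ?thesis
      by (simp add: abs_mult mult_ac)
  next
    case False
    then show ?thesis
      using C01_outside(1)[OF u] by simp
  qed
  have conv: "(\<lambda>j. LINT x|lebesgue. w x * (\<rho>s j x * ?u x)) \<longlonglongrightarrow> (LINT x|lebesgue. w x * (\<rho> x * ?u x))"
    by (rule integral_dominated_convergence[where w = "\<lambda>x. R * r powr (- a) * \<bar>w x * ?u x\<bar>"])
       (use meas int_j dom ptw bd in auto)
  show "integrable lebesgue (\<lambda>x. w x * (\<rho> x * ?u x))"
    by (rule integrable_dominated_convergence[where w = "\<lambda>x. R * r powr (- a) * \<bar>w x * ?u x\<bar>"
          and s = "\<lambda>j x. w x * (\<rho>s j x * ?u x)"])
       (use meas int_j dom ptw bd in auto)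
  have "(\<lambda>j. \<bar>LINT x|lebesgue. w x * (\<rho>s j x * ?u x)\<bar>) \<longlonglongrightarrow> \<bar>LINT x|lebesgue. w x * (\<rho> x * ?u x)\<bar>"
    using conv by (rule tendsto_rabs)
  then show "\<bar>LINT x|lebesgue. w x * (\<rho> x * ?u x)\<bar>
    \<le> trace_constant * R * (r powr (- a) * annulus_L1 r y w' + r powr (- a - 1) * annulus_L1 r y w)"
    by (rule LIMSEQ_le_const2) (use trace_scaled(2)[OF w r k \<rho>] in blast)
qed

section \<open>Integration by parts with cutoffs\<close>

lemma continuous_on_times_compact_support:
  fixes g \<psi> :: "real^'n \<Rightarrow> real"
  assumes "open \<Omega>" "continuous_on \<Omega> g" "continuous_on UNIV \<psi>" "compact K" "K \<subseteq> \<Omega>" "\<And>x. x \<notin> K \<Longrightarrow> \<psi> x = 0"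
  shows "continuous_on UNIV (\<lambda>x. g x * \<psi> x)"
proof -
  have "open (- K)"
    using assms(4) by (simp add: open_Compl compact_imp_closed)
  moreover have "continuous_on \<Omega> (\<lambda>x. g x * \<psi> x)"
    using assms(2) continuous_on_subset[OF assms(3)] by (intro continuous_intros) auto
  moreover have "continuous_on (- K) (\<lambda>x. g x * \<psi> x)"
  proof (rule continuous_on_eq[OF continuous_on_const[of _ 0]])
    show "0 = g x * \<psi> x" if "x \<in> - K" for x
      using assms(6)[of x] that by simp
  qed
  ultimately have "continuous_on (\<Omega> \<union> - K) (\<lambda>x. g x * \<psi> x)"
    using assms(1) by (intro continuous_on_open_Un)
  moreover have "\<Omega> \<union> - K = UNIV"
    using assms(5) by auto
  ultimately show ?thesis
    by simp
qed

text \<open>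
  The product rule is moved to the test function: \<open>P \<psi>\<close> is again a test function on \<open>\<Omega>\<close>, even though \<open>P\<close> may
  be irregular outside.
\<close>

lemma weak_product_by_parts:
  fixes P u u' \<psi> :: "real^'n \<Rightarrow> real"
  assumes op: "open \<Omega>" and u: "has_weak_partial \<Omega> j u u'" and P: "C1_on \<Omega> P" and \<psi>: "\<psi> \<in> C01 \<Omega>"
  shows "integrable lebesgue (\<lambda>x. (P x * u x) * partial j \<psi> x)"
    and "integrable lebesgue (\<lambda>x. u x * (partial j P x * \<psi> x))"
    and "(LINT x|lebesgue. (P x * u x) * partial j \<psi> x)
      = - (LINT x|lebesgue. u' x * (P x * \<psi> x)) - (LINT x|lebesgue. u x * (partial j P x * \<psi> x))"
proof -
  have loc: "Lp_loc \<Omega> 1 u"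
    using u by (simp add: has_weak_partial_def)
  obtain K where K: "compact K" "K \<subseteq> \<Omega>" "\<And>x. x \<notin> K \<Longrightarrow> \<psi> x = 0" "\<And>x i. x \<notin> K \<Longrightarrow> partial i \<psi> x = 0"
    using C01_support[OF \<psi>] by metis
  have "integrable lebesgue (\<lambda>x. u x * (P x * partial j \<psi> x))"
    by (rule Lp_loc_1_times_integrable[OF loc op K(1,2)
          continuous_on_times_compact_support[OF op C1_on_continuous[OF P] C01_continuous(2)[OF \<psi>] K(1,2,4)]])
       (simp_all add: K(4))
  then show 1: "integrable lebesgue (\<lambda>x. (P x * u x) * partial j \<psi> x)"
    by (simp add: mult_ac)
  have cont: "continuous_on \<Omega> (partial j P)"
    using P by (simp add: C1_on_def)
  show 2: "integrable lebesgue (\<lambda>x. u x * (partial j P x * \<psi> x))"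
    by (rule Lp_loc_1_times_integrable[OF loc op K(1,2)
          continuous_on_times_compact_support[OF op cont C01_continuous(1)[OF \<psi>] K(1,2,3)]])
       (simp_all add: K(3))
  have P\<psi>: "(\<lambda>x. P x * \<psi> x) \<in> C01 \<Omega>"
    by (rule C01_mult[OF op P \<psi>])
  have part: "u x * partial j (\<lambda>x. P x * \<psi> x) x = (P x * u x) * partial j \<psi> x + u x * (partial j P x * \<psi> x)" for x
  proof (cases "x \<in> \<Omega>")
    case True
    then have "P differentiable (at x)"
      using P by (simp add: C1_on_def)
    from partial_mult[OF this C01_differentiable[OF \<psi>]] show ?thesis
      by (simp add: algebra_simps)
  next
    case False
    then show ?thesis
      using C01_outside[OF \<psi> False] C01_outside(2)[OF P\<psi> False] by simp
  qed
  have "- (LINT x|lebesgue. u' x * (P x * \<psi> x)) = (LINT x|lebesgue. u x * partial j (\<lambda>x. P x * \<psi> x) x)"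
    by (rule weak_partial_by_parts[OF u op P\<psi>, symmetric])
  also have "\<dots> = (LINT x|lebesgue. (P x * u x) * partial j \<psi> x) + (LINT x|lebesgue. u x * (partial j P x * \<psi> x))"
    unfolding part by (rule Bochner_Integration.integral_add[OF 1 2])
  finally show "(LINT x|lebesgue. (P x * u x) * partial j \<psi> x)
      = - (LINT x|lebesgue. u' x * (P x * \<psi> x)) - (LINT x|lebesgue. u x * (partial j P x * \<psi> x))"
    by simp
qed

lemma has_weak_partial_1_plus:
  fixes u u' :: "real^'n \<Rightarrow> real"
  assumes op: "open \<Omega>" and u: "has_weak_partial \<Omega> j u u'"
  shows "has_weak_partial \<Omega> j (\<lambda>x. 1 + u x) u'"
proof (rule has_weak_partialI[OF op])
  have loc: "Lp_loc \<Omega> 1 u" "Lp_loc \<Omega> 1 u'"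
    using u by (auto simp: has_weak_partial_def)
  show "Lp_loc \<Omega> 1 u'" by (fact loc)
  show "Lp_loc \<Omega> 1 (\<lambda>x. 1 + u x)"
  proof (rule Lp_loc_1I)
    show "(\<lambda>x. 1 + u x) \<in> borel_measurable (lebesgue_on \<Omega>)"
      using loc(1) by (auto simp: Lp_loc_def)
    fix K assume K: "compact K" "K \<subseteq> \<Omega>"
    have "integrable lebesgue (\<lambda>x. indicator K x *\<^sub>R 1 + indicator K x *\<^sub>R u x)"
      using lmeasurable_compact[OF K(1)] Lp_loc_1_set_integrable[OF loc(1) op K]
      by (intro Bochner_Integration.integrable_add) (auto simp: fmeasurable_def)
    then show "integrable lebesgue (\<lambda>x. indicator K x *\<^sub>R (1 + u x))"
      by (simp add: distrib_left)
  qed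
  fix \<psi> assume \<psi>: "\<psi> \<in> C01 \<Omega>"
  have "(LINT x|lebesgue. (1 + u x) * partial j \<psi> x) = (LINT x|lebesgue. partial j \<psi> x + u x * partial j \<psi> x)"
    by (simp add: distrib_right)
  also have "\<dots> = (LINT x|lebesgue. partial j \<psi> x) + (LINT x|lebesgue. u x * partial j \<psi> x)"
    by (rule Bochner_Integration.integral_add[OF C01_integrable(2)[OF \<psi>] Lp_loc_1_times_C01(2)[OF loc(1) op \<psi>]])
  also have "\<dots> = - (LINT x|lebesgue. u' x * \<psi> x)"
    unfolding integral_partial_0[OF \<psi>] weak_partial_by_parts[OF u op \<psi>] by simp
  finally show "(LINT x|lebesgue. (1 + u x) * partial j \<psi> x) = - (LINT x|lebesgue. u' x * \<psi> x)" .
qed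

lemma W2p_loc_weak_partials:
  assumes "W2p_loc \<Omega> p w"
  shows "has_weak_partial \<Omega> i w (weak_partial \<Omega> i w)"
    and "has_weak_partial \<Omega> i (weak_partial \<Omega> j w) (weak_partial \<Omega> i (weak_partial \<Omega> j w))"
proof -
  obtain g where "has_weak_partial \<Omega> i w g"
    using assms unfolding W2p_loc_def by blast
  then show "has_weak_partial \<Omega> i w (weak_partial \<Omega> i w)"
    by (rule weak_partial_works)
  obtain g where "has_weak_partial \<Omega> i (weak_partial \<Omega> j w) g"
    using assms unfolding W2p_loc_def by blast
  then show "has_weak_partial \<Omega> i (weak_partial \<Omega> j w) (weak_partial \<Omega> i (weak_partial \<Omega> j w))"
    by (rule weak_partial_works)
qed

text \<open>
  Where \<open>|x - y| > \<eta>\<close> and \<open>\<phi>\<close> or its gradient does not vanish, \<open>x\<close> stays in a compact subset of the punctured ball.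
\<close>

lemma LZ_integrand_integrable:
  fixes A :: "real^'n \<Rightarrow> real^'n^'n" and y :: "real^'n"
  assumes A_meas: "A \<in> borel_measurable lebesgue" and A_bdd: "bounded (range A)"
    and Z: "W2p_loc (ball y \<epsilon> - {y}) p Z" and \<phi>: "\<phi> \<in> C01 (ball y \<epsilon>)" and \<eta>: "0 < \<eta>"
  shows "set_integrable lebesgue (ball y \<epsilon> \<inter> {x. \<eta> < norm (x - y)}) (LZ_integrand A y (ball y \<epsilon>) Z \<phi>)"
proof -
  let ?\<Omega> = "ball y \<epsilon> - {y}" and ?S = "ball y \<epsilon> \<inter> {x. \<eta> < norm (x - y)}"
  have op: "open ?\<Omega>"
    by auto
  obtain K0 where K0: "compact K0" "K0 \<subseteq> ball y \<epsilon>" "\<And>x. x \<notin> K0 \<Longrightarrow> \<phi> x = 0" "\<And>x i. x \<notin> K0 \<Longrightarrow> partial i \<phi> x = 0"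
    using C01_support[OF \<phi>] by metis
  let ?K = "K0 - ball y \<eta>"
  have K: "compact ?K" "?K \<subseteq> ?\<Omega>"
    using K0(1,2) \<eta> by (auto intro: compact_diff)
  have S: "?S \<in> sets lebesgue"
  proof -
    have "?S = ball y \<epsilon> - cball y \<eta>"
      by (auto simp: dist_norm norm_minus_commute)
    then show ?thesis
      by simp
  qed
  obtain a where a: "\<And>z. norm (A z) \<le> a"
    using A_bdd by (auto simp: bounded_iff)
  have a_comp: "\<bar>A z $ i $ j\<bar> \<le> a" for z i j
    using norm_vec_le_sum(2)[of "A z" i] norm_vec_le_sum(2)[of "A z $ i" j] a[of z] by simp
  have loc: "Lp_loc ?\<Omega> 1 (weak_partial ?\<Omega> i Z)" "Lp_loc ?\<Omega> 1 (weak_partial ?\<Omega> i (weak_partial ?\<Omega> j Z))" for i j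
    using W2p_loc_weak_partials[OF Z] by (auto simp: has_weak_partial_def)
  have cont_meas: "f \<in> borel_measurable lebesgue" if "continuous_on UNIV f" for f :: "real^'n \<Rightarrow> real"
    using that by (intro measurable_completion) (simp add: borel_measurable_continuous_onI)
  obtain F0 where F0: "\<And>x. \<bar>\<phi> x\<bar> \<le> F0"
    using continuous_compact_support_bounded[OF C01_continuous(1)[OF \<phi>] K0(1,3)] by metis
  have F1: "\<exists>F. \<forall>x. \<bar>partial j \<phi> x\<bar> \<le> F" for j
    using continuous_compact_support_bounded[OF C01_continuous(2)[OF \<phi>] K0(1,4)] by metis
  have int1: "integrable lebesgue (\<lambda>x. (indicator ?K x *\<^sub>R weak_partial ?\<Omega> i (weak_partial ?\<Omega> j Z) x)
      * ((A x $ i $ j - A y $ i $ j) * (\<phi> x * indicator ?S x)))" for i j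
  proof (rule integrable_mult_bounded[OF Lp_loc_1_set_integrable[OF loc(2) op K]])
    show "(\<lambda>x. (A x $ i $ j - A y $ i $ j) * (\<phi> x * indicator ?S x)) \<in> borel_measurable lebesgue"
      using measurable_matrix_component[OF A_meas] cont_meas[OF C01_continuous(1)[OF \<phi>]] S
      by (intro borel_measurable_times borel_measurable_diff borel_measurable_const borel_measurable_indicator)
    show "\<bar>(A x $ i $ j - A y $ i $ j) * (\<phi> x * indicator ?S x)\<bar> \<le> (a + a) * (F0 * 1)" for x
    proof -
      have "\<bar>A x $ i $ j - A y $ i $ j\<bar> \<le> a + a"
        using a_comp[of x i j] a_comp[of y i j] by linarith
      then show ?thesis
        unfolding abs_mult using F0[of x] by (intro mult_mono) (auto simp: indicator_def)
    qed
  qed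
  have int2: "integrable lebesgue (\<lambda>x. A y $ i $ j * ((indicator ?K x *\<^sub>R weak_partial ?\<Omega> i Z x)
      * (partial j \<phi> x * indicator ?S x)))" for i j
  proof -
    obtain F where F: "\<And>x. \<bar>partial j \<phi> x\<bar> \<le> F"
      using F1 by metis
    have "integrable lebesgue (\<lambda>x. (indicator ?K x *\<^sub>R weak_partial ?\<Omega> i Z x) * (partial j \<phi> x * indicator ?S x))"
    proof (rule integrable_mult_bounded[OF Lp_loc_1_set_integrable[OF loc(1) op K]])
      show "(\<lambda>x. partial j \<phi> x * indicator ?S x) \<in> borel_measurable lebesgue"
        using cont_meas[OF C01_continuous(2)[OF \<phi>]] S
        by (intro borel_measurable_times borel_measurable_indicator)
      show "\<bar>partial j \<phi> x * indicator ?S x\<bar> \<le> F * 1" for x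
        unfolding abs_mult using F[of x] by (intro mult_mono) (auto simp: indicator_def)
    qed
    then show ?thesis
      by (rule integrable_mult_right)
  qed
  have "integrable lebesgue (\<lambda>x. \<Sum>i\<in>UNIV. \<Sum>j\<in>UNIV.
      (indicator ?K x *\<^sub>R weak_partial ?\<Omega> i (weak_partial ?\<Omega> j Z) x) * ((A x $ i $ j - A y $ i $ j) * (\<phi> x * indicator ?S x))
      - A y $ i $ j * ((indicator ?K x *\<^sub>R weak_partial ?\<Omega> i Z x) * (partial j \<phi> x * indicator ?S x)))"
    by (intro Bochner_Integration.integrable_sum Bochner_Integration.integrable_diff int1 int2)
  also have "(\<lambda>x. \<Sum>i\<in>UNIV. \<Sum>j\<in>UNIV.
      (indicator ?K x *\<^sub>R weak_partial ?\<Omega> i (weak_partial ?\<Omega> j Z) x) * ((A x $ i $ j - A y $ i $ j) * (\<phi> x * indicator ?S x))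
      - A y $ i $ j * ((indicator ?K x *\<^sub>R weak_partial ?\<Omega> i Z x) * (partial j \<phi> x * indicator ?S x)))
      = (\<lambda>x. indicator ?S x *\<^sub>R LZ_integrand A y (ball y \<epsilon>) Z \<phi> x)"
  proof
    fix x
    show "(\<Sum>i\<in>UNIV. \<Sum>j\<in>UNIV.
      (indicator ?K x *\<^sub>R weak_partial ?\<Omega> i (weak_partial ?\<Omega> j Z) x) * ((A x $ i $ j - A y $ i $ j) * (\<phi> x * indicator ?S x))
      - A y $ i $ j * ((indicator ?K x *\<^sub>R weak_partial ?\<Omega> i Z x) * (partial j \<phi> x * indicator ?S x)))
      = indicator ?S x *\<^sub>R LZ_integrand A y (ball y \<epsilon>) Z \<phi> x"
    proof (cases "x \<in> ?S")
      case False
      then have "indicator ?S x = (0::real)"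
        by (rule indicator_simps(2))
      then show ?thesis
        by simp
    next
      case S: True
      then have i: "indicator ?S x = (1::real)"
        by (rule indicator_simps(1))
      show ?thesis
      proof (cases "x \<in> K0")
        case True
        then have "x \<in> ?K"
          using S by (auto simp: dist_norm norm_minus_commute)
        then have "indicator ?K x = (1::real)"
          by (rule indicator_simps(1))
        then show ?thesis
          unfolding i LZ_integrand_def weak_hess_def weak_grad_def by (simp add: mult_ac)
      next
        case False
        then show ?thesis
          unfolding i LZ_integrand_def by (simp add: K0(3,4))
      qed
    qed
  qed
  finally show ?thesis
    by (simp only: set_integrable_def)
qed

lemma annulus_cut_range: "0 \<le> annulus_cut y r k x" "annulus_cut y r k x \<le> 1"
  by (simp_all add: annulus_cut_eq step_range)

lemma annulus_cut_C1: "C1_on S (annulus_cut y r k)"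
  unfolding annulus_cut_def by (rule C1_on_ellip_cut)

text \<open>
  On the open set \<open>|x - y| > sqrt 2 * r\<close> the cutoffs tend to \<open>1\<close>, elsewhere they vanish.
\<close>

lemma cut_integral_tendsto:
  fixes F :: "real^'n \<Rightarrow> real"
  assumes r: "0 < r" and F: "set_integrable lebesgue (U \<inter> {x. sqrt 2 * r < norm (x - y)}) F"
    and out: "\<And>x. x \<notin> U \<Longrightarrow> F x = 0"
  shows "(\<lambda>k. LINT x|lebesgue. F x * annulus_cut y r (real (Suc k)) x)
    \<longlonglongrightarrow> (LINT x:(U \<inter> {x. sqrt 2 * r < norm (x - y)})|lebesgue. F x)"
proof -
  let ?S = "U \<inter> {x. sqrt 2 * r < norm (x - y)}"
  have S_iff: "sqrt 2 * r < norm (x - y) \<longleftrightarrow> 0 < (norm (x - y))\<^sup>2 / r\<^sup>2 - 2" for x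
  proof -
    have "sqrt 2 * r < norm (x - y) \<longleftrightarrow> (sqrt 2 * r)\<^sup>2 < (norm (x - y))\<^sup>2"
      using r power2_less_imp_less[of "sqrt 2 * r" "norm (x - y)"] power_strict_mono[of "sqrt 2 * r" "norm (x - y)" 2]
      by auto
    also have "\<dots> \<longleftrightarrow> 0 < (norm (x - y))\<^sup>2 / r\<^sup>2 - 2"
      using r by (simp add: power_mult_distrib pos_less_divide_eq)
    finally show ?thesis .
  qed
  have zero: "F x * annulus_cut y r (real (Suc k)) x = (indicator ?S x *\<^sub>R F x) * annulus_cut y r (real (Suc k)) x" for k x
  proof (cases "x \<in> ?S")
    case False
    have "F x * annulus_cut y r (real (Suc k)) x = 0"
    proof (cases "x \<in> U")
      case True
      then have "\<not> 0 < (norm (x - y))\<^sup>2 / r\<^sup>2 - 2"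
        using False S_iff by blast
      then have "annulus_cut y r (real (Suc k)) x = 0"
        unfolding annulus_cut_eq by (intro step_eq_0 mult_nonneg_nonpos) auto
      then show ?thesis
        by simp
    qed (simp add: out)
    then show ?thesis
      using False by simp
  qed simp
  have int: "integrable lebesgue (\<lambda>x. indicator ?S x *\<^sub>R F x)"
    using F by (simp add: set_integrable_def)
  show ?thesis
    unfolding set_lebesgue_integral_def zero
  proof (rule integral_dominated_convergence[where w = "\<lambda>x. norm (indicator ?S x *\<^sub>R F x)"])
    show "(\<lambda>x. indicator ?S x *\<^sub>R F x) \<in> borel_measurable lebesgue"
      using int by (rule borel_measurable_integrable)
    have "annulus_cut y r (real (Suc k)) \<in> borel_measurable lebesgue" for k
    proof (rule measurable_completion)
      show "annulus_cut y r (real (Suc k)) \<in> borel_measurable lborel"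
        unfolding measurable_lborel1 measurable_lborel2 by (rule borel_measurable_continuous_onI[OF C1_on_continuous[OF annulus_cut_C1]])
    qed
    then show "(\<lambda>x. indicator ?S x *\<^sub>R F x * annulus_cut y r (real (Suc k)) x) \<in> borel_measurable lebesgue" for k
      by (rule borel_measurable_times[OF borel_measurable_integrable[OF int]])
    show "integrable lebesgue (\<lambda>x. norm (indicator ?S x *\<^sub>R F x))"
      using int by (rule integrable_norm)
    show "AE x in lebesgue. norm (indicator ?S x *\<^sub>R F x * annulus_cut y r (real (Suc k)) x) \<le> norm (indicator ?S x *\<^sub>R F x)" for k
    proof (rule AE_I2)
      fix x
      show "norm (indicator ?S x *\<^sub>R F x * annulus_cut y r (real (Suc k)) x) \<le> norm (indicator ?S x *\<^sub>R F x)"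
        using mult_left_le[of "\<bar>annulus_cut y r (real (Suc k)) x\<bar>" "\<bar>indicator ?S x *\<^sub>R F x\<bar>"]
          annulus_cut_range[of y r "real (Suc k)" x]
        by (simp add: abs_mult)
    qed
    show "AE x in lebesgue. (\<lambda>k. indicator ?S x *\<^sub>R F x * annulus_cut y r (real (Suc k)) x) \<longlonglongrightarrow> indicator ?S x *\<^sub>R F x"
    proof (rule AE_I2)
      fix x
      show "(\<lambda>k. indicator ?S x *\<^sub>R F x * annulus_cut y r (real (Suc k)) x) \<longlonglongrightarrow> indicator ?S x *\<^sub>R F x"
      proof (cases "x \<in> ?S")
        case True
        then have "0 < (norm (x - y))\<^sup>2 / r\<^sup>2 - 2"
          using S_iff by blast
        then have "(\<lambda>k. annulus_cut y r (real (Suc k)) x) \<longlonglongrightarrow> 1"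
          using step_tendsto[of "(norm (x - y))\<^sup>2 / r\<^sup>2 - 2"] unfolding annulus_cut_eq by simp
        from tendsto_mult_left[OF this, of "indicator ?S x *\<^sub>R F x"] show ?thesis
          by simp
      qed simp
    qed
  qed
qed

text \<open>
  The equation removes \<open>a\<^sub>i\<^sub>j(x) \<partial>\<^sub>i\<partial>\<^sub>jZ\<close>. In what is left one derivative is moved from \<open>\<partial>\<^sub>i\<partial>\<^sub>jZ\<close> to \<open>\<phi> u\<close>, where \<open>u\<close> is the
  cutoff; the terms with \<open>\<partial>\<^sub>i\<phi>\<close> cancel by the symmetry of \<open>A y\<close>, and the gradient of \<open>u\<close> survives.
\<close>

lemma cut_pairing:
  fixes A :: "real^'n \<Rightarrow> real^'n^'n" and y :: "real^'n"
  assumes sol: "strong_solution A p (ball y \<epsilon> - {y}) Z" and sym: "transpose (A y) = A y"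
    and \<phi>: "\<phi> \<in> C01 (ball y \<epsilon>)" and r: "0 < r" and k: "1 \<le> k"
    and ann: "annulus r y \<subseteq> ball y \<epsilon>"
  shows "(LINT x|lebesgue. LZ_integrand A y (ball y \<epsilon>) Z \<phi> x * annulus_cut y r k x)
    = (\<Sum>i\<in>UNIV. \<Sum>j\<in>UNIV. A y $ i $ j *
        (LINT x|lebesgue. weak_partial (ball y \<epsilon> - {y}) j Z x * (\<phi> x * partial i (annulus_cut y r k) x)))"
proof -
  let ?\<Omega> = "ball y \<epsilon> - {y}"
  define u where "u = annulus_cut y r k"
  define \<tau> where "\<tau> = (\<lambda>x. \<phi> x * u x)"
  define g where "g = (\<lambda>i. weak_partial ?\<Omega> i Z)"
  define h where "h = (\<lambda>i j. weak_partial ?\<Omega> i (g j))"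
  have op: "open ?\<Omega>"
    by auto
  have W: "W2p_loc ?\<Omega> p Z"
    using sol by (simp add: strong_solution_def)
  have D2: "has_weak_partial ?\<Omega> i (g j) (h i j)" for i j
    unfolding g_def h_def by (rule W2p_loc_weak_partials[OF W])
  have loc: "Lp_loc ?\<Omega> 1 (g i)" "Lp_loc ?\<Omega> 1 (h i j)" for i j
    using D2 by (auto simp: has_weak_partial_def)
  obtain K0 where K0: "compact K0" "K0 \<subseteq> ball y \<epsilon>" "\<And>x. x \<notin> K0 \<Longrightarrow> \<phi> x = 0" "\<And>x i. x \<notin> K0 \<Longrightarrow> partial i \<phi> x = 0"
    using C01_support[OF \<phi>] by metis
  let ?K = "K0 - ball y r"
  have K: "compact ?K" "?K \<subseteq> ?\<Omega>"
    using K0(1,2) r by (auto intro: compact_diff)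
  have u_near: "u x = 0" if "x \<in> ball y r" for x
  proof -
    have "(norm (x - y))\<^sup>2 < r\<^sup>2"
      using that by (intro power_strict_mono) (auto simp: dist_norm norm_minus_commute)
    then have "(norm (x - y))\<^sup>2 / r\<^sup>2 < 1"
      using r by simp
    then show ?thesis
      using k unfolding u_def annulus_cut_eq by (intro step_eq_0 mult_nonneg_nonpos) auto
  qed
  have u_C1: "C1_on S u" for S
    unfolding u_def by (rule annulus_cut_C1)
  have \<tau>: "\<tau> \<in> C01 ?\<Omega>"
  proof (rule C01I[OF op _ K])
    show "C1_on ?\<Omega> \<tau>"
      unfolding \<tau>_def by (intro C1_on_mult C01_C1[OF \<phi>] u_C1)
    show "\<tau> x = 0" if "x \<notin> ?K" for x
      using that u_near[of x] K0(3)[of x] by (auto simp: \<tau>_def)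
  qed
  have u_diff: "u differentiable (at x)" for x
    using u_C1[of UNIV] by (simp add: C1_on_def)
  have p\<tau>: "partial i \<tau> x = \<phi> x * partial i u x + partial i \<phi> x * u x" for i x
    unfolding \<tau>_def by (rule partial_mult[OF C01_differentiable[OF \<phi>] u_diff])
  have pu: "(\<lambda>x. \<phi> x * partial i u x) \<in> C01 ?\<Omega>" for i
  proof -
    have "(\<lambda>x. \<phi> x * partial i u x) \<in> C01 (annulus r y)"
      unfolding u_def by (rule C01_times_partial_annulus_cut[OF r k C01_C1[OF \<phi>]])
    moreover have "annulus r y \<subseteq> ?\<Omega>"
      using ann r by (auto simp: annulus_def)
    ultimately show ?thesis
      by (rule C01_mono)
  qed
  have int1: "integrable lebesgue (\<lambda>x. g j x * (\<phi> x * partial i u x))" for i j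
    by (rule Lp_loc_1_times_C01(1)[OF loc(1) op pu])
  have int2: "integrable lebesgue (\<lambda>x. g j x * (partial i \<phi> x * u x))" for i j
  proof (rule Lp_loc_1_times_integrable[OF loc(1) op K])
    show "continuous_on UNIV (\<lambda>x. partial i \<phi> x * u x)"
      by (intro continuous_on_mult C01_continuous[OF \<phi>] C1_on_continuous[OF u_C1])
    show "partial i \<phi> x * u x = 0" if "x \<notin> ?K" for x
      using that u_near[of x] K0(4)[of x] by auto
  qed
  have int3: "integrable lebesgue (\<lambda>x. h i j x * \<tau> x)" for i j
    by (rule Lp_loc_1_times_C01(1)[OF loc(2) op \<tau>])
  let ?F = "LZ_integrand A y (ball y \<epsilon>) Z \<phi>"
  have F_AE: "AE x in lebesgue. ?F x * u x =
      (\<Sum>i\<in>UNIV. \<Sum>j\<in>UNIV. - (A y $ i $ j * (h i j x * \<tau> x + g i x * (partial j \<phi> x * u x))))"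
  proof -
    have "AE x in lebesgue. x \<in> ?\<Omega> \<longrightarrow> (\<Sum>i\<in>UNIV. \<Sum>j\<in>UNIV. A x $ i $ j * weak_hess ?\<Omega> Z x $ i $ j) = 0"
      using sol by (simp add: strong_solution_def)
    then show ?thesis
    proof eventually_elim
      case (elim x)
      have F: "?F x = (\<Sum>i\<in>UNIV. \<Sum>j\<in>UNIV. (A x $ i $ j - A y $ i $ j) * h i j x * \<phi> x - A y $ i $ j * g i x * partial j \<phi> x)"
        by (simp add: LZ_integrand_def weak_hess_def weak_grad_def g_def h_def)
      show ?case
      proof (cases "x \<in> ?\<Omega>")
        case True
        then have eq0: "(\<Sum>i\<in>UNIV. \<Sum>j\<in>UNIV. A x $ i $ j * h i j x) = 0"
          using elim by (simp add: weak_hess_def g_def h_def)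
        have "?F x = (\<Sum>i\<in>UNIV. \<Sum>j\<in>UNIV. A x $ i $ j * h i j x) * \<phi> x
            + (\<Sum>i\<in>UNIV. \<Sum>j\<in>UNIV. - (A y $ i $ j * (h i j x * \<phi> x + g i x * partial j \<phi> x)))"
          unfolding F sum_distrib_right sum.distrib[symmetric]
          by (intro sum.cong refl) (simp add: algebra_simps)
        then have "?F x * u x = (\<Sum>i\<in>UNIV. \<Sum>j\<in>UNIV. - (A y $ i $ j * (h i j x * \<phi> x + g i x * partial j \<phi> x))) * u x"
          unfolding eq0 by simp
        also have "\<dots> = (\<Sum>i\<in>UNIV. \<Sum>j\<in>UNIV. - (A y $ i $ j * (h i j x * \<phi> x + g i x * partial j \<phi> x)) * u x)"
          by (simp only: sum_distrib_right)
        also have "\<dots> = (\<Sum>i\<in>UNIV. \<Sum>j\<in>UNIV. - (A y $ i $ j * (h i j x * \<tau> x + g i x * (partial j \<phi> x * u x))))"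
          by (intro sum.cong refl) (simp add: \<tau>_def algebra_simps)
        finally show ?thesis .
      next
        case False
        then have "x \<in> ball y r \<or> x \<notin> K0"
          using r K0(2) by auto
        then show ?thesis
        proof
          assume "x \<in> ball y r"
          then show ?thesis
            by (simp add: \<tau>_def u_near)
        next
          assume "x \<notin> K0"
          then show ?thesis
            unfolding F by (simp add: \<tau>_def K0(3,4))
        qed
      qed
    qed
  qed
  have rhs_int: "integrable lebesgue (\<lambda>x. - (A y $ i $ j * (h i j x * \<tau> x + g i x * (partial j \<phi> x * u x))))" for i j
    by (intro Bochner_Integration.integrable_minus integrable_mult_right Bochner_Integration.integrable_add int2 int3)
  have Fu_meas: "(\<lambda>x. ?F x * u x) \<in> borel_measurable lebesgue"
  proof (rule borel_measurable_AE)
    show "(\<lambda>x. \<Sum>i\<in>UNIV. \<Sum>j\<in>UNIV. - (A y $ i $ j * (h i j x * \<tau> x + g i x * (partial j \<phi> x * u x)))) \<in> borel_measurable lebesgue"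
      by (intro borel_measurable_sum borel_measurable_integrable[OF rhs_int])
    show "AE x in lebesgue. (\<Sum>i\<in>UNIV. \<Sum>j\<in>UNIV. - (A y $ i $ j * (h i j x * \<tau> x + g i x * (partial j \<phi> x * u x)))) = ?F x * u x"
      using F_AE by eventually_elim simp
  qed
  have "(LINT x|lebesgue. ?F x * u x)
      = (LINT x|lebesgue. (\<Sum>i\<in>UNIV. \<Sum>j\<in>UNIV. - (A y $ i $ j * (h i j x * \<tau> x + g i x * (partial j \<phi> x * u x)))))"
    by (rule integral_cong_AE[OF Fu_meas _ F_AE]) (intro borel_measurable_sum borel_measurable_integrable[OF rhs_int])
  also have "\<dots> = (\<Sum>i\<in>UNIV. \<Sum>j\<in>UNIV. LINT x|lebesgue. - (A y $ i $ j * (h i j x * \<tau> x + g i x * (partial j \<phi> x * u x))))"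
    by (simp only: Bochner_Integration.integral_sum Bochner_Integration.integrable_sum rhs_int)
  also have "\<dots> = (\<Sum>i\<in>UNIV. \<Sum>j\<in>UNIV. A y $ i $ j * (LINT x|lebesgue. g j x * (\<phi> x * partial i u x))
      + A y $ i $ j * (LINT x|lebesgue. g j x * (partial i \<phi> x * u x))
      - A y $ i $ j * (LINT x|lebesgue. g i x * (partial j \<phi> x * u x)))"
  proof (intro sum.cong refl)
    fix i j
    have "(LINT x|lebesgue. h i j x * \<tau> x) = - (LINT x|lebesgue. g j x * partial i \<tau> x)"
      using weak_partial_by_parts[OF D2 op \<tau>, of j i] by simp
    also have "(LINT x|lebesgue. g j x * partial i \<tau> x)
        = (LINT x|lebesgue. g j x * (\<phi> x * partial i u x)) + (LINT x|lebesgue. g j x * (partial i \<phi> x * u x))"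
      unfolding p\<tau> distrib_left by (rule Bochner_Integration.integral_add[OF int1 int2])
    finally have h\<tau>: "(LINT x|lebesgue. h i j x * \<tau> x)
        = - ((LINT x|lebesgue. g j x * (\<phi> x * partial i u x)) + (LINT x|lebesgue. g j x * (partial i \<phi> x * u x)))" .
    have "(LINT x|lebesgue. - (A y $ i $ j * (h i j x * \<tau> x + g i x * (partial j \<phi> x * u x))))
        = - (A y $ i $ j * ((LINT x|lebesgue. h i j x * \<tau> x) + (LINT x|lebesgue. g i x * (partial j \<phi> x * u x))))"
      using int2[of i j] int3[of i j] by simp
    then show "(LINT x|lebesgue. - (A y $ i $ j * (h i j x * \<tau> x + g i x * (partial j \<phi> x * u x))))
      = A y $ i $ j * (LINT x|lebesgue. g j x * (\<phi> x * partial i u x))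
      + A y $ i $ j * (LINT x|lebesgue. g j x * (partial i \<phi> x * u x))
      - A y $ i $ j * (LINT x|lebesgue. g i x * (partial j \<phi> x * u x))"
      unfolding h\<tau> by (simp add: algebra_simps)
  qed
  also have "\<dots> = (\<Sum>i\<in>UNIV. \<Sum>j\<in>UNIV. A y $ i $ j * (LINT x|lebesgue. g j x * (\<phi> x * partial i u x)))
      + ((\<Sum>i\<in>UNIV. \<Sum>j\<in>UNIV. A y $ i $ j * (LINT x|lebesgue. g j x * (partial i \<phi> x * u x)))
      - (\<Sum>i\<in>UNIV. \<Sum>j\<in>UNIV. A y $ i $ j * (LINT x|lebesgue. g i x * (partial j \<phi> x * u x))))"
    by (simp only: sum.distrib sum_subtractf)
  also have "(\<Sum>i\<in>UNIV. \<Sum>j\<in>UNIV. A y $ i $ j * (LINT x|lebesgue. g i x * (partial j \<phi> x * u x)))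
      = (\<Sum>j\<in>UNIV. \<Sum>i\<in>UNIV. A y $ i $ j * (LINT x|lebesgue. g i x * (partial j \<phi> x * u x)))"
    by (rule sum.swap)
  also have "\<dots> = (\<Sum>i\<in>UNIV. \<Sum>j\<in>UNIV. A y $ i $ j * (LINT x|lebesgue. g j x * (partial i \<phi> x * u x)))"
  proof -
    have "A y $ i $ j = A y $ j $ i" for i j
      using sym by (metis transpose_def vec_lambda_beta)
    then show ?thesis
      by simp
  qed
  finally show ?thesis
    by (simp add: u_def g_def)
qed

section \<open>Splitting the pairing\<close>

text \<open>
  Integrals of an integrable function over shrinking intervals.
\<close>

lemma sq_dini_tendsto_0:
  assumes "set_integrable lborel {0<..<1} (\<lambda>t. (\<omega> t)\<^sup>2 / t)"
  shows "(sq_dini \<omega> \<longlongrightarrow> 0) (at_right 0)"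
proof (rule tendsto_at_right_sequentially[where b = 1])
  fix S :: "nat \<Rightarrow> real"
  assume S: "\<And>n. 0 < S n" "\<And>n. S n < 1" "S \<longlonglongrightarrow> 0"
  define g where "g = (\<lambda>t. indicator {0<..<1} t *\<^sub>R ((\<omega> t)\<^sup>2 / t))"
  have g: "integrable lborel g"
    using assms by (simp add: set_integrable_def g_def)
  have eq: "sq_dini \<omega> (S n) = (LINT t|lborel. indicator {0<..<S n} t *\<^sub>R g t)" for n
    unfolding sq_dini_def set_lebesgue_integral_def g_def using S(2)[of n]
    by (intro Bochner_Integration.integral_cong refl) (auto simp: indicator_def)
  have "(\<lambda>n. LINT t|lborel. indicator {0<..<S n} t *\<^sub>R g t) \<longlonglongrightarrow> (LINT t|(lborel :: real measure). (0::real))"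
  proof (rule integral_dominated_convergence[where w = "\<lambda>t. norm (g t)"])
    show "(\<lambda>t. indicator {0<..<S n} t *\<^sub>R g t) \<in> borel_measurable lborel" for n
      using borel_measurable_integrable[OF g] by measurable
    show "AE t in lborel. (\<lambda>n. indicator {0<..<S n} t *\<^sub>R g t) \<longlonglongrightarrow> 0"
    proof (rule AE_I2)
      fix t :: real
      show "(\<lambda>n. indicator {0<..<S n} t *\<^sub>R g t) \<longlonglongrightarrow> 0"
      proof (cases "0 < t")
        case True
        then have "\<forall>\<^sub>F n in sequentially. S n < t"
          by (rule order_tendstoD(2)[OF S(3)])
        then show ?thesis
          by (intro tendsto_eventually) (auto elim!: eventually_mono)
      qed (simp add: g_def)
    qed
    show "AE t in lborel. norm (indicator {0<..<S n} t *\<^sub>R g t) \<le> norm (g t)" for n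
      by (rule AE_I2) (auto simp: indicator_def)
  qed (use g in auto)
  then show "(\<lambda>n. sq_dini \<omega> (S n)) \<longlonglongrightarrow> 0"
    unfolding eq by simp
qed simp

lemma uniform_limit_sum:
  fixes f :: "'i \<Rightarrow> 'a \<Rightarrow> 'b \<Rightarrow> real"
  assumes "finite I" "\<And>i. i \<in> I \<Longrightarrow> uniform_limit X (f i) (l i) F"
  shows "uniform_limit X (\<lambda>a x. \<Sum>i\<in>I. f i a x) (\<lambda>x. \<Sum>i\<in>I. l i x) F"
  using assms
proof (induction I rule: finite_induct)
  case empty
  then show ?case
    by (simp add: uniform_limit_const)
next
  case (insert i I)
  then show ?case
    by (simp add: uniform_limit_add)
qed

lemma uniform_limit_cmult_0:
  fixes f :: "'a \<Rightarrow> 'b \<Rightarrow> real"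
  assumes "uniform_limit X f (\<lambda>_. 0) F"
  shows "uniform_limit X (\<lambda>a x. c * f a x) (\<lambda>_. 0) F"
  using bounded_linear.uniform_limit[OF bounded_linear_mult_right[of c] assms] by simp

lemma matrix_vector_bound:
  fixes B :: "real^'n^'m"
  obtains l where "0 < l" "\<And>z. norm (B *v z) \<le> l * norm z"
  using bounded_linear.pos_bounded[OF matrix_vector_mul_bounded_linear, of B] by (metis mult.commute)

text \<open>
  The field and the gradient of the cutoff both point away from \<open>y\<close>. Positivity allows replacing a continuous weight by its
  limit in \<open>flux_near_constant\<close>.
\<close>

lemma flux_kernel_nonneg:
  fixes y :: "real^'n" and B :: "real^'n^'n"
  assumes "0 < m" "\<And>z. m * norm z \<le> norm (B *v z)" "0 \<le> k"
  shows "0 \<le> (\<Sum>i\<in>UNIV. flux_field B y i x * partial i (annulus_cut y r k) x)"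
proof -
  have "(\<Sum>i\<in>UNIV. flux_field B y i x * partial i (annulus_cut y r k) x)
    = ((norm (B *v (x - y)))\<^sup>2) powr (- real CARD('n) / 2) * (\<Sum>i\<in>UNIV. (x - y) $ i * partial i (annulus_cut y r k) x)"
    unfolding flux_field_def[OF assms(1,2)] sum_distrib_left by (simp only: mult.assoc)
  also have "0 \<le> \<dots>"
    unfolding annulus_cut_def euler_ellip_cut using assms(3)
    by (intro mult_nonneg_nonneg) (auto simp: step_deriv_nonneg)
  finally show ?thesis .
qed

lemma partial_annulus_cut_C01:
  assumes "0 < r" "1 \<le> k"
  shows "partial i (annulus_cut y r k) \<in> C01 (annulus r y)"
  using C01_times_partial_annulus_cut[OF assms C1_on_const[of "annulus r y" 1], of i] by simp

lemma flux_near_constant: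
  fixes y :: "real^'n" and B :: "real^'n^'n"
  assumes B: "det B \<noteq> 0" and r: "0 < r" and k: "1 \<le> k"
    and G: "continuous_on (annulus r y) G" "\<And>x. x \<in> annulus r y \<Longrightarrow> \<bar>G x - L\<bar> \<le> e"
  shows "\<bar>(LINT x|lebesgue. G x * (\<Sum>i\<in>UNIV. flux_field B y i x * partial i (annulus_cut y r k) x))
      - L * (sphere_area TYPE('n) / \<bar>det B\<bar>)\<bar> \<le> e * (sphere_area TYPE('n) / \<bar>det B\<bar>)"
proof -
  obtain m where m: "0 < m" "\<And>z. m * norm z \<le> norm (B *v z)"
    using matrix_injective_bound[OF B] by blast
  define q where "q = (\<lambda>x. \<Sum>i\<in>UNIV. flux_field B y i x * partial i (annulus_cut y r k) x)"
  have C01: "partial i (annulus_cut y r k) \<in> C01 (annulus r y)" for i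
    by (rule partial_annulus_cut_C01[OF r k])
  have q0: "q x = 0" if "x \<notin> annulus r y" for x
    unfolding q_def using C01_outside(1)[OF C01 that] by simp
  have q_nonneg: "0 \<le> q x" for x
    unfolding q_def using flux_kernel_nonneg[OF m, of k y x r] k by simp
  have sub: "annulus r y \<subseteq> UNIV - {y}"
    using r by (auto simp: annulus_def)
  have q_int: "integrable lebesgue q"
    unfolding q_def by (rule flux_integrable[OF m C01_mono[OF C01 sub]])
  have q_val: "(LINT x|lebesgue. q x) = sphere_area TYPE('n) / \<bar>det B\<bar>"
    unfolding q_def annulus_cut_def by (rule flux_value[OF B]) (use r k in auto)
  have flux_C1: "C1_on (annulus r y) (flux_field B y i)" for i
  proof -
    obtain l where l: "0 < l" "\<And>z. norm (B *v z) \<le> l * norm z"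
      using matrix_vector_bound[of B] by blast
    obtain R where "\<And>r i'. 0 < r \<Longrightarrow> scaled_bound y r i' (real CARD('n) - 1) R (flux_field B y i)"
      using scaled_bound_flux_field[OF m l] by metis
    then show ?thesis
      using r by (auto simp: scaled_bound_def)
  qed
  have Gq_int: "integrable lebesgue (\<lambda>x. G x * q x)"
  proof -
    have "integrable lebesgue (\<lambda>x. (G x * flux_field B y i x) * partial i (annulus_cut y r k) x)" for i
    proof -
      obtain K where K: "compact K" "K \<subseteq> annulus r y" "\<And>x. x \<notin> K \<Longrightarrow> partial i (annulus_cut y r k) x = 0"
        using C01_support[OF C01[of i]] by metis
      have "continuous_on UNIV (\<lambda>x. (G x * flux_field B y i x) * partial i (annulus_cut y r k) x)"
        by (rule continuous_on_times_compact_support[OF open_annulus _ C01_continuous(1)[OF C01] K])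
          (intro continuous_on_mult G(1) C1_on_continuous[OF flux_C1])
      then show ?thesis
        by (rule integrable_compact_support[OF _ K(1)]) (simp add: K(3))
    qed
    then have "integrable lebesgue (\<lambda>x. \<Sum>i\<in>UNIV. (G x * flux_field B y i x) * partial i (annulus_cut y r k) x)"
      by (intro Bochner_Integration.integrable_sum)
    then show ?thesis
      unfolding q_def sum_distrib_left by (simp only: mult.assoc)
  qed
  have "\<bar>(LINT x|lebesgue. G x * q x) - L * (LINT x|lebesgue. q x)\<bar> = \<bar>LINT x|lebesgue. G x * q x - L * q x\<bar>"
    using Gq_int q_int by simp
  also have "\<dots> \<le> (LINT x|lebesgue. \<bar>G x * q x - L * q x\<bar>)"
    using integral_norm_bound[of lebesgue "\<lambda>x. G x * q x - L * q x"] by simp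
  also have "\<dots> \<le> (LINT x|lebesgue. e * q x)"
  proof (rule integral_mono)
    show "integrable lebesgue (\<lambda>x. \<bar>G x * q x - L * q x\<bar>)"
      by (intro integrable_abs Bochner_Integration.integrable_diff Gq_int integrable_mult_right q_int)
    show "integrable lebesgue (\<lambda>x. e * q x)"
      by (intro integrable_mult_right q_int)
    show "\<bar>G x * q x - L * q x\<bar> \<le> e * q x" for x
    proof (cases "x \<in> annulus r y")
      case True
      then have "\<bar>G x - L\<bar> * q x \<le> e * q x"
        by (intro mult_right_mono G(2) q_nonneg)
      then show ?thesis
        using q_nonneg[of x] by (simp add: abs_mult flip: left_diff_distrib)
    qed (simp add: q0)
  qed
  also have "\<dots> = e * (LINT x|lebesgue. q x)"
    by simp
  finally show ?thesis
    unfolding q_val unfolding q_def .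
qed

text \<open>
  Convergence is uniform in the sharpness \<open>k\<close> of the cutoff, because the trace inequality is.
\<close>

lemma trace_uniformly_small:
  fixes y :: "real^'n"
  assumes w: "has_weak_partial (ball y \<delta> - {y}) i w w'" and \<delta>: "0 < \<delta>"
    and small: "L1_small y a w'" "L1_small y (a + 1) w" and d: "0 < d"
    and \<rho>: "\<And>r. 0 < r \<Longrightarrow> r < d \<Longrightarrow>
      \<exists>\<rho>s. (\<forall>j::nat. scaled_bound y r i a R (\<rho>s j)) \<and> (\<forall>x\<in>annulus r y. (\<lambda>j. \<rho>s j x) \<longlonglongrightarrow> \<rho> x)"
  shows "uniform_limit {1..} (\<lambda>r k. LINT x|lebesgue. w x * (\<rho> x * partial i (annulus_cut y r k) x)) (\<lambda>_. 0) (at_right 0)"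
proof (rule uniform_limitI)
  define E where "E = (\<lambda>r. trace_constant * R * (r powr (- a) * annulus_L1 r y w' + r powr (- a - 1) * annulus_L1 r y w))"
  have "(E \<longlongrightarrow> trace_constant * R * (0 + 0)) (at_right 0)"
    unfolding E_def using small by (intro tendsto_mult_left tendsto_add) (simp_all add: L1_small_def)
  then have E: "(E \<longlongrightarrow> 0) (at_right 0)"
    by simp
  fix e :: real assume "0 < e"
  from order_tendstoD(2)[OF E this] have e1: "\<forall>\<^sub>F r in at_right 0. E r < e" .
  have "0 < min d (\<delta> / 2)"
    using d \<delta> by simp
  then have "\<forall>\<^sub>F r in at_right 0. 0 < r \<and> r < d \<and> 2 * r < \<delta>"
    by (rule eventually_at_right_0I) auto
  with e1 show "\<forall>\<^sub>F r in at_right 0. \<forall>k\<in>{1..}. dist (LINT x|lebesgue. w x * (\<rho> x * partial i (annulus_cut y r k) x)) 0 < e"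
  proof eventually_elim
    case (elim r)
    then have r: "0 < r" "2 * r < \<delta>" and "E r < e" "r < d"
      by auto
    obtain \<rho>s where s: "\<And>j::nat. scaled_bound y r i a R (\<rho>s j)" "\<And>x. x \<in> annulus r y \<Longrightarrow> (\<lambda>j. \<rho>s j x) \<longlonglongrightarrow> \<rho> x"
      using \<rho>[OF r(1) \<open>r < d\<close>] by metis
    show ?case
    proof
      fix k :: real assume "k \<in> {1..}"
      then have "1 \<le> k"
        by simp
      from trace_scaled_limit(2)[OF w r this s] \<open>E r < e\<close>
      show "dist (LINT x|lebesgue. w x * (\<rho> x * partial i (annulus_cut y r k) x)) 0 < e"
        by (simp add: E_def)
    qed
  qed
qed

lemma scaled_bound_C01:
  fixes \<phi> :: "real^'n \<Rightarrow> real"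
  assumes \<phi>: "\<phi> \<in> C01 \<Omega>"
  obtains F where "\<And>r. 0 < r \<Longrightarrow> r \<le> 1 \<Longrightarrow> scaled_bound y r i 0 F \<phi>"
proof -
  obtain K where K: "compact K" "\<And>x. x \<notin> K \<Longrightarrow> \<phi> x = 0" "\<And>x. x \<notin> K \<Longrightarrow> partial i \<phi> x = 0"
    using C01_support[OF \<phi>] by metis
  obtain F where F: "\<And>x. \<bar>\<phi> x\<bar> \<le> F"
    using continuous_compact_support_bounded[OF C01_continuous(1)[OF \<phi>] K(1,2)] by metis
  obtain F' where F': "\<And>x. \<bar>partial i \<phi> x\<bar> \<le> F'"
    using continuous_compact_support_bounded[OF C01_continuous(2)[OF \<phi>] K(1,3)] by metis
  show thesis
  proof (rule that)
    show "scaled_bound y r i 0 (max F F') \<phi>" if "0 < r" "r \<le> 1" for r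
      using that F F' by (intro scaled_bound_test_function[OF _ _ \<phi>]) (auto simp: le_max_iff_disj)
  qed
qed

text \<open>
  The gradient of \<open>N\<close> is \<open>B (B (x - y)) / N\<close>, and \<open>M\<close> undoes the two factors \<open>B\<close>, so that the conormal derivative of a function
  of \<open>N\<close> points in the direction \<open>x - y\<close>.
\<close>

lemma conormal_profile:
  fixes M :: "real^'n^'n" and x y :: "real^'n"
  assumes M: "spd M" and cont: "continuous_on {0<..\<epsilon>} J" and m: "0 < m" "\<And>z. m * norm z \<le> norm (inv_sqrt M *v z)"
  defines "N \<equiv> norm (inv_sqrt M *v (x - y))"
  assumes N: "0 < N" "N < \<epsilon>"
  shows "(\<Sum>j\<in>UNIV. M $ i $ j * partial j (\<lambda>x. profile CARD('n) J \<epsilon> (norm (inv_sqrt M *v (x - y)))) x)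
    = - (exp (J N) * flux_field (inv_sqrt M) y i x)"
proof -
  let ?B = "inv_sqrt M"
  have p: "partial j (\<lambda>x. profile CARD('n) J \<epsilon> (norm (?B *v (x - y)))) x
      = - (N powr (1 - real CARD('n)) * exp (J N)) / N * (?B *v (?B *v (x - y))) $ j" for j
    using norm_radial_deriv(2)[OF profile_deriv[OF cont N, unfolded N_def] N(1)[unfolded N_def], where i = j]
      inv_sqrt_inner[OF M, of "?B *v (x - y)" "axis j 1"]
    by (simp add: N_def inner_axis)
  have "(\<Sum>j\<in>UNIV. M $ i $ j * partial j (\<lambda>x. profile CARD('n) J \<epsilon> (norm (?B *v (x - y)))) x)
      = - (N powr (1 - real CARD('n)) * exp (J N)) / N * (M *v (?B *v (?B *v (x - y)))) $ i"
    unfolding p matrix_vector_mult_def[of M] vec_lambda_beta sum_distrib_left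
    by (intro sum.cong refl) (simp add: mult_ac)
  also have "\<dots> = - (exp (J N) * ((N powr (1 - real CARD('n)) / N) * (x - y) $ i))"
    unfolding inv_sqrt_square[OF M] by simp
  also have "N powr (1 - real CARD('n)) / N = N powr (- real CARD('n))"
    using N(1) by (simp add: powr_diff powr_minus field_simps)
  also have "N powr (- real CARD('n)) * (x - y) $ i = flux_field ?B y i x"
    unfolding flux_field_def[OF m] powr_square_norm N_def ..
  finally show ?thesis .
qed

text \<open>
  The gradient of \<open>P (1 + u) + v\<close> is \<open>P \<nabla>u + (1 + u) \<nabla>P + \<nabla>v\<close>, tested with \<open>\<phi> \<partial>\<^sub>i\<chi>\<close> for a cutoff \<open>\<chi>\<close>. In the middle term
  \<open>conormal_profile\<close> applies; its part without \<open>u\<close> is the main one, and the other three are remainders.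
\<close>

lemma pairing_decomposition:
  fixes M :: "real^'n^'n" and y :: "real^'n" and Z u v \<phi> :: "real^'n \<Rightarrow> real"
  assumes M: "spd M" and det: "det (inv_sqrt M) \<noteq> 0" and op: "open \<Omega>" and r: "0 < r" and k: "1 \<le> k"
    and ann: "annulus r y \<subseteq> \<Omega>"
  defines "N \<equiv> \<lambda>x. norm (inv_sqrt M *v (x - y))"
  assumes cont: "continuous_on {0<..\<epsilon>} J" and N: "\<And>x. x \<in> annulus r y \<Longrightarrow> 0 < N x \<and> N x < \<epsilon>"
  defines "P \<equiv> \<lambda>x. profile CARD('n) J \<epsilon> (N x)"
  assumes P: "C1_on (annulus r y) P"
    and Z: "\<And>j. has_weak_partial \<Omega> j Z (g j)"
    and form: "\<And>x. x \<in> annulus r y \<Longrightarrow> Z x = P x * (1 + u x) + v x"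
    and u: "\<And>j. has_weak_partial (annulus r y) j u (u' j)"
    and v: "\<And>j. has_weak_partial (annulus r y) j v (v' j)"
    and \<phi>: "\<phi> \<in> C01 \<Omega>'"
  shows "(\<Sum>i\<in>UNIV. \<Sum>j\<in>UNIV. M $ i $ j * (LINT x|lebesgue. g j x * (\<phi> x * partial i (annulus_cut y r k) x)))
    = (\<Sum>i\<in>UNIV. \<Sum>j\<in>UNIV. M $ i $ j * (LINT x|lebesgue. u' j x * ((P x * \<phi> x) * partial i (annulus_cut y r k) x)))
    + (\<Sum>i\<in>UNIV. \<Sum>j\<in>UNIV. M $ i $ j * (LINT x|lebesgue. v' j x * (\<phi> x * partial i (annulus_cut y r k) x)))
    - (\<Sum>i\<in>UNIV. LINT x|lebesgue. u x * (((exp (J (N x)) * \<phi> x) * flux_field (inv_sqrt M) y i x) * partial i (annulus_cut y r k) x))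
    - (LINT x|lebesgue. (exp (J (N x)) * \<phi> x) * (\<Sum>i\<in>UNIV. flux_field (inv_sqrt M) y i x * partial i (annulus_cut y r k) x))"
proof -
  let ?B = "inv_sqrt M" and ?R = "annulus r y"
  obtain m where m: "0 < m" "\<And>z. m * norm z \<le> norm (?B *v z)"
    using matrix_injective_bound[OF det] by blast
  obtain l where l: "0 < l" "\<And>z. norm (?B *v z) \<le> l * norm z"
    using matrix_vector_bound[of ?B] by blast
  define \<Psi> where "\<Psi> = (\<lambda>i x. \<phi> x * partial i (annulus_cut y r k) x)"
  define E where "E = (\<lambda>x. exp (J (N x)))"
  define X where "X = flux_field ?B y"
  have \<Psi>: "\<Psi> i \<in> C01 ?R" for i
    unfolding \<Psi>_def by (rule C01_times_partial_annulus_cut[OF r k C01_C1[OF \<phi>]])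
  have \<Psi>0: "\<Psi> i x = 0" "partial j (\<Psi> i) x = 0" if "x \<notin> ?R" for i j x
    using C01_outside[OF \<Psi> that] by auto
  note opR = open_annulus[of r y]
  have u1: "has_weak_partial ?R j (\<lambda>x. 1 + u x) (u' j)" for j
    by (rule has_weak_partial_1_plus[OF opR u])
  have part: "(LINT x|lebesgue. g j x * \<Psi> i x) = (LINT x|lebesgue. u' j x * (P x * \<Psi> i x))
      + (LINT x|lebesgue. v' j x * \<Psi> i x) + (LINT x|lebesgue. (1 + u x) * (partial j P x * \<Psi> i x))" for i j
  proof -
    note w = weak_product_by_parts[OF opR u1[of j] P \<Psi>[of i]]
    have v_loc: "Lp_loc ?R 1 v"
      using v[of j] by (simp add: has_weak_partial_def)
    have v_int: "integrable lebesgue (\<lambda>x. v x * partial j (\<Psi> i) x)"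
      by (rule Lp_loc_1_times_C01(2)[OF v_loc opR \<Psi>])
    have "(LINT x|lebesgue. g j x * \<Psi> i x) = - (LINT x|lebesgue. Z x * partial j (\<Psi> i) x)"
      using weak_partial_by_parts[OF Z[of j] op C01_mono[OF \<Psi>[of i] ann]] by simp
    also have "(LINT x|lebesgue. Z x * partial j (\<Psi> i) x)
        = (LINT x|lebesgue. (P x * (1 + u x)) * partial j (\<Psi> i) x + v x * partial j (\<Psi> i) x)"
    proof (rule Bochner_Integration.integral_cong[OF refl])
      show "Z x * partial j (\<Psi> i) x = (P x * (1 + u x)) * partial j (\<Psi> i) x + v x * partial j (\<Psi> i) x" for x
        by (cases "x \<in> ?R") (simp_all add: form \<Psi>0 distrib_right)
    qed
    also have "\<dots> = (LINT x|lebesgue. (P x * (1 + u x)) * partial j (\<Psi> i) x) + (LINT x|lebesgue. v x * partial j (\<Psi> i) x)"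
      by (rule Bochner_Integration.integral_add[OF w(1) v_int])
    also have "(LINT x|lebesgue. v x * partial j (\<Psi> i) x) = - (LINT x|lebesgue. v' j x * \<Psi> i x)"
      by (rule weak_partial_by_parts[OF v opR \<Psi>])
    finally show ?thesis
      unfolding w(3) by simp
  qed
  have E_cont: "continuous_on ?R E"
  proof -
    have "continuous_on ?R N"
      unfolding N_def by (intro continuous_on_norm linear_continuous_on_compose[OF _ matrix_vector_mul_linear] continuous_intros)
    then show ?thesis
      unfolding E_def using N by (intro continuous_on_exp continuous_on_compose2[OF cont]) force+
  qed
  have X_cont: "continuous_on ?R (X i)" for i
  proof -
    obtain R where "\<And>r i'. 0 < r \<Longrightarrow> scaled_bound y r i' (real CARD('n) - 1) R (flux_field ?B y i)"
      using scaled_bound_flux_field[OF m l] by metis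
    then show ?thesis
      using r unfolding X_def by (auto simp: scaled_bound_def intro: C1_on_continuous)
  qed
  have EX: "continuous_on UNIV (\<lambda>x. (E x * X i x) * \<Psi> i x)"
    "integrable lebesgue (\<lambda>x. (E x * X i x) * \<Psi> i x)"
    "integrable lebesgue (\<lambda>x. u x * ((E x * X i x) * \<Psi> i x))" for i
  proof -
    obtain K where K: "compact K" "K \<subseteq> ?R" "\<And>x. x \<notin> K \<Longrightarrow> \<Psi> i x = 0"
      using C01_support[OF \<Psi>[of i]] by metis
    show c: "continuous_on UNIV (\<lambda>x. (E x * X i x) * \<Psi> i x)"
      by (rule continuous_on_times_compact_support[OF opR _ C01_continuous(1)[OF \<Psi>] K])
        (intro continuous_on_mult E_cont X_cont)
    show "integrable lebesgue (\<lambda>x. (E x * X i x) * \<Psi> i x)"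
      by (rule integrable_compact_support[OF c K(1)]) (simp add: K(3))
    have "Lp_loc ?R 1 u"
      using u by (auto simp: has_weak_partial_def)
    then show "integrable lebesgue (\<lambda>x. u x * ((E x * X i x) * \<Psi> i x))"
      by (rule Lp_loc_1_times_integrable[OF _ opR K(1,2) c]) (simp add: K(3))
  qed
  have main: "(\<Sum>j\<in>UNIV. M $ i $ j * (LINT x|lebesgue. (1 + u x) * (partial j P x * \<Psi> i x)))
      = - (LINT x|lebesgue. (E x * X i x) * \<Psi> i x) - (LINT x|lebesgue. u x * ((E x * X i x) * \<Psi> i x))" for i
  proof -
    have int: "integrable lebesgue (\<lambda>x. (1 + u x) * (partial j P x * \<Psi> i x))" for j
      by (rule weak_product_by_parts(2)[OF opR u1[of j] P \<Psi>[of i]])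
    have "(\<Sum>j\<in>UNIV. M $ i $ j * (LINT x|lebesgue. (1 + u x) * (partial j P x * \<Psi> i x)))
        = (\<Sum>j\<in>UNIV. LINT x|lebesgue. M $ i $ j * ((1 + u x) * (partial j P x * \<Psi> i x)))"
      by simp
    also have "\<dots> = (LINT x|lebesgue. (\<Sum>j\<in>UNIV. M $ i $ j * ((1 + u x) * (partial j P x * \<Psi> i x))))"
      by (rule Bochner_Integration.integral_sum[symmetric]) (intro integrable_mult_right int)
    also have "\<dots> = (LINT x|lebesgue. - ((E x * X i x) * \<Psi> i x) - u x * ((E x * X i x) * \<Psi> i x))"
    proof (rule Bochner_Integration.integral_cong[OF refl])
      fix x
      show "(\<Sum>j\<in>UNIV. M $ i $ j * ((1 + u x) * (partial j P x * \<Psi> i x)))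
          = - ((E x * X i x) * \<Psi> i x) - u x * ((E x * X i x) * \<Psi> i x)"
      proof (cases "x \<in> ?R")
        case True
        have "(\<Sum>j\<in>UNIV. M $ i $ j * ((1 + u x) * (partial j P x * \<Psi> i x)))
            = (\<Sum>j\<in>UNIV. M $ i $ j * partial j P x) * ((1 + u x) * \<Psi> i x)"
          unfolding sum_distrib_right by (intro sum.cong refl) (simp only: mult_ac)
        also have "(\<Sum>j\<in>UNIV. M $ i $ j * partial j P x) = - (E x * X i x)"
          using N[OF True] conormal_profile[OF M cont m, of x y i] unfolding P_def N_def E_def X_def by blast
        finally show ?thesis
          by (simp add: algebra_simps)
      qed (simp add: \<Psi>0)
    qed
    finally show ?thesis
      using EX(2,3)[of i] by simp
  qed
  have flux: "(\<Sum>i\<in>UNIV. LINT x|lebesgue. (E x * X i x) * \<Psi> i x)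
      = (LINT x|lebesgue. (E x * \<phi> x) * (\<Sum>i\<in>UNIV. X i x * partial i (annulus_cut y r k) x))"
  proof -
    have "(\<Sum>i\<in>UNIV. LINT x|lebesgue. (E x * X i x) * \<Psi> i x) = (LINT x|lebesgue. (\<Sum>i\<in>UNIV. (E x * X i x) * \<Psi> i x))"
      by (rule Bochner_Integration.integral_sum[symmetric]) (rule EX(2))
    then show ?thesis
      unfolding sum_distrib_left \<Psi>_def by (simp only: mult_ac)
  qed
  have rw: "u' j x * ((P x * \<phi> x) * partial i (annulus_cut y r k) x) = u' j x * (P x * \<Psi> i x)"
    "u x * (((exp (J (N x)) * \<phi> x) * flux_field ?B y i x) * partial i (annulus_cut y r k) x) = u x * ((E x * X i x) * \<Psi> i x)" for i j x
    by (simp_all add: \<Psi>_def E_def X_def)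
  have fold: "\<phi> x * partial i (annulus_cut y r k) x = \<Psi> i x" "exp (J (N x)) = E x" "flux_field ?B y i x = X i x" for i x
    by (simp_all add: \<Psi>_def E_def X_def)
  have "(\<Sum>i\<in>UNIV. \<Sum>j\<in>UNIV. M $ i $ j * (LINT x|lebesgue. g j x * \<Psi> i x))
    = (\<Sum>i\<in>UNIV. \<Sum>j\<in>UNIV. M $ i $ j * (LINT x|lebesgue. u' j x * (P x * \<Psi> i x)))
    + (\<Sum>i\<in>UNIV. \<Sum>j\<in>UNIV. M $ i $ j * (LINT x|lebesgue. v' j x * \<Psi> i x))
    + (\<Sum>i\<in>UNIV. \<Sum>j\<in>UNIV. M $ i $ j * (LINT x|lebesgue. (1 + u x) * (partial j P x * \<Psi> i x)))"
    unfolding part distrib_left sum.distrib ..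
  also have "(\<Sum>i\<in>UNIV. \<Sum>j\<in>UNIV. M $ i $ j * (LINT x|lebesgue. (1 + u x) * (partial j P x * \<Psi> i x)))
    = - (LINT x|lebesgue. (E x * \<phi> x) * (\<Sum>i\<in>UNIV. X i x * partial i (annulus_cut y r k) x))
      - (\<Sum>i\<in>UNIV. LINT x|lebesgue. u x * ((E x * X i x) * \<Psi> i x))"
    unfolding main sum_subtractf sum_negf flux ..
  finally show ?thesis
    unfolding rw unfolding fold by linarith
qed


text \<open>
  The measure \<open>\<Sum>\<^sub>i X\<^sub>i \<partial>\<^sub>i\<chi>\<close> is nonnegative, of fixed total mass, and concentrates at \<open>y\<close>.
\<close>

lemma flux_tendsto:
  fixes y :: "real^'n" and B :: "real^'n^'n"
  assumes B: "det B \<noteq> 0" and G: "(G \<longlongrightarrow> L) (at y)" and d: "0 < d"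
    and cont: "\<And>r. 0 < r \<Longrightarrow> r < d \<Longrightarrow> continuous_on (annulus r y) G"
  shows "uniform_limit {1..} (\<lambda>r k. LINT x|lebesgue. G x * (\<Sum>i\<in>UNIV. flux_field B y i x * partial i (annulus_cut y r k) x))
    (\<lambda>_. L * (sphere_area TYPE('n) / \<bar>det B\<bar>)) (at_right 0)"
proof (rule uniform_limitI)
  define C0 where "C0 = sphere_area TYPE('n) / \<bar>det B\<bar>"
  have C0: "0 \<le> C0"
    by (simp add: C0_def sphere_area_def)
  fix e :: real assume e: "0 < e"
  define e' where "e' = e / (C0 + 1)"
  have e': "0 < e'" "e' * C0 < e"
    using e C0 by (simp_all add: e'_def field_simps)
  obtain b where b: "0 < b" "\<And>x. x \<noteq> y \<Longrightarrow> dist x y < b \<Longrightarrow> dist (G x) L < e'"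
    using tendstoD[OF G e'(1)] unfolding eventually_at by auto
  have "0 < min d (b / 2)"
    using d b(1) by simp
  then have "\<forall>\<^sub>F r in at_right 0. 0 < r \<and> r < d \<and> 2 * r < b"
    by (rule eventually_at_right_0I) auto
  then show "\<forall>\<^sub>F r in at_right 0. \<forall>k\<in>{1..}. dist (LINT x|lebesgue. G x * (\<Sum>i\<in>UNIV. flux_field B y i x * partial i (annulus_cut y r k) x))
      (L * (sphere_area TYPE('n) / \<bar>det B\<bar>)) < e"
  proof eventually_elim
    case (elim r)
    have close: "\<bar>G x - L\<bar> \<le> e'" if "x \<in> annulus r y" for x
    proof -
      have "x \<noteq> y" "dist x y < b"
        using that elim by (auto simp: annulus_def dist_norm)
      from b(2)[OF this] show ?thesis
        by (simp add: dist_real_def)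
    qed
    show ?case
    proof
      fix k :: real assume "k \<in> {1..}"
      then have "1 \<le> k"
        by simp
      from flux_near_constant[OF B _ this cont close] elim e'(2)
      show "dist (LINT x|lebesgue. G x * (\<Sum>i\<in>UNIV. flux_field B y i x * partial i (annulus_cut y r k) x))
          (L * (sphere_area TYPE('n) / \<bar>det B\<bar>)) < e"
        unfolding dist_real_def C0_def by fastforce
    qed
  qed
qed

lemma has_weak_partial_lincomb:
  fixes f g :: "'k::finite \<Rightarrow> real^'n \<Rightarrow> real"
  assumes op: "open \<Omega>" and fg: "\<And>k. has_weak_partial \<Omega> i (f k) (g k)"
  shows "has_weak_partial \<Omega> i (\<lambda>x. \<Sum>k\<in>UNIV. c k * f k x) (\<lambda>x. \<Sum>k\<in>UNIV. c k * g k x)"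
proof (rule has_weak_partialI[OF op])
  have loc: "Lp_loc \<Omega> 1 (f k)" "Lp_loc \<Omega> 1 (g k)" for k
    using fg[of k] by (auto simp: has_weak_partial_def)
  show "Lp_loc \<Omega> 1 (\<lambda>x. \<Sum>k\<in>UNIV. c k * f k x)" "Lp_loc \<Omega> 1 (\<lambda>x. \<Sum>k\<in>UNIV. c k * g k x)"
    by (intro Lp_loc_1_lincomb op loc)+
  fix \<psi> assume \<psi>: "\<psi> \<in> C01 \<Omega>"
  have sum: "(LINT x|lebesgue. (\<Sum>k\<in>UNIV. c k * w k x) * z x) = (\<Sum>k\<in>UNIV. c k * (LINT x|lebesgue. w k x * z x))"
    if "\<And>k. integrable lebesgue (\<lambda>x. w k x * z x)" for w :: "'k \<Rightarrow> real^'n \<Rightarrow> real" and z :: "real^'n \<Rightarrow> real"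
  proof -
    have "(LINT x|lebesgue. (\<Sum>k\<in>UNIV. c k * w k x) * z x) = (LINT x|lebesgue. (\<Sum>k\<in>UNIV. c k * (w k x * z x)))"
      unfolding sum_distrib_right by (simp only: mult.assoc)
    also have "\<dots> = (\<Sum>k\<in>UNIV. LINT x|lebesgue. c k * (w k x * z x))"
      by (rule Bochner_Integration.integral_sum) (intro integrable_mult_right that)
    finally show ?thesis
      by simp
  qed
  show "(LINT x|lebesgue. (\<Sum>k\<in>UNIV. c k * f k x) * partial i \<psi> x) = - (LINT x|lebesgue. (\<Sum>k\<in>UNIV. c k * g k x) * \<psi> x)"
    using sum[OF Lp_loc_1_times_C01(2)[OF loc(1) op \<psi>]] sum[OF Lp_loc_1_times_C01(1)[OF loc(2) op \<psi>]]
      weak_partial_by_parts[OF fg op \<psi>]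
    by (simp add: sum_negf)
qed

section \<open>Passage to the limit\<close>

text \<open>
  Three of the four terms of \<open>pairing_decomposition\<close> tend to \<open>0\<close> by the trace inequality. The orders match in each: the factor
  \<open>P\<close> of degree \<open>2 - n\<close> meets the gradient of \<open>\<zeta>(N)\<close>, the flux field of degree \<open>1 - n\<close> meets \<open>\<zeta>(N)\<close>, and \<open>\<phi>\<close> meets the
  gradient of \<open>v\<close>, where \<open>v\<close> is \<open>o(r powr (2 - n))\<close> since \<open>exp I\<close> is bounded.
\<close>

lemma pairing_limit:
  fixes A :: "real^'n \<Rightarrow> real^'n^'n" and y :: "real^'n"
  assumes n: "3 \<le> CARD('n)" and p: "1 < p" and M: "spd (A y)"
    and A: "A \<in> borel_measurable lebesgue" "bounded (range A)"
    and \<omega>: "(\<omega> \<longlongrightarrow> 0) (at_right 0)" "(sq_dini \<omega> \<longlongrightarrow> 0) (at_right 0)" and \<epsilon>: "0 < \<epsilon>"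
    and cs: "constructed_solution A y \<omega> p \<epsilon> Z h \<zeta> v"
    and lim: "((\<lambda>r. exp (I_fun A y \<epsilon> r)) \<longlongrightarrow> L) (at_right 0)" and \<phi>: "\<phi> \<in> C01 (ball y \<epsilon>)"
  shows "uniform_limit {1..} (\<lambda>r k. \<Sum>i\<in>UNIV. \<Sum>j\<in>UNIV. A y $ i $ j *
      (LINT x|lebesgue. weak_partial (ball y \<epsilon> - {y}) j Z x * (\<phi> x * partial i (annulus_cut y r k) x)))
    (\<lambda>_. - (L * \<phi> y * (sphere_area TYPE('n) / \<bar>det (inv_sqrt (A y))\<bar>))) (at_right 0)"
proof -
  let ?M = "A y"
  define B where "B = inv_sqrt (A y)"
  define J where "J = I_fun A y \<epsilon>"
  let ?n = "real CARD('n)"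
  have "B ** spd_sqrt (A y) = mat 1"
    by (simp add: matrix_eq B_def inv_sqrt_left[OF M] flip: matrix_vector_mul_assoc)
  then have "det B * det (spd_sqrt (A y)) = 1"
    by (metis det_mul det_I)
  then have det: "det B \<noteq> 0"
    by auto
  obtain m where m: "0 < m" "\<And>z. m * norm z \<le> norm (B *v z)"
    using matrix_injective_bound[OF det] by blast
  obtain l where l: "0 < l" "\<And>z. norm (B *v z) \<le> l * norm z"
    using matrix_vector_bound[of B] by blast
  obtain C where C: "0 \<le> C" "slowly_varying J C \<epsilon>"
    using I_fun_slowly_varying[OF A] unfolding J_def by blast
  have J_cont: "continuous_on {0<..\<epsilon>} J"
    by (rule slowly_varying_continuous[OF C(2)])
  have J_lim: "((\<lambda>r. exp (J r)) \<longlongrightarrow> L) (at_right 0)"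
    using lim by (simp add: J_def)
  obtain K where K: "\<And>t. 0 < t \<Longrightarrow> t \<le> \<epsilon> \<Longrightarrow> exp (J t) \<le> K"
    using exp_bounded_of_limit[OF J_cont J_lim] by metis
  define N where "N = (\<lambda>x. norm (B *v (x - y)))"
  define P where "P = (\<lambda>x. profile CARD('n) J \<epsilon> (N x))"
  define f where "f = (\<lambda>w. \<zeta> (norm (w - y)))"
  obtain \<delta> c where \<delta>: "0 < \<delta>" "\<delta> \<le> \<epsilon>" and Wf: "W2p_loc (ball y \<delta> - {y}) p f" and Wv: "W2p_loc (ball y \<delta> - {y}) p v"
    and bound: "\<And>r. 0 < r \<Longrightarrow> 2 * r < \<delta> \<Longrightarrow> M2_mean p f r y \<le> c * max (\<omega> r) (sq_dini \<omega> r)"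
      "\<And>r. 0 < r \<Longrightarrow> 2 * r < \<delta> \<Longrightarrow> M2_mean p v r y \<le> c * r powr (2 - ?n) * exp (J r) * \<omega> r"
    using cs unfolding constructed_solution_def f_def J_def by blast
  have sol: "strong_solution A p (ball y \<epsilon> - {y}) Z"
    and form: "\<And>x. x \<in> ball y \<epsilon> - {y} \<Longrightarrow> Z x = h (N x) + v x"
    and h: "\<And>r. 0 < r \<Longrightarrow> r < \<epsilon> \<Longrightarrow> h r = profile CARD('n) J \<epsilon> r * (1 + \<zeta> r)"
    using cs unfolding constructed_solution_def profile_def N_def B_def J_def by blast+
  have small_r: "\<forall>\<^sub>F r in at_right 0. 0 < r \<and> 2 * r < \<delta>"
    using \<delta>(1) by (intro eventually_at_right_0I[of "\<delta> / 2"]) auto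
  have "((\<lambda>r. c * max (\<omega> r) (sq_dini \<omega> r)) \<longlongrightarrow> c * max 0 0) (at_right 0)"
    by (intro tendsto_mult_left tendsto_max \<omega>)
  then have f_lim: "((\<lambda>r. c * max (\<omega> r) (sq_dini \<omega> r)) \<longlongrightarrow> 0) (at_right 0)"
    by simp
  have "((\<lambda>r. r powr 0 * M2_mean p f r y) \<longlongrightarrow> 0) (at_right 0)"
  proof (rule tendsto_sandwich[OF _ _ tendsto_const f_lim])
    show "\<forall>\<^sub>F r in at_right 0. 0 \<le> r powr 0 * M2_mean p f r y"
      using small_r by eventually_elim (simp add: M2_mean_ge(4))
    show "\<forall>\<^sub>F r in at_right 0. r powr 0 * M2_mean p f r y \<le> c * max (\<omega> r) (sq_dini \<omega> r)"
      using small_r by eventually_elim (simp add: bound(1))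
  qed
  note f_small = W2p_L1_small[OF Wf p \<delta>(1) this]
  have "((\<lambda>r. c * exp (J r) * \<omega> r) \<longlongrightarrow> c * L * 0) (at_right 0)"
    by (intro tendsto_mult tendsto_const J_lim \<omega>(1))
  then have v_lim: "((\<lambda>r. c * exp (J r) * \<omega> r) \<longlongrightarrow> 0) (at_right 0)"
    by simp
  have v_bound: "r powr (?n - 2) * M2_mean p v r y \<le> c * exp (J r) * \<omega> r" if "0 < r" "2 * r < \<delta>" for r
  proof -
    have "r powr (?n - 2) * M2_mean p v r y \<le> r powr (?n - 2) * (c * r powr (2 - ?n) * exp (J r) * \<omega> r)"
      by (intro mult_left_mono bound(2) that) simp
    also have "\<dots> = (r powr (?n - 2) * r powr (2 - ?n)) * (c * exp (J r) * \<omega> r)"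
      by (simp only: mult_ac)
    also have "r powr (?n - 2) * r powr (2 - ?n) = 1"
      using that(1) by (simp flip: powr_add)
    finally show ?thesis
      by simp
  qed
  have "((\<lambda>r. r powr (?n - 2) * M2_mean p v r y) \<longlongrightarrow> 0) (at_right 0)"
  proof (rule tendsto_sandwich[OF _ _ tendsto_const v_lim])
    show "\<forall>\<^sub>F r in at_right 0. 0 \<le> r powr (?n - 2) * M2_mean p v r y"
      using small_r by eventually_elim (simp add: M2_mean_ge(4))
    show "\<forall>\<^sub>F r in at_right 0. r powr (?n - 2) * M2_mean p v r y \<le> c * exp (J r) * \<omega> r"
      using small_r by eventually_elim (simp add: v_bound)
  qed
  note v_small = W2p_L1_small[OF Wv p \<delta>(1) this]
  define fd where "fd = (\<lambda>k. weak_partial (ball y \<delta> - {y}) k f)"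
  define fdd where "fdd = (\<lambda>q k. weak_partial (ball y \<delta> - {y}) q (fd k))"
  define vd where "vd = (\<lambda>k. weak_partial (ball y \<delta> - {y}) k v)"
  define vdd where "vdd = (\<lambda>q k. weak_partial (ball y \<delta> - {y}) q (vd k))"
  have wf: "has_weak_partial (ball y \<delta> - {y}) k f (fd k)" "has_weak_partial (ball y \<delta> - {y}) q (fd k) (fdd q k)" for k q
    unfolding fd_def fdd_def by (rule W2p_loc_weak_partials[OF Wf])+
  have wv: "has_weak_partial (ball y \<delta> - {y}) k v (vd k)" "has_weak_partial (ball y \<delta> - {y}) q (vd k) (vdd q k)" for k q
    unfolding vd_def vdd_def by (rule W2p_loc_weak_partials[OF Wv])+
  \<comment> \<open>The hypotheses concern \<open>f = \<zeta>(|x - y|)\<close>, the solution contains \<open>\<zeta>(N) = f \<circ> T\<close>. The ball shrinks since \<open>T\<close> may expand.\<close>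
  define T where "T = (\<lambda>x. y + B *v (x - y))"
  define \<delta>0 where "\<delta>0 = min \<delta> (\<delta> / l)"
  have \<delta>0: "0 < \<delta>0" "\<delta>0 \<le> \<delta>" "l * \<delta>0 \<le> \<delta>"
    using \<delta>(1) l(1) by (auto simp: \<delta>0_def min_def field_simps)
  have op: "open (ball y \<delta> - {y})" "open (ball y \<delta>0 - {y})"
    by auto
  have sub: "ball y \<delta>0 - {y} \<subseteq> T -` (ball y \<delta> - {y})"
  proof
    fix x assume x: "x \<in> ball y \<delta>0 - {y}"
    then have nx: "0 < norm (x - y)" "norm (x - y) < \<delta>0"
      by (auto simp: dist_norm norm_minus_commute)
    have "0 < m * norm (x - y)" "l * norm (x - y) < l * \<delta>0"
      using m(1) l(1) nx by simp_all
    then have "0 < norm (B *v (x - y))" "norm (B *v (x - y)) < \<delta>"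
      using m(2)[of "x - y"] l(2)[of "x - y"] \<delta>0(3) by linarith+
    then show "x \<in> T -` (ball y \<delta> - {y})"
      by (auto simp: T_def dist_norm)
  qed
  define u where "u = (\<lambda>x. f (T x))"
  define ud where "ud = (\<lambda>j x. \<Sum>k\<in>UNIV. B $ k $ j * fd k (T x))"
  define udd where "udd = (\<lambda>i j x. \<Sum>k\<in>UNIV. B $ k $ j * (\<Sum>q\<in>UNIV. B $ q $ i * fdd q k (T x)))"
  have openT: "open (T -` (ball y \<delta> - {y}))"
    unfolding T_def by (rule open_vimage[OF op(1) continuous_on_affine_matrix])
  have pull: "has_weak_partial (ball y \<delta>0 - {y}) i (\<lambda>x. w (T x)) (\<lambda>x. \<Sum>q\<in>UNIV. B $ q $ i * w' q (T x))"
    if "\<And>q. has_weak_partial (ball y \<delta> - {y}) q w (w' q)" for w w' i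
    unfolding T_def
    by (rule has_weak_partial_subset[OF has_weak_partial_affine_matrix[OF det op(1) that]
          openT[unfolded T_def] op(2) sub[unfolded T_def]])
  have wu: "has_weak_partial (ball y \<delta>0 - {y}) j u (ud j)" for j
    unfolding u_def ud_def by (rule pull[OF wf(1)])
  have wfdT: "has_weak_partial (ball y \<delta>0 - {y}) i (\<lambda>x. fd k (T x)) (\<lambda>x. \<Sum>q\<in>UNIV. B $ q $ i * fdd q k (T x))" for i k
    by (rule pull[OF wf(2)])
  have wud: "has_weak_partial (ball y \<delta>0 - {y}) i (ud j) (udd i j)" for i j
    unfolding ud_def udd_def by (rule has_weak_partial_lincomb[OF op(2) wfdT])
  have loc: "Lp_loc (ball y \<delta> - {y}) 1 f" "Lp_loc (ball y \<delta> - {y}) 1 (fd k)" "Lp_loc (ball y \<delta> - {y}) 1 (fdd q k)" for q k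
    using wf(1)[of k] wf(2)[of q k] by (simp_all add: has_weak_partial_def)
  have locT: "Lp_loc (ball y \<delta>0 - {y}) 1 (\<lambda>x. w (T x))" if "Lp_loc (ball y \<delta> - {y}) 1 w" for w
    unfolding T_def
    by (rule Lp_loc_subset[OF Lp_loc_1_affine_matrix(1)[OF det op(1) that]
          openT[unfolded T_def] op(2) sub[unfolded T_def]])
  have f_small': "L1_small y ?n f" "L1_small y (?n - 1) (fd k)" "L1_small y (?n - 2) (fdd q k)" for q k
    using f_small(1) f_small(2)[of k] f_small(3)[of q k] by (simp_all add: fd_def fdd_def)
  have u_small: "L1_small y (?n - 1 + 1) u" "L1_small y (?n - 1) (ud j)" "L1_small y (?n - 2) (udd i j)" for i j
  proof -
    show "L1_small y (?n - 1 + 1) u"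
      unfolding u_def T_def using L1_small_affine_matrix[OF loc(1) \<delta>(1) f_small'(1) det m] by simp
    have 1: "L1_small y (?n - 1) (\<lambda>x. fd k (T x))" for k
      unfolding T_def by (rule L1_small_affine_matrix[OF loc(2) \<delta>(1) f_small'(2) det m])
    have 2: "L1_small y (?n - 2) (\<lambda>x. fdd q k (T x))" for q k
      unfolding T_def by (rule L1_small_affine_matrix[OF loc(3) \<delta>(1) f_small'(3) det m])
    show "L1_small y (?n - 1) (ud j)"
      unfolding ud_def by (rule L1_small_lincomb[OF locT[OF loc(2)] \<delta>0(1) 1])
    show "L1_small y (?n - 2) (udd i j)"
      unfolding udd_def
      by (intro L1_small_lincomb[OF Lp_loc_1_lincomb[OF op(2) locT[OF loc(3)]] \<delta>0(1)] L1_small_lincomb[OF locT[OF loc(3)] \<delta>0(1) 2])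
  qed
  define d where "d = min 1 (min (\<delta>0 / 2) (\<epsilon> / (4 * l)))"
  have d: "0 < d"
    using \<delta>0(1) \<epsilon> l(1) by (simp add: d_def)
  have dr: "r \<le> 1" "2 * r < \<delta>0" "2 * l * r \<le> \<epsilon> / 2" "2 * l * r < \<epsilon>" if "0 < r" "r < d" for r
  proof -
    have r: "r < 1" "r < \<delta>0 / 2" "r < \<epsilon> / (4 * l)"
      using that(2) by (simp_all add: d_def)
    have "r * (4 * l) < \<epsilon>"
      using r(3) l(1) by (simp add: pos_less_divide_eq)
    then show "2 * l * r \<le> \<epsilon> / 2"
      by (simp add: mult_ac)
    then show "2 * l * r < \<epsilon>"
      using \<epsilon> by linarith
    show "r \<le> 1" "2 * r < \<delta>0"
      using r by linarith+
  qed
  have N_range: "0 < N x" "N x < \<epsilon>" if "0 < r" "r < d" "x \<in> annulus r y" for r x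
  proof -
    have "m * r < N x" "N x < 2 * l * r" "0 < m * r"
      using N_annulus[OF m l that(3)] m(1) that(1) by (simp_all add: N_def)
    then show "0 < N x" "N x < \<epsilon>"
      using dr(4)[OF that(1,2)] by linarith+
  qed
  obtain RP where RP: "\<And>r i. 0 < r \<Longrightarrow> 2 * l * r \<le> \<epsilon> / 2 \<Longrightarrow> scaled_bound y r i (?n - 2) RP P"
    using scaled_bound_profile[OF m l n \<epsilon> J_cont K] unfolding P_def N_def by blast
  define G where "G = (\<lambda>x. exp (J (N x)) * \<phi> x)"
  \<comment> \<open>\<open>G\<close> is merely Lipschitz on annuli, hence the approximating weights.\<close>
  have T2: "uniform_limit {1..} (\<lambda>r k. LINT x|lebesgue. u x * ((G x * flux_field B y i x) * partial i (annulus_cut y r k) x)) (\<lambda>_. 0) (at_right 0)" for i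
  proof -
    obtain F where F: "\<And>r. 0 < r \<Longrightarrow> r \<le> 1 \<Longrightarrow> scaled_bound y r i 0 F \<phi>"
      using scaled_bound_C01[OF \<phi>] by metis
    obtain RX where RX: "\<And>r i'. 0 < r \<Longrightarrow> scaled_bound y r i' (?n - 1) RX (flux_field B y i)"
      using scaled_bound_flux_field[OF m l] by metis
    show ?thesis
    proof (rule trace_uniformly_small[OF wu \<delta>0(1) u_small(2) u_small(1) d])
      fix r assume r: "0 < r" "r < d"
      obtain E where E: "\<And>k::nat. \<And>i. scaled_bound y r i 0 ((1 + l) * (K * (1 + C / m))) (E k)"
        "\<And>x. x \<in> annulus r y \<Longrightarrow> (\<lambda>k. E k x) \<longlonglongrightarrow> exp (J (N x))"
        using scaled_bound_steklov[OF m l C(2,1) \<epsilon> K r(1) dr(4)[OF r]] unfolding N_def by metis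
      let ?\<rho>s = "\<lambda>k x. E k x * \<phi> x * flux_field B y i x"
      have "scaled_bound y r i (?n - 1) (2 * (2 * ((1 + l) * (K * (1 + C / m))) * F) * RX) (?\<rho>s k)" for k
        using scaled_bound_mult[OF r(1) scaled_bound_mult[OF r(1) E(1) F[OF r(1) dr(1)[OF r]]] RX[OF r(1)]] by simp
      moreover have "(\<lambda>k. ?\<rho>s k x) \<longlonglongrightarrow> G x * flux_field B y i x" if "x \<in> annulus r y" for x
        unfolding G_def by (intro tendsto_mult_right E(2) that)
      ultimately show "\<exists>\<rho>s. (\<forall>k::nat. scaled_bound y r i (?n - 1) (2 * (2 * ((1 + l) * (K * (1 + C / m))) * F) * RX) (\<rho>s k)) \<and>
          (\<forall>x\<in>annulus r y. (\<lambda>k. \<rho>s k x) \<longlonglongrightarrow> G x * flux_field B y i x)"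
        by (intro exI[of _ ?\<rho>s] conjI allI ballI)
    qed
  qed
  have T3: "uniform_limit {1..} (\<lambda>r k. LINT x|lebesgue. ud j x * ((P x * \<phi> x) * partial i (annulus_cut y r k) x)) (\<lambda>_. 0) (at_right 0)" for i j
  proof -
    obtain F where F: "\<And>r. 0 < r \<Longrightarrow> r \<le> 1 \<Longrightarrow> scaled_bound y r i 0 F \<phi>"
      using scaled_bound_C01[OF \<phi>] by metis
    have "L1_small y (?n - 2 + 1) (ud j)"
      using u_small(2) by simp
    then show ?thesis
    proof (rule trace_uniformly_small[OF wud \<delta>0(1) u_small(3) _ d])
      fix r assume r: "0 < r" "r < d"
      have "scaled_bound y r i (?n - 2) (2 * RP * F) (\<lambda>x. P x * \<phi> x)"
        using scaled_bound_mult[OF r(1) RP[OF r(1) dr(3)[OF r]] F[OF r(1) dr(1)[OF r]]] by simp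
      then show "\<exists>\<rho>s. (\<forall>k::nat. scaled_bound y r i (?n - 2) (2 * RP * F) (\<rho>s k)) \<and> (\<forall>x\<in>annulus r y. (\<lambda>k. \<rho>s k x) \<longlonglongrightarrow> P x * \<phi> x)"
        by (intro exI[of _ "\<lambda>_ x. P x * \<phi> x"]) simp
    qed
  qed
  have T4: "uniform_limit {1..} (\<lambda>r k. LINT x|lebesgue. vd j x * (\<phi> x * partial i (annulus_cut y r k) x)) (\<lambda>_. 0) (at_right 0)" for i j
  proof -
    obtain F where F: "\<And>r. 0 < r \<Longrightarrow> r \<le> 1 \<Longrightarrow> scaled_bound y r i 0 F \<phi>"
      using scaled_bound_C01[OF \<phi>] by metis
    have "L1_small y 0 (vdd i j)" "L1_small y (0 + 1) (vd j)"
      using v_small(3)[of i j] v_small(2)[of j] by (simp_all add: vd_def vdd_def)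
    then show ?thesis
    proof (rule trace_uniformly_small[OF wv(2) \<delta>(1) _ _ d])
      fix r assume r: "0 < r" "r < d"
      then show "\<exists>\<rho>s. (\<forall>k::nat. scaled_bound y r i 0 F (\<rho>s k)) \<and> (\<forall>x\<in>annulus r y. (\<lambda>k. \<rho>s k x) \<longlonglongrightarrow> \<phi> x)"
        using F[OF r(1) dr(1)[OF r]] by (intro exI[of _ "\<lambda>_. \<phi>"]) simp
    qed
  qed
  have T1: "uniform_limit {1..} (\<lambda>r k. LINT x|lebesgue. G x * (\<Sum>i\<in>UNIV. flux_field B y i x * partial i (annulus_cut y r k) x))
      (\<lambda>_. L * \<phi> y * (sphere_area TYPE('n) / \<bar>det B\<bar>)) (at_right 0)"
  proof (rule flux_tendsto[OF det _ d])
    have N_cont: "continuous_on S N" for S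
      unfolding N_def by (intro continuous_on_norm linear_continuous_on_compose[OF _ matrix_vector_mul_linear] continuous_intros)
    have "isCont N y"
      using N_cont[of UNIV] by (simp add: continuous_on_eq_continuous_at)
    then have "(N \<longlongrightarrow> 0) (at y)"
      by (simp add: isCont_def N_def)
    moreover have "\<forall>\<^sub>F x in at y. N x \<in> {0<..} \<and> N x \<noteq> 0"
    proof (rule eventually_mono[OF eventually_neq_at_within])
      fix x :: "real^'n" assume "x \<noteq> y"
      then have "0 < m * norm (x - y)"
        using m(1) by simp
      then show "N x \<in> {0<..} \<and> N x \<noteq> 0"
        using m(2)[of "x - y"] unfolding N_def greaterThan_iff by linarith
    qed
    ultimately have "filterlim N (at_right 0) (at y)"
      by (simp add: filterlim_at)
    from filterlim_compose[OF J_lim this] have "((\<lambda>x. exp (J (N x))) \<longlongrightarrow> L) (at y)" .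
    moreover have "(\<phi> \<longlongrightarrow> \<phi> y) (at y)"
      using C01_continuous(1)[OF \<phi>] by (simp add: continuous_on_eq_continuous_at isCont_def)
    ultimately show "(G \<longlongrightarrow> L * \<phi> y) (at y)"
      unfolding G_def by (rule tendsto_mult)
    show "continuous_on (annulus r y) G" if "0 < r" "r < d" for r
      unfolding G_def using N_range[OF that]
      by (intro continuous_on_mult continuous_on_exp continuous_on_compose2[OF J_cont N_cont] continuous_on_subset[OF C01_continuous(1)[OF \<phi>]])
        (auto simp: less_imp_le)
  qed
  have dec: "(\<Sum>i\<in>UNIV. \<Sum>j\<in>UNIV. A y $ i $ j * (LINT x|lebesgue. weak_partial (ball y \<epsilon> - {y}) j Z x * (\<phi> x * partial i (annulus_cut y r k) x)))
    = (\<Sum>i\<in>UNIV. \<Sum>j\<in>UNIV. A y $ i $ j * (LINT x|lebesgue. ud j x * ((P x * \<phi> x) * partial i (annulus_cut y r k) x)))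
    + (\<Sum>i\<in>UNIV. \<Sum>j\<in>UNIV. A y $ i $ j * (LINT x|lebesgue. vd j x * (\<phi> x * partial i (annulus_cut y r k) x)))
    - (\<Sum>i\<in>UNIV. LINT x|lebesgue. u x * ((G x * flux_field B y i x) * partial i (annulus_cut y r k) x))
    - (LINT x|lebesgue. G x * (\<Sum>i\<in>UNIV. flux_field B y i x * partial i (annulus_cut y r k) x))"
    if r: "0 < r" "r < d" and k: "1 \<le> k" for r k
  proof -
    have "annulus r y \<subseteq> ball y \<delta>0 - {y}"
      using r(1) dr(2)[OF r] by (auto simp: annulus_def dist_norm norm_minus_commute)
    then have ann: "annulus r y \<subseteq> ball y \<delta>0 - {y}" "annulus r y \<subseteq> ball y \<delta> - {y}" "annulus r y \<subseteq> ball y \<epsilon> - {y}"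
      using \<delta>0(2) \<delta>(2) by auto
    have op\<epsilon>: "open (ball y \<epsilon> - {y})"
      by auto
    have "W2p_loc (ball y \<epsilon> - {y}) p Z"
      using sol by (simp add: strong_solution_def)
    note wZ = W2p_loc_weak_partials(1)[OF this]
    have P_C1: "C1_on (annulus r y) P"
      using RP[OF r(1) dr(3)[OF r]] by (simp add: scaled_bound_def)
    have Z_form: "Z x = P x * (1 + u x) + v x" if x: "x \<in> annulus r y" for x
    proof -
      have "u x = \<zeta> (N x)"
        by (simp add: u_def f_def T_def N_def)
      then show ?thesis
        using form[OF subsetD[OF ann(3) x]] h[OF N_range[OF r x]] by (simp add: P_def)
    qed
    have wu': "has_weak_partial (annulus r y) j u (ud j)" for j
      by (rule has_weak_partial_subset[OF wu op(2) open_annulus ann(1)])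
    have wv': "has_weak_partial (annulus r y) j v (vd j)" for j
      by (rule has_weak_partial_subset[OF wv(1) op(1) open_annulus ann(2)])
    have NR: "0 < norm (inv_sqrt (A y) *v (x - y)) \<and> norm (inv_sqrt (A y) *v (x - y)) < \<epsilon>" if "x \<in> annulus r y" for x
      using N_range[OF r that] by (simp add: N_def B_def)
    show ?thesis
      unfolding G_def N_def B_def P_def
      by (rule pairing_decomposition[OF M det[unfolded B_def] op\<epsilon> r(1) k ann(3) J_cont NR
            P_C1[unfolded P_def N_def B_def] wZ Z_form[unfolded P_def N_def B_def] wu' wv' \<phi>])
  qed
  have "uniform_limit {1..} (\<lambda>r k.
      (\<Sum>i\<in>UNIV. \<Sum>j\<in>UNIV. A y $ i $ j * (LINT x|lebesgue. ud j x * ((P x * \<phi> x) * partial i (annulus_cut y r k) x)))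
    + (\<Sum>i\<in>UNIV. \<Sum>j\<in>UNIV. A y $ i $ j * (LINT x|lebesgue. vd j x * (\<phi> x * partial i (annulus_cut y r k) x)))
    - (\<Sum>i\<in>UNIV. LINT x|lebesgue. u x * ((G x * flux_field B y i x) * partial i (annulus_cut y r k) x))
    - (LINT x|lebesgue. G x * (\<Sum>i\<in>UNIV. flux_field B y i x * partial i (annulus_cut y r k) x)))
    (\<lambda>_. (\<Sum>i\<in>(UNIV :: 'n set). \<Sum>j\<in>(UNIV :: 'n set). 0) + (\<Sum>i\<in>(UNIV :: 'n set). \<Sum>j\<in>(UNIV :: 'n set). 0)
      - (\<Sum>i\<in>(UNIV :: 'n set). 0) - L * \<phi> y * (sphere_area TYPE('n) / \<bar>det B\<bar>)) (at_right 0)"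
    by (intro uniform_limit_minus uniform_limit_add uniform_limit_sum uniform_limit_cmult_0 finite_class.finite_UNIV T1 T2 T3 T4)
  then have lim_dec: "uniform_limit {1..} (\<lambda>r k.
      (\<Sum>i\<in>UNIV. \<Sum>j\<in>UNIV. A y $ i $ j * (LINT x|lebesgue. ud j x * ((P x * \<phi> x) * partial i (annulus_cut y r k) x)))
    + (\<Sum>i\<in>UNIV. \<Sum>j\<in>UNIV. A y $ i $ j * (LINT x|lebesgue. vd j x * (\<phi> x * partial i (annulus_cut y r k) x)))
    - (\<Sum>i\<in>UNIV. LINT x|lebesgue. u x * ((G x * flux_field B y i x) * partial i (annulus_cut y r k) x))
    - (LINT x|lebesgue. G x * (\<Sum>i\<in>UNIV. flux_field B y i x * partial i (annulus_cut y r k) x)))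
    (\<lambda>_. - (L * \<phi> y * (sphere_area TYPE('n) / \<bar>det (inv_sqrt (A y))\<bar>))) (at_right 0)"
    by (simp only: sum.neutral_const add_0 diff_0 B_def diff_zero)
  \<comment> \<open>All radii below \<open>d\<close> have their annulus inside every domain in play.\<close>
  have "\<forall>\<^sub>F r in at_right 0. 0 < r \<and> r < d"
    using d by (rule eventually_at_right_0I) auto
  then have eq: "\<forall>\<^sub>F r in at_right 0. \<forall>k\<in>{1..}. (\<Sum>i\<in>UNIV. \<Sum>j\<in>UNIV. A y $ i $ j * (LINT x|lebesgue. weak_partial (ball y \<epsilon> - {y}) j Z x * (\<phi> x * partial i (annulus_cut y r k) x)))
    = (\<Sum>i\<in>UNIV. \<Sum>j\<in>UNIV. A y $ i $ j * (LINT x|lebesgue. ud j x * ((P x * \<phi> x) * partial i (annulus_cut y r k) x)))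
    + (\<Sum>i\<in>UNIV. \<Sum>j\<in>UNIV. A y $ i $ j * (LINT x|lebesgue. vd j x * (\<phi> x * partial i (annulus_cut y r k) x)))
    - (\<Sum>i\<in>UNIV. LINT x|lebesgue. u x * ((G x * flux_field B y i x) * partial i (annulus_cut y r k) x))
    - (LINT x|lebesgue. G x * (\<Sum>i\<in>UNIV. flux_field B y i x * partial i (annulus_cut y r k) x))"
  proof eventually_elim
    case (elim r)
    show ?case
    proof
      fix k :: real assume "k \<in> {1..}"
      then have "1 \<le> k"
        by simp
      from elim have "0 < r" "r < d"
        by auto
      from dec[OF this \<open>1 \<le> k\<close>] show "(\<Sum>i\<in>UNIV. \<Sum>j\<in>UNIV. A y $ i $ j * (LINT x|lebesgue. weak_partial (ball y \<epsilon> - {y}) j Z x * (\<phi> x * partial i (annulus_cut y r k) x)))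
    = (\<Sum>i\<in>UNIV. \<Sum>j\<in>UNIV. A y $ i $ j * (LINT x|lebesgue. ud j x * ((P x * \<phi> x) * partial i (annulus_cut y r k) x)))
    + (\<Sum>i\<in>UNIV. \<Sum>j\<in>UNIV. A y $ i $ j * (LINT x|lebesgue. vd j x * (\<phi> x * partial i (annulus_cut y r k) x)))
    - (\<Sum>i\<in>UNIV. LINT x|lebesgue. u x * ((G x * flux_field B y i x) * partial i (annulus_cut y r k) x))
    - (LINT x|lebesgue. G x * (\<Sum>i\<in>UNIV. flux_field B y i x * partial i (annulus_cut y r k) x))" .
    qed
  qed
  show ?thesis
    by (rule iffD2[OF uniform_limit_cong[OF eq refl] lim_dec])
qed

text \<open>
  For fixed \<open>r\<close> the limit in \<open>k\<close> is the integral over \<open>|x - y| > sqrt 2 * r\<close>, so the uniform estimate of \<open>pairing_limit\<close>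
  carries over to it.
\<close>

lemma solves_delta_of_limit:
  fixes A :: "real^'n \<Rightarrow> real^'n^'n" and y :: "real^'n"
  assumes n: "3 \<le> CARD('n)" and p: "1 < p" and M: "spd (A y)"
    and A: "A \<in> borel_measurable lebesgue" "bounded (range A)"
    and \<omega>: "(\<omega> \<longlongrightarrow> 0) (at_right 0)" "(sq_dini \<omega> \<longlongrightarrow> 0) (at_right 0)" and \<epsilon>: "0 < \<epsilon>"
    and cs: "constructed_solution A y \<omega> p \<epsilon> Z h \<zeta> v"
    and lim: "((\<lambda>r. exp (I_fun A y \<epsilon> r)) \<longlongrightarrow> L) (at_right 0)"
  shows "solves_delta A y (ball y \<epsilon>) Z (sphere_area TYPE('n) * sqrt (det (A y)) * L)"
  unfolding solves_delta_def
proof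
  fix \<phi> assume \<phi>: "\<phi> \<in> C01 (ball y \<epsilon>)"
  have sol: "strong_solution A p (ball y \<epsilon> - {y}) Z"
    using cs unfolding constructed_solution_def by blast
  then have W: "W2p_loc (ball y \<epsilon> - {y}) p Z"
    by (simp add: strong_solution_def)
  have sym: "transpose (A y) = A y"
    using M by (simp add: spd_def)
  define F where "F = LZ_integrand A y (ball y \<epsilon>) Z \<phi>"
  define lm where "lm = - (L * \<phi> y * (sphere_area TYPE('n) / \<bar>det (inv_sqrt (A y))\<bar>))"
  define D where "D = (\<lambda>\<eta>. LINT x:(ball y \<epsilon> \<inter> {x. \<eta> < norm (x - y)})|lebesgue. F x)"
  define Q where "Q = (\<lambda>r k. LINT x|lebesgue. F x * annulus_cut y r k x)"
  have F_int: "set_integrable lebesgue (ball y \<epsilon> \<inter> {x. \<eta> < norm (x - y)}) F" if "0 < \<eta>" for \<eta>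
    unfolding F_def by (rule LZ_integrand_integrable[OF A W \<phi> that])
  have F_out: "F x = 0" if "x \<notin> ball y \<epsilon>" for x
    unfolding F_def LZ_integrand_def by (simp add: C01_outside[OF \<phi> that])
  have "inv_sqrt (A y) ** spd_sqrt (A y) = mat 1"
    by (simp add: matrix_eq inv_sqrt_left[OF M] flip: matrix_vector_mul_assoc)
  then have "det (inv_sqrt (A y)) * det (spd_sqrt (A y)) = 1"
    by (metis det_mul det_I)
  then have "\<bar>det (inv_sqrt (A y))\<bar> * sqrt (det (A y)) = 1"
    by (metis det_spd_sqrt[OF M] abs_mult abs_one)
  then have "1 / \<bar>det (inv_sqrt (A y))\<bar> = sqrt (det (A y))"
    by (metis divide_eq_eq mult.commute mult_zero_left zero_neq_one)
  then have lm: "- lm = sphere_area TYPE('n) * sqrt (det (A y)) * L * \<phi> y"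
    unfolding lm_def by (simp add: divide_inverse mult_ac)
  have "(D \<longlongrightarrow> lm) (at_right 0)"
  proof (rule tendstoI)
    fix e :: real assume "0 < e"
    then have e: "0 < e / 2"
      by simp
    have "\<forall>\<^sub>F r in at_right 0. 0 < r \<and> 2 * r < \<epsilon>"
      using \<epsilon> by (intro eventually_at_right_0I[of "\<epsilon> / 2"]) auto
    with uniform_limitD[OF pairing_limit[OF n p M A \<omega> \<epsilon> cs lim \<phi>] e]
    have "\<forall>\<^sub>F r in at_right 0. dist (D (sqrt 2 * r)) lm \<le> e / 2"
    proof eventually_elim
      case (elim r)
      then have r: "0 < r" "2 * r < \<epsilon>"
        by auto
      have ann: "annulus r y \<subseteq> ball y \<epsilon>"
        using r by (auto simp: annulus_def dist_norm norm_minus_commute)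
      have "dist (Q r (real (Suc k))) lm \<le> e / 2" for k
        using elim(1) cut_pairing[OF sol sym \<phi> r(1) _ ann, of "real (Suc k)"]
        by (auto simp: Q_def F_def lm_def less_imp_le simp del: of_nat_Suc)
      moreover have "0 < sqrt 2 * r"
        using r(1) by simp
      from cut_integral_tendsto[OF r(1) F_int[OF this] F_out]
      have "(\<lambda>k. Q r (real (Suc k))) \<longlonglongrightarrow> D (sqrt 2 * r)"
        unfolding Q_def D_def .
      then have "(\<lambda>k. dist (Q r (real (Suc k))) lm) \<longlonglongrightarrow> dist (D (sqrt 2 * r)) lm"
        by (intro tendsto_intros)
      ultimately show "dist (D (sqrt 2 * r)) lm \<le> e / 2"
        by (intro LIMSEQ_le_const2[of "\<lambda>k. dist (Q r (real (Suc k))) lm"]) auto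
    qed
    then obtain b where b: "0 < b" "\<And>r. 0 < r \<Longrightarrow> r < b \<Longrightarrow> dist (D (sqrt 2 * r)) lm \<le> e / 2"
      unfolding eventually_at_right_field by auto
    show "\<forall>\<^sub>F \<eta> in at_right 0. dist (D \<eta>) lm < e"
    proof (rule eventually_at_right_0I)
      show "0 < sqrt 2 * b"
        using b(1) by simp
      fix \<eta> assume \<eta>: "0 < \<eta>" "\<eta> < sqrt 2 * b"
      then have "0 < \<eta> / sqrt 2" "\<eta> / sqrt 2 < b"
        by (auto simp: pos_divide_less_eq mult.commute)
      from b(2)[OF this] show "dist (D \<eta>) lm < e"
        using e by simp
    qed
  qed
  then have "has_improper_integral F (ball y \<epsilon>) y lm"
    using F_int unfolding has_improper_integral_def D_def by blast
  then show "\<exists>l. has_improper_integral (LZ_integrand A y (ball y \<epsilon>) Z \<phi>) (ball y \<epsilon>) y l \<and>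
      - l = sphere_area TYPE('n) * sqrt (det (A y)) * L * \<phi> y"
    using lm unfolding F_def by blast
qed

theorem corollary3:
  fixes A :: "real^'n \<Rightarrow> real^'n^'n" and y :: "real^'n"
    and \<omega> :: "real \<Rightarrow> real" and p \<kappa> :: real
  assumes n: "3 \<le> CARD('n)"
    and p: "1 < p"
    and A_sym: "\<And>x. transpose (A x) = A x"
    and A_bounded: "bounded (range A)"
    and A_measurable: "A \<in> borel_measurable lebesgue"
    and A_elliptic: "spd (A y)"
    and A_modulus: "\<And>x r. \<lbrakk>0 < r; r < 1; norm (x - y) = r\<rbrakk> \<Longrightarrow> onorm (\<lambda>\<xi>. (A x - A y) *v \<xi>) \<le> \<omega> r"
    and \<omega>_cont: "continuous_on {0..<1} \<omega>"
    and \<omega>_mono: "mono_on {0..<1} \<omega>"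
    and \<omega>_0: "\<omega> 0 = 0"
    and \<omega>_dini: "set_integrable lborel {0<..<1} (\<lambda>t. (\<omega> t)\<^sup>2 / t)"
    and \<kappa>: "0 < \<kappa>" "\<kappa> < 1"
    and \<omega>_\<kappa>: "antimono_on {0<..<1} (\<lambda>r. \<omega> r * r powr (-1 + \<kappa>))"
  shows "\<exists>\<epsilon>0>0. \<forall>\<epsilon>. 0 < \<epsilon> \<and> \<epsilon> < \<epsilon>0 \<longrightarrow>
    (\<forall>Z h \<zeta> v. constructed_solution A y \<omega> p \<epsilon> Z h \<zeta> v \<longrightarrow>
       (\<forall>I0. (I_fun A y \<epsilon> \<longlongrightarrow> I0) (at_right 0) \<longrightarrow>
          solves_delta A y (ball y \<epsilon>) Z (sphere_area TYPE('n) * sqrt (det (A y)) * exp I0)) \<and>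
       (filterlim (I_fun A y \<epsilon>) at_bot (at_right 0) \<longrightarrow>
          solves_delta A y (ball y \<epsilon>) Z 0))"
proof (intro exI[of _ 1] conjI allI impI)
  \<comment> \<open>Small \<open>\<epsilon>\<close> serves to construct \<open>Z\<close>, which is given here.\<close>
  have "(\<omega> \<longlongrightarrow> \<omega> 0) (at 0 within {0..1/2})"
  proof -
    have "continuous_on {0..1/2} \<omega>"
      by (rule continuous_on_subset[OF \<omega>_cont]) auto
    then show ?thesis
      unfolding continuous_on_def by (rule bspec) auto
  qed
  then have \<omega>_lim: "(\<omega> \<longlongrightarrow> 0) (at_right 0)"
    by (simp add: \<omega>_0 at_within_Icc_at_right)
  fix \<epsilon> Z h \<zeta> v
  assume "0 < \<epsilon> \<and> \<epsilon> < 1" and cs: "constructed_solution A y \<omega> p \<epsilon> Z h \<zeta> v"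
  then have \<epsilon>: "0 < \<epsilon>"
    by simp
  note delta = solves_delta_of_limit[OF n p A_elliptic A_measurable A_bounded \<omega>_lim
      sq_dini_tendsto_0[OF \<omega>_dini] \<epsilon> cs]
  show "solves_delta A y (ball y \<epsilon>) Z (sphere_area TYPE('n) * sqrt (det (A y)) * exp I0)"
    if "(I_fun A y \<epsilon> \<longlongrightarrow> I0) (at_right 0)" for I0
    by (rule delta[OF tendsto_exp[OF that]])
  show "solves_delta A y (ball y \<epsilon>) Z 0" if "filterlim (I_fun A y \<epsilon>) at_bot (at_right 0)"
    using delta[OF filterlim_compose[OF exp_at_bot that]] by simp
qed simp

end
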